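(* Let $M_0\in \mathrm{SL}(2,\mathbb{R})$ and let $\boldsymbol{\xi}\in\mathbb{R}^2$ be Diophantine. For $T>0$ let $R^2_{N(T)}(f)$ be the pair correlation function of the directions of the points of the affine lattice $(\mathbb{Z}^2+\boldsymbol{\xi})M_0$ of length less than $T$, as defined in the context. Then, for any continuous function $f:\mathbb{R}\to\mathbb{R}$ of compact support, $$\lim_{T\to\infty}R^2_{N(T)}(f)=\int_{\mathbb{R}}f(s)\,ds.$$
   Context: Vectors in $\mathbb{R}^2$ are row vectors, and matrices act on them from the right. A vector $\boldsymbol{\xi}\in\mathbb{R}^2$ is Diophantine of type $\kappa$ if there exists $C>0$ such that $|\boldsymbol{k}\cdot\boldsymbol{\xi}+\ell|\ge C(|k_1|+|k_2|)^{-\kappa}$ for all $\boldsymbol{k}=(k_1,k_2)\in\mathbb{Z}^2\setminus\{0\}$ and all $\ell\in\mathbb{Z}$. It is called Diophantine if it is Diophantine of type $\kappa$ for some $\kappa$. Given $M_0\in\mathrm{SL}(2,\mathbb{R})$ and $\boldsymbol{\xi}\in\mathbb{R}^2$, let $\mathcal{L}_{\boldsymbol{\xi}}=(\mathbb{Z}^2+\boldsymbol{\xi})M_0$. For $T>0$ let $\mathcal{P}_T$ be the set of $\boldsymbol{y}\in\mathcal{L}_{\boldsymbol{\xi}}\setminus\{0\}$ with Euclidean norm $\|\boldsymbol{y}\|<T$, and let $N(T)=\#\mathcal{P}_T$. The directions $\|\boldsymbol{y}\|^{-1}\boldsymbol{y}$, $\boldsymbol{y}\in\mathcal{P}_T$,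 are counted with multiplicity (a direction attained by $k$ points of $\mathcal{P}_T$ is recorded $k$ times) and written as $(\cos(2\pi\xi_n),\sin(2\pi\xi_n))$, with $\xi_n=\xi_n(T)\in\mathbb{T}=\mathbb{R}/\mathbb{Z}$, $n=1,\dots,N(T)$. The pair correlation function is $$R^2_{N(T)}(f)=\frac{1}{N(T)}\sum_{\substack{1\le n_1,n_2\le N(T)\\ n_1\ne n_2}}\ \sum_{m\in\mathbb{Z}}f\big(N(T)(\xi_{n_1}-\xi_{n_2}+m)\big).$$ *)

theory Defs
  imports "HOL-Analysis.Analysis"
begin

definition integer_points :: "(real ^ 2) set" where
  "integer_points = {k. \<forall>i. k $ i \<in> \<int>}"

definition diophantine_of_type :: "real \<Rightarrow> real ^ 2 \<Rightarrow> bool" where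
  "diophantine_of_type \<kappa> \<xi> \<longleftrightarrow>
     (\<exists>C>0. \<forall>k \<in> integer_points - {0}. \<forall>l::int.
        \<bar>k \<bullet> \<xi> + of_int l\<bar> \<ge> C * (\<bar>k $ 1\<bar> + \<bar>k $ 2\<bar>) powr (-\<kappa>))"

definition diophantine :: "real ^ 2 \<Rightarrow> bool" where
  "diophantine \<xi> \<longleftrightarrow> (\<exists>\<kappa>. diophantine_of_type \<kappa> \<xi>)"

definition affine_lattice :: "real ^ 2 ^ 2 \<Rightarrow> real ^ 2 \<Rightarrow> (real ^ 2) set" where
  "affine_lattice M \<xi> = (\<lambda>k. (k + \<xi>) v* M) ` integer_points"

definition lattice_points_upto :: "real ^ 2 ^ 2 \<Rightarrow> real ^ 2 \<Rightarrow> real \<Rightarrow> (real ^ 2) set" where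
  "lattice_points_upto M \<xi> T = {y \<in> affine_lattice M \<xi> - {0}. norm y < T}"

(* The representative in [0, 1) of the direction of y in R/Z; see direction_angle_polar and
   direction_angle_unique. *)
definition direction_angle :: "real ^ 2 \<Rightarrow> real" where
  "direction_angle y = Arg2pi (Complex (y $ 1) (y $ 2)) / (2 * pi)"

(* Pair correlation at scale card I of a finite family in R/Z, given by real representatives
   (the sum over m makes their choice irrelevant). The family is indexed by I, so coinciding
   values with distinct indices are counted with multiplicity. For f of compact support only
   finitely many m contribute. *)
definition pair_correlation :: "'i set \<Rightarrow> ('i \<Rightarrow> real) \<Rightarrow> (real \<Rightarrow> real) \<Rightarrow> real" where
  "pair_correlation I \<theta> f =
     1 / real (card I) *
     (\<Sum>i\<in>I. \<Sum>j\<in>I - {i}. \<Sum>\<^sub>\<infinity>m::int. f (real (card I) * (\<theta> i - \<theta> j + of_int m)))"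

(* The index set is the point set itself: each point of length less than T contributes its
   direction once. *)
definition direction_pair_correlation ::
    "real ^ 2 ^ 2 \<Rightarrow> real ^ 2 \<Rightarrow> real \<Rightarrow> (real \<Rightarrow> real) \<Rightarrow> real" where
  "direction_pair_correlation M \<xi> T f =
     pair_correlation (lattice_points_upto M \<xi> T) direction_angle f"

lemma direction_angle_range: "0 \<le> direction_angle y" "direction_angle y < 1"
  using Arg2pi[of "Complex (y $ 1) (y $ 2)"] by (auto simp: direction_angle_def)

lemma direction_angle_polar:
  "y = norm y *\<^sub>R vector [cos (2 * pi * direction_angle y), sin (2 * pi * direction_angle y)]"
proof -
  define z where "z = Complex (y $ 1) (y $ 2)"
  have n: "cmod z = norm y"
    by (simp add: z_def cmod_def norm_vec_def L2_set_def UNIV_2)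
  have "z = of_real (cmod z) * exp (\<i> * of_real (Arg2pi z))"
    using Arg2pi[of z] unfolding is_Arg_def by blast
  then have z: "z = of_real (norm y) * cis (Arg2pi z)"
    by (simp add: n cis_conv_exp)
  have "y $ 1 = norm y * cos (Arg2pi z)" "y $ 2 = norm y * sin (Arg2pi z)"
    using arg_cong[OF z, of Re] arg_cong[OF z, of Im] by (simp_all add: z_def)
  moreover have "2 * pi * direction_angle y = Arg2pi z"
    by (simp add: direction_angle_def z_def)
  ultimately show ?thesis
    by (simp add: vec_eq_iff forall_2)
qed

lemma direction_angle_unique:
  assumes "y \<noteq> 0" "0 \<le> t" "t < 1"
    and "y = norm y *\<^sub>R vector [cos (2 * pi * t), sin (2 * pi * t)]"
  shows "direction_angle y = t"
proof -
  have c: "y $ 1 = norm y * cos (2 * pi * t)" "y $ 2 = norm y * sin (2 * pi * t)"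
    using arg_cong[OF assms(4), of "\<lambda>v. v $ 1"] arg_cong[OF assms(4), of "\<lambda>v. v $ 2"]
    by simp_all
  have "Arg2pi (Complex (y $ 1) (y $ 2)) = 2 * pi * t"
  proof (rule Arg2pi_unique[where r = "norm y"])
    have "of_real (norm y) * cis (2 * pi * t) = Complex (y $ 1) (y $ 2)"
      using c by (simp add: complex_eq_iff)
    then show "of_real (norm y) * exp (\<i> * of_real (2 * pi * t)) = Complex (y $ 1) (y $ 2)"
      by (simp only: cis_conv_exp)
  qed (use assms in auto)
  then show ?thesis
    by (simp add: direction_angle_def)
qed

lemma finite_lattice_points_upto:
  assumes "det M \<noteq> 0"
  shows "finite (lattice_points_upto M \<xi> T)"
proof -
  obtain B where B: "M ** B = mat 1"
    using assms unfolding invertible_det_nz[symmetric] invertible_def by auto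
  have "(\<lambda>y. y v* B) = (*v) (transpose B)"
    by (rule ext) simp
  then have lin: "bounded_linear (\<lambda>y. y v* B)"
    by (simp only: matrix_vector_mul_bounded_linear)
  define S where "S = {k \<in> integer_points. norm ((k + \<xi>) v* M) < T}"
  obtain K where K: "norm (y v* B) \<le> norm y * K" "K > 0" for y
    using bounded_linear.pos_bounded[OF lin] by auto
  define c where "c = T * K + norm \<xi>"
  have bd: "\<bar>k $ i\<bar> \<le> c" if "k \<in> S" for k i
  proof -
    have "((k + \<xi>) v* M) v* B = k + \<xi>"
      by (simp add: vector_matrix_mul_assoc B)
    then have "norm (k + \<xi>) \<le> norm ((k + \<xi>) v* M) * K"
      using K(1)[of "(k + \<xi>) v* M"] by simp
    also have "\<dots> \<le> T * K"
      using that K(2) by (intro mult_right_mono) (auto simp: S_def)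
    finally show ?thesis
      using component_le_norm_cart[of k i] norm_diff_ineq[of k \<xi>] by (simp add: c_def)
  qed
  have fin: "finite {x::real. x \<in> \<int> \<and> \<bar>x\<bar> \<le> c}"
    by (rule finite_abs_int_segment)
  have "S \<subseteq> (\<lambda>(a, b). vector [a, b]) ` ({x. x \<in> \<int> \<and> \<bar>x\<bar> \<le> c} \<times> {x. x \<in> \<int> \<and> \<bar>x\<bar> \<le> c})"
  proof
    fix k assume k: "k \<in> S"
    have "k = vector [k $ 1, k $ 2]"
      by (simp add: vec_eq_iff forall_2)
    moreover have "k $ i \<in> {x. x \<in> \<int> \<and> \<bar>x\<bar> \<le> c}" for i
      using k bd by (simp add: S_def integer_points_def)
    ultimately show "k \<in> (\<lambda>(a, b). vector [a, b]) ` ({x. x \<in> \<int> \<and> \<bar>x\<bar> \<le> c} \<times> {x. x \<in> \<int> \<and> \<bar>x\<bar> \<le> c})"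
      by (intro image_eqI[where x = "(k $ 1, k $ 2)"]) simp_all
  qed
  then have "finite S"
    by (rule finite_subset) (intro finite_imageI finite_cartesian_product fin)
  moreover have "lattice_points_upto M \<xi> T \<subseteq> (\<lambda>k. (k + \<xi>) v* M) ` S"
    by (auto simp: lattice_points_upto_def affine_lattice_def S_def)
  ultimately show ?thesis
    by (rule finite_surj)
qed

end

theory Submission
  imports Defs
begin

text \<open>
Identify the plane with \<open>\<complex>\<close>. The points under study form a translate \<open>\<zeta> + \<Lambda>\<close> of a unimodular
lattice \<open>\<Lambda>\<close>. Two points \<open>y\<close>, \<open>z\<close> of norm below \<open>T\<close> matter for the pair correlation only if the angle between
them is \<open>O(1/T^2)\<close>, that is, if the triangle \<open>0, y, z\<close> has bounded area. Write \<open>z - y = d m\<close> with \<open>m\<close>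
primitive and \<open>d \<ge> 1\<close>, and put \<open>w = wd y m\<close>, \<open>\<tau> = ip y m / |m|^2\<close>, \<open>\<rho> = |m| / T\<close>. Since the
number of points is \<open>N \<sim> \<pi> T^2\<close>, the rescaled angle is close to \<open>d w / (2 \<tau> (\<tau> + d) \<rho>^2)\<close>
(\<open>angle_linearization\<close>). If \<open>z\<close> is the point farther from the origin, the conditions on the pair become
\<open>0 < \<tau>\<close> and \<open>(\<tau> + d) \<rho> < 1\<close> in the limit. So the pair sum is a sum over primitive \<open>m\<close> and over \<open>d\<close> of sums of fixed
functions of \<open>(w, \<tau>, \<rho>)\<close> over \<open>y \<in> \<zeta> + \<Lambda>\<close>.

For given \<open>m\<close> the pairs \<open>(w, \<tau>)\<close> run through a sheared translate of \<open>\<int>^2\<close>, whose position is fixed by two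
phases modulo 1: \<open>wd \<zeta> m\<close>, and \<open>wd n \<zeta>\<close> for a lattice vector \<open>n\<close> with \<open>wd n m = 1\<close>. Once these phases are
known to be equidistributed on average over \<open>m\<close>, the sum over \<open>y\<close> may be replaced by the integral over \<open>w\<close> and
\<open>\<tau>\<close> (\<open>affine_equidistribution\<close>). The integral over \<open>w\<close> produces \<open>\<integral> f\<close>, the integral over \<open>\<tau>\<close> produces an
explicit function \<open>radial_profile\<close> of \<open>d \<rho>\<close> (\<open>main_term_mean\<close>), and summation over \<open>d m\<close>, i.e. over
all nonzero lattice vectors, gives \<open>\<pi> T^2 / 2\<close> (\<open>radial_sum\<close>); the pairs with \<open>y\<close> farther out double this.

Equidistribution of the phases is a bound \<open>o(T^2)\<close> for character sums over the oriented bases \<open>(a, n)\<close>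
with \<open>m = a + n\<close> (\<open>cone_character_sum\<close>). It is proved by contraction. The pairs with
\<open>m = w1 a + w2 n\<close> form a cone whose size is proportional to \<open>T^2 / (w1 w2)\<close>; it splits, as in the Stern-Brocot
tree, into the cones with weights \<open>(w1 + w2, w2)\<close> and \<open>(w1, w1 + w2)\<close>. If \<open>w1\<close> is much larger
than \<open>w2\<close>, then for fixed \<open>a\<close> the vector \<open>n\<close> runs through a long arithmetic progression, so the character sum is
a geometric sum that is small on average by Weyl's criterion. Boundedly many splittings lead to such a cone
carrying a fixed fraction of the mass, hence the best constant in a bound \<open>B T^2 / (w1 w2)\<close> valid for all
cones can always be improved (\<open>char_bound_improve\<close>), and must be 0.

The limits are uniform only for \<open>|m| \<ge> \<epsilon> T\<close>. The Diophantine condition bounds the number of pairs with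
\<open>|m| < \<epsilon> T\<close> by \<open>O(\<epsilon> powr (1/\<kappa>) T^2)\<close> (\<open>short_differences_rare\<close>): a line in direction \<open>m\<close> passing close to the origin
carries many pairs of nearly equal direction, and \<open>wd \<zeta> m\<close> must be close to an integer for it to contain points of \<open>\<zeta> + \<Lambda>\<close>.
\<close>

section \<open>Plane lattices and primitive vectors\<close>

text \<open>The wedge product: the oriented area spanned by \<open>x\<close> and \<open>y\<close>.\<close>

definition wd :: "complex \<Rightarrow> complex \<Rightarrow> real" where
  "wd x y = Im (cnj x * y)"

text \<open>The inner product of the plane, written so that \<open>cnj x * y = ip x y + \<i> wd x y\<close>.\<close>

definition ip :: "complex \<Rightarrow> complex \<Rightarrow> real" where
  "ip x y = Re (cnj x * y)"

lemma wd_add_left: "wd (x + y) z = wd x z + wd y z"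
  and wd_add_right: "wd z (x + y) = wd z x + wd z y"
  and wd_diff_left: "wd (x - y) z = wd x z - wd y z"
  and wd_diff_right: "wd z (x - y) = wd z x - wd z y"
  and wd_minus_left: "wd (- x) z = - wd x z"
  and wd_minus_right: "wd z (- x) = - wd z x"
  and wd_of_int_left: "wd (of_int k * x) z = of_int k * wd x z"
  and wd_of_int_right: "wd z (of_int k * x) = of_int k * wd z x"
  and wd_of_real_left: "wd (of_real r * x) z = r * wd x z"
  and wd_of_real_right: "wd z (of_real r * x) = r * wd z x"
  and wd_of_nat_left: "wd (of_nat k' * x) z = of_nat k' * wd x z"
  and wd_of_nat_right: "wd z (of_nat k' * x) = of_nat k' * wd z x"
  and wd_self [simp]: "wd x x = 0"
  and wd_zero_left [simp]: "wd 0 x = 0"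
  and wd_zero_right [simp]: "wd x 0 = 0"
  by (simp_all add: wd_def algebra_simps)

lemma wd_swap: "wd y x = - wd x y"
  by (simp add: wd_def algebra_simps)

lemma ip_add_left: "ip (x + y) z = ip x z + ip y z"
  and ip_add_right: "ip z (x + y) = ip z x + ip z y"
  and ip_diff_left: "ip (x - y) z = ip x z - ip y z"
  and ip_diff_right: "ip z (x - y) = ip z x - ip z y"
  and ip_of_int_left: "ip (of_int k * x) z = of_int k * ip x z"
  and ip_of_int_right: "ip z (of_int k * x) = of_int k * ip z x"
  and ip_of_real_left: "ip (of_real r * x) z = r * ip x z"
  and ip_of_real_right: "ip z (of_real r * x) = r * ip z x"
  and ip_of_nat_left: "ip (of_nat k' * x) z = of_nat k' * ip x z"
  and ip_of_nat_right: "ip z (of_nat k' * x) = of_nat k' * ip z x"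
  and ip_zero_left [simp]: "ip 0 x = 0"
  and ip_zero_right [simp]: "ip x 0 = 0"
  by (simp_all add: ip_def algebra_simps)

lemma ip_commute: "ip x y = ip y x"
  by (simp add: ip_def algebra_simps)

lemma ip_self: "ip x x = (norm x)^2"
  using cmod_power2[of x] by (simp add: ip_def power2_eq_square)

lemmas wd_simps = wd_add_left wd_add_right wd_diff_left wd_diff_right wd_minus_left wd_minus_right
  wd_of_int_left wd_of_int_right wd_of_nat_left wd_of_nat_right wd_of_real_left wd_of_real_right
lemmas ip_simps = ip_add_left ip_add_right ip_diff_left ip_diff_right
  ip_of_int_left ip_of_int_right ip_of_nat_left ip_of_nat_right ip_of_real_left ip_of_real_right

lemma ip_wd_norm: "(ip x y)^2 + (wd x y)^2 = (norm x)^2 * (norm y)^2"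
proof -
  have "(norm (cnj x * y))^2 = (ip x y)^2 + (wd x y)^2"
    by (simp add: cmod_power2 ip_def wd_def)
  then show ?thesis by (simp add: norm_mult power_mult_distrib)
qed

lemma abs_wd_le: "\<bar>wd x y\<bar> \<le> norm x * norm y"
  and abs_ip_le: "\<bar>ip x y\<bar> \<le> norm x * norm y"
  using abs_Im_le_cmod[of "cnj x * y"] abs_Re_le_cmod[of "cnj x * y"]
  by (simp_all add: wd_def ip_def norm_mult)

lemma cramer_wd:
  assumes "wd k m = 1"
  shows "x = of_real (wd x m) * k + of_real (wd k x) * m"
proof -
  have *: "Re k * Im m - Im k * Re m = 1"
    using assms by (simp add: wd_def)
  show ?thesis
  proof (rule complex_eqI)
    have "Re x = Re x * (Re k * Im m - Im k * Re m)"
      using * by simp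
    then show "Re x = Re (of_real (wd x m) * k + of_real (wd k x) * m)"
      by (simp add: wd_def algebra_simps)
    have "Im x = Im x * (Re k * Im m - Im k * Re m)"
      using * by simp
    then show "Im x = Im (of_real (wd x m) * k + of_real (wd k x) * m)"
      by (simp add: wd_def algebra_simps)
  qed
qed

text \<open>The grid of mesh \<open>s / 2\<close> has at most one point of \<open>S\<close> in each cell.\<close>

lemma card_separated_disc:
  fixes S :: "complex set"
  assumes "\<And>z. z \<in> S \<Longrightarrow> norm z < R"
    and "\<And>z w. z \<in> S \<Longrightarrow> w \<in> S \<Longrightarrow> z \<noteq> w \<Longrightarrow> s \<le> norm (z - w)"
    and "0 < s" "s \<le> R"
  shows "finite S" "real (card S) \<le> 49 * (R / s)^2"
proof -
  define q where "q = s / 2"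
  have q: "q > 0" using assms by (simp add: q_def)
  define g where "g z = (\<lfloor>Re z / q\<rfloor>, \<lfloor>Im z / q\<rfloor>)" for z
  define n where "n = \<lfloor>R / q\<rfloor>"
  have n: "2 \<le> n" unfolding n_def using assms by (simp add: q_def le_floor_iff field_simps)
  have inj: "inj_on g S"
  proof (rule inj_onI, rule ccontr)
    fix z w assume zw: "z \<in> S" "w \<in> S" "g z = g w" "z \<noteq> w"
    have *: "\<bar>x - y\<bar> < q" if "\<lfloor>x / q\<rfloor> = \<lfloor>y / q\<rfloor>" for x y
    proof -
      have "\<bar>x / q - y / q\<bar> < 1" using that by linarith
      then show ?thesis using q by (simp add: abs_if field_simps split: if_splits)
    qed
    have "norm (z - w) \<le> \<bar>Re (z - w)\<bar> + \<bar>Im (z - w)\<bar>" by (rule cmod_le)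
    also have "\<dots> < q + q" using *[of "Re z" "Re w"] *[of "Im z" "Im w"] zw(3) by (simp add: g_def)
    finally show False using assms(2)[OF zw(1,2,4)] by (simp add: q_def)
  qed
  have sub: "g ` S \<subseteq> {-n-1..n} \<times> {-n-1..n}"
  proof -
    have "\<lfloor>x / q\<rfloor> \<in> {-n-1..n}" if "\<bar>x\<bar> \<le> R" for x
    proof -
      have "x / q \<le> R / q" "- (R / q) \<le> x / q" using that q by (auto simp: field_simps)
      then show ?thesis unfolding n_def by (simp add: floor_mono) linarith
    qed
    moreover have "\<bar>Re z\<bar> \<le> R" "\<bar>Im z\<bar> \<le> R" if "z \<in> S" for z
      using assms(1)[OF that] abs_Re_le_cmod[of z] abs_Im_le_cmod[of z] by auto
    ultimately show ?thesis by (auto simp: g_def)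
  qed
  have "finite (g ` S)" using sub by (rule finite_subset) auto
  then show "finite S" using inj by (simp add: finite_image_iff)
  have "card S = card (g ` S)" using inj by (simp add: card_image)
  also have "\<dots> \<le> card ({-n-1..n} \<times> {-n-1..n})" using sub by (intro card_mono) auto
  also have "\<dots> = nat (2 * n + 2) ^ 2"
  proof -
    have "card {-n-1..n} = nat (2 * n + 2)" by simp
    then show ?thesis by (simp only: card_cartesian_product power2_eq_square)
  qed
  finally have "real (card S) \<le> real (nat (2 * n + 2) ^ 2)" by linarith
  also have "\<dots> = (2 * of_int n + 2)^2" using n by simp
  also have "\<dots> \<le> (2 * (R / q) + 2)^2"
    using n by (intro power_mono add_mono mult_left_mono) (auto simp: n_def)
  also have "\<dots> \<le> (7 * (R / s))^2"
    using assms by (intro power_mono) (auto simp: q_def field_simps)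
  also have "\<dots> = 49 * (R / s)^2" by (simp add: power_mult_distrib power_divide)
  finally show "real (card S) \<le> 49 * (R / s)^2" .
qed

locale unimodular_lattice =
  fixes u v :: complex
  assumes wd_basis: "wd u v = 1"
begin

definition lattice :: "complex set" where
  "lattice = range (\<lambda>(i::int, j::int). of_int i * u + of_int j * v)"

lemma latticeI: "of_int i * u + of_int j * v \<in> lattice"
  unfolding lattice_def by (rule image_eqI[of _ _ "(i, j)"]) auto

lemma latticeE:
  assumes "x \<in> lattice" obtains i j where "x = of_int i * u + of_int j * v"
  using assms unfolding lattice_def by auto

lemma basis_in_lattice [simp]: "u \<in> lattice" "v \<in> lattice"
  using latticeI[of 1 0] latticeI[of 0 1] by auto

lemma lattice_0 [simp]: "0 \<in> lattice"
  using latticeI[of 0 0] by simp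

lemma lattice_add [intro]: "x \<in> lattice \<Longrightarrow> y \<in> lattice \<Longrightarrow> x + y \<in> lattice"
proof -
  assume "x \<in> lattice" "y \<in> lattice"
  then obtain i j k l where "x = of_int i * u + of_int j * v" "y = of_int k * u + of_int l * v"
    by (metis latticeE)
  then have "x + y = of_int (i + k) * u + of_int (j + l) * v" by (simp add: algebra_simps)
  then show ?thesis using latticeI by metis
qed

lemma lattice_of_int [intro]: "x \<in> lattice \<Longrightarrow> of_int n * x \<in> lattice"
proof -
  assume "x \<in> lattice"
  then obtain i j where "x = of_int i * u + of_int j * v"
    by (metis latticeE)
  then have "of_int n * x = of_int (n * i) * u + of_int (n * j) * v" by (simp add: algebra_simps)
  then show ?thesis using latticeI by metis
qed

lemma lattice_of_nat [intro]: "x \<in> lattice \<Longrightarrow> of_nat n * x \<in> lattice"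
  using lattice_of_int[of x "int n"] by simp

lemma lattice_minus [intro]: "x \<in> lattice \<Longrightarrow> - x \<in> lattice"
  using lattice_of_int[of x "-1"] by simp

lemma lattice_diff [intro]: "x \<in> lattice \<Longrightarrow> y \<in> lattice \<Longrightarrow> x - y \<in> lattice"
  using lattice_add[of x "- y"] by auto

lemma wd_basis': "wd v u = -1"
  using wd_basis by (simp add: wd_swap[of v u])

lemma wd_coords:
  "wd (of_int i * u + of_int j * v) (of_int k * u + of_int l * v) = of_int (i * l - j * k)"
  by (simp add: wd_simps wd_basis wd_basis')

lemma wd_lattice:
  assumes "x \<in> lattice" "y \<in> lattice" obtains k where "wd x y = of_int k"
  using assms by (metis latticeE wd_coords)

text \<open>A lower bound for the norm of nonzero lattice vectors, not the exact minimum.\<close>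

definition min_norm :: real where
  "min_norm = 1 / (norm u + norm v)"

lemma min_norm_pos: "min_norm > 0"
proof -
  have "u \<noteq> 0" using wd_basis by (auto simp: wd_def)
  then show ?thesis by (simp add: min_norm_def add_pos_nonneg)
qed

text \<open>One of the integers \<open>wd x v\<close>, \<open>wd u x\<close> is nonzero, and \<open>\<bar>wd\<bar>\<close> is at most the product of the norms.\<close>

lemma min_norm_le:
  assumes "x \<in> lattice" "x \<noteq> 0"
  shows "min_norm \<le> norm x"
proof -
  obtain i j where x: "x = of_int i * u + of_int j * v" using assms(1) by (rule latticeE)
  have "i \<noteq> 0 \<or> j \<noteq> 0" using assms(2) x by auto
  moreover have "wd x v = of_int i" "wd u x = of_int j"
    using wd_coords[of i j 0 1] wd_coords[of 1 0 i j] x by auto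
  moreover have "1 \<le> \<bar>real_of_int k\<bar>" if "k \<noteq> 0" for k using that by linarith
  ultimately have "1 \<le> \<bar>wd x v\<bar> \<or> 1 \<le> \<bar>wd u x\<bar>" by auto
  then have "1 \<le> norm x * norm v \<or> 1 \<le> norm u * norm x"
    using abs_wd_le[of x v] abs_wd_le[of u x] by linarith
  moreover have "norm x * norm v \<le> norm x * (norm u + norm v)" "norm u * norm x \<le> norm x * (norm u + norm v)"
    by (auto simp: algebra_simps)
  ultimately have "1 \<le> norm x * (norm u + norm v)" by linarith
  moreover have "norm u + norm v > 0" using min_norm_pos by (simp add: min_norm_def)
  ultimately show ?thesis by (simp add: min_norm_def field_simps)
qed

text \<open>Lattice vectors that extend to an oriented basis \<open>(k, m)\<close>; in coordinates, those with coprime entries.\<close>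

definition primitive :: "complex \<Rightarrow> bool" where
  "primitive m \<longleftrightarrow> m \<in> lattice \<and> (\<exists>k\<in>lattice. wd k m = 1)"

lemma primitiveE:
  assumes "primitive m"
  obtains k where "m \<in> lattice" "k \<in> lattice" "wd k m = 1"
  using assms unfolding primitive_def by auto

lemma primitive_nonzero: "primitive m \<Longrightarrow> m \<noteq> 0"
  by (auto simp: primitive_def)

lemma primitive_decomposition:
  assumes "x \<in> lattice" "x \<noteq> 0"
  obtains d m where "primitive m" "d \<ge> (1::nat)" "x = of_nat d * m"
proof -
  obtain i j where x: "x = of_int i * u + of_int j * v" using assms(1) by (rule latticeE)
  define g where "g = gcd i j"
  have g: "g > 0" using assms(2) x by (auto simp: g_def)
  obtain i' j' where ij: "i = g * i'" "j = g * j'"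
    unfolding g_def by (meson dvd_def gcd_dvd1 gcd_dvd2)
  define m where "m = of_int i' * u + of_int j' * v"
  have "coprime i' j'"
    using g by (metis g_def ij coprime_iff_gcd_eq_1 gcd_mult_distrib_int
        mult_cancel_left mult.right_neutral abs_of_pos less_irrefl)
  then obtain p q where "p * i' + q * j' = 1"
    by (metis bezout_int coprime_iff_gcd_eq_1)
  then have "- q * j' - p * i' = -1" by (simp add: algebra_simps)
  then have "wd (of_int (- q) * u + of_int p * v) m = of_int (-1)"
    unfolding m_def wd_coords by (simp only:)
  then have "wd (- (of_int (- q) * u + of_int p * v)) m = 1"
    by (simp only: wd_minus_left of_int_minus of_int_1 minus_minus)
  then have "primitive m"
    unfolding primitive_def using latticeI lattice_minus m_def by blast
  moreover have "x = of_nat (nat g) * m"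
    using g by (simp add: x m_def ij algebra_simps of_nat_nat)
  moreover have "nat g \<ge> 1" using g by linarith
  ultimately show ?thesis using that by blast
qed

lemma primitive_unique:
  assumes "primitive m" "primitive m'" "of_nat d * m = of_nat d' * m'" "d \<ge> 1" "d' \<ge> 1"
  shows "d = d' \<and> m = m'"
proof -
  have *: "e' dvd e" if h: "primitive n" "primitive n'" "of_nat e * n = of_nat e' * n'" for n n' e e'
  proof -
    obtain k where k: "k \<in> lattice" "wd k n = 1" by (rule primitiveE[OF h(1)])
    have "n' \<in> lattice" by (rule primitiveE[OF h(2)])
    then obtain l where l: "wd k n' = of_int l" using wd_lattice[OF k(1)] by metis
    have "real e = wd k (of_nat e * n)" by (simp add: k wd_simps)
    also have "\<dots> = of_int (int e' * l)" by (simp only: h(3) wd_simps l) simp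
    finally have "int e = int e' * l" by linarith
    then show ?thesis by (metis dvd_triv_left int_dvd_int_iff)
  qed
  have "d = d'" using *[OF assms(1,2,3)] *[OF assms(2,1) assms(3)[symmetric]] by (simp add: dvd_antisym)
  then show ?thesis using assms by auto
qed

section \<open>Counting affine lattice points in discs\<close>

text \<open>The points of the affine lattice \<open>\<zeta> + \<Lambda>\<close> in an open disc, not the disc itself.\<close>

definition disc :: "complex \<Rightarrow> real \<Rightarrow> complex set" where
  "disc \<zeta> T = {z. z - \<zeta> \<in> lattice \<and> norm z < T}"

lemma lattice_image_vec:
  fixes \<zeta> :: complex and T :: real
  defines "s1 \<equiv> wd \<zeta> v" and "s2 \<equiv> wd u \<zeta>"
  defines "K \<equiv> {(i::int, j::int). norm (of_real (of_int i + s1) * u + of_real (of_int j + s2) * v) < T}"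
  shows "bij_betw (\<lambda>(i, j). of_real (of_int i + s1) * u + of_real (of_int j + s2) * v) K (disc \<zeta> T)"
proof -
  have \<zeta>: "\<zeta> = of_real s1 * u + of_real s2 * v"
    unfolding s1_def s2_def by (rule cramer_wd) (rule wd_basis)
  have eq: "of_real (of_int i + s1) * u + of_real (of_int j + s2) * v = \<zeta> + (of_int i * u + of_int j * v)" for i j :: int
    by (subst \<zeta>) (simp add: algebra_simps)
  have inj: "i = k \<and> j = l" if "of_int i * u + of_int j * v = of_int k * u + of_int l * v" for i j k l :: int
  proof -
    have "wd (of_int i * u + of_int j * v) v = of_int i" "wd u (of_int i * u + of_int j * v) = of_int j" for i j
      using wd_coords[of i j 0 1] wd_coords[of 1 0 i j] by auto
    from this[of i j] this[of k l] that have "real_of_int i = of_int k" "real_of_int j = of_int l" by simp_all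
    then show ?thesis by simp
  qed
  show ?thesis
    unfolding bij_betw_def
  proof
    show "inj_on (\<lambda>(i, j). of_real (of_int i + s1) * u + of_real (of_int j + s2) * v) K"
    proof (rule inj_onI, clarify)
      fix i j k l :: int
      assume "of_real (of_int i + s1) * u + of_real (of_int j + s2) * v = of_real (of_int k + s1) * u + of_real (of_int l + s2) * v"
      then have "of_int i * u + of_int j * v = of_int k * u + of_int l * v"
        by (simp only: eq add_left_cancel)
      then show "i = k \<and> j = l" by (rule inj)
    qed
    show "(\<lambda>(i, j). of_real (of_int i + s1) * u + of_real (of_int j + s2) * v) ` K = disc \<zeta> T"
    proof (intro equalityI subsetI)
      fix z assume "z \<in> (\<lambda>(i, j). of_real (of_int i + s1) * u + of_real (of_int j + s2) * v) ` K"
      then show "z \<in> disc \<zeta> T" unfolding K_def disc_def eq by (auto simp: latticeI)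
    next
      fix z assume z: "z \<in> disc \<zeta> T"
      then obtain i j where ij: "z - \<zeta> = of_int i * u + of_int j * v"
        unfolding disc_def by (auto elim: latticeE)
      then have "z = \<zeta> + (of_int i * u + of_int j * v)" by (simp add: algebra_simps)
      then show "z \<in> (\<lambda>(i, j). of_real (of_int i + s1) * u + of_real (of_int j + s2) * v) ` K"
        using z unfolding K_def disc_def eq by (intro image_eqI[of _ _ "(i, j)"]) auto
    qed
  qed
qed

lemma finite_disc: "finite (disc \<zeta> T)"
proof -
  define R where "R = max T min_norm"
  show ?thesis
  proof (rule card_separated_disc[where s = min_norm and R = R])
    fix z w assume zw: "z \<in> disc \<zeta> T" "w \<in> disc \<zeta> T" "z \<noteq> w"
    have "(z - \<zeta>) - (w - \<zeta>) \<in> lattice" using zw unfolding disc_def by blast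
    then show "min_norm \<le> norm (z - w)" using zw by (intro min_norm_le) auto
  qed (auto simp: disc_def R_def min_norm_pos)
qed

definition vec2 :: "real \<Rightarrow> real \<Rightarrow> real ^ 2" where "vec2 x y = vector [x, y]"

definition coord :: "real ^ 2 \<Rightarrow> real ^ 2" where
  "coord y = vec2 (wd (Complex (y $ 1) (y $ 2)) v) (wd u (Complex (y $ 1) (y $ 2)))"

definition comb :: "real ^ 2 \<Rightarrow> complex" where
  "comb x = of_real (x $ 1) * u + of_real (x $ 2) * v"

text \<open>In lattice coordinates the disc is an ellipse, and the coordinate change has determinant 1.\<close>

lemma measure_ellipse:
  assumes "T \<ge> 0"
  shows "{x. norm (comb x) < T} \<in> lmeasurable" "measure lebesgue {x. norm (comb x) < T} = pi * T^2"
proof -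
  have lin: "linear coord"
    by (rule linearI) (auto simp: coord_def vec2_def wd_def vec_eq_iff forall_2 algebra_simps)
  have det1: "det (matrix coord) = 1"
  proof -
    have "det (matrix coord) = Im v * Re u - Re v * Im u"
      by (simp add: det_2 matrix_def coord_def vec2_def wd_def axis_def)
    then show ?thesis using wd_basis by (simp add: wd_def algebra_simps)
  qed
  have comb_coord: "comb (coord y) = Complex (y $ 1) (y $ 2)" for y
    using cramer_wd[OF wd_basis, of "Complex (y $ 1) (y $ 2)"] by (simp add: comb_def coord_def vec2_def)
  have surj: "\<exists>y. x = coord y" for x
  proof
    have "wd (comb x) v = x $ 1" "wd u (comb x) = x $ 2"
      by (simp_all add: comb_def wd_simps wd_basis)
    then show "x = coord (vec2 (Re (comb x)) (Im (comb x)))"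
      by (simp add: coord_def vec2_def vec_eq_iff forall_2)
  qed
  have nrm: "norm (comb (coord y)) = norm y" for y
    by (simp add: comb_coord cmod_def norm_vec_def L2_set_def UNIV_2)
  have eq: "{x. norm (comb x) < T} = coord ` ball 0 T"
  proof (intro equalityI subsetI)
    fix x assume "x \<in> {x. norm (comb x) < T}"
    moreover obtain y where "x = coord y" using surj by blast
    ultimately show "x \<in> coord ` ball 0 T" using nrm by auto
  qed (auto simp: nrm)
  show "{x. norm (comb x) < T} \<in> lmeasurable"
    unfolding eq by (rule measurable_linear_image[OF lin]) simp
  have "measure lebesgue (coord ` ball 0 T) = \<bar>det (matrix coord)\<bar> * measure lebesgue (ball 0 T :: (real^2) set)"
    by (rule measure_linear_image[OF lin]) simp
  also have "\<dots> = pi * T^2"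
    using circle_area[OF assms, of 0] by (simp add: det1 measure_completion)
  finally show "measure lebesgue {x. norm (comb x) < T} = pi * T^2"
    unfolding eq .
qed

text \<open>Attach to each point its unit cell in lattice coordinates. The cells cover the ellipse shrunk by their diameter and lie in the ellipse enlarged by it, and the two areas differ by \<open>O(T + 1)\<close>.\<close>

lemma card_disc_asymp:
  obtains C where "C \<ge> 0" "\<And>T. T \<ge> 0 \<Longrightarrow> \<bar>real (card (disc \<zeta> T)) - pi * T^2\<bar> \<le> C * (T + 1)"
proof -
  define c where "c = norm u + norm v"
  define s1 s2 where "s1 = wd \<zeta> v" and "s2 = wd u \<zeta>"
  define K where "K T = {(i::int, j::int). norm (of_real (of_int i + s1) * u + of_real (of_int j + s2) * v) < T}" for T
  have bij: "bij_betw (\<lambda>(i, j). of_real (of_int i + s1) * u + of_real (of_int j + s2) * v) (K T) (disc \<zeta> T)" for T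
    using lattice_image_vec[of \<zeta> T] unfolding K_def s1_def s2_def .
  have card: "card (disc \<zeta> T) = card (K T)" for T using bij_betw_same_card[OF bij] by simp
  have fin: "finite (K T)" for T using bij_betw_finite[OF bij] finite_disc by blast
  define p where "p = (\<lambda>(i::int, j::int). vec2 (of_int i + s1) (of_int j + s2))"
  define q where "q = (\<lambda>(i::int, j::int). vec2 (of_int i + 1 + s1) (of_int j + 1 + s2))"
  define E where "E T = {x. norm (comb x) < T}" for T
  have K: "k \<in> K T \<longleftrightarrow> norm (comb (p k)) < T" for k T
    by (auto simp: K_def p_def comb_def vec2_def split: prod.splits)
  have close: "norm (comb x - comb (p k)) \<le> c" if "x \<in> cbox (p k) (q k)" for x k
  proof -
    obtain i j where k: "k = (i, j)" by (cases k)
    have b: "\<bar>x $ 1 - (of_int i + s1)\<bar> \<le> 1" "\<bar>x $ 2 - (of_int j + s2)\<bar> \<le> 1"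
      using that by (auto simp: k p_def q_def vec2_def mem_box_cart forall_2)
    have "comb x - comb (p k) = of_real (x $ 1 - (of_int i + s1)) * u + of_real (x $ 2 - (of_int j + s2)) * v"
      by (simp add: comb_def p_def k vec2_def algebra_simps)
    also have "norm \<dots> \<le> \<bar>x $ 1 - (of_int i + s1)\<bar> * norm u + \<bar>x $ 2 - (of_int j + s2)\<bar> * norm v"
      by (rule order_trans[OF norm_triangle_ineq]) (simp only: norm_mult norm_of_real order_refl)
    also have "\<dots> \<le> 1 * norm u + 1 * norm v"
      using b by (intro add_mono mult_right_mono) auto
    finally show ?thesis by (simp add: c_def)
  qed
  have pq: "measure lebesgue (cbox (p k) (q k)) = 1" "measure lebesgue (box (p k) (q k)) = 1" for k
  proof -
    obtain i j where k: "k = (i, j)" by (cases k)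
    have ne: "cbox (p k) (q k) \<noteq> {}"
      by (auto simp: k p_def q_def vec2_def interval_ne_empty_cart forall_2)
    have "measure lborel (cbox (p k) (q k)) = 1"
      using content_cbox_cart[OF ne] by (simp add: k p_def q_def vec2_def UNIV_2)
    then show "measure lebesgue (cbox (p k) (q k)) = 1" "measure lebesgue (box (p k) (q k)) = 1"
      by (simp_all add: measure_completion measure_lborel_box_eq measure_lborel_cbox_eq)
  qed
  have upper: "real (card (K T)) \<le> pi * (T + c)^2" if "T \<ge> 0" for T
  proof -
    have disj: "disjoint_family_on (\<lambda>k. box (p k) (q k)) (K T)"
      unfolding disjoint_family_on_def
    proof (intro ballI impI)
      fix k l assume kl: "k \<in> K T" "l \<in> K T" "k \<noteq> l"
      show "box (p k) (q k) \<inter> box (p l) (q l) = {}"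
      proof (rule ccontr)
        assume "box (p k) (q k) \<inter> box (p l) (q l) \<noteq> {}"
        then obtain x where x: "x \<in> box (p k) (q k)" "x \<in> box (p l) (q l)" by auto
        obtain i j where ij1: "k = (i, j)" by (cases k)
        obtain i' j' where ij2: "l = (i', j')" by (cases l)
        note ij = ij1 ij2
        have "of_int i + s1 < x $ 1" "x $ 1 < of_int i + 1 + s1" "of_int i' + s1 < x $ 1" "x $ 1 < of_int i' + 1 + s1"
             "of_int j + s2 < x $ 2" "x $ 2 < of_int j + 1 + s2" "of_int j' + s2 < x $ 2" "x $ 2 < of_int j' + 1 + s2"
          using x by (auto simp: ij p_def q_def vec2_def mem_box_cart forall_2)
        then have "i = i'" "j = j'" by linarith+
        then show False using kl ij by simp
      qed
    qed
    have c0: "c \<ge> 0" by (simp add: c_def)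
    have "real (card (K T)) = (\<Sum>k\<in>K T. measure lebesgue (box (p k) (q k)))" by (simp add: pq)
    also have "\<dots> = measure lebesgue (\<Union>k\<in>K T. box (p k) (q k))"
      by (rule measure_finite_Union[symmetric]) (use fin disj in \<open>auto simp: fmeasurableD2\<close>)
    also have "\<dots> \<le> measure lebesgue (E (T + c))"
    proof (rule measure_mono_fmeasurable)
      show "(\<Union>k\<in>K T. box (p k) (q k)) \<subseteq> E (T + c)"
      proof (clarify)
        fix k x assume k: "k \<in> K T" and x: "x \<in> box (p k) (q k)"
        have "norm (comb x) \<le> norm (comb (p k)) + norm (comb x - comb (p k))"
          using norm_triangle_ineq[of "comb (p k)" "comb x - comb (p k)"] by simp
        also have "\<dots> < T + c" using k close[of x k] x box_subset_cbox[of "p k" "q k"] K[of k T] by (simp add: subset_iff)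
        finally show "x \<in> E (T + c)" by (simp add: E_def)
      qed
      show "E (T + c) \<in> lmeasurable" unfolding E_def using that c0 by (intro measure_ellipse) auto
      show "(\<Union>k\<in>K T. box (p k) (q k)) \<in> sets lebesgue" using fin by (intro sets.finite_UN) auto
    qed
    also have "\<dots> = pi * (T + c)^2" unfolding E_def using that c0 by (intro measure_ellipse) auto
    finally show ?thesis .
  qed
  have lower: "pi * (T - c)^2 \<le> real (card (K T))" if "T \<ge> c" for T
  proof -
    have "pi * (T - c)^2 = measure lebesgue (E (T - c))" unfolding E_def using that by (intro measure_ellipse(2)[symmetric]) auto
    also have "\<dots> \<le> measure lebesgue (\<Union>k\<in>K T. cbox (p k) (q k))"
    proof (rule measure_mono_fmeasurable)
      show "E (T - c) \<subseteq> (\<Union>k\<in>K T. cbox (p k) (q k))"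
      proof
        fix x assume x: "x \<in> E (T - c)"
        define k where "k = (\<lfloor>x $ 1 - s1\<rfloor>, \<lfloor>x $ 2 - s2\<rfloor>)"
        have fl: "of_int \<lfloor>y - s\<rfloor> + s \<le> y \<and> y \<le> of_int \<lfloor>y - s\<rfloor> + 1 + s" for y s :: real by linarith
        have xk: "x \<in> cbox (p k) (q k)"
          using fl[where y = "x $ 1" and s = s1] fl[where y = "x $ 2" and s = s2]
          by (simp add: k_def p_def q_def vec2_def mem_box_cart forall_2)
        have "norm (comb (p k)) \<le> norm (comb x) + norm (comb x - comb (p k))"
          using norm_triangle_ineq4[of "comb x" "comb x - comb (p k)"] by simp
        also have "\<dots> < T" using x close[OF xk] by (simp add: E_def)
        finally show "x \<in> (\<Union>k\<in>K T. cbox (p k) (q k))" using xk K by blast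
      qed
      show "E (T - c) \<in> sets lebesgue" unfolding E_def using that by (intro fmeasurableD measure_ellipse) auto
      show "(\<Union>k\<in>K T. cbox (p k) (q k)) \<in> lmeasurable" using fin by (intro fmeasurable.finite_UN) auto
    qed
    also have "\<dots> \<le> (\<Sum>k\<in>K T. measure lebesgue (cbox (p k) (q k)))"
      using fin by (intro measure_UNION_le) auto
    also have "\<dots> = real (card (K T))" by (simp add: pq)
    finally show ?thesis .
  qed
  define C where "C = pi * (2 * c + c^2)"
  have c0: "c \<ge> 0" by (simp add: c_def)
  show thesis
  proof (rule that)
    show "C \<ge> 0" using c0 by (simp add: C_def)
    fix T :: real assume T: "T \<ge> 0"
    have "(T + c)^2 - T^2 \<le> (2 * c + c^2) * (T + 1)"
    proof -
      have "(2 * c + c^2) * (T + 1) - ((T + c)^2 - T^2) = c^2 * T + 2 * c" by (simp add: power2_eq_square algebra_simps)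
      moreover have "0 \<le> c^2 * T + 2 * c" using T c0 by simp
      ultimately show ?thesis by linarith
    qed
    then have "pi * ((T + c)^2 - T^2) \<le> C * (T + 1)" unfolding C_def by (simp add: mult.assoc)
    then have up: "real (card (K T)) - pi * T^2 \<le> C * (T + 1)"
      using upper[OF T] by (simp add: algebra_simps)
    have lo: "pi * T^2 - real (card (K T)) \<le> C * (T + 1)"
    proof (cases "T \<ge> c")
      case True
      have "T^2 - (T - c)^2 \<le> (2 * c + c^2) * (T + 1)"
      proof -
        have "(2 * c + c^2) * (T + 1) - (T^2 - (T - c)^2) = c^2 * T + 2 * c + 2 * c^2" by (simp add: power2_eq_square algebra_simps)
        moreover have "0 \<le> c^2 * T + 2 * c + 2 * c^2" using T c0 by simp
        ultimately show ?thesis by linarith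
      qed
      then have "pi * (T^2 - (T - c)^2) \<le> C * (T + 1)" unfolding C_def by (simp add: mult.assoc)
      then show ?thesis using lower[OF True] by (simp add: algebra_simps)
    next
      case False
      then have "T * T \<le> c * T" using T by (intro mult_right_mono) auto
      also have "\<dots> \<le> (2 * c + c^2) * (T + 1)" using T c0 by (intro mult_mono) auto
      finally have "pi * T^2 \<le> C * (T + 1)" unfolding C_def by (simp add: mult.assoc power2_eq_square)
      then show ?thesis by linarith
    qed
    show "\<bar>real (card (disc \<zeta> T)) - pi * T^2\<bar> \<le> C * (T + 1)" using up lo card by (simp add: abs_le_iff)
  qed
qed

end

section \<open>Bounds of quadratic growth\<close>

text \<open>\<open>b\<close> bounds the upper limit of \<open>norm (S T) / T^2\<close>. In particular \<open>qbound S 0\<close> means \<open>S T = o(T^2)\<close>.\<close>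

definition qbound :: "(real \<Rightarrow> 'a::real_normed_vector) \<Rightarrow> real \<Rightarrow> bool" where
  "qbound S b \<longleftrightarrow> (\<forall>e>0. \<forall>\<^sub>F T in at_top. norm (S T) \<le> (b + e) * T^2)"

lemma qboundI: "(\<And>e. e > 0 \<Longrightarrow> \<forall>\<^sub>F T in at_top. norm (S T) \<le> (b + e) * T^2) \<Longrightarrow> qbound S b"
  by (simp add: qbound_def)

lemma qboundD: "qbound S b \<Longrightarrow> e > 0 \<Longrightarrow> \<forall>\<^sub>F T in at_top. norm (S T) \<le> (b + e) * T^2"
  by (simp add: qbound_def)

lemma qbound_mono:
  assumes "qbound S b" "b \<le> b'" "\<forall>\<^sub>F T in at_top. norm (S' T) \<le> norm (S T)"
  shows "qbound S' b'"
proof (rule qboundI)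
  fix e :: real assume "e > 0"
  show "\<forall>\<^sub>F T in at_top. norm (S' T) \<le> (b' + e) * T^2"
    using qboundD[OF assms(1) \<open>e > 0\<close>] assms(3)
  proof eventually_elim
    case (elim T)
    have "(b + e) * T^2 \<le> (b' + e) * T^2" using assms(2) by (intro mult_right_mono) auto
    then show ?case using elim by linarith
  qed
qed

lemma qbound_weaken: "qbound S b \<Longrightarrow> b \<le> b' \<Longrightarrow> qbound S b'"
  by (rule qbound_mono) auto

lemma qbound_add:
  assumes "qbound S b" "qbound S' b'"
  shows "qbound (\<lambda>T. S T + S' T) (b + b')"
proof (rule qboundI)
  fix e :: real assume "e > 0"
  then have "e / 2 > 0" by simp
  show "\<forall>\<^sub>F T in at_top. norm (S T + S' T) \<le> (b + b' + e) * T^2"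
    using qboundD[OF assms(1) \<open>e / 2 > 0\<close>] qboundD[OF assms(2) \<open>e / 2 > 0\<close>]
  proof eventually_elim
    case (elim T)
    have "norm (S T + S' T) \<le> norm (S T) + norm (S' T)" by (rule norm_triangle_ineq)
    also have "\<dots> \<le> (b + b' + e) * T^2" using elim by (simp add: algebra_simps)
    finally show ?case .
  qed
qed

lemma qbound_minus: "qbound S b \<Longrightarrow> qbound (\<lambda>T. - S T) b"
  by (simp add: qbound_def)

lemma qbound_diff: "qbound S b \<Longrightarrow> qbound S' b' \<Longrightarrow> qbound (\<lambda>T. S T - S' T) (b + b')"
  using qbound_add[OF _ qbound_minus] by fastforce

lemma qbound_zero [simp]: "qbound (\<lambda>T. 0) 0"
  by (simp add: qbound_def)

lemma qbound_sum:
  "finite I \<Longrightarrow> (\<And>i. i \<in> I \<Longrightarrow> qbound (S i) (b i)) \<Longrightarrow> qbound (\<lambda>T. \<Sum>i\<in>I. S i T) (\<Sum>i\<in>I. b i)"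
  by (induction I rule: finite_induct) (auto intro: qbound_add)

lemma qbound_sum0:
  "finite I \<Longrightarrow> (\<And>i. i \<in> I \<Longrightarrow> qbound (S i) 0) \<Longrightarrow> qbound (\<lambda>T. \<Sum>i\<in>I. S i T) 0"
  using qbound_sum[of I S "\<lambda>_. 0"] by simp

lemma qbound_cmult:
  fixes c :: "'a::real_normed_field"
  assumes "qbound S b"
  shows "qbound (\<lambda>T. c * S T) (norm c * b)"
proof (rule qboundI)
  fix e :: real assume e: "e > 0"
  define d where "d = e / (norm c + 1)"
  have c: "norm c + 1 > 0" by (simp add: add_nonneg_pos)
  have "d > 0" using e c by (simp add: d_def)
  moreover have "norm c * e \<le> (norm c + 1) * e" using e by (intro mult_right_mono) auto
  then have "norm c * d \<le> e" using c by (simp add: d_def pos_divide_le_eq mult.commute)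
  ultimately have d: "d > 0" "norm c * d \<le> e" by auto
  show "\<forall>\<^sub>F T in at_top. norm (c * S T) \<le> (norm c * b + e) * T^2"
    using qboundD[OF assms d(1)]
  proof eventually_elim
    case (elim T)
    have "norm (c * S T) \<le> norm c * ((b + d) * T^2)"
      unfolding norm_mult using elim by (intro mult_left_mono) auto
    also have "\<dots> = (norm c * b + norm c * d) * T^2" by (simp add: algebra_simps)
    also have "\<dots> \<le> (norm c * b + e) * T^2" using d by (intro mult_right_mono) auto
    finally show ?case .
  qed
qed

lemma qbound_scale:
  assumes "qbound S b" "c > 0"
  shows "qbound (\<lambda>T. S (c * T)) (c^2 * b)"
proof (rule qboundI)
  fix e :: real assume e: "e > 0"
  have "e / c^2 > 0" using e assms by simp
  have "filterlim (\<lambda>T. c * T) at_top at_top"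
    by (rule filterlim_tendsto_pos_mult_at_top[OF tendsto_const assms(2) filterlim_ident])
  from eventually_compose_filterlim[OF qboundD[OF assms(1) \<open>e / c^2 > 0\<close>] this]
  show "\<forall>\<^sub>F T in at_top. norm (S (c * T)) \<le> (c^2 * b + e) * T^2"
  proof eventually_elim
    case (elim T)
    have "(b + e / c^2) * (c * T)^2 = (c^2 * b + e) * T^2"
      using assms(2) by (simp add: power_mult_distrib distrib_right)
    then show ?case using elim by simp
  qed
qed

lemma qbound_linear:
  assumes "\<forall>\<^sub>F T in at_top. norm (S T) \<le> C * T"
  shows "qbound S 0"
proof (rule qboundI)
  fix e :: real assume e: "e > 0"
  show "\<forall>\<^sub>F T in at_top. norm (S T) \<le> (0 + e) * T^2"
    using assms eventually_ge_at_top[of "max 1 (C / e)"]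
  proof eventually_elim
    case (elim T)
    then have "C \<le> e * T" using e by (simp add: field_simps)
    then have "C * T \<le> e * T * T" using elim by (intro mult_right_mono) auto
    then have "norm (S T) \<le> e * T * T" using elim by linarith
    then show ?case by (simp add: power2_eq_square mult.assoc)
  qed
qed

lemma qbound_bounded:
  assumes "\<forall>\<^sub>F T in at_top. norm (S T) \<le> C"
  shows "qbound S 0"
proof (rule qbound_linear[where C = "\<bar>C\<bar>"])
  show "\<forall>\<^sub>F T in at_top. norm (S T) \<le> \<bar>C\<bar> * T"
    using assms eventually_ge_at_top[of 1]
  proof eventually_elim
    case (elim T)
    have "\<bar>C\<bar> * 1 \<le> \<bar>C\<bar> * T" using elim by (intro mult_left_mono) auto
    then show ?case using elim by linarith
  qed
qed

lemma qbound_limit: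
  assumes "\<And>d. d > 0 \<Longrightarrow> qbound S (b + d)"
  shows "qbound S b"
proof (rule qboundI)
  fix e :: real assume e: "e > 0"
  show "\<forall>\<^sub>F T in at_top. norm (S T) \<le> (b + e) * T^2"
    using qboundD[OF assms[of "e / 2"], of "e / 2"] e by (simp add: add.assoc)
qed

lemma qbound_ge0: "qbound S b \<Longrightarrow> b \<ge> 0"
proof (rule ccontr)
  assume S: "qbound S b" and "\<not> b \<ge> 0"
  then have b: "b < 0" by simp
  have "\<forall>\<^sub>F T in at_top. norm (S T) \<le> (b + - b / 2) * T^2"
    using qboundD[OF S, of "- b / 2"] b by simp
  then have "\<forall>\<^sub>F T::real in at_top. False"
    using eventually_gt_at_top[of 0]
  proof eventually_elim
    case (elim T)
    have "(b + - b / 2) * T^2 < 0" using b elim by (intro mult_neg_pos) auto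
    then show ?case using elim norm_ge_zero[of "S T"] by linarith
  qed
  then show False by simp
qed

lemma qbound_iff_tendsto: "qbound S 0 \<longleftrightarrow> ((\<lambda>T. norm (S T) / T^2) \<longlongrightarrow> 0) at_top"
proof
  assume S: "qbound S 0"
  show "((\<lambda>T. norm (S T) / T^2) \<longlongrightarrow> 0) at_top"
  proof (rule tendstoI)
    fix e :: real assume "e > 0"
    then have "e / 2 > 0" by simp
    show "\<forall>\<^sub>F T in at_top. dist (norm (S T) / T^2) 0 < e"
      using qboundD[OF S \<open>e / 2 > 0\<close>] eventually_gt_at_top[of 0]
    proof eventually_elim
      case (elim T)
      have "norm (S T) / T^2 \<le> e / 2" using elim by (simp add: pos_divide_le_eq)
      then have "norm (S T) / T^2 < e" using \<open>e > 0\<close> by linarith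
      then show ?case by simp
    qed
  qed
next
  assume L: "((\<lambda>T. norm (S T) / T^2) \<longlongrightarrow> 0) at_top"
  show "qbound S 0"
  proof (rule qboundI)
    fix e :: real assume "e > 0"
    show "\<forall>\<^sub>F T in at_top. norm (S T) \<le> (0 + e) * T^2"
      using tendstoD[OF L \<open>e > 0\<close>] eventually_gt_at_top[of 0]
      by eventually_elim (simp add: field_simps)
  qed
qed

section \<open>Exponential sums\<close>

definition cis2pi :: "real \<Rightarrow> complex" where
  "cis2pi x = cis (2 * pi * x)"

lemma cis2pi_add: "cis2pi (x + y) = cis2pi x * cis2pi y"
  by (simp add: cis2pi_def cis_mult ring_distribs)

lemma norm_cis2pi [simp]: "norm (cis2pi x) = 1"
  by (simp add: cis2pi_def)

lemma cis2pi_0 [simp]: "cis2pi 0 = 1"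
  by (simp add: cis2pi_def)

lemma cis2pi_of_int [simp]: "cis2pi (of_int k) = 1"
  by (simp add: cis2pi_def cis_multiple_2pi)

lemma cis2pi_eq_1_iff: "cis2pi x = 1 \<longleftrightarrow> x \<in> \<int>"
proof
  assume "cis2pi x = 1"
  then have "cos (2 * pi * x) = 1" by (simp add: cis2pi_def complex_eq_iff)
  then obtain k where "2 * pi * x = of_int k * (2 * pi)" unfolding cos_one_2pi_int by (auto simp: algebra_simps)
  then have "x = of_int k" by simp
  then show "x \<in> \<int>" by simp
qed (auto elim!: Ints_cases)

lemma cnj_cis2pi: "cnj (cis2pi x) = cis2pi (- x)"
  by (simp add: cis2pi_def cis_cnj)

text \<open>The modulus of the normalized Dirichlet kernel: it is at most 1, and small in mean square over equidistributed \<open>x\<close>.\<close>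

definition dirichlet :: "nat \<Rightarrow> real \<Rightarrow> real" where
  "dirichlet H x = norm (\<Sum>h<H. cis2pi (real h * x)) / real H"

lemma dirichlet_le_1: "dirichlet H x \<le> 1"
proof -
  have "norm (\<Sum>h<H. cis2pi (real h * x)) \<le> (\<Sum>h<H. norm (cis2pi (real h * x)))" by (rule norm_sum)
  also have "\<dots> = real H" by simp
  finally show ?thesis by (simp add: dirichlet_def divide_le_eq)
qed

lemma dirichlet_nonneg: "0 \<le> dirichlet H x"
  by (simp add: dirichlet_def)

lemma dirichlet_square:
  "complex_of_real ((dirichlet H x)^2) = (\<Sum>h<H. \<Sum>k<H. cis2pi ((real h - real k) * x)) / of_nat (H^2)"
proof -
  have "complex_of_real ((norm (\<Sum>h<H. cis2pi (real h * x)))^2) = (\<Sum>h<H. cis2pi (real h * x)) * cnj (\<Sum>k<H. cis2pi (real k * x))"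
    by (metis complex_norm_square of_real_power)
  also have "\<dots> = (\<Sum>h<H. \<Sum>k<H. cis2pi (real h * x) * cis2pi (- (real k * x)))"
    by (simp only: cnj_sum cnj_cis2pi sum_product)
  also have "\<dots> = (\<Sum>h<H. \<Sum>k<H. cis2pi ((real h - real k) * x))"
    by (intro sum.cong) (auto simp: cis2pi_add[symmetric] algebra_simps)
  finally show ?thesis by (simp add: dirichlet_def power_divide)
qed

text \<open>Shifting the summation range by \<open>h\<close> changes the sum by at most \<open>2 h\<close>, so the sum may be averaged over \<open>h < H\<close>; each term is then multiplied by the Dirichlet kernel. Unlike the closed form of the geometric sum, this bound can be averaged over \<open>x\<close>.\<close>

lemma sum_cis2pi_interval:
  assumes "H > 0" "p \<le> q + (1::int)"
  shows "norm (\<Sum>t=p..q. cis2pi (of_int t * x)) \<le> real (card {p..q}) * dirichlet H x + 2 * real H"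
proof -
  define S where "S = (\<Sum>t=p..q. cis2pi (of_int t * x))"
  have shift: "norm (S - cis2pi (real h * x) * S) \<le> 2 * real h" for h
  proof (induction h)
    case 0 then show ?case by simp
  next
    case (Suc h)
    have one: "norm (S - cis2pi x * S) \<le> 2"
    proof -
      have "cis2pi x * S = (\<Sum>t=p..q. cis2pi (of_int (t + 1) * x))"
        unfolding S_def sum_distrib_left by (intro sum.cong) (auto simp: cis2pi_add[symmetric] algebra_simps)
      also have "\<dots> = (\<Sum>t\<in>{p+1..q+1}. cis2pi (of_int t * x))"
        by (rule sum.reindex_bij_witness[of _ "\<lambda>t. t - 1" "\<lambda>t. t + 1"]) auto
      finally have e: "cis2pi x * S = (\<Sum>t\<in>{p+1..q+1}. cis2pi (of_int t * x))" .
      show ?thesis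
      proof (cases "p \<le> q")
        case True
        have "{p..q} = insert p {p+1..q}" "{p+1..q+1} = insert (q+1) {p+1..q}" using True by auto
        then have "S - cis2pi x * S = cis2pi (of_int p * x) - cis2pi (of_int (q + 1) * x)"
          unfolding e unfolding S_def by simp
        then show ?thesis using norm_triangle_ineq4[of "cis2pi (of_int p * x)" "cis2pi (of_int (q+1) * x)"] by simp
      qed (simp add: S_def)
    qed
    have "S - cis2pi (real (Suc h) * x) * S = (S - cis2pi x * S) + cis2pi x * (S - cis2pi (real h * x) * S)"
      by (simp add: cis2pi_add algebra_simps)
    also have "norm \<dots> \<le> norm (S - cis2pi x * S) + norm (S - cis2pi (real h * x) * S)"
      by (rule order_trans[OF norm_triangle_ineq]) (simp add: norm_mult)
    finally show ?case using one Suc by simp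
  qed
  have "of_nat H * S - (\<Sum>h<H. cis2pi (real h * x)) * S = (\<Sum>h<H. S - cis2pi (real h * x) * S)"
    by (simp add: sum_subtractf sum_distrib_right)
  also have "norm \<dots> \<le> (\<Sum>h<H. norm (S - cis2pi (real h * x) * S))"
    by (rule norm_sum)
  also have "\<dots> \<le> (\<Sum>h<H. 2 * real H)"
  proof (rule sum_mono)
    fix h assume "h \<in> {..<H}"
    then have "2 * real h \<le> 2 * real H" by simp
    then show "norm (S - cis2pi (real h * x) * S) \<le> 2 * real H" using shift[of h] by linarith
  qed
  also have "\<dots> = real H * (2 * real H)" by simp
  finally have A: "norm (of_nat H * S - (\<Sum>h<H. cis2pi (real h * x)) * S) \<le> real H * (2 * real H)" .
  have "real H * norm S = norm (of_nat H * S)" by (simp add: norm_mult)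
  also have "\<dots> \<le> norm ((\<Sum>h<H. cis2pi (real h * x)) * S) + real H * (2 * real H)"
    using A norm_triangle_sub[of "of_nat H * S" "(\<Sum>h<H. cis2pi (real h * x)) * S"] by linarith
  also have "norm ((\<Sum>h<H. cis2pi (real h * x)) * S) = real H * (norm S * dirichlet H x)"
    using assms by (simp add: norm_mult dirichlet_def)
  finally have "real H * norm S \<le> real H * (norm S * dirichlet H x + 2 * real H)"
    by (simp add: algebra_simps)
  then have "norm S \<le> norm S * dirichlet H x + 2 * real H" using assms by simp
  moreover have "norm S \<le> real (card {p..q})"
    unfolding S_def by (rule order_trans[OF norm_sum]) simp
  then have "norm S * dirichlet H x \<le> real (card {p..q}) * dirichlet H x"
    by (intro mult_right_mono dirichlet_nonneg)
  ultimately show ?thesis unfolding S_def by linarith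
qed

definition order_convex :: "int set \<Rightarrow> bool" where
  "order_convex J \<longleftrightarrow> (\<forall>p\<in>J. \<forall>r\<in>J. \<forall>q. p \<le> q \<longrightarrow> q \<le> r \<longrightarrow> q \<in> J)"

lemma order_convex_interval:
  assumes "order_convex J" "finite J"
  obtains p q where "J = {p..q}" "p \<le> q + 1"
proof (cases "J = {}")
  case True then show ?thesis using that[of 0 "-1"] by auto
next
  case False
  have mem: "Min J \<in> J" "Max J \<in> J" using assms False by auto
  have "J = {Min J..Max J}"
  proof (intro equalityI subsetI)
    fix q assume "q \<in> {Min J..Max J}"
    then show "q \<in> J" using mem assms(1) unfolding order_convex_def by (meson atLeastAtMost_iff)
  qed (use assms in auto)
  moreover have "Min J \<le> Max J + 1" using Min_le[OF assms(2) mem(2)] by simp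
  ultimately show ?thesis by (rule that)
qed

lemma sum_cis2pi_order_convex:
  assumes "order_convex J" "finite J" "H > 0"
  shows "norm (\<Sum>t\<in>J. cis2pi (of_int t * x)) \<le> real (card J) * dirichlet H x + 2 * real H"
proof -
  obtain p q where "J = {p..q}" "p \<le> q + 1" using assms by (blast elim: order_convex_interval)
  then show ?thesis using sum_cis2pi_interval[OF assms(3)] by blast
qed

lemma quadratic_between:
  fixes \<alpha> \<beta> \<gamma> p q r :: real
  assumes "\<alpha> \<ge> 0" "p \<le> q" "q \<le> r"
  shows "\<alpha> * q^2 + \<beta> * q + \<gamma> \<le> max (\<alpha> * p^2 + \<beta> * p + \<gamma>) (\<alpha> * r^2 + \<beta> * r + \<gamma>)"
proof -
  let ?f = "\<lambda>x. \<alpha> * x^2 + \<beta> * x + \<gamma>"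
  have "(r - p) * ?f q = (r - q) * ?f p + (q - p) * ?f r - \<alpha> * ((r - p) * ((q - p) * (r - q)))"
    by (simp add: power2_eq_square algebra_simps)
  also have "\<dots> \<le> (r - q) * ?f p + (q - p) * ?f r"
    using assms by simp
  also have "\<dots> \<le> (r - q) * max (?f p) (?f r) + (q - p) * max (?f p) (?f r)"
    using assms by (intro add_mono mult_left_mono) auto
  also have "\<dots> = (r - p) * max (?f p) (?f r)" by (simp add: algebra_simps)
  finally have *: "(r - p) * ?f q \<le> (r - p) * max (?f p) (?f r)" .
  show ?thesis
  proof (cases "p = r")
    case True then show ?thesis using assms by simp
  next
    case False
    then have "r - p > 0" using assms by simp
    then show ?thesis using * by (rule mult_left_le_imp_le[rotated])
  qed
qed

context unimodular_lattice
begin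

definition pdisc :: "real \<Rightarrow> complex set" where
  "pdisc X = {a \<in> lattice. a \<noteq> 0 \<and> norm a < X}"

lemma pdisc_disc: "pdisc X = disc 0 X - {0}"
  by (auto simp: pdisc_def disc_def)

lemma finite_pdisc [simp]: "finite (pdisc X)"
  by (simp add: pdisc_disc finite_disc)

definition disc_const :: real where "disc_const = 49 / min_norm^2"

lemma disc_const_pos: "disc_const > 0"
  using min_norm_pos by (simp add: disc_const_def)

lemma card_pdisc: "real (card (pdisc X)) \<le> disc_const * X^2"
proof (cases "min_norm \<le> X")
  case True
  have "real (card (pdisc X)) \<le> 49 * (X / min_norm)^2"
  proof (rule card_separated_disc)
    fix z w assume "z \<in> pdisc X" "w \<in> pdisc X" "z \<noteq> w"
    then show "min_norm \<le> norm (z - w)" by (intro min_norm_le) (auto simp: pdisc_def)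
  qed (use True min_norm_pos in \<open>auto simp: pdisc_def\<close>)
  then show ?thesis by (simp add: disc_const_def power_divide)
next
  case False
  then have "pdisc X = {}" using min_norm_le by (force simp: pdisc_def)
  then show ?thesis using disc_const_pos by simp
qed

text \<open>A bound on dyadic shells with a positive exponent sums to a geometric series.\<close>

lemma dyadic_sum:
  fixes g :: "complex \<Rightarrow> real"
  assumes shell: "\<And>R. 0 < R \<Longrightarrow> R \<le> X \<Longrightarrow> (\<Sum>a\<in>pdisc R - pdisc (R / 2). g a) \<le> K * R powr p"
    and pos: "p > 0" "X > 0" "K \<ge> 0"
  shows "(\<Sum>a\<in>pdisc X. g a) \<le> K / (1 - 2 powr (- p)) * X powr p"
proof -
  define r where "r = 2 powr (- p)"
  have "(2::real) powr (- p) < 2 powr 0" using pos by (intro powr_less_mono) auto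
  then have r: "0 < r" "r < 1" by (auto simp: r_def)
  have sub: "pdisc (Y / 2) \<subseteq> pdisc Y" if "Y > 0" for Y using that by (auto simp: pdisc_def)
  have step: "(\<Sum>a\<in>pdisc X - pdisc (X / 2 ^ n). g a) \<le> K * X powr p * (\<Sum>i<n. r ^ i)" for n
  proof (induction n)
    case 0 then show ?case by simp
  next
    case (Suc n)
    let ?R = "X / 2 ^ n"
    have R: "0 < ?R" "?R \<le> X" using pos by (auto simp: divide_le_eq)
    have s: "pdisc ?R \<subseteq> pdisc X" using R by (auto simp: pdisc_def)
    have R2: "X / 2 ^ Suc n = ?R / 2" by simp
    have "pdisc X - pdisc (X / 2 ^ Suc n) = (pdisc X - pdisc ?R) \<union> (pdisc ?R - pdisc (?R / 2))"
      unfolding R2 using sub[OF R(1)] s by auto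
    also have "(\<Sum>a\<in>\<dots>. g a) = (\<Sum>a\<in>pdisc X - pdisc ?R. g a) + (\<Sum>a\<in>pdisc ?R - pdisc (?R / 2). g a)"
      by (rule sum.union_disjoint) auto
    also have "\<dots> \<le> K * X powr p * (\<Sum>i<n. r ^ i) + K * ?R powr p"
      using Suc shell[OF R] by (rule add_mono)
    also have "?R powr p = X powr p * r ^ n"
    proof -
      have "r ^ n = r powr real n" using r by (simp only: powr_realpow)
      also have "\<dots> = (2 powr real n) powr (- p)" by (simp only: r_def powr_powr mult.commute)
      also have "2 powr real n = (2::real) ^ n" by (simp only: powr_realpow zero_less_numeral)
      finally have "r ^ n = (2 ^ n) powr (- p)" .
      moreover have "?R powr p = X powr p / (2 ^ n) powr p" using pos by (simp add: powr_divide)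
      ultimately show ?thesis by (simp add: powr_minus divide_inverse)
    qed
    finally show ?case by (simp add: algebra_simps)
  qed
  have "\<exists>n. X / min_norm < 2 ^ n" by (rule real_arch_pow) simp
  then obtain n where n: "X / min_norm < 2 ^ n" ..
  have "pdisc (X / 2 ^ n) = {}"
  proof -
    have "X / 2 ^ n < min_norm" using n min_norm_pos by (simp add: field_simps)
    then show ?thesis using min_norm_le by (force simp: pdisc_def)
  qed
  then have "(\<Sum>a\<in>pdisc X. g a) \<le> K * X powr p * (\<Sum>i<n. r ^ i)"
    using step[of n] by simp
  also have "\<dots> \<le> K * X powr p * (1 / (1 - r))"
  proof (rule mult_left_mono)
    have "(\<Sum>i<n. r ^ i) = (1 - r ^ n) / (1 - r)" using r by (simp add: sum_gp_strict)
    also have "\<dots> \<le> 1 / (1 - r)" using r by (intro divide_right_mono) auto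
    finally show "(\<Sum>i<n. r ^ i) \<le> 1 / (1 - r)" .
  qed (use pos in auto)
  finally show ?thesis by (simp add: r_def)
qed

lemma sum_inverse_norm:
  assumes "X > 0"
  shows "(\<Sum>a\<in>pdisc X. 1 / norm a) \<le> 4 * disc_const * X"
proof -
  have "(\<Sum>a\<in>pdisc X. 1 / norm a) \<le> (2 * disc_const) / (1 - 2 powr (- 1)) * X powr 1"
  proof (rule dyadic_sum)
    fix R :: real assume R: "0 < R" "R \<le> X"
    have "(\<Sum>a\<in>pdisc R - pdisc (R / 2). 1 / norm a) \<le> (\<Sum>a\<in>pdisc R - pdisc (R / 2). 2 / R)"
      using R by (intro sum_mono) (auto simp: pdisc_def field_simps)
    also have "\<dots> = real (card (pdisc R - pdisc (R / 2))) * (2 / R)" by simp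
    also have "\<dots> \<le> real (card (pdisc R)) * (2 / R)"
      using R by (intro mult_right_mono of_nat_mono card_mono) auto
    also have "\<dots> \<le> disc_const * R^2 * (2 / R)"
      using R card_pdisc[of R] by (intro mult_right_mono) auto
    also have "\<dots> = 2 * disc_const * R powr 1" using R by (simp add: power2_eq_square)
    finally show "(\<Sum>a\<in>pdisc R - pdisc (R / 2). 1 / norm a) \<le> 2 * disc_const * R powr 1" .
  qed (use assms disc_const_pos in auto)
  then show ?thesis using assms by (simp add: powr_minus)
qed

end

text \<open>Irrationality of \<open>\<zeta>\<close> in the form in which Weyl summation uses it.\<close>

locale shifted_lattice = unimodular_lattice +
  fixes \<zeta> :: complex
  assumes irrational: "h \<noteq> 0 \<Longrightarrow> \<exists>b\<in>lattice. of_int h * wd \<zeta> b \<notin> \<int>"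
begin

text \<open>Translation by a lattice vector \<open>b\<close> changes the disc only near its boundary, by \<open>O(X)\<close> points, and multiplies the sum by a root \<open>q = cis2pi (h wd \<zeta> b)\<close>. As \<open>q \<noteq> 1\<close> for a suitable \<open>b\<close>, the sum itself is \<open>O(X)\<close>.\<close>

lemma weyl_sum:
  assumes "h \<noteq> 0"
  shows "qbound (\<lambda>X. \<Sum>a\<in>disc 0 X. cis2pi (of_int h * wd \<zeta> a)) 0"
proof -
  obtain b where b: "b \<in> lattice" "of_int h * wd \<zeta> b \<notin> \<int>" using irrational[OF assms] by blast
  define q where "q = cis2pi (of_int h * wd \<zeta> b)"
  have q: "norm (1 - q) > 0" using b by (simp add: q_def cis2pi_eq_1_iff)
  define \<beta> where "\<beta> = norm b"
  have \<beta>: "\<beta> \<ge> 0" by (simp add: \<beta>_def)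
  obtain C where C: "C \<ge> 0" "\<And>T. T \<ge> 0 \<Longrightarrow> \<bar>real (card (disc 0 T)) - pi * T^2\<bar> \<le> C * (T + 1)"
    using card_disc_asymp by blast
  define S where "S X = (\<Sum>a\<in>disc 0 X. cis2pi (of_int h * wd \<zeta> a))" for X
  have main: "norm ((1 - q) * S X) \<le> 4 * pi * \<beta> * X + 4 * C * (X + \<beta> + 1)" if X: "X \<ge> \<beta>" for X
  proof -
    define f where "f a = cis2pi (of_int h * wd \<zeta> a)" for a
    define D where "D = disc 0 X"
    define D' where "D' = (\<lambda>a. a + b) ` D"
    define I where "I = disc 0 (X - \<beta>)"
    define U where "U = disc 0 (X + \<beta>)"
    have fin: "finite D" "finite D'" "finite I" "finite U" by (auto simp: D_def D'_def I_def U_def finite_disc)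
    have "I \<subseteq> D" "D \<subseteq> U" using \<beta> by (auto simp: I_def D_def U_def disc_def)
    have "I \<subseteq> D'"
    proof
      fix x assume x: "x \<in> I"
      have "norm (x - b) \<le> norm x + norm b" by (rule norm_triangle_ineq4)
      then have "x - b \<in> D" using x b by (auto simp: I_def D_def disc_def \<beta>_def)
      then show "x \<in> D'" unfolding D'_def by (rule image_eqI[rotated]) simp
    qed
    have "D' \<subseteq> U"
    proof
      fix x assume "x \<in> D'"
      then obtain a where a: "a \<in> D" "x = a + b" by (auto simp: D'_def)
      have "norm (a + b) \<le> norm a + norm b" by (rule norm_triangle_ineq)
      then show "x \<in> U" using a b by (auto simp: U_def D_def disc_def \<beta>_def)
    qed
    have "q * S X = (\<Sum>a\<in>D. f (a + b))"
      unfolding S_def D_def[symmetric] sum_distrib_left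
      by (intro sum.cong) (auto simp: f_def q_def wd_simps ring_distribs cis2pi_add)
    also have "\<dots> = (\<Sum>a\<in>D'. f a)"
      unfolding D'_def by (subst sum.reindex) (auto simp: inj_on_def)
    finally have "(1 - q) * S X = (\<Sum>a\<in>D. f a) - (\<Sum>a\<in>D'. f a)"
      by (simp add: algebra_simps S_def D_def f_def)
    also have "\<dots> = (\<Sum>a\<in>D - I. f a) - (\<Sum>a\<in>D' - I. f a)"
      using fin \<open>I \<subseteq> D\<close> \<open>I \<subseteq> D'\<close> by (simp add: sum_diff)
    also have "norm \<dots> \<le> norm (\<Sum>a\<in>D - I. f a) + norm (\<Sum>a\<in>D' - I. f a)"
      by (rule norm_triangle_ineq4)
    also have "\<dots> \<le> real (card (D - I)) + real (card (D' - I))"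
      by (intro add_mono; rule order_trans[OF norm_sum]) (auto simp: f_def)
    also have "\<dots> = real (card D) + real (card D') - 2 * real (card I)"
      using fin \<open>I \<subseteq> D\<close> \<open>I \<subseteq> D'\<close> card_mono[OF fin(1) \<open>I \<subseteq> D\<close>] card_mono[OF fin(2) \<open>I \<subseteq> D'\<close>]
      by (simp add: card_Diff_subset of_nat_diff)
    also have "card D' = card D" unfolding D'_def by (rule card_image) (auto simp: inj_on_def)
    finally have 1: "norm ((1 - q) * S X) \<le> 2 * (real (card D) - real (card I))" by simp
    have "real (card D) \<le> real (card U)" using fin \<open>D \<subseteq> U\<close> by (simp add: card_mono)
    then have "real (card D) \<le> pi * X^2 + C * (X + 1)"
      using C(2)[of X] \<beta> X by (simp add: D_def abs_le_iff)
    moreover have "pi * (X - \<beta>)^2 - C * (X - \<beta> + 1) \<le> real (card I)"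
      using C(2)[of "X - \<beta>"] X by (simp add: I_def abs_le_iff)
    ultimately have "2 * (real (card D) - real (card I)) \<le> 2 * (pi * X^2 + C * (X + 1) - (pi * (X - \<beta>)^2 - C * (X - \<beta> + 1)))"
      by (intro mult_left_mono diff_mono) auto
    also have "\<dots> = 4 * pi * \<beta> * X - 2 * pi * \<beta>^2 + 2 * C * (X + 1) + 2 * C * (X - \<beta> + 1)"
      by (simp add: power2_eq_square algebra_simps)
    finally have 2: "2 * (real (card D) - real (card I)) \<le> 4 * pi * \<beta> * X - 2 * pi * \<beta>^2 + 2 * C * (X + 1) + 2 * C * (X - \<beta> + 1)" .
    have "pi * \<beta>^2 \<ge> 0" "C * \<beta> \<ge> 0" using C \<beta> by auto
    then show ?thesis using 1 2 unfolding ring_distribs by linarith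
  qed
  show ?thesis
  proof (rule qbound_linear)
    show "\<forall>\<^sub>F X in at_top. norm (\<Sum>a\<in>disc 0 X. cis2pi (of_int h * wd \<zeta> a)) \<le> ((4 * pi * \<beta> + 12 * C) / norm (1 - q)) * X"
      using eventually_ge_at_top[of "\<beta> + 1"]
    proof eventually_elim
      case (elim X)
      have "C * (X + \<beta> + 1) \<le> C * (3 * X)" using elim \<beta> C by (intro mult_left_mono) auto
      moreover have "norm (1 - q) * norm (S X) \<le> 4 * pi * \<beta> * X + 4 * C * (X + \<beta> + 1)"
        using main[of X] elim unfolding norm_mult by linarith
      ultimately have "norm (1 - q) * norm (S X) \<le> (4 * pi * \<beta> + 12 * C) * X"
        unfolding ring_distribs by linarith
      then show ?case using q by (simp add: S_def field_simps)
    qed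
  qed
qed

end

section \<open>Cones of lattice bases\<close>

definition mvec :: "nat \<Rightarrow> nat \<Rightarrow> complex \<Rightarrow> complex \<Rightarrow> complex" where
  "mvec w1 w2 a n = of_nat w1 * a + of_nat w2 * n"

context unimodular_lattice
begin

text \<open>Bases \<open>(a, n)\<close> of orientation \<open>\<sigma> = \<plusminus>1\<close> such that \<open>m = w1 a + w2 n\<close> forms acute angles with both. For given \<open>m\<close> there is at most one such basis.\<close>

definition cone :: "real \<Rightarrow> nat \<Rightarrow> nat \<Rightarrow> real \<Rightarrow> (complex \<times> complex) set" where
  "cone \<sigma> w1 w2 T = {(a, n). a \<in> lattice \<and> n \<in> lattice \<and> wd n a = \<sigma> \<and>
     0 < ip a (mvec w1 w2 a n) \<and> 0 < ip n (mvec w1 w2 a n) \<and> norm (mvec w1 w2 a n) < T}"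

lemma cone_swap: "(a, n) \<in> cone \<sigma> w1 w2 T \<longleftrightarrow> (n, a) \<in> cone (- \<sigma>) w2 w1 T"
  using wd_swap[of a n] by (auto simp: cone_def mvec_def add.commute)

lemma mvec_lattice: "a \<in> lattice \<Longrightarrow> n \<in> lattice \<Longrightarrow> mvec w1 w2 a n \<in> lattice"
  by (auto simp: mvec_def)

lemma cone_mvec:
  assumes "(a, n) \<in> cone \<sigma> w1 w2 T"
  shows "mvec w1 w2 a n \<noteq> 0" "min_norm \<le> norm (mvec w1 w2 a n)" "norm (mvec w1 w2 a n) < T" "0 < T"
    "wd a (mvec w1 w2 a n) = - real w2 * \<sigma>" "wd n (mvec w1 w2 a n) = real w1 * \<sigma>"
    "real w1 * ip a (mvec w1 w2 a n) + real w2 * ip n (mvec w1 w2 a n) = (norm (mvec w1 w2 a n))^2"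
proof -
  show ne: "mvec w1 w2 a n \<noteq> 0" using assms by (auto simp: cone_def)
  show "min_norm \<le> norm (mvec w1 w2 a n)" using ne assms mvec_lattice by (intro min_norm_le) (auto simp: cone_def)
  show T: "norm (mvec w1 w2 a n) < T" using assms by (simp add: cone_def)
  then show "0 < T" using norm_ge_zero[of "mvec w1 w2 a n"] by linarith
  have w: "wd n a = \<sigma>" "wd a n = - \<sigma>" using assms wd_swap[of a n] by (auto simp: cone_def)
  show "wd a (mvec w1 w2 a n) = - real w2 * \<sigma>" "wd n (mvec w1 w2 a n) = real w1 * \<sigma>"
    by (simp_all add: mvec_def wd_simps w)
  show "real w1 * ip a (mvec w1 w2 a n) + real w2 * ip n (mvec w1 w2 a n) = (norm (mvec w1 w2 a n))^2"
    unfolding ip_self[symmetric] mvec_def ip_simps ip_commute[of n a] by (simp add: algebra_simps)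
qed

lemma cone_norm_left:
  assumes "(a, n) \<in> cone \<sigma> w1 w2 T" "w1 > 0" "\<bar>\<sigma>\<bar> = 1"
  shows "(norm a)^2 \<le> (T / w1)^2 + (w2 / min_norm)^2" "a \<in> lattice" "a \<noteq> 0"
proof -
  let ?m = "mvec w1 w2 a n"
  have pos: "0 < norm ?m" "min_norm \<le> norm ?m" using cone_mvec[OF assms(1)] by auto
  have ips: "0 < ip a ?m" "0 < ip n ?m" using assms by (auto simp: cone_def)
  have "real w1 * ip a ?m \<le> (norm ?m)^2" using cone_mvec(7)[OF assms(1)] ips by (simp add: add_increasing2 flip: cone_mvec(7)[OF assms(1)])
  then have "ip a ?m \<le> (norm ?m)^2 / w1" using assms(2) by (simp add: pos_le_divide_eq mult.commute)
  then have A: "(ip a ?m)^2 \<le> ((norm ?m)^2 / w1)^2" using ips by (intro power_mono) auto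
  have "(norm a)^2 * (norm ?m)^2 = (ip a ?m)^2 + (wd a ?m)^2" by (simp add: ip_wd_norm)
  also have "(wd a ?m)^2 = (real w2)^2"
  proof -
    have "\<sigma>^2 = 1" using assms(3) by (metis power2_abs one_power2)
    then show ?thesis by (simp add: cone_mvec(5)[OF assms(1)] power_mult_distrib)
  qed
  finally have "(norm a)^2 * (norm ?m)^2 \<le> ((norm ?m)^2 / w1)^2 + (real w2)^2" using A by linarith
  then have "(norm a)^2 \<le> (((norm ?m)^2 / w1)^2 + (real w2)^2) / (norm ?m)^2"
    using pos by (simp add: pos_le_divide_eq)
  also have "\<dots> = (norm ?m / w1)^2 + (w2 / norm ?m)^2"
    using pos by (simp add: add_divide_distrib power_divide power2_eq_square)
  also have "\<dots> \<le> (T / w1)^2 + (w2 / min_norm)^2"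
    using cone_mvec(3)[OF assms(1)] pos min_norm_pos
    by (intro add_mono power_mono divide_right_mono divide_left_mono) auto
  finally show "(norm a)^2 \<le> (T / w1)^2 + (w2 / min_norm)^2" .
  show "a \<in> lattice" "a \<noteq> 0" using assms by (auto simp: cone_def)
qed

lemma cone_norm_right:
  assumes "(a, n) \<in> cone \<sigma> w1 w2 T" "w2 > 0" "\<bar>\<sigma>\<bar> = 1"
  shows "(norm n)^2 \<le> (T / w2)^2 + (w1 / min_norm)^2" "n \<in> lattice" "n \<noteq> 0"
  using cone_norm_left[OF cone_swap[THEN iffD1, OF assms(1)] assms(2)] assms(3) by simp_all

lemma finite_cone:
  assumes "w1 > 0" "w2 > 0" "\<bar>\<sigma>\<bar> = 1"
  shows "finite (cone \<sigma> w1 w2 T)"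
proof (rule finite_subset)
  define A where "A w w' = sqrt ((T / w)^2 + (w' / min_norm)^2) + 1" for w w' :: nat
  show "cone \<sigma> w1 w2 T \<subseteq> pdisc (A w1 w2) \<times> pdisc (A w2 w1)"
  proof clarify
    fix a n assume an: "(a, n) \<in> cone \<sigma> w1 w2 T"
    have "norm a < A w1 w2" "norm n < A w2 w1"
      using cone_norm_left[OF an assms(1,3)] cone_norm_right[OF an assms(2,3)]
      unfolding A_def using real_le_rsqrt by (smt (verit))+
    then show "a \<in> pdisc (A w1 w2) \<and> n \<in> pdisc (A w2 w1)"
      using cone_norm_left[OF an assms(1,3)] cone_norm_right[OF an assms(2,3)] by (auto simp: pdisc_def)
  qed
qed simp

definition cone_sum :: "(complex \<Rightarrow> complex \<Rightarrow> complex) \<Rightarrow> real \<Rightarrow> nat \<Rightarrow> nat \<Rightarrow> real \<Rightarrow> complex" where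
  "cone_sum F \<sigma> w1 w2 T = (\<Sum>(a, n)\<in>cone \<sigma> w1 w2 T. F a n)"

lemma cone_sum_swap: "cone_sum F \<sigma> w1 w2 T = cone_sum (\<lambda>a n. F n a) (- \<sigma>) w2 w1 T"
  unfolding cone_sum_def
  by (rule sum.reindex_bij_witness[of _ "\<lambda>(a, n). (n, a)" "\<lambda>(a, n). (n, a)"])
     (auto intro: cone_swap[THEN iffD1] cone_swap[THEN iffD2])

text \<open>According to which of \<open>a\<close>, \<open>n\<close> has the larger inner product with \<open>m\<close>, one of \<open>(a, n - a)\<close>, \<open>(a - n, n)\<close> satisfies the cone conditions for the same \<open>m\<close> with weights \<open>(w1 + w2, w2)\<close> or \<open>(w1, w1 + w2)\<close>. Equality forces \<open>m\<close> to be bounded, which accounts for the error \<open>K\<close>.\<close>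

lemma cone_split:
  assumes w: "w1 > 0" "w2 > 0" "\<bar>\<sigma>\<bar> = 1" and F: "\<And>a n. norm (F a n) \<le> B"
  shows "\<exists>K. \<forall>T. norm (cone_sum F \<sigma> w1 w2 T - cone_sum (\<lambda>a n. F a (a + n)) \<sigma> (w1 + w2) w2 T
            - cone_sum (\<lambda>a n. F (a + n) n) \<sigma> w1 (w1 + w2) T) \<le> K"
proof -
  define X where "X = real (w1 + w2) / min_norm + 1"
  define Bd where "Bd T = {(a, n) \<in> cone \<sigma> w1 w2 T. ip a (mvec w1 w2 a n) = ip n (mvec w1 w2 a n)}" for T
  define C1 where "C1 T = {(a, n) \<in> cone \<sigma> w1 w2 T. ip a (mvec w1 w2 a n) < ip n (mvec w1 w2 a n)}" for T
  define C2 where "C2 T = {(a, n) \<in> cone \<sigma> w1 w2 T. ip n (mvec w1 w2 a n) < ip a (mvec w1 w2 a n)}" for T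
  have fin: "finite (cone \<sigma> w1 w2 T)" for T using finite_cone w by blast
  have Bd: "Bd T \<subseteq> cone \<sigma> w1 w2 X" for T
  proof clarify
    fix a n assume "(a, n) \<in> Bd T"
    then have an: "(a, n) \<in> cone \<sigma> w1 w2 T" and eq: "ip a (mvec w1 w2 a n) = ip n (mvec w1 w2 a n)"
      by (auto simp: Bd_def)
    let ?m = "mvec w1 w2 a n" let ?b = "a - n"
    have "ip ?b ?m = 0" using eq by (simp add: ip_simps)
    moreover have wdb: "wd ?b ?m = - (real (w1 + w2) * \<sigma>)"
      using cone_mvec(5,6)[OF an] by (simp add: wd_simps algebra_simps)
    ultimately have "(norm ?b * norm ?m)^2 = (real (w1 + w2) * \<sigma>)^2"
      using ip_wd_norm[of ?b ?m] by (simp only: power2_minus power_mult_distrib) simp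
    then have "norm ?b * norm ?m = \<bar>real (w1 + w2) * \<sigma>\<bar>"
      by (metis abs_of_nonneg mult_nonneg_nonneg norm_ge_zero real_sqrt_abs)
    then have nb: "norm ?b * norm ?m = real (w1 + w2)" using w(3) by (simp add: abs_mult)
    have "?b \<noteq> 0"
    proof
      assume "?b = 0"
      then have "wd ?b ?m = 0" by (simp only: wd_zero_left)
      then show False using wdb w by simp
    qed
    then have "min_norm \<le> norm ?b" using an by (intro min_norm_le) (auto simp: cone_def)
    then have "min_norm * norm ?m \<le> real (w1 + w2)" unfolding nb[symmetric] by (rule mult_right_mono) simp
    then have "norm ?m \<le> real (w1 + w2) / min_norm" using min_norm_pos by (simp add: pos_le_divide_eq mult.commute)
    then show "(a, n) \<in> cone \<sigma> w1 w2 X" using an by (simp add: cone_def X_def)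
  qed
  have m1: "mvec w1 w2 a (a + n) = mvec (w1 + w2) w2 a n" for a n by (simp add: mvec_def algebra_simps)
  have m2: "mvec w1 w2 (a + n) n = mvec w1 (w1 + w2) a n" for a n by (simp add: mvec_def algebra_simps)
  have s1: "(\<Sum>(a, n)\<in>C1 T. F a n) = cone_sum (\<lambda>a n. F a (a + n)) \<sigma> (w1 + w2) w2 T" for T
    unfolding cone_sum_def
  proof (rule sum.reindex_bij_witness[of _ "\<lambda>(a, n). (a, a + n)" "\<lambda>(a, n). (a, n - a)"])
    fix x assume "x \<in> C1 T"
    then obtain a n where x: "x = (a, n)" "(a, n) \<in> cone \<sigma> w1 w2 T" "ip a (mvec w1 w2 a n) < ip n (mvec w1 w2 a n)"
      by (auto simp: C1_def)
    show "(case x of (a, n) \<Rightarrow> (a, n - a)) \<in> cone \<sigma> (w1 + w2) w2 T"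
      using x m1[of a "n - a"] by (auto simp: cone_def wd_simps ip_simps)
  next
    fix y assume "y \<in> cone \<sigma> (w1 + w2) w2 T"
    then obtain a n where y: "y = (a, n)" "(a, n) \<in> cone \<sigma> (w1 + w2) w2 T" by (cases y) auto
    then show "(case y of (a, n) \<Rightarrow> (a, a + n)) \<in> C1 T"
      by (auto simp: C1_def cone_def wd_simps ip_simps m1)
  qed auto
  have s2: "(\<Sum>(a, n)\<in>C2 T. F a n) = cone_sum (\<lambda>a n. F (a + n) n) \<sigma> w1 (w1 + w2) T" for T
    unfolding cone_sum_def
  proof (rule sum.reindex_bij_witness[of _ "\<lambda>(a, n). (a + n, n)" "\<lambda>(a, n). (a - n, n)"])
    fix x assume "x \<in> C2 T"
    then obtain a n where x: "x = (a, n)" "(a, n) \<in> cone \<sigma> w1 w2 T" "ip n (mvec w1 w2 a n) < ip a (mvec w1 w2 a n)"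
      by (auto simp: C2_def)
    show "(case x of (a, n) \<Rightarrow> (a - n, n)) \<in> cone \<sigma> w1 (w1 + w2) T"
      using x m2[of "a - n" n] by (auto simp: cone_def wd_simps ip_simps)
  next
    fix y assume "y \<in> cone \<sigma> w1 (w1 + w2) T"
    then obtain a n where y: "y = (a, n)" "(a, n) \<in> cone \<sigma> w1 (w1 + w2) T" by (cases y) auto
    then show "(case y of (a, n) \<Rightarrow> (a + n, n)) \<in> C2 T"
      by (auto simp: C2_def cone_def wd_simps ip_simps m2)
  qed auto
  show ?thesis
  proof (intro exI allI)
    fix T
    have "cone \<sigma> w1 w2 T = (C1 T \<union> C2 T) \<union> Bd T"
      by (auto simp: C1_def C2_def Bd_def)
    moreover have "(\<Sum>(a, n)\<in>(C1 T \<union> C2 T) \<union> Bd T. F a n) = (\<Sum>(a, n)\<in>C1 T. F a n) + (\<Sum>(a, n)\<in>C2 T. F a n) + (\<Sum>(a, n)\<in>Bd T. F a n)"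
    proof -
      have f: "finite (C1 T)" "finite (C2 T)" "finite (Bd T)"
        using fin[of T] by (auto simp: C1_def C2_def Bd_def intro: rev_finite_subset)
      show ?thesis
        using f by (subst sum.union_disjoint; (subst sum.union_disjoint)?) (auto simp: C1_def C2_def Bd_def)
    qed
    ultimately have "cone_sum F \<sigma> w1 w2 T - cone_sum (\<lambda>a n. F a (a + n)) \<sigma> (w1 + w2) w2 T
            - cone_sum (\<lambda>a n. F (a + n) n) \<sigma> w1 (w1 + w2) T = (\<Sum>(a, n)\<in>Bd T. F a n)"
      by (simp add: cone_sum_def[of F] s1 s2)
    also have "norm \<dots> \<le> (\<Sum>(a, n)\<in>Bd T. \<bar>B\<bar>)"
      using F by (intro sum_norm_le) (auto intro: order_trans[OF F abs_ge_self])
    also have "\<dots> = real (card (Bd T)) * \<bar>B\<bar>" by (simp add: case_prod_beta)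
    also have "\<dots> \<le> real (card (cone \<sigma> w1 w2 X)) * \<bar>B\<bar>"
      using Bd fin by (intro mult_right_mono of_nat_mono card_mono) auto
    finally show "norm (cone_sum F \<sigma> w1 w2 T - cone_sum (\<lambda>a n. F a (a + n)) \<sigma> (w1 + w2) w2 T
            - cone_sum (\<lambda>a n. F (a + n) n) \<sigma> w1 (w1 + w2) T) \<le> real (card (cone \<sigma> w1 w2 X)) * \<bar>B\<bar>" .
  qed
qed

lemma cone_split_qbound:
  assumes w: "w1 > 0" "w2 > 0" "\<bar>\<sigma>\<bar> = 1" and F: "\<And>a n. norm (F a n) \<le> B"
    and 1: "qbound (cone_sum (\<lambda>a n. F a (a + n)) \<sigma> (w1 + w2) w2) b1"
    and 2: "qbound (cone_sum (\<lambda>a n. F (a + n) n) \<sigma> w1 (w1 + w2)) b2"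
  shows "qbound (cone_sum F \<sigma> w1 w2) (b1 + b2)"
proof -
  obtain K where K: "norm (cone_sum F \<sigma> w1 w2 T - cone_sum (\<lambda>a n. F a (a + n)) \<sigma> (w1 + w2) w2 T
            - cone_sum (\<lambda>a n. F (a + n) n) \<sigma> w1 (w1 + w2) T) \<le> K" for T
    using cone_split[of w1 w2 \<sigma> F B] w F by blast
  have "qbound (\<lambda>T. cone_sum F \<sigma> w1 w2 T - cone_sum (\<lambda>a n. F a (a + n)) \<sigma> (w1 + w2) w2 T
            - cone_sum (\<lambda>a n. F (a + n) n) \<sigma> w1 (w1 + w2) T) 0"
    using K by (intro qbound_bounded[where C = K]) auto
  from qbound_add[OF this qbound_add[OF 1 2]] show ?thesis by simp
qed

definition fibre :: "real \<Rightarrow> nat \<Rightarrow> nat \<Rightarrow> real \<Rightarrow> complex \<Rightarrow> complex set" where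
  "fibre \<sigma> w1 w2 T a = {n. (a, n) \<in> cone \<sigma> w1 w2 T}"

lemma wd_zero_multiple:
  assumes "a \<in> lattice" "n0 \<in> lattice" "\<bar>wd n0 a\<bar> = 1" "x \<in> lattice" "wd x a = 0"
  obtains t :: int where "x = of_int t * a"
proof -
  have s: "wd n0 a * wd n0 a = 1" using assms(3) by (metis abs_mult_self_eq mult_1)
  have "wd (of_real (wd n0 a) * n0) a = 1" by (simp add: wd_simps s)
  from cramer_wd[OF this, of x] have "x = of_real (wd n0 a * wd n0 x) * a"
    by (simp add: assms wd_simps)
  moreover obtain i where "wd n0 a = of_int i" using wd_lattice assms by metis
  moreover obtain j where "wd n0 x = of_int j" using wd_lattice assms by metis
  ultimately have "x = of_int (i * j) * a" by simp
  then show thesis by (rule that)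
qed

text \<open>For fixed \<open>a\<close>, the vectors \<open>n\<close> lie on a line in direction \<open>a\<close>. Along it, the conditions on \<open>m\<close> and on its angle with \<open>a\<close> cut out an interval \<open>J\<close>, and the condition on the angle with \<open>n\<close> fails on a subinterval \<open>K\<close>, because it is quadratic in the parameter with positive leading coefficient.\<close>

lemma fibre_structure:
  assumes "n0 \<in> fibre \<sigma> w1 w2 T a" "w1 > 0" "w2 > 0" "\<bar>\<sigma>\<bar> = 1"
  obtains J K where "order_convex J" "order_convex K" "finite J" "K \<subseteq> J"
    "real (card J) \<le> 2 * T / (w2 * norm a) + 1"
    "bij_betw (\<lambda>t. n0 + of_int t * a) (J - K) (fibre \<sigma> w1 w2 T a)"
proof -
  define m0 where "m0 = mvec w1 w2 a n0"
  define m where "m x = m0 + of_real (x * w2) * a" for x :: real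
  have mt: "mvec w1 w2 a (n0 + of_int t * a) = m (of_int t)" for t
    by (simp add: m_def m0_def mvec_def algebra_simps)
  define J where "J = {t::int. 0 < ip a (m (of_int t)) \<and> norm (m (of_int t)) < T}"
  define K where "K = {t \<in> J. ip (n0 + of_int t * a) (m (of_int t)) \<le> 0}"
  have c0: "(a, n0) \<in> cone \<sigma> w1 w2 T" using assms by (simp add: fibre_def)
  have a: "a \<in> lattice" "a \<noteq> 0" "n0 \<in> lattice" "wd n0 a = \<sigma>" using c0 by (auto simp: cone_def)
  have T: "T > 0" using cone_mvec[OF c0] by simp
  have ipa: "ip a (m x) = 0 * x^2 + (w2 * (norm a)^2) * x + ip a m0" for x
    unfolding m_def ip_simps ip_self by (simp add: algebra_simps)
  have nm: "(norm (m x))^2 = (w2^2 * (norm a)^2) * x^2 + (2 * w2 * ip a m0) * x + (norm m0)^2" for x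
    unfolding ip_self[symmetric] m_def ip_simps ip_commute[of m0 a]
    by (simp add: power2_eq_square algebra_simps)
  have ipn: "ip (n0 + of_real x * a) (m x) = (w2 * (norm a)^2) * x^2 + (ip a m0 + w2 * ip n0 a) * x + ip n0 m0" for x
    unfolding m_def ip_simps ip_self by (simp add: power2_eq_square algebra_simps)
  have pos: "0 < real w2 * (norm a)^2" using a assms by simp
  have ipa_mono: "ip a (m p) \<le> ip a (m q)" if "p \<le> q" for p q
    unfolding ipa using that pos by (simp add: mult_left_mono)
  have convJ: "order_convex J"
    unfolding order_convex_def
  proof (intro ballI allI impI)
    fix p r q assume h: "p \<in> J" "r \<in> J" "p \<le> q" "q \<le> r"
    have "0 < ip a (m (of_int q))" using h ipa_mono[of "of_int p" "of_int q"] by (simp add: J_def)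
    moreover have "(norm (m (of_int q)))^2 \<le> max ((norm (m (of_int p)))^2) ((norm (m (of_int r)))^2)"
      unfolding nm using h by (intro quadratic_between) auto
    then have "(norm (m (of_int q)))^2 < T^2"
      using h T by (auto simp: J_def max_def power_strict_mono split: if_splits elim!: le_less_trans)
    then have "norm (m (of_int q)) < T" using T by (simp add: power_less_imp_less_base)
    ultimately show "q \<in> J" by (simp add: J_def)
  qed
  have convK: "order_convex K"
    unfolding order_convex_def
  proof (intro ballI allI impI)
    fix p r q assume h: "p \<in> K" "r \<in> K" "p \<le> q" "q \<le> r"
    then have "q \<in> J" using convJ unfolding order_convex_def K_def by blast
    moreover have "ip (n0 + of_real (of_int q) * a) (m (of_int q)) \<le>
       max (ip (n0 + of_real (of_int p) * a) (m (of_int p))) (ip (n0 + of_real (of_int r) * a) (m (of_int r)))"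
      unfolding ipn using h pos by (intro quadratic_between) auto
    then have "ip (n0 + of_int q * a) (m (of_int q)) \<le> 0" using h by (auto simp: K_def max_def split: if_splits)
    ultimately show "q \<in> K" by (simp add: K_def)
  qed
  have diff: "real_of_int (r - p) * (w2 * norm a) \<le> 2 * T" if "p \<in> J" "r \<in> J" for p r
  proof -
    have "m (of_int r) - m (of_int p) = of_real (of_int (r - p) * w2) * a" by (simp add: m_def algebra_simps)
    then have "norm (m (of_int r) - m (of_int p)) = \<bar>of_int (r - p) * w2\<bar> * norm a"
      by (simp only: norm_mult norm_of_real)
    then have "\<bar>real_of_int (r - p)\<bar> * (w2 * norm a) = norm (m (of_int r) - m (of_int p))"
      by (simp add: abs_mult)
    also have "\<dots> \<le> norm (m (of_int r)) + norm (m (of_int p))" by (rule norm_triangle_ineq4)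
    also have "\<dots> \<le> 2 * T" using that by (simp add: J_def)
    finally have "\<bar>real_of_int (r - p)\<bar> * (w2 * norm a) \<le> 2 * T" .
    moreover have "real_of_int (r - p) * (w2 * norm a) \<le> \<bar>real_of_int (r - p)\<bar> * (w2 * norm a)"
      by (intro mult_right_mono) auto
    ultimately show ?thesis by linarith
  qed
  have wa: "0 < w2 * norm a" using a assms by simp
  define D where "D = 2 * T / (w2 * norm a)"
  have D: "real_of_int (r - p) \<le> D" if "p \<in> J" "r \<in> J" for p r
    using diff[OF that] wa by (simp add: D_def pos_le_divide_eq)
  have z: "0 \<in> J" using c0 by (simp add: J_def cone_def m_def m0_def)
  have "J \<subseteq> {\<lfloor>- D\<rfloor>..\<lceil>D\<rceil>}"
  proof
    fix t assume t: "t \<in> J"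
    show "t \<in> {\<lfloor>- D\<rfloor>..\<lceil>D\<rceil>}" using D[OF t z] D[OF z t] by simp linarith
  qed
  then have finJ: "finite J" by (rule finite_subset) simp
  obtain p q where pq: "J = {p..q}" "p \<le> q + 1" using order_convex_interval[OF convJ finJ] by blast
  have "p \<le> q" using z pq by auto
  then have "real (card J) = of_int (q - p) + 1" using pq by simp
  moreover have "real_of_int (q - p) \<le> D" using D[of p q] pq \<open>p \<le> q\<close> by simp
  ultimately have cardJ: "real (card J) \<le> 2 * T / (w2 * norm a) + 1" by (simp add: D_def)
  have "bij_betw (\<lambda>t. n0 + of_int t * a) (J - K) (fibre \<sigma> w1 w2 T a)"
    unfolding bij_betw_def
  proof
    show "inj_on (\<lambda>t. n0 + of_int t * a) (J - K)" using a by (auto simp: inj_on_def)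
    show "(\<lambda>t. n0 + of_int t * a) ` (J - K) = fibre \<sigma> w1 w2 T a"
    proof (intro equalityI subsetI)
      fix n assume "n \<in> (\<lambda>t. n0 + of_int t * a) ` (J - K)"
      then obtain t where t: "t \<in> J" "t \<notin> K" "n = n0 + of_int t * a" by auto
      then show "n \<in> fibre \<sigma> w1 w2 T a"
        using a by (auto simp: fibre_def cone_def mt J_def K_def wd_simps)
    next
      fix n assume "n \<in> fibre \<sigma> w1 w2 T a"
      then have c: "(a, n) \<in> cone \<sigma> w1 w2 T" by (simp add: fibre_def)
      have "wd (n - n0) a = 0" using c a by (simp add: wd_simps cone_def)
      moreover have "n - n0 \<in> lattice" using c a by (auto simp: cone_def)
      ultimately obtain t where t: "n - n0 = of_int t * a" using wd_zero_multiple[of a n0 "n - n0"] a assms by metis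
      then have n: "n = n0 + of_int t * a" by (simp add: algebra_simps)
      have "t \<in> J - K" using c unfolding n by (auto simp: cone_def mt J_def K_def)
      then show "n \<in> (\<lambda>t. n0 + of_int t * a) ` (J - K)" using n by blast
    qed
  qed
  moreover have "K \<subseteq> J" by (auto simp: K_def)
  ultimately show thesis using that convJ convK finJ cardJ by blast
qed

lemma card_fibre:
  assumes "w1 > 0" "w2 > 0" "\<bar>\<sigma>\<bar> = 1" "T > 0"
  shows "real (card (fibre \<sigma> w1 w2 T a)) \<le> 2 * T / (w2 * norm a) + 1"
proof (cases "fibre \<sigma> w1 w2 T a = {}")
  case True then show ?thesis using assms by simp
next
  case False
  then obtain n0 where "n0 \<in> fibre \<sigma> w1 w2 T a" by auto
  then obtain J K where JK: "finite J" "K \<subseteq> J" "real (card J) \<le> 2 * T / (w2 * norm a) + 1"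
    "bij_betw (\<lambda>t. n0 + of_int t * a) (J - K) (fibre \<sigma> w1 w2 T a)"
    using fibre_structure assms by metis
  have "card (fibre \<sigma> w1 w2 T a) = card (J - K)" using bij_betw_same_card[OF JK(4)] by simp
  also have "\<dots> \<le> card J" using JK by (intro card_mono) auto
  finally show ?thesis using JK(3) by linarith
qed

lemma eventually_cone_left:
  assumes "w1 > 0" "\<bar>\<sigma>\<bar> = 1"
  shows "\<forall>\<^sub>F T in at_top. \<forall>a n. (a, n) \<in> cone \<sigma> w1 w2 T \<longrightarrow> a \<in> pdisc (2 * T / w1)"
  using eventually_ge_at_top[of "real w1 * real w2 / min_norm + 1"]
proof eventually_elim
  case (elim T)
  show ?case
  proof (intro allI impI)
    fix a n assume an: "(a, n) \<in> cone \<sigma> w1 w2 T"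
    have T: "T > 0" using cone_mvec[OF an] by simp
    have "w2 / min_norm \<le> T / w1" using elim assms by (simp add: field_simps)
    then have "(w2 / min_norm)^2 \<le> (T / w1)^2" using min_norm_pos by (intro power_mono) auto
    moreover have "0 < (T / w1)^2" using T assms by simp
    ultimately have "(norm a)^2 < 4 * (T / w1)^2" using cone_norm_left(1)[OF an assms] by linarith
    also have "\<dots> = (2 * T / w1)^2" by (simp add: power2_eq_square)
    finally have "norm a < 2 * T / w1" using T by (simp add: power_less_imp_less_base)
    then show "a \<in> pdisc (2 * T / w1)" using cone_norm_left[OF an assms] by (simp add: pdisc_def)
  qed
qed

lemma cone_sum_fibres:
  assumes "w1 > 0" "w2 > 0" "\<bar>\<sigma>\<bar> = 1" "\<forall>a n. (a, n) \<in> cone \<sigma> w1 w2 T \<longrightarrow> a \<in> P" "finite P"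
  shows "cone_sum F \<sigma> w1 w2 T = (\<Sum>a\<in>P. \<Sum>n\<in>fibre \<sigma> w1 w2 T a. F a n)"
    "card (cone \<sigma> w1 w2 T) = (\<Sum>a\<in>P. card (fibre \<sigma> w1 w2 T a))"
proof -
  have fin: "finite (cone \<sigma> w1 w2 T)" using finite_cone assms by blast
  have finf: "finite (fibre \<sigma> w1 w2 T a)" for a
    by (rule finite_subset[of _ "snd ` cone \<sigma> w1 w2 T"]) (use fin in \<open>force simp: fibre_def\<close>)+
  have eq: "cone \<sigma> w1 w2 T = (SIGMA a:P. fibre \<sigma> w1 w2 T a)" using assms(4) by (auto simp: fibre_def)
  show "cone_sum F \<sigma> w1 w2 T = (\<Sum>a\<in>P. \<Sum>n\<in>fibre \<sigma> w1 w2 T a. F a n)"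
    unfolding cone_sum_def eq using assms finf by (subst sum.Sigma) auto
  show "card (cone \<sigma> w1 w2 T) = (\<Sum>a\<in>P. card (fibre \<sigma> w1 w2 T a))"
    unfolding eq using assms finf by (subst card_SigmaI) auto
qed

definition cone_const :: real where "cone_const = 20 * disc_const"

text \<open>Sum the fibre bound over \<open>a\<close>; when \<open>w2 \<le> w1\<close>, the term \<open>1\<close> per fibre is absorbed in the main term.\<close>

lemma card_cone_aux:
  assumes "w1 > 0" "w2 > 0" "\<bar>\<sigma>\<bar> = 1" "w2 \<le> w1"
  shows "\<forall>\<^sub>F T in at_top. real (card (cone \<sigma> w1 w2 T)) \<le> cone_const * T^2 / (w1 * w2)"
  using eventually_cone_left[OF assms(1,3), of w2] eventually_gt_at_top[of 0]
proof eventually_elim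
  case (elim T)
  define X where "X = 2 * T / w1"
  have X: "X > 0" using elim assms by (simp add: X_def)
  have "real (card (cone \<sigma> w1 w2 T)) = (\<Sum>a\<in>pdisc X. real (card (fibre \<sigma> w1 w2 T a)))"
    using cone_sum_fibres(2)[OF assms(1-3), of T "pdisc X"] elim by (simp add: X_def)
  also have "\<dots> \<le> (\<Sum>a\<in>pdisc X. 2 * T / w2 * (1 / norm a) + 1)"
    using card_fibre[OF assms(1-3)] elim by (intro sum_mono) (auto simp: divide_divide_eq_left)
  also have "\<dots> = 2 * T / w2 * (\<Sum>a\<in>pdisc X. 1 / norm a) + real (card (pdisc X))"
    by (simp add: sum.distrib sum_distrib_left)
  also have "\<dots> \<le> 2 * T / w2 * (4 * disc_const * X) + disc_const * X^2"
    using sum_inverse_norm[OF X] card_pdisc[of X] elim by (intro add_mono mult_left_mono) auto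
  also have "X^2 \<le> 4 * T^2 / (w1 * w2)"
  proof -
    have "real w1 * real w2 \<le> real w1 * real w1" using assms by (intro mult_left_mono) auto
    then have "4 * T^2 / (real w1 * real w1) \<le> 4 * T^2 / (real w1 * real w2)"
      using assms by (intro divide_left_mono) auto
    then show ?thesis by (simp add: X_def power2_eq_square)
  qed
  then have "2 * T / w2 * (4 * disc_const * X) + disc_const * X^2 \<le> 2 * T / w2 * (4 * disc_const * X) + disc_const * (4 * T^2 / (w1 * w2))"
    using disc_const_pos by (intro add_left_mono mult_left_mono) auto
  also have "\<dots> = cone_const * T^2 / (w1 * w2)"
    by (simp add: X_def cone_const_def power2_eq_square field_simps)
  finally show ?case .
qed

lemma card_cone_swap: "card (cone \<sigma> w1 w2 T) = card (cone (- \<sigma>) w2 w1 T)"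
  by (rule bij_betw_same_card[of "\<lambda>(a, n). (n, a)"], rule bij_betw_byWitness[of _ "\<lambda>(a, n). (n, a)"])
     (auto intro: cone_swap[THEN iffD1] cone_swap[THEN iffD2])

lemma card_cone:
  assumes "w1 > 0" "w2 > 0" "\<bar>\<sigma>\<bar> = 1"
  shows "\<forall>\<^sub>F T in at_top. real (card (cone \<sigma> w1 w2 T)) \<le> cone_const * T^2 / (w1 * w2)"
proof (cases "w2 \<le> w1")
  case True then show ?thesis by (rule card_cone_aux[OF assms])
next
  case False
  then show ?thesis using card_cone_aux[of w2 w1 "- \<sigma>"] assms
    by (simp add: card_cone_swap[of \<sigma> w1 w2] mult.commute)
qed

lemma cone_const_pos: "cone_const > 0"
  using disc_const_pos by (simp add: cone_const_def)

lemma cone_sum_trivial: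
  assumes "w1 > 0" "w2 > 0" "\<bar>\<sigma>\<bar> = 1" "\<And>a n. norm (F a n) \<le> B"
  shows "qbound (cone_sum F \<sigma> w1 w2) (\<bar>B\<bar> * cone_const / (real w1 * real w2))"
proof (rule qboundI)
  fix e :: real assume "e > 0"
  show "\<forall>\<^sub>F T in at_top. norm (cone_sum F \<sigma> w1 w2 T) \<le> (\<bar>B\<bar> * cone_const / (real w1 * real w2) + e) * T^2"
    using card_cone[OF assms(1-3)]
  proof eventually_elim
    case (elim T)
    have "norm (cone_sum F \<sigma> w1 w2 T) \<le> (\<Sum>(a, n)\<in>cone \<sigma> w1 w2 T. \<bar>B\<bar>)"
      unfolding cone_sum_def using assms(4) by (intro sum_norm_le) (auto intro: order_trans[OF assms(4) abs_ge_self])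
    also have "\<dots> = \<bar>B\<bar> * real (card (cone \<sigma> w1 w2 T))" by (simp add: case_prod_beta)
    also have "\<dots> \<le> \<bar>B\<bar> * (cone_const * T^2 / (real w1 * real w2))" using elim by (intro mult_left_mono) auto
    also have "\<dots> \<le> (\<bar>B\<bar> * cone_const / (real w1 * real w2) + e) * T^2" using \<open>e > 0\<close> by (simp add: algebra_simps)
    finally show ?case .
  qed
qed

end

section \<open>Character sums over cones\<close>

context shifted_lattice
begin

definition chi :: "int \<Rightarrow> int \<Rightarrow> complex \<Rightarrow> complex \<Rightarrow> complex" where
  "chi c1 c2 a n = cis2pi (wd \<zeta> (of_int c1 * a + of_int c2 * n))"

lemma norm_chi [simp]: "norm (chi c1 c2 a n) = 1"
  by (simp add: chi_def)

lemma chi_child1: "chi c1 c2 a (a + n) = chi (c1 + c2) c2 a n"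
  and chi_child2: "chi c1 c2 (a + n) n = chi c1 (c1 + c2) a n"
  by (simp_all add: chi_def algebra_simps)

lemma chi_swap: "chi c1 c2 n a = chi c2 c1 a n"
  by (simp add: chi_def add.commute)

text \<open>Expanding the square gives \<open>H\<close> diagonal terms of size at most the number of points and, off the diagonal, Weyl sums.\<close>

lemma dirichlet_mean_square:
  assumes "c \<noteq> 0" "H > 0"
  shows "qbound (\<lambda>X. \<Sum>a\<in>disc 0 X. complex_of_real ((dirichlet H (of_int c * wd \<zeta> a))^2)) (disc_const / real H)"
proof -
  have diag: "qbound (\<lambda>X. \<Sum>a\<in>disc 0 X. (1::complex)) disc_const"
  proof (rule qboundI)
    fix e :: real assume e: "e > 0"
    show "\<forall>\<^sub>F T in at_top. norm (\<Sum>a\<in>disc 0 T. (1::complex)) \<le> (disc_const + e) * T^2"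
      using eventually_ge_at_top[of "max 1 (1 / e)"]
    proof eventually_elim
      case (elim T)
      have "disc 0 T = insert 0 (pdisc T)" using elim by (auto simp: disc_def pdisc_def)
      moreover have "0 \<notin> pdisc T" by (simp add: pdisc_def)
      ultimately have "real (card (disc 0 T)) = real (card (pdisc T)) + 1" by simp
      also have "\<dots> \<le> disc_const * T^2 + e * T^2"
      proof -
        have "1 \<le> e * T" using elim e by (simp add: field_simps)
        also have "e * T \<le> e * T^2" using elim e by (simp add: power2_eq_square)
        finally show ?thesis using card_pdisc[of T] by linarith
      qed
      finally show ?case by (simp add: distrib_right)
    qed
  qed
  define f where "f h k X = (\<Sum>a\<in>disc 0 X. cis2pi ((real h - real k) * (of_int c * wd \<zeta> a)))" for h k :: nat and X
  have f: "qbound (f h k) (if h = k then disc_const else 0)" for h k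
  proof (cases "h = k")
    case True then show ?thesis using diag by (simp add: f_def[abs_def])
  next
    case False
    then have "(int h - int k) * c \<noteq> 0" using assms by simp
    from weyl_sum[OF this] show ?thesis using False by (simp add: f_def[abs_def] mult.assoc)
  qed
  have "qbound (\<lambda>X. \<Sum>h<H. \<Sum>k<H. f h k X) (\<Sum>h<H. \<Sum>k<H. (if h = k then disc_const else 0))"
    by (intro qbound_sum finite_lessThan f)
  then have "qbound (\<lambda>X. \<Sum>h<H. \<Sum>k<H. f h k X) (real H * disc_const)"
    by simp
  from qbound_cmult[OF this, of "1 / of_nat (H^2)"]
  have "qbound (\<lambda>X. (1 / of_nat (H^2)) * (\<Sum>h<H. \<Sum>k<H. f h k X)) (norm (1 / of_nat (H^2) :: complex) * (real H * disc_const))" .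
  also have "norm (1 / of_nat (H^2) :: complex) * (real H * disc_const) = disc_const / real H"
    using assms by (simp add: norm_divide norm_mult power2_eq_square)
  also have "(\<lambda>X. (1 / of_nat (H^2)) * (\<Sum>h<H. \<Sum>k<H. f h k X)) =
    (\<lambda>X. \<Sum>a\<in>disc 0 X. complex_of_real ((dirichlet H (of_int c * wd \<zeta> a))^2))"
  proof
    fix X
    have "(\<Sum>a\<in>disc 0 X. complex_of_real ((dirichlet H (of_int c * wd \<zeta> a))^2)) =
      (1 / of_nat (H^2)) * (\<Sum>a\<in>disc 0 X. \<Sum>h<H. \<Sum>k<H. cis2pi ((real h - real k) * (of_int c * wd \<zeta> a)))"
      unfolding dirichlet_square by (simp add: sum_divide_distrib)
    also have "(\<Sum>a\<in>disc 0 X. \<Sum>h<H. \<Sum>k<H. cis2pi ((real h - real k) * (of_int c * wd \<zeta> a))) = (\<Sum>h<H. \<Sum>k<H. f h k X)"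
      unfolding f_def by (subst sum.swap, rule sum.cong[OF refl], rule sum.swap)
    finally show "(1 / of_nat (H^2)) * (\<Sum>h<H. \<Sum>k<H. f h k X) =
      (\<Sum>a\<in>disc 0 X. complex_of_real ((dirichlet H (of_int c * wd \<zeta> a))^2))" by simp
  qed
  finally show ?thesis .
qed

lemma dirichlet_mean:
  assumes "c \<noteq> 0" "H > 0"
  shows "\<forall>\<^sub>F X in at_top. (\<Sum>a\<in>pdisc X. dirichlet H (of_int c * wd \<zeta> a)) \<le> 3 * disc_const * X^2 / sqrt H"
proof -
  have e: "disc_const / real H > 0" using assms disc_const_pos by simp
  show ?thesis
    using qboundD[OF dirichlet_mean_square[OF assms] e]
  proof eventually_elim
    case (elim X)
    let ?g = "\<lambda>a. dirichlet H (of_int c * wd \<zeta> a)"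
    define s where "s = sqrt (real H)"
    have s: "s > 0" "s * s = real H" using assms by (auto simp: s_def)
    have "(\<Sum>a\<in>pdisc X. (?g a)^2) \<le> (\<Sum>a\<in>disc 0 X. (?g a)^2)"
      by (rule sum_mono2) (auto simp: finite_disc pdisc_disc)
    also have "\<dots> \<le> norm (\<Sum>a\<in>disc 0 X. complex_of_real ((?g a)^2))"
      unfolding of_real_sum[symmetric] norm_of_real by simp
    also have "\<dots> \<le> 2 * disc_const / real H * X^2" using elim by simp
    finally have sq: "(\<Sum>a\<in>pdisc X. (?g a)^2) \<le> 2 * disc_const / real H * X^2" .
    have "(\<Sum>a\<in>pdisc X. ?g a) \<le> (\<Sum>a\<in>pdisc X. 1 / s + s * (?g a)^2)"
    proof (rule sum_mono)
      fix a
      show "?g a \<le> 1 / s + s * (?g a)^2"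
      proof (cases "?g a \<le> 1 / s")
        case True
        have "0 \<le> s * (?g a)^2" using s by simp
        then show ?thesis using True by linarith
      next
        case False
        then have "1 \<le> s * ?g a" using s by (simp add: field_simps)
        then have "1 * ?g a \<le> (s * ?g a) * ?g a" by (intro mult_right_mono dirichlet_nonneg)
        then have "?g a \<le> s * (?g a)^2" by (simp add: power2_eq_square mult.assoc)
        moreover have "0 < 1 / s" using s by simp
        ultimately show ?thesis by linarith
      qed
    qed
    also have "\<dots> = real (card (pdisc X)) * (1 / s) + s * (\<Sum>a\<in>pdisc X. (?g a)^2)"
      by (simp add: sum.distrib sum_distrib_left)
    also have "\<dots> \<le> disc_const * X^2 * (1 / s) + s * (2 * disc_const / real H * X^2)"
      using s sq card_pdisc[of X] by (intro add_mono mult_left_mono mult_right_mono) auto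
    also have "\<dots> = 3 * disc_const * X^2 / s"
      using s by (simp add: s(2)[symmetric] field_simps)
    finally show ?case by (simp add: s_def)
  qed
qed

lemma fibre_sum_bound:
  fixes H :: nat
  assumes "w1 > 0" "w2 > 0" "\<bar>\<sigma>\<bar> = 1" "T > 0" "H > 0"
  shows "norm (\<Sum>n\<in>fibre \<sigma> w1 w2 T a. chi c1 c2 a n)
    \<le> 2 * (2 * T / (w2 * norm a) + 1) * dirichlet H (of_int c2 * wd \<zeta> a) + 4 * H"
proof (cases "fibre \<sigma> w1 w2 T a = {}")
  case True then show ?thesis using assms dirichlet_nonneg by simp
next
  case False
  then obtain n0 where n0: "n0 \<in> fibre \<sigma> w1 w2 T a" by auto
  obtain J K where JK: "order_convex J" "order_convex K" "finite J" "K \<subseteq> J"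
    "real (card J) \<le> 2 * T / (w2 * norm a) + 1"
    "bij_betw (\<lambda>t. n0 + of_int t * a) (J - K) (fibre \<sigma> w1 w2 T a)"
    using fibre_structure[OF n0 assms(1-3)] .
  define x where "x = of_int c2 * wd \<zeta> a"
  have finK: "finite K" using JK finite_subset by blast
  have cK: "real (card K) \<le> real (card J)" using JK by (simp add: card_mono)
  have "(\<Sum>n\<in>fibre \<sigma> w1 w2 T a. chi c1 c2 a n) = (\<Sum>t\<in>J - K. chi c1 c2 a (n0 + of_int t * a))"
    by (rule sum.reindex_bij_betw[OF JK(6), symmetric])
  also have "\<dots> = (\<Sum>t\<in>J - K. chi c1 c2 a n0 * cis2pi (of_int t * x))"
  proof (rule sum.cong[OF refl])
    fix t
    have "wd \<zeta> (of_int c1 * a + of_int c2 * (n0 + of_int t * a)) = wd \<zeta> (of_int c1 * a + of_int c2 * n0) + of_int t * x"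
      unfolding x_def distrib_left wd_simps by (simp add: wd_of_int_right mult.left_commute[of _ "of_int t"])
    then show "chi c1 c2 a (n0 + of_int t * a) = chi c1 c2 a n0 * cis2pi (of_int t * x)"
      by (simp add: chi_def cis2pi_add)
  qed
  also have "\<dots> = chi c1 c2 a n0 * ((\<Sum>t\<in>J. cis2pi (of_int t * x)) - (\<Sum>t\<in>K. cis2pi (of_int t * x)))"
    using JK by (simp add: sum_distrib_left[symmetric] sum_diff)
  also have "norm \<dots> \<le> norm (\<Sum>t\<in>J. cis2pi (of_int t * x)) + norm (\<Sum>t\<in>K. cis2pi (of_int t * x))"
    by (simp add: norm_mult norm_triangle_ineq4)
  also have "\<dots> \<le> (real (card J) * dirichlet H x + 2 * real H) + (real (card K) * dirichlet H x + 2 * real H)"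
    using sum_cis2pi_order_convex[OF JK(1,3) assms(5)] sum_cis2pi_order_convex[OF JK(2) finK assms(5)] by (intro add_mono)
  also have "\<dots> \<le> 2 * (2 * T / (w2 * norm a) + 1) * dirichlet H x + 4 * H"
  proof -
    have "real (card J) * dirichlet H x \<le> (2 * T / (w2 * norm a) + 1) * dirichlet H x"
      using JK by (intro mult_right_mono dirichlet_nonneg)
    moreover have "real (card K) * dirichlet H x \<le> real (card J) * dirichlet H x"
      using cK by (intro mult_right_mono dirichlet_nonneg)
    moreover have "2 * (2 * T / (w2 * norm a) + 1) * dirichlet H x = 2 * ((2 * T / (w2 * norm a) + 1) * dirichlet H x)" by simp
    ultimately show ?thesis by linarith
  qed
  finally show ?thesis by (simp add: x_def)
qed

text \<open>Sum the fibre bound over \<open>a\<close>. The Dirichlet kernel is small on average, except that the weight \<open>1 / norm a\<close> must be controlled separately for \<open>norm a < \<kappa> X\<close>; the last term comes from the error \<open>O(H)\<close> in each of the \<open>O(T^2 / w1^2)\<close> fibres.\<close>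

lemma good_cone_bound:
  fixes H L :: nat
  assumes w: "w1 > 0" "w2 > 0" "\<bar>\<sigma>\<bar> = 1" and c: "c2 \<noteq> 0" and H: "H > 0" and \<kappa>: "0 < \<kappa>" "\<kappa> \<le> 1"
    and L: "L > 0" "real L * w2 \<le> w1"
  shows "\<forall>\<^sub>F T in at_top. norm (cone_sum (chi c1 c2) \<sigma> w1 w2 T)
    \<le> disc_const * (32 * \<kappa> + 24 / (\<kappa> * sqrt H) + (8 + 16 * H) / L) * T^2 / (w1 * w2)"
proof -
  have scale: "filterlim (\<lambda>T. 2 * T / real w1) at_top at_top"
  proof -
    have "filterlim (\<lambda>T. (2 / real w1) * T) at_top at_top"
      by (rule filterlim_tendsto_pos_mult_at_top[OF tendsto_const _ filterlim_ident]) (use w in simp)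
    then show ?thesis by simp
  qed
  show ?thesis
    using eventually_cone_left[OF w(1,3), of w2] eventually_gt_at_top[of 0]
      eventually_compose_filterlim[OF dirichlet_mean[OF c H] scale]
  proof eventually_elim
    case (elim T)
    define X where "X = 2 * T / w1"
    define g where "g a = dirichlet H (of_int c2 * wd \<zeta> a)" for a
    have X: "X > 0" using elim w by (simp add: X_def)
    have g: "0 \<le> g a" "g a \<le> 1" for a by (auto simp: g_def dirichlet_nonneg dirichlet_le_1)
    have gs: "(\<Sum>a\<in>pdisc X. g a) \<le> 3 * disc_const * X^2 / sqrt H" using elim(3) by (simp add: g_def X_def)
    have "norm (cone_sum (chi c1 c2) \<sigma> w1 w2 T) = norm (\<Sum>a\<in>pdisc X. \<Sum>n\<in>fibre \<sigma> w1 w2 T a. chi c1 c2 a n)"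
      using cone_sum_fibres(1)[OF w, of T "pdisc X" "chi c1 c2"] elim by (simp add: X_def)
    also have "\<dots> \<le> (\<Sum>a\<in>pdisc X. 2 * (2 * T / (w2 * norm a) + 1) * g a + 4 * H)"
      using fibre_sum_bound[OF w elim(2) H] by (intro sum_norm_le) (simp add: g_def)
    also have "\<dots> \<le> (\<Sum>a\<in>pdisc X. 4 * T / w2 * (g a / norm a) + (2 + 4 * H))"
    proof (rule sum_mono)
      fix a
      have "2 * (2 * T / (w2 * norm a) + 1) * g a = 4 * T / w2 * (g a / norm a) + 2 * g a"
        by (simp add: algebra_simps divide_divide_eq_left)
      then show "2 * (2 * T / (w2 * norm a) + 1) * g a + 4 * H \<le> 4 * T / w2 * (g a / norm a) + (2 + 4 * H)"
        using g(2)[of a] by linarith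
    qed
    also have "\<dots> = 4 * T / w2 * (\<Sum>a\<in>pdisc X. g a / norm a) + (2 + 4 * H) * real (card (pdisc X))"
      by (simp add: sum.distrib sum_distrib_left)
    also have "\<dots> \<le> 4 * T / w2 * (4 * disc_const * \<kappa> * X + 3 * disc_const * X / (\<kappa> * sqrt H)) + (2 + 4 * H) * (disc_const * X^2)"
    proof (intro add_mono mult_left_mono)
      have k: "\<kappa> * X > 0" using \<kappa> X by simp
      have sub: "pdisc (\<kappa> * X) \<subseteq> pdisc X"
      proof
        fix a assume "a \<in> pdisc (\<kappa> * X)"
        moreover have "\<kappa> * X \<le> 1 * X" using \<kappa> X by (intro mult_right_mono) auto
        ultimately show "a \<in> pdisc X" by (auto simp: pdisc_def)
      qed
      have "(\<Sum>a\<in>pdisc X. g a / norm a) = (\<Sum>a\<in>pdisc X - pdisc (\<kappa> * X). g a / norm a) + (\<Sum>a\<in>pdisc (\<kappa> * X). g a / norm a)"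
        using sub by (intro sum.subset_diff) auto
      also have "\<dots> \<le> (\<Sum>a\<in>pdisc X - pdisc (\<kappa> * X). g a / (\<kappa> * X)) + (\<Sum>a\<in>pdisc (\<kappa> * X). 1 / norm a)"
        using g k by (intro add_mono sum_mono divide_left_mono divide_right_mono) (auto simp: pdisc_def not_less)
      also have "\<dots> \<le> (\<Sum>a\<in>pdisc X. g a / (\<kappa> * X)) + 4 * disc_const * (\<kappa> * X)"
        using sum_inverse_norm[OF k] g k by (intro add_mono sum_mono2) auto
      also have "(\<Sum>a\<in>pdisc X. g a / (\<kappa> * X)) \<le> (3 * disc_const * X^2 / sqrt H) / (\<kappa> * X)"
        unfolding sum_divide_distrib[symmetric] using gs k by (intro divide_right_mono) auto
      also have "(3 * disc_const * X^2 / sqrt H) / (\<kappa> * X) = 3 * disc_const * X / (\<kappa> * sqrt H)"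
        using X by (simp add: power2_eq_square mult.commute)
      finally show "(\<Sum>a\<in>pdisc X. g a / norm a) \<le> 4 * disc_const * \<kappa> * X + 3 * disc_const * X / (\<kappa> * sqrt H)"
        by (simp add: mult.assoc)
    qed (use card_pdisc elim(2) in auto)
    also have "(2 + 4 * H) * (disc_const * X^2) \<le> (2 + 4 * H) * (disc_const * (4 * T^2 / (L * (w1 * w2))))"
    proof -
      have "real w1 * (real L * real w2) \<le> real w1 * real w1" using L by (intro mult_left_mono) auto
      then have "4 * T^2 / (real w1 * real w1) \<le> 4 * T^2 / (real w1 * (real L * real w2))"
        using w L by (intro divide_left_mono) auto
      then have "X^2 \<le> 4 * T^2 / (L * (w1 * w2))" by (simp add: X_def power2_eq_square mult_ac)
      then show ?thesis using disc_const_pos by (intro mult_left_mono) auto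
    qed
    finally have "norm (cone_sum (chi c1 c2) \<sigma> w1 w2 T) \<le>
      4 * T / w2 * (4 * disc_const * \<kappa> * X + 3 * disc_const * X / (\<kappa> * sqrt H)) +
      (2 + 4 * H) * (disc_const * (4 * T^2 / (L * (w1 * w2))))" by simp
    also have "\<dots> = disc_const * (32 * \<kappa> + 24 / (\<kappa> * sqrt H) + (8 + 16 * H) / L) * T^2 / (w1 * w2)"
    proof -
      have "4 * T / w2 * (4 * disc_const * \<kappa> * X + 3 * disc_const * X / (\<kappa> * sqrt H)) =
        disc_const * (32 * \<kappa> + 24 / (\<kappa> * sqrt H)) * T^2 / (w1 * w2)"
        by (simp add: X_def power2_eq_square algebra_simps add_divide_distrib)
      moreover have "(2 + 4 * H) * (disc_const * (4 * T^2 / (L * (w1 * w2)))) = disc_const * ((8 + 16 * H) / L) * T^2 / (w1 * w2)"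
        by (simp add: algebra_simps add_divide_distrib)
      ultimately show ?thesis by (simp add: algebra_simps add_divide_distrib)
    qed
    finally show ?case by simp
  qed
qed

text \<open>The threshold \<open>L\<close> depends on \<open>\<eta>\<close> alone, neither on the weights nor on the character. This uniformity drives the contraction below.\<close>

lemma good_cone:
  assumes "\<eta> > 0"
  shows "\<exists>L>0. \<forall>\<sigma> w1 w2 c1 c2. \<bar>\<sigma>\<bar> = 1 \<longrightarrow> w1 > 0 \<longrightarrow> w2 > 0 \<longrightarrow> real L * w2 \<le> w1 \<longrightarrow> c2 \<noteq> 0 \<longrightarrow>
     qbound (cone_sum (chi c1 c2) \<sigma> w1 w2) (\<eta> / (real w1 * real w2))"
proof -
  define \<kappa> where "\<kappa> = min 1 (\<eta> / (96 * disc_const))"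
  have \<kappa>: "0 < \<kappa>" "\<kappa> \<le> 1" using assms disc_const_pos by (auto simp: \<kappa>_def)
  have k1: "disc_const * (32 * \<kappa>) \<le> \<eta> / 3"
  proof -
    have "\<kappa> \<le> \<eta> / (96 * disc_const)" by (simp add: \<kappa>_def)
    then show ?thesis using disc_const_pos by (simp add: field_simps)
  qed
  obtain H0 :: nat where H0: "(72 * disc_const / (\<kappa> * \<eta>))^2 \<le> real H0" using real_arch_simple by blast
  define H where "H = Suc H0"
  have h: "72 * disc_const / (\<kappa> * \<eta>) \<le> sqrt H" using H0 by (intro real_le_rsqrt) (simp add: H_def)
  have sH: "sqrt H > 0" by (simp add: H_def)
  have k2: "disc_const * (24 / (\<kappa> * sqrt H)) \<le> \<eta> / 3"
    using h sH \<kappa> assms by (simp add: field_simps)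
  obtain L0 :: nat where L0: "3 * disc_const * (8 + 16 * H) / \<eta> \<le> real L0" using real_arch_simple by blast
  define L where "L = Suc L0"
  have "3 * disc_const * (8 + 16 * H) / \<eta> \<le> real L" using L0 by (simp add: L_def)
  then have k3: "disc_const * ((8 + 16 * H) / L) \<le> \<eta> / 3"
    using assms by (simp add: L_def field_simps)
  have k: "disc_const * (32 * \<kappa> + 24 / (\<kappa> * sqrt H) + (8 + 16 * H) / L) \<le> \<eta>"
    unfolding distrib_left using k1 k2 k3 by linarith
  show ?thesis
  proof (intro exI[of _ L] conjI allI impI)
    show "L > 0" by (simp add: L_def)
    fix \<sigma> :: real and w1 w2 :: nat and c1 c2 :: int
    assume h: "\<bar>\<sigma>\<bar> = 1" "w1 > 0" "w2 > 0" "real L * w2 \<le> w1" "c2 \<noteq> 0"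
    have "H > 0" by (simp add: H_def)
    show "qbound (cone_sum (chi c1 c2) \<sigma> w1 w2) (\<eta> / (real w1 * real w2))"
    proof (rule qboundI)
      fix e :: real assume "e > 0"
      show "\<forall>\<^sub>F T in at_top. norm (cone_sum (chi c1 c2) \<sigma> w1 w2 T) \<le> (\<eta> / (real w1 * real w2) + e) * T^2"
        using good_cone_bound[OF h(2,3,1,5) \<open>H > 0\<close> \<kappa> \<open>L > 0\<close> h(4), of c1]
      proof eventually_elim
        case (elim T)
        have "disc_const * (32 * \<kappa> + 24 / (\<kappa> * sqrt H) + (8 + 16 * H) / L) * T^2 / (real w1 * real w2) \<le> \<eta> * T^2 / (real w1 * real w2)"
          using k by (intro divide_right_mono mult_right_mono) auto
        also have "\<dots> \<le> (\<eta> / (real w1 * real w2) + e) * T^2" using \<open>e > 0\<close> by (simp add: distrib_right)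
        finally show ?case using elim by simp
      qed
    qed
  qed
qed

definition char_bound :: "real \<Rightarrow> bool" where
  "char_bound B \<longleftrightarrow> (\<forall>\<sigma> w1 w2 c1 c2. \<bar>\<sigma>\<bar> = 1 \<longrightarrow> w1 > 0 \<longrightarrow> w2 > 0 \<longrightarrow> (c1 \<noteq> 0 \<or> c2 \<noteq> 0) \<longrightarrow>
     qbound (cone_sum (chi c1 c2) \<sigma> w1 w2) (B / (real w1 * real w2)))"

lemma char_boundD:
  assumes "char_bound B" "\<bar>\<sigma>\<bar> = 1" "w1 > 0" "w2 > 0" "c1 \<noteq> 0 \<or> c2 \<noteq> 0"
  shows "qbound (cone_sum (chi c1 c2) \<sigma> w1 w2) (B / (real w1 * real w2))"
  using assms unfolding char_bound_def by blast

text \<open>Split \<open>L\<close> times, always keeping the child with weights \<open>(w1 + w2, w2)\<close>. The sizes of the other children form a telescoping series.\<close>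

lemma iterate_split:
  assumes w: "w1 > 0" "w2 > 0" "\<bar>\<sigma>\<bar> = 1"
    and child: "\<And>i. qbound (cone_sum (chi (c1 + int i * c2) (c1 + int (Suc i) * c2)) \<sigma> (w1 + i * w2) (w1 + Suc i * w2))
                    (D / (real (w1 + i * w2) * real (w1 + Suc i * w2)))"
    and last: "qbound (cone_sum (chi (c1 + int L * c2) c2) \<sigma> (w1 + L * w2) w2) g"
  shows "qbound (cone_sum (chi c1 c2) \<sigma> w1 w2) (D * (1 / (real w1 * real w2) - 1 / (real (w1 + L * w2) * real w2)) + g)"
  using last
proof (induction L arbitrary: g)
  case 0
  then show ?case by simp
next
  case (Suc L)
  let ?a = "real (w1 + L * w2)" and ?b = "real (w1 + Suc L * w2)"
  have "qbound (cone_sum (chi (c1 + int L * c2) c2) \<sigma> (w1 + L * w2) w2) (g + D / (?a * ?b))"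
  proof (rule cone_split_qbound)
    show "qbound (cone_sum (\<lambda>a n. chi (c1 + int L * c2) c2 a (a + n)) \<sigma> (w1 + L * w2 + w2) w2) g"
      using Suc.prems by (simp add: chi_child1 algebra_simps)
    show "qbound (cone_sum (\<lambda>a n. chi (c1 + int L * c2) c2 (a + n) n) \<sigma> (w1 + L * w2) (w1 + L * w2 + w2)) (D / (?a * ?b))"
      using child[of L] by (simp add: chi_child2 algebra_simps)
  qed (use w in auto)
  from Suc.IH[OF this] have "qbound (cone_sum (chi c1 c2) \<sigma> w1 w2)
     (D * (1 / (real w1 * real w2) - 1 / (?a * real w2)) + (g + D / (?a * ?b)))" .
  also have "D * (1 / (real w1 * real w2) - 1 / (?a * real w2)) + (g + D / (?a * ?b)) =
     D * (1 / (real w1 * real w2) - 1 / (?b * real w2)) + g"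
  proof -
    have ab: "?a > 0" "?b > 0" "real w2 > 0" unfolding of_nat_0_less_iff using w by auto
    have gen: "1 / (a * w) - 1 / (b * w) = 1 / (a * b)" if "b = a + w" "a > 0" "b > 0" "w > 0" for a b w :: real
      using that by (simp add: divide_simps)
    have "1 / (?a * real w2) - 1 / (?b * real w2) = 1 / (?a * ?b)"
      by (rule gen) (use ab in \<open>simp_all add: algebra_simps\<close>)
    then have D: "D / (?a * ?b) = D * (1 / (?a * real w2) - 1 / (?b * real w2))"
      by (simp only: times_divide_eq_right mult_1_right)
    have "D * (p - q) + (g + D * (q - r)) = D * (p - r) + g" for p q r :: real by (simp add: algebra_simps)
    then show ?thesis unfolding D .
  qed
  finally show ?case .
qed

text \<open>If \<open>w2 \<le> w1\<close> and \<open>c2 \<noteq> 0\<close>, after \<open>L\<close> splittings the bound \<open>\<eta>\<close> applies to a cone with a fixed fraction of the total size, and the bound \<open>B\<close> to the rest. The other cases follow by exchanging \<open>a\<close> and \<open>n\<close> and, if one coefficient is 0, by splitting until the trivial bound suffices for the last cone.\<close>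

lemma char_bound_improve:
  assumes B: "char_bound B" and \<eta>: "0 < \<eta>" "\<eta> \<le> B"
  shows "\<exists>p>0. char_bound (B - p * (B - \<eta>))"
proof -
  obtain L where L: "L > 0" and good: "\<And>\<sigma> w1 w2 c1 c2. \<bar>\<sigma>\<bar> = 1 \<Longrightarrow> w1 > 0 \<Longrightarrow> w2 > 0 \<Longrightarrow> real L * w2 \<le> w1 \<Longrightarrow> c2 \<noteq> 0 \<Longrightarrow>
     qbound (cone_sum (chi c1 c2) \<sigma> w1 w2) (\<eta> / (real w1 * real w2))"
    using good_cone[OF \<eta>(1)] by blast
  \<comment> \<open>The fraction \<open>w1 / (w1 + L w2)\<close> of the size left after \<open>L\<close> splittings is at least \<open>1 / (1 + L)\<close>.\<close>
  define p where "p = 1 / (1 + real L)"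
  define B' where "B' = B - p * (B - \<eta>)"
  have p: "p > 0" "p \<le> 1" by (auto simp: p_def)
  have B'0: "B' \<ge> 0"
  proof -
    have "p * (B - \<eta>) \<le> 1 * (B - \<eta>)" using p \<eta> by (intro mult_right_mono) auto
    then show ?thesis using \<eta> by (simp add: B'_def)
  qed
  have I: "qbound (cone_sum (chi c1 c2) \<sigma> w1 w2) (B' / (real w1 * real w2))"
    if h: "\<bar>\<sigma>\<bar> = 1" "w1 > 0" "w2 > 0" "w2 \<le> w1" "c2 \<noteq> 0" for \<sigma> w1 w2 c1 c2
  proof -
    let ?W = "real (w1 + L * w2)"
    have "qbound (cone_sum (chi c1 c2) \<sigma> w1 w2) (B * (1 / (real w1 * real w2) - 1 / (?W * real w2)) + \<eta> / (?W * real w2))"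
    proof (rule iterate_split)
      fix i :: nat
      have nz: "c1 + int i * c2 \<noteq> 0 \<or> c1 + int (Suc i) * c2 \<noteq> 0"
        using h(5) by (auto simp: algebra_simps)
      show "qbound (cone_sum (chi (c1 + int i * c2) (c1 + int (Suc i) * c2)) \<sigma> (w1 + i * w2) (w1 + Suc i * w2))
                    (B / (real (w1 + i * w2) * real (w1 + Suc i * w2)))"
        by (rule char_boundD[OF B h(1) _ _ nz]) (use h in auto)
      show "qbound (cone_sum (chi (c1 + int L * c2) c2) \<sigma> (w1 + L * w2) w2) (\<eta> / (?W * real w2))"
        by (rule good) (use h in auto)
    qed (fact h)+
    then show ?thesis
    proof (rule qbound_weaken)
      have pos: "?W > 0" "real w1 > 0" "real w2 > 0" unfolding of_nat_0_less_iff using h by simp_all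
      have "real L * real w2 \<le> real L * real w1" using h by (intro mult_left_mono) auto
      then have "p \<le> real w1 / ?W" using pos by (simp add: p_def field_simps)
      then have "p * (B - \<eta>) \<le> real w1 / ?W * (B - \<eta>)" using \<eta> by (intro mult_right_mono) auto
      then have "(B - real w1 / ?W * (B - \<eta>)) / (real w1 * real w2) \<le> B' / (real w1 * real w2)"
        unfolding B'_def by (intro divide_right_mono diff_left_mono) simp_all
      moreover have "(B - real w1 / ?W * (B - \<eta>)) / (real w1 * real w2) =
        B * (1 / (real w1 * real w2) - 1 / (?W * real w2)) + \<eta> / (?W * real w2)"
        using pos by (simp add: divide_simps del: of_nat_add of_nat_mult) (simp add: algebra_simps del: of_nat_add of_nat_mult)
      ultimately show "B * (1 / (real w1 * real w2) - 1 / (?W * real w2)) + \<eta> / (?W * real w2) \<le> B' / (real w1 * real w2)"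
        by linarith
    qed
  qed
  have swap: "cone_sum (chi c1 c2) \<sigma> w1 w2 = cone_sum (chi c2 c1) (- \<sigma>) w2 w1" for \<sigma> w1 w2 c1 c2
  proof
    fix T show "cone_sum (chi c1 c2) \<sigma> w1 w2 T = cone_sum (chi c2 c1) (- \<sigma>) w2 w1 T"
      by (subst cone_sum_swap) (simp add: chi_swap[of c1 c2] cone_sum_def)
  qed
  have II: "qbound (cone_sum (chi c1 c2) \<sigma> w1 w2) (B' / (real w1 * real w2))"
    if h: "\<bar>\<sigma>\<bar> = 1" "w1 > 0" "w2 > 0" "w1 \<le> w2" "c1 \<noteq> 0" for \<sigma> w1 w2 c1 c2
    unfolding swap[of c1 c2 \<sigma>] using I[of "-\<sigma>" w2 w1 c1 c2] h by (simp add: mult.commute)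
  \<comment> \<open>All other children carry the character with coefficients \<open>(c1, c1)\<close>, to which the previous case applies.\<close>
  have III: "qbound (cone_sum (chi c1 0) \<sigma> w1 w2) (B' / (real w1 * real w2))"
    if h: "\<bar>\<sigma>\<bar> = 1" "w1 > 0" "w2 > 0" "c1 \<noteq> 0" for \<sigma> w1 w2 c1
  proof (rule qbound_limit)
    fix d :: real assume d: "d > 0"
    obtain M :: nat where M: "cone_const / d \<le> real M" using real_arch_simple by blast
    let ?W = "real (w1 + M * w2)"
    have pos: "?W > 0" "real w1 > 0" "real w2 > 0" unfolding of_nat_0_less_iff using h by simp_all
    have "qbound (cone_sum (chi c1 0) \<sigma> w1 w2) (B' * (1 / (real w1 * real w2) - 1 / (?W * real w2)) + \<bar>1\<bar> * cone_const / (?W * real w2))"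
    proof (rule iterate_split)
      fix i :: nat
      show "qbound (cone_sum (chi (c1 + int i * 0) (c1 + int (Suc i) * 0)) \<sigma> (w1 + i * w2) (w1 + Suc i * w2))
                    (B' / (real (w1 + i * w2) * real (w1 + Suc i * w2)))"
        using II[of \<sigma> "w1 + i * w2" "w1 + Suc i * w2" c1 c1] h by simp
      show "qbound (cone_sum (chi (c1 + int M * 0) 0) \<sigma> (w1 + M * w2) w2) (\<bar>1\<bar> * cone_const / (?W * real w2))"
        by (rule cone_sum_trivial) (use h in auto)
    qed (fact h)+
    then show "qbound (cone_sum (chi c1 0) \<sigma> w1 w2) (B' / (real w1 * real w2) + d)"
    proof (rule qbound_weaken)
      have "B' * (1 / (real w1 * real w2) - 1 / (?W * real w2)) \<le> B' * (1 / (real w1 * real w2))"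
        using pos B'0 by (intro mult_left_mono) (auto simp del: of_nat_add of_nat_mult)
      moreover have "cone_const / (?W * real w2) \<le> d"
      proof -
        have w2: "1 \<le> real w2" "1 \<le> real w1" using h by linarith+
        have "real M * 1 \<le> real M * real w2" using w2 by (intro mult_left_mono) auto
        then have "real M \<le> ?W" by simp
        also have "\<dots> = ?W * 1" by simp
        also have "\<dots> \<le> ?W * real w2" using w2 pos by (intro mult_left_mono) auto
        finally have "cone_const / d \<le> ?W * real w2" using M by linarith
        then show ?thesis using d pos by (simp add: field_simps del: of_nat_add of_nat_mult)
      qed
      ultimately show "B' * (1 / (real w1 * real w2) - 1 / (?W * real w2)) + \<bar>1\<bar> * cone_const / (?W * real w2) \<le> B' / (real w1 * real w2) + d"
        by simp
    qed
  qed
  have IV: "qbound (cone_sum (chi 0 c2) \<sigma> w1 w2) (B' / (real w1 * real w2))"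
    if h: "\<bar>\<sigma>\<bar> = 1" "w1 > 0" "w2 > 0" "c2 \<noteq> 0" for \<sigma> w1 w2 c2
    unfolding swap[of 0 c2 \<sigma>] using III[of "-\<sigma>" w2 w1 c2] h by (simp add: mult.commute)
  have "char_bound B'"
    unfolding char_bound_def
  proof (intro allI impI)
    fix \<sigma> :: real and w1 w2 :: nat and c1 c2 :: int
    assume h: "\<bar>\<sigma>\<bar> = 1" "w1 > 0" "w2 > 0" "c1 \<noteq> 0 \<or> c2 \<noteq> 0"
    show "qbound (cone_sum (chi c1 c2) \<sigma> w1 w2) (B' / (real w1 * real w2))"
    proof (cases "c1 = 0 \<or> c2 = 0")
      case True then show ?thesis using h III[of \<sigma> w1 w2 c1] IV[of \<sigma> w1 w2 c2] by auto
    next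
      case False
      then show ?thesis using h I[of \<sigma> w1 w2 c2 c1] II[of \<sigma> w1 w2 c1 c2] by (cases "w2 \<le> w1") auto
    qed
  qed
  then show ?thesis unfolding B'_def using p by blast
qed

text \<open>The admissible constants form a closed set bounded below, and a positive infimum could be improved.\<close>

lemma char_bound_0: "char_bound 0"
proof -
  define A where "A = {B. 0 \<le> B \<and> char_bound B}"
  have c: "cone_const \<in> A"
    unfolding A_def char_bound_def
    using cone_const_pos cone_sum_trivial[where B = 1 and F = "chi c1 c2" for c1 c2] by auto
  have bdd: "bdd_below A" by (rule bdd_belowI[of _ 0]) (simp add: A_def)
  define B0 where "B0 = Inf A"
  have B0: "B0 \<ge> 0" unfolding B0_def using c by (intro cInf_greatest) (auto simp: A_def)
  have ok: "char_bound B0"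
    unfolding char_bound_def
  proof (intro allI impI)
    fix \<sigma> :: real and w1 w2 :: nat and c1 c2 :: int
    assume h: "\<bar>\<sigma>\<bar> = 1" "w1 > 0" "w2 > 0" "c1 \<noteq> 0 \<or> c2 \<noteq> 0"
    show "qbound (cone_sum (chi c1 c2) \<sigma> w1 w2) (B0 / (real w1 * real w2))"
    proof (rule qbound_limit)
      fix d :: real assume d: "d > 0"
      have "Inf A < B0 + d * (real w1 * real w2)" using d h by (simp add: B0_def)
      then obtain B where B: "B \<in> A" "B < B0 + d * (real w1 * real w2)"
        using c bdd by (metis cInf_lessD empty_iff)
      have "qbound (cone_sum (chi c1 c2) \<sigma> w1 w2) (B / (real w1 * real w2))"
        using B h char_boundD unfolding A_def by blast
      then show "qbound (cone_sum (chi c1 c2) \<sigma> w1 w2) (B0 / (real w1 * real w2) + d)"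
        by (rule qbound_weaken) (use B h in \<open>simp add: field_simps\<close>)
    qed
  qed
  have "B0 = 0"
  proof (rule ccontr)
    assume "B0 \<noteq> 0"
    then have pos: "B0 > 0" using B0 by simp
    then obtain p where p: "p > 0" "char_bound (B0 - p * (B0 - B0 / 2))"
      using char_bound_improve[OF ok, of "B0 / 2"] by auto
    have "qbound (cone_sum (chi 1 0) 1 1 1) ((B0 - p * (B0 - B0 / 2)) / (real 1 * real 1))"
      by (rule char_boundD[OF p(2)]) auto
    then have "B0 - p * (B0 - B0 / 2) \<ge> 0" using qbound_ge0 by fastforce
    then have "B0 - p * (B0 - B0 / 2) \<in> A" using p by (simp add: A_def)
    then have "B0 \<le> B0 - p * (B0 - B0 / 2)" unfolding B0_def using bdd by (intro cInf_lower)
    moreover have "p * (B0 - B0 / 2) > 0" using p pos by (intro mult_pos_pos) auto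
    ultimately show False by linarith
  qed
  then show ?thesis using ok by simp
qed

theorem cone_character_sum:
  assumes "\<bar>\<sigma>\<bar> = 1" "w1 > 0" "w2 > 0" "c1 \<noteq> 0 \<or> c2 \<noteq> 0"
  shows "qbound (cone_sum (chi c1 c2) \<sigma> w1 w2) 0"
proof -
  have "qbound (cone_sum (chi c1 c2) \<sigma> w1 w2) (0 / (real w1 * real w2))"
    using char_boundD[OF char_bound_0 assms] .
  then show ?thesis by simp
qed

end

section \<open>Character sums with continuous weights\<close>

context shifted_lattice
begin

text \<open>The orthogonal projection of \<open>p1 a + p2 n\<close> on \<open>m\<close>, in units of \<open>m\<close>. Splitting a cone preserves it if \<open>(p1, p2)\<close> is transformed like \<open>(w1, w2)\<close>.\<close>

definition proj_ratio :: "nat \<Rightarrow> nat \<Rightarrow> nat \<Rightarrow> nat \<Rightarrow> complex \<Rightarrow> complex \<Rightarrow> real" where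
  "proj_ratio p1 p2 w1 w2 a n = ip (mvec p1 p2 a n) (mvec w1 w2 a n) / (norm (mvec w1 w2 a n))^2"

lemma mvec_children:
  "mvec w1 w2 a (a + n) = mvec (w1 + w2) w2 a n"
  "mvec w1 w2 (a + n) n = mvec w1 (w1 + w2) a n"
  by (simp_all add: mvec_def algebra_simps)

text \<open>Since \<open>w1 x + w2 y = 1\<close> for the projections \<open>x, y \<ge> 0\<close> of \<open>a\<close> and \<open>n\<close>, the ratio is a mean of the Farey neighbours \<open>p1 / w1\<close> and \<open>p2 / w2\<close>, whose distance is \<open>1 / (w1 w2)\<close>.\<close>

lemma proj_ratio_in_cell:
  assumes an: "(a, n) \<in> cone \<sigma> w1 w2 T" and w: "w1 > 0" "w2 > 0" and p: "p1 \<le> w1" "p2 \<le> w2"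
    and uni: "\<bar>int p2 * int w1 - int p1 * int w2\<bar> = 1"
  shows "\<bar>proj_ratio p1 p2 w1 w2 a n - real p1 / real w1\<bar> \<le> 1 / (real w1 * real w2)" "proj_ratio p1 p2 w1 w2 a n \<in> {0..1}"
proof -
  let ?m = "mvec w1 w2 a n"
  define q where "q = (norm ?m)^2"
  have q: "q > 0" using cone_mvec(1)[OF an] by (simp add: q_def)
  define x y where "x = ip a ?m / q" and "y = ip n ?m / q"
  have xy: "x > 0" "y > 0" using an q by (auto simp: x_def y_def cone_def)
  have s: "real w1 * x + real w2 * y = 1"
    using cone_mvec(7)[OF an] q by (simp add: x_def y_def q_def add_divide_distrib[symmetric])
  have l: "proj_ratio p1 p2 w1 w2 a n = real p1 * x + real p2 * y"
    by (simp add: proj_ratio_def mvec_def[of p1] ip_simps x_def y_def q_def add_divide_distrib)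
  have y2: "y \<le> 1 / real w2"
  proof -
    have "real w1 * x > 0" using w xy by simp
    then show ?thesis using s w by (simp add: field_simps)
  qed
  have "real w1 * (real p1 * x + real p2 * y - real p1 / real w1) = real p1 * (real w1 * x) + real w1 * real p2 * y - real p1"
    using w by (simp add: algebra_simps)
  also have "\<dots> = (of_int (int p2 * int w1 - int p1 * int w2)) * y"
  proof -
    have w1x: "real w1 * x = 1 - real w2 * y" using s by simp
    show ?thesis unfolding w1x by (simp add: algebra_simps)
  qed
  finally have "\<bar>real w1 * (real p1 * x + real p2 * y - real p1 / real w1)\<bar> = \<bar>of_int (int p2 * int w1 - int p1 * int w2)\<bar> * \<bar>y\<bar>"
    by (simp only: abs_mult)
  also have "\<bar>real_of_int (int p2 * int w1 - int p1 * int w2)\<bar> = 1" using uni by linarith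
  finally have "real w1 * \<bar>real p1 * x + real p2 * y - real p1 / real w1\<bar> = y" using xy by (simp add: abs_mult)
  then have "\<bar>real p1 * x + real p2 * y - real p1 / real w1\<bar> = y / real w1" using w by (simp add: field_simps)
  also have "\<dots> \<le> (1 / real w2) / real w1" using y2 by (intro divide_right_mono) auto
  finally show "\<bar>proj_ratio p1 p2 w1 w2 a n - real p1 / real w1\<bar> \<le> 1 / (real w1 * real w2)"
    by (simp add: l mult.commute)
  have "real p1 * x \<le> real w1 * x" "real p2 * y \<le> real w2 * y" using p xy by (auto intro: mult_right_mono)
  then have "real p1 * x + real p2 * y \<le> 1" using s by linarith
  then show "proj_ratio p1 p2 w1 w2 a n \<in> {0..1}" using xy by (simp add: l)
qed

text \<open>Split until \<open>w1 + w2 > N\<close>; on such a cone \<open>\<psi>\<close> is constant up to \<open>\<epsilon>\<close>, and the error terms add up because the sizes of the cones do. The induction runs over the number \<open>D\<close> of splittings still needed.\<close>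

lemma weighted_cell:
  fixes \<psi> :: "real \<Rightarrow> complex"
  assumes B: "\<And>x. norm (\<psi> x) \<le> B" and \<epsilon>: "\<epsilon> > 0"
    and N: "N > 0" "\<And>x y. x \<in> {0..1} \<Longrightarrow> y \<in> {0..1} \<Longrightarrow> \<bar>x - y\<bar> \<le> 1 / real N \<Longrightarrow> norm (\<psi> x - \<psi> y) \<le> \<epsilon>"
    and c: "c1 \<noteq> 0 \<or> c2 \<noteq> 0" and s: "\<bar>\<sigma>\<bar> = 1"
    and w: "w1 > 0" "w2 > 0" "p1 \<le> w1" "p2 \<le> w2" "\<bar>int p2 * int w1 - int p1 * int w2\<bar> = 1"
    and D: "N + 1 \<le> w1 + w2 + D"
  shows "qbound (cone_sum (\<lambda>a n. \<psi> (proj_ratio p1 p2 w1 w2 a n) * chi c1 c2 a n) \<sigma> w1 w2) (\<epsilon> * cone_const / (real w1 * real w2))"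
  using w D c
proof (induction D arbitrary: w1 w2 p1 p2 c1 c2)
  case 0
  let ?F = "\<lambda>a n. \<psi> (proj_ratio p1 p2 w1 w2 a n) * chi c1 c2 a n"
  let ?x0 = "real p1 / real w1"
  have w: "w1 > 0" "w2 > 0" "p1 \<le> w1" "p2 \<le> w2" using 0 by auto
  have N1: "1 / (real w1 * real w2) \<le> 1 / real N"
  proof -
    \<comment> \<open>Here \<open>w1 w2 \<ge> w1 + w2 - 1 \<ge> N\<close>.\<close>
    obtain u1 u2 where u: "w1 = Suc u1" "w2 = Suc u2" using w gr0_implies_Suc by metis
    have "N \<le> w1 + w2 - 1" using 0 by simp
    also have "\<dots> \<le> w1 * w2" by (simp add: u)
    finally have "real N \<le> real w1 * real w2" by (metis of_nat_mult of_nat_mono)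
    then show ?thesis using N(1) by (intro divide_left_mono) auto
  qed
  have x0: "?x0 \<in> {0..1}" using w by simp
  have close: "norm (\<psi> (proj_ratio p1 p2 w1 w2 a n) - \<psi> ?x0) \<le> \<epsilon>" if "(a, n) \<in> cone \<sigma> w1 w2 T" for a n T
    using proj_ratio_in_cell[OF that w(1,2,3,4) 0(5)] N1 x0 by (intro N(2)) auto
  have A: "qbound (\<lambda>T. \<psi> ?x0 * cone_sum (chi c1 c2) \<sigma> w1 w2 T) (norm (\<psi> ?x0) * 0)"
    by (rule qbound_cmult, rule cone_character_sum) (use w s 0 in auto)
  have E: "qbound (\<lambda>T. cone_sum ?F \<sigma> w1 w2 T - \<psi> ?x0 * cone_sum (chi c1 c2) \<sigma> w1 w2 T) (\<epsilon> * cone_const / (real w1 * real w2))"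
  proof (rule qboundI)
    fix e :: real assume "e > 0"
    show "\<forall>\<^sub>F T in at_top. norm (cone_sum ?F \<sigma> w1 w2 T - \<psi> ?x0 * cone_sum (chi c1 c2) \<sigma> w1 w2 T)
       \<le> (\<epsilon> * cone_const / (real w1 * real w2) + e) * T^2"
      using card_cone[OF w(1,2) s]
    proof eventually_elim
      case (elim T)
      have "cone_sum ?F \<sigma> w1 w2 T - \<psi> ?x0 * cone_sum (chi c1 c2) \<sigma> w1 w2 T =
         (\<Sum>(a, n)\<in>cone \<sigma> w1 w2 T. (\<psi> (proj_ratio p1 p2 w1 w2 a n) - \<psi> ?x0) * chi c1 c2 a n)"
        unfolding cone_sum_def sum_distrib_left sum_subtractf[symmetric]
        by (intro sum.cong) (auto simp: algebra_simps)
      also have "norm \<dots> \<le> (\<Sum>(a, n)\<in>cone \<sigma> w1 w2 T. \<epsilon>)"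
        using close by (intro sum_norm_le) (auto simp: norm_mult)
      also have "\<dots> = \<epsilon> * real (card (cone \<sigma> w1 w2 T))" by (simp add: case_prod_beta)
      also have "\<dots> \<le> \<epsilon> * (cone_const * T^2 / (real w1 * real w2))"
        using elim \<epsilon> by (intro mult_left_mono) auto
      also have "\<dots> \<le> (\<epsilon> * cone_const / (real w1 * real w2) + e) * T^2"
        using \<open>e > 0\<close> by (simp add: distrib_right mult.assoc)
      finally show ?case .
    qed
  qed
  show ?case using qbound_add[OF E A] by simp
next
  case (Suc D)
  let ?F = "\<lambda>a n. \<psi> (proj_ratio p1 p2 w1 w2 a n) * chi c1 c2 a n"
  have w: "w1 > 0" "w2 > 0" by (fact Suc.prems)+
  have c1: "\<bar>int p2 * int (w1 + w2) - int (p1 + p2) * int w2\<bar> = 1"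
    and c2: "\<bar>int (p1 + p2) * int w1 - int p1 * int (w1 + w2)\<bar> = 1"
    using Suc.prems(5) by (simp_all add: algebra_simps)
  have "qbound (cone_sum (\<lambda>a n. ?F a (a + n)) \<sigma> (w1 + w2) w2) (\<epsilon> * cone_const / (real (w1 + w2) * real w2))"
  proof -
    have eq: "(\<lambda>a n. ?F a (a + n)) = (\<lambda>a n. \<psi> (proj_ratio (p1 + p2) p2 (w1 + w2) w2 a n) * chi (c1 + c2) c2 a n)"
      by (simp add: proj_ratio_def mvec_children chi_child1)
    show ?thesis unfolding eq by (rule Suc.IH) (use Suc.prems c1 in auto)
  qed
  moreover have "qbound (cone_sum (\<lambda>a n. ?F (a + n) n) \<sigma> w1 (w1 + w2)) (\<epsilon> * cone_const / (real w1 * real (w1 + w2)))"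
  proof -
    have eq: "(\<lambda>a n. ?F (a + n) n) = (\<lambda>a n. \<psi> (proj_ratio p1 (p1 + p2) w1 (w1 + w2) a n) * chi c1 (c1 + c2) a n)"
      by (simp add: proj_ratio_def mvec_children chi_child2)
    show ?thesis unfolding eq by (rule Suc.IH) (use Suc.prems c2 in auto)
  qed
  moreover have "norm (?F a n) \<le> B" for a n using B by (simp add: norm_mult)
  ultimately have "qbound (cone_sum ?F \<sigma> w1 w2) (\<epsilon> * cone_const / (real (w1 + w2) * real w2) + \<epsilon> * cone_const / (real w1 * real (w1 + w2)))"
    using cone_split_qbound[OF w s, of ?F B] by blast
  also have "\<epsilon> * cone_const / (real (w1 + w2) * real w2) + \<epsilon> * cone_const / (real w1 * real (w1 + w2)) = \<epsilon> * cone_const / (real w1 * real w2)"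
  proof -
    have "K / (z * y) + K / (x * z) = K / (x * y)" if "x > 0" "y > 0" "z = x + y" for K x y z :: real
    proof -
      have "z > 0" using that by simp
      then have "K / (z * y) + K / (x * z) = (K * (x + y)) / (x * y * z)"
        using that(1,2) by (simp add: add_divide_distrib distrib_left)
      also have "\<dots> = K / (x * y)" unfolding that(3)[symmetric] using \<open>z > 0\<close> by simp
      finally show ?thesis .
    qed
    from this[of "real w1" "real w2" "real (w1 + w2)" "\<epsilon> * cone_const"] show ?thesis using w by simp
  qed
  finally show ?case .
qed

lemma weighted_character_sum:
  fixes \<psi> :: "real \<Rightarrow> complex"
  assumes cont: "continuous_on {0..1} \<psi>" and c: "c1 \<noteq> 0 \<or> c2 \<noteq> 0"
  shows "qbound (cone_sum (\<lambda>a n. \<psi> (proj_ratio 0 1 1 1 a n) * chi c1 c2 a n) 1 1 1) 0"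
proof -
  define \<phi> where "\<phi> x = \<psi> (max 0 (min 1 x))" for x
  have "compact (\<psi> ` {0..1})" using cont by (intro compact_continuous_image) auto
  then obtain B where B: "\<And>x. x \<in> {0..1} \<Longrightarrow> norm (\<psi> x) \<le> B"
    by (meson bounded_iff compact_imp_bounded image_eqI)
  have \<phi>B: "norm (\<phi> x) \<le> B" for x unfolding \<phi>_def by (rule B) auto
  have eq: "\<phi> x = \<psi> x" if "x \<in> {0..1}" for x using that by (simp add: \<phi>_def)
  have uc: "uniformly_continuous_on {0..1} \<psi>" using cont by (intro compact_uniformly_continuous) auto
  have "qbound (cone_sum (\<lambda>a n. \<phi> (proj_ratio 0 1 1 1 a n) * chi c1 c2 a n) 1 1 1) 0"
  proof (rule qbound_limit)
    fix d :: real assume d: "d > 0"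
    define \<epsilon> where "\<epsilon> = d / cone_const"
    have \<epsilon>: "\<epsilon> > 0" using d cone_const_pos by (simp add: \<epsilon>_def)
    obtain \<delta> where \<delta>: "\<delta> > 0" "\<And>x y. x \<in> {0..1} \<Longrightarrow> y \<in> {0..1} \<Longrightarrow> \<bar>x - y\<bar> < \<delta> \<Longrightarrow> norm (\<psi> x - \<psi> y) < \<epsilon>"
      using uc \<epsilon> unfolding uniformly_continuous_on_def dist_norm real_norm_def by metis
    obtain N :: nat where N: "N > 0" "1 / real N < \<delta>" using nat_approx_posE[OF \<delta>(1)] by blast
    have "qbound (cone_sum (\<lambda>a n. \<phi> (proj_ratio 0 1 1 1 a n) * chi c1 c2 a n) 1 1 1) (\<epsilon> * cone_const / (real 1 * real 1))"
    proof (rule weighted_cell[where N = N and D = N and B = B])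
      fix x y :: real assume "x \<in> {0..1}" "y \<in> {0..1}" "\<bar>x - y\<bar> \<le> 1 / real N"
      then show "norm (\<phi> x - \<phi> y) \<le> \<epsilon>" using eq \<delta>(2)[of x y] N by force
    qed (use \<phi>B \<epsilon> N c in auto)
    then show "qbound (cone_sum (\<lambda>a n. \<phi> (proj_ratio 0 1 1 1 a n) * chi c1 c2 a n) 1 1 1) (0 + d)"
      using cone_const_pos by (simp add: \<epsilon>_def)
  qed
  moreover have "cone_sum (\<lambda>a n. \<phi> (proj_ratio 0 1 1 1 a n) * chi c1 c2 a n) 1 1 1 = cone_sum (\<lambda>a n. \<psi> (proj_ratio 0 1 1 1 a n) * chi c1 c2 a n) 1 1 1"
  proof
    fix T
    have "proj_ratio 0 1 1 1 a n \<in> {0..1}" if "(a, n) \<in> cone 1 1 1 T" for a n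
      using proj_ratio_in_cell(2)[OF that, of 0 1] by simp
    then show "cone_sum (\<lambda>a n. \<phi> (proj_ratio 0 1 1 1 a n) * chi c1 c2 a n) 1 1 1 T = cone_sum (\<lambda>a n. \<psi> (proj_ratio 0 1 1 1 a n) * chi c1 c2 a n) 1 1 1 T"
      unfolding cone_sum_def by (intro sum.cong) (auto simp: eq)
  qed
  ultimately show ?thesis by simp
qed

abbreviation cone1 :: "real \<Rightarrow> (complex \<times> complex) set" where
  "cone1 \<equiv> cone 1 1 1"

lemma finite_cone1 [simp]: "finite (cone1 T)"
  by (rule finite_cone) auto

lemma card_cone1: "\<forall>\<^sub>F T in at_top. real (card (cone1 T)) \<le> cone_const * T^2"
  using card_cone[of 1 1 1] by simp

text \<open>Replace the radius by the nearest lower multiple of \<open>1 / N\<close> and write the sum as a combination of sums over discs of radius \<open>k T / N\<close>.\<close>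

lemma radial_character_sum:
  fixes \<Psi> :: "real \<Rightarrow> real \<Rightarrow> complex"
  assumes cont: "continuous_on ({0..1} \<times> {0..1}) (\<lambda>(x, r). \<Psi> x r)" and c: "c1 \<noteq> 0 \<or> c2 \<noteq> 0"
  shows "qbound (\<lambda>T. \<Sum>(a, n)\<in>cone1 T. \<Psi> (proj_ratio 0 1 1 1 a n) (norm (a + n) / T) * chi c1 c2 a n) 0"
proof (rule qbound_limit)
  fix d :: real assume d: "d > 0"
  define \<epsilon> where "\<epsilon> = d / cone_const"
  have \<epsilon>: "\<epsilon> > 0" using d cone_const_pos by (simp add: \<epsilon>_def)
  have "compact ({0..1} \<times> {0..1::real} :: (real \<times> real) set)" by (intro compact_Times) auto
  then have uc: "uniformly_continuous_on ({0..1} \<times> {0..1}) (\<lambda>(x, r). \<Psi> x r)"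
    using cont by (intro compact_uniformly_continuous) auto
  obtain \<delta> where \<delta>: "\<delta> > 0" and \<delta>': "\<And>x r s. x \<in> {0..1} \<Longrightarrow> r \<in> {0..1} \<Longrightarrow> s \<in> {0..1} \<Longrightarrow> \<bar>r - s\<bar> < \<delta> \<Longrightarrow> norm (\<Psi> x r - \<Psi> x s) < \<epsilon>"
  proof -
    obtain \<delta> where d: "\<delta> > 0" "\<forall>p\<in>{0..1} \<times> {0..1}. \<forall>p'\<in>{0..1} \<times> {0..1}. dist p' p < \<delta> \<longrightarrow> dist ((\<lambda>(x, r). \<Psi> x r) p') ((\<lambda>(x, r). \<Psi> x r) p) < \<epsilon>"
      using uc \<epsilon> unfolding uniformly_continuous_on_def by blast
    show thesis
    proof (rule that[OF d(1)])
      fix x r s :: real assume h: "x \<in> {0..1}" "r \<in> {0..1}" "s \<in> {0..1}" "\<bar>r - s\<bar> < \<delta>"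
      have "dist (x, r) (x, s) < \<delta>" using h by (simp add: dist_Pair_Pair dist_real_def)
      then show "norm (\<Psi> x r - \<Psi> x s) < \<epsilon>"
        using d(2)[rule_format, of "(x, s)" "(x, r)"] h by (simp add: dist_norm)
    qed
  qed
  obtain N :: nat where N: "N > 0" "1 / real N < \<delta>" using nat_approx_posE[OF \<delta>(1)] by blast
  define st where "st r = of_int \<lfloor>real N * r\<rfloor> / real N" for r
  define G where "G k T = cone_sum (\<lambda>a n. \<Psi> (proj_ratio 0 1 1 1 a n) (real k / real N) * chi c1 c2 a n) 1 1 1 T" for k T
  have qG: "qbound (\<lambda>T. G k (x * T)) 0" if "k \<le> N" "x \<ge> 0" for k x
  proof (cases "x = 0")
    case True
    have "cone1 0 = {}" by (auto simp: cone_def)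
    then show ?thesis using True by (simp add: G_def cone_sum_def)
  next
    case False
    have "continuous_on {0..1} (\<lambda>x. (\<lambda>(x, r). \<Psi> x r) (x, real k / real N))"
      by (rule continuous_on_compose2[OF cont]) (use that N in \<open>auto intro!: continuous_intros\<close>)
    then have "qbound (G k) 0" unfolding G_def using c by (intro weighted_character_sum) auto
    then show ?thesis using qbound_scale[of "G k" 0 x] False that by simp
  qed
  have step: "(\<Sum>(a, n)\<in>cone1 (real k / real N * T). \<Psi> (proj_ratio 0 1 1 1 a n) (st (norm (a + n) / T)) * chi c1 c2 a n) =
     (\<Sum>i<k. G i (real (Suc i) / real N * T) - G i (real i / real N * T))" if "T > 0" for k T
  proof (induction k)
    case 0
    have "cone1 0 = {}" by (auto simp: cone_def)
    then show ?case by simp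
  next
    case (Suc k)
    let ?F = "\<lambda>(a, n). \<Psi> (proj_ratio 0 1 1 1 a n) (st (norm (a + n) / T)) * chi c1 c2 a n"
    let ?Fk = "\<lambda>(a, n). \<Psi> (proj_ratio 0 1 1 1 a n) (real k / real N) * chi c1 c2 a n"
    let ?A = "cone1 (real k / real N * T)" and ?B = "cone1 (real (Suc k) / real N * T)"
    have "real k / real N * T \<le> real (Suc k) / real N * T"
      using that by (intro mult_right_mono divide_right_mono) auto
    then have sub: "?A \<subseteq> ?B" by (auto simp: cone_def)
    have "sum ?F ?B = sum ?F (?B - ?A) + sum ?F ?A"
      by (rule sum.subset_diff[OF sub finite_cone1])
    also have "sum ?F (?B - ?A) = sum ?Fk (?B - ?A)"
    proof (rule sum.cong[OF refl], clarify)
      fix a n assume an: "(a, n) \<in> ?B" "(a, n) \<notin> ?A"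
      then have "norm (a + n) < real (Suc k) / real N * T" "\<not> norm (a + n) < real k / real N * T"
        by (auto simp: cone_def mvec_def)
      then have "real N * (norm (a + n) / T) < real (Suc k)" "real k \<le> real N * (norm (a + n) / T)"
        using that N by (auto simp: field_simps)
      then have "\<lfloor>real N * (norm (a + n) / T)\<rfloor> = int k" by linarith
      then have "st (norm (a + n) / T) = real k / real N" by (simp add: st_def)
      then show "\<Psi> (proj_ratio 0 1 1 1 a n) (st (norm (a + n) / T)) * chi c1 c2 a n = \<Psi> (proj_ratio 0 1 1 1 a n) (real k / real N) * chi c1 c2 a n"
        by simp
    qed
    also have "sum ?Fk (?B - ?A) = G k (real (Suc k) / real N * T) - G k (real k / real N * T)"
      unfolding G_def cone_sum_def by (rule sum_diff[OF finite_cone1 sub])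
    finally show ?case using Suc by simp
  qed
  define S where "S T = (\<Sum>i<N. G i (real (Suc i) / real N * T) - G i (real i / real N * T))" for T
  have qS: "qbound S 0" unfolding S_def
  proof (rule qbound_sum0)
    fix i assume "i \<in> {..<N}"
    then show "qbound (\<lambda>T. G i (real (Suc i) / real N * T) - G i (real i / real N * T)) 0"
      using qbound_diff[OF qG[of i "real (Suc i) / real N"] qG[of i "real i / real N"]] by simp
  qed simp
  define R where "R T = (\<Sum>(a, n)\<in>cone1 T. \<Psi> (proj_ratio 0 1 1 1 a n) (norm (a + n) / T) * chi c1 c2 a n)" for T
  have "qbound (\<lambda>T. R T - S T) d"
  proof (rule qboundI)
    fix e :: real assume "e > 0"
    show "\<forall>\<^sub>F T in at_top. norm (R T - S T) \<le> (d + e) * T^2"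
      using card_cone1 eventually_gt_at_top[of 0]
    proof eventually_elim
      case (elim T)
      have "S T = (\<Sum>(a, n)\<in>cone1 T. \<Psi> (proj_ratio 0 1 1 1 a n) (st (norm (a + n) / T)) * chi c1 c2 a n)"
        using step[OF elim(2), of N] N by (simp add: S_def)
      then have "R T - S T = (\<Sum>(a, n)\<in>cone1 T. (\<Psi> (proj_ratio 0 1 1 1 a n) (norm (a + n) / T) - \<Psi> (proj_ratio 0 1 1 1 a n) (st (norm (a + n) / T))) * chi c1 c2 a n)"
        unfolding R_def by (simp add: sum_subtractf[symmetric] case_prod_beta algebra_simps)
      also have "norm \<dots> \<le> (\<Sum>(a, n)\<in>cone1 T. \<epsilon>)"
      proof (rule sum_norm_le, clarify)
        fix a n assume an: "(a, n) \<in> cone1 T"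
        have l: "proj_ratio 0 1 1 1 a n \<in> {0..1}" using proj_ratio_in_cell(2)[OF an, of 0 1] by simp
        define r where "r = norm (a + n) / T"
        have r: "0 \<le> r" "r < 1" using an elim by (auto simp: cone_def mvec_def r_def)
        have "real N * r < real N" using r N by simp
        then have fl: "of_int \<lfloor>real N * r\<rfloor> \<le> real N * r" "real N * r < of_int \<lfloor>real N * r\<rfloor> + 1" "0 \<le> \<lfloor>real N * r\<rfloor>"
          using r by auto
        then have "st r \<le> r" "r < st r + 1 / real N" "0 \<le> st r" using N by (auto simp: st_def field_simps)
        then have "norm (\<Psi> (proj_ratio 0 1 1 1 a n) r - \<Psi> (proj_ratio 0 1 1 1 a n) (st r)) < \<epsilon>"
          using r N(2) by (intro \<delta>' l) auto
        then show "norm ((\<Psi> (proj_ratio 0 1 1 1 a n) (norm (a + n) / T) - \<Psi> (proj_ratio 0 1 1 1 a n) (st (norm (a + n) / T))) * chi c1 c2 a n) \<le> \<epsilon>"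
          by (simp add: norm_mult r_def)
      qed
      also have "\<dots> = \<epsilon> * real (card (cone1 T))" by (simp add: case_prod_beta)
      also have "\<dots> \<le> \<epsilon> * (cone_const * T^2)" using elim \<epsilon> by (intro mult_left_mono) auto
      also have "\<dots> = d * T^2" using cone_const_pos by (simp add: \<epsilon>_def)
      also have "\<dots> \<le> (d + e) * T^2" using \<open>e > 0\<close> by (intro mult_right_mono) auto
      finally show ?case .
    qed
  qed
  from qbound_add[OF this qS] show "qbound (\<lambda>T. \<Sum>(a, n)\<in>cone1 T. \<Psi> (proj_ratio 0 1 1 1 a n) (norm (a + n) / T) * chi c1 c2 a n) (0 + d)"
    by (simp add: R_def)
qed

end

section \<open>Equidistribution of the phases on the torus\<close>

text \<open>The mean over the torus \<open>(\<real> / \<int>)^2\<close>, as an integral over the unit square.\<close>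

definition torus_mean :: "(real \<Rightarrow> real \<Rightarrow> 'a) \<Rightarrow> 'a::banach" where
  "torus_mean P = integral (cbox (0, 0) (1, 1)) (\<lambda>(\<alpha>, \<beta>). P \<alpha> \<beta>)"

text \<open>Trigonometric polynomials in \<open>\<alpha>\<close>, \<open>\<beta>\<close> whose coefficients are continuous in the parameters \<open>x\<close>, \<open>r\<close>, together with their mean over the torus as a function of the parameters.\<close>

inductive trig_poly :: "(real \<Rightarrow> real \<Rightarrow> real \<Rightarrow> real \<Rightarrow> complex) \<Rightarrow> (real \<Rightarrow> real \<Rightarrow> complex) \<Rightarrow> bool" where
  base: "continuous_on ({0..1} \<times> {0..1}) (\<lambda>(x, r). \<Psi> x r) \<Longrightarrow>
    trig_poly (\<lambda>\<alpha> \<beta> x r. \<Psi> x r * cis2pi (of_int c1 * \<alpha> + of_int c2 * \<beta>)) (if c1 = 0 \<and> c2 = 0 then \<Psi> else (\<lambda>_ _. 0))"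
| add: "trig_poly P M \<Longrightarrow> trig_poly Q N \<Longrightarrow> trig_poly (\<lambda>\<alpha> \<beta> x r. P \<alpha> \<beta> x r + Q \<alpha> \<beta> x r) (\<lambda>x r. M x r + N x r)"

lemma continuous_on_cis2pi [continuous_intros]:
  "continuous_on S f \<Longrightarrow> continuous_on S (\<lambda>x. cis2pi (f x))"
  unfolding cis2pi_def by (intro continuous_intros)

lemma cis2pi_integral: "integral {0..1} (\<lambda>x. cis2pi (of_int c * x)) = (if c = 0 then 1 else 0)"
proof (cases "c = 0")
  case False
  define k where "k = 2 * pi * of_int c"
  have k: "k \<noteq> 0" using False by (simp add: k_def)
  have "((\<lambda>x. cis (k * x)) has_integral (cis (k * 1) / (\<i> * of_real k) - cis (k * 0) / (\<i> * of_real k))) {0..1}"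
  proof (rule fundamental_theorem_of_calculus)
    fix x :: real
    have "((\<lambda>x. exp (\<i> * of_real k * of_real x) / (\<i> * of_real k)) has_vector_derivative exp (\<i> * of_real k * of_real x)) (at x within {0..1})"
      using k by (auto intro!: derivative_eq_intros has_vector_derivative_real_field)
    then show "((\<lambda>x. cis (k * x) / (\<i> * of_real k)) has_vector_derivative cis (k * x)) (at x within {0..1})"
      by (simp add: cis_conv_exp mult.assoc)
  qed simp
  moreover have "cis (k * 1) = 1" by (simp add: k_def cis_multiple_2pi)
  ultimately have "((\<lambda>x. cis (k * x)) has_integral 0) {0..1}" by simp
  moreover have "(\<lambda>x. cis (k * x)) = (\<lambda>x. cis2pi (of_int c * x))" by (simp add: k_def cis2pi_def mult.assoc)
  ultimately show ?thesis using False by (simp add: integral_unique)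
qed simp

lemma torus_mean_cont:
  fixes P :: "real \<Rightarrow> real \<Rightarrow> 'a::banach"
  assumes "continuous_on (cbox (0, 0) (1, 1)) (\<lambda>(\<alpha>, \<beta>). P \<alpha> \<beta>)"
  shows "(\<lambda>(\<alpha>, \<beta>). P \<alpha> \<beta>) integrable_on cbox (0, 0) (1, 1)"
  using assms by (rule integrable_continuous)

lemma torus_mean_character:
  "torus_mean (\<lambda>\<alpha> \<beta>. z * cis2pi (of_int c1 * \<alpha> + of_int c2 * \<beta>)) = (if c1 = 0 \<and> c2 = 0 then z else 0)"
proof -
  have "torus_mean (\<lambda>\<alpha> \<beta>. z * cis2pi (of_int c1 * \<alpha> + of_int c2 * \<beta>)) =
    integral (cbox 0 1) (\<lambda>\<alpha>. integral (cbox 0 1) (\<lambda>\<beta>. z * cis2pi (of_int c1 * \<alpha> + of_int c2 * \<beta>)))"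
  proof -
    have "continuous_on (cbox (0, 0) (1, 1)) (\<lambda>(\<alpha>, \<beta>). z * cis2pi (of_int c1 * \<alpha> + of_int c2 * \<beta>))"
      by (auto intro!: continuous_intros simp: case_prod_unfold)
    from integral_prod_continuous[OF this] show ?thesis by (simp add: torus_mean_def)
  qed
  also have "\<dots> = integral {0..1} (\<lambda>\<alpha>. integral {0..1} (\<lambda>\<beta>. (z * cis2pi (of_int c1 * \<alpha>)) * cis2pi (of_int c2 * \<beta>)))"
    by (simp add: cis2pi_add mult.assoc)
  also have "\<dots> = (if c1 = 0 \<and> c2 = 0 then z else 0)"
    by (simp add: cis2pi_integral)
  finally show ?thesis .
qed

lemma trig_poly_mean:
  assumes "trig_poly P M"
  shows "continuous_on UNIV (\<lambda>(\<alpha>, \<beta>). P \<alpha> \<beta> x r) \<and> torus_mean (\<lambda>\<alpha> \<beta>. P \<alpha> \<beta> x r) = M x r"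
  using assms
proof induction
  case (base \<Psi> c1 c2)
  then show ?case by (auto intro!: continuous_intros simp: torus_mean_character case_prod_beta)
next
  case (add P M Q N)
  then have c: "continuous_on UNIV (\<lambda>(\<alpha>, \<beta>). P \<alpha> \<beta> x r)" "continuous_on UNIV (\<lambda>(\<alpha>, \<beta>). Q \<alpha> \<beta> x r)" by auto
  have i: "(\<lambda>(\<alpha>, \<beta>). P \<alpha> \<beta> x r) integrable_on cbox (0, 0) (1, 1)" "(\<lambda>(\<alpha>, \<beta>). Q \<alpha> \<beta> x r) integrable_on cbox (0, 0) (1, 1)"
    by (rule integrable_continuous, rule continuous_on_subset[OF c(1)], simp,
        rule integrable_continuous, rule continuous_on_subset[OF c(2)], simp)
  have "torus_mean (\<lambda>\<alpha> \<beta>. P \<alpha> \<beta> x r + Q \<alpha> \<beta> x r) = torus_mean (\<lambda>\<alpha> \<beta>. P \<alpha> \<beta> x r) + torus_mean (\<lambda>\<alpha> \<beta>. Q \<alpha> \<beta> x r)"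
    unfolding torus_mean_def using integral_add[OF i] by (simp add: case_prod_unfold)
  then show ?case using c add by (auto intro!: continuous_intros simp: case_prod_beta)
qed

lemma trig_poly_mult:
  assumes "trig_poly P M" "trig_poly Q N"
  shows "\<exists>K. trig_poly (\<lambda>\<alpha> \<beta> x r. P \<alpha> \<beta> x r * Q \<alpha> \<beta> x r) K"
  using assms(1)
proof induction
  case (base \<Psi> c1 c2)
  show ?case using assms(2)
  proof induction
    case (base \<Phi> d1 d2)
    have c: "continuous_on ({0..1} \<times> {0..1}) (\<lambda>(x, r). \<Psi> x r * \<Phi> x r)"
      using base \<open>continuous_on ({0..1} \<times> {0..1}) (\<lambda>(x, r). \<Psi> x r)\<close>
      by (auto intro!: continuous_intros simp: case_prod_beta)
    have "(\<lambda>\<alpha> \<beta> x r. \<Psi> x r * cis2pi (of_int c1 * \<alpha> + of_int c2 * \<beta>) * (\<Phi> x r * cis2pi (of_int d1 * \<alpha> + of_int d2 * \<beta>))) =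
      (\<lambda>\<alpha> \<beta> x r. (\<Psi> x r * \<Phi> x r) * cis2pi (of_int (c1 + d1) * \<alpha> + of_int (c2 + d2) * \<beta>))"
      by (intro ext) (simp add: cis2pi_add distrib_right)
    then show ?case using trig_poly.base[OF c, of "c1 + d1" "c2 + d2"] by auto
  next
    case (add P M Q N)
    then obtain K L where "trig_poly (\<lambda>\<alpha> \<beta> x r. \<Psi> x r * cis2pi (of_int c1 * \<alpha> + of_int c2 * \<beta>) * P \<alpha> \<beta> x r) K"
      "trig_poly (\<lambda>\<alpha> \<beta> x r. \<Psi> x r * cis2pi (of_int c1 * \<alpha> + of_int c2 * \<beta>) * Q \<alpha> \<beta> x r) L" by auto
    from trig_poly.add[OF this] show ?case by (auto simp: distrib_left)
  qed
next
  case (add P M R N')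
  then obtain K L where "trig_poly (\<lambda>\<alpha> \<beta> x r. P \<alpha> \<beta> x r * Q \<alpha> \<beta> x r) K" "trig_poly (\<lambda>\<alpha> \<beta> x r. R \<alpha> \<beta> x r * Q \<alpha> \<beta> x r) L" by auto
  from trig_poly.add[OF this] show ?case by (auto simp: distrib_right)
qed

definition is_trig_poly :: "(real \<Rightarrow> real \<Rightarrow> real \<Rightarrow> real \<Rightarrow> complex) \<Rightarrow> bool" where
  "is_trig_poly P \<longleftrightarrow> (\<exists>M. trig_poly P M)"

lemma is_trig_polyI: "trig_poly P M \<Longrightarrow> is_trig_poly P"
  unfolding is_trig_poly_def by (rule exI)

lemma is_trig_poly_add:
  assumes "is_trig_poly P" "is_trig_poly Q"
  shows "is_trig_poly (\<lambda>\<alpha> \<beta> x r. P \<alpha> \<beta> x r + Q \<alpha> \<beta> x r)"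
proof -
  obtain M N where "trig_poly P M" "trig_poly Q N" using assms unfolding is_trig_poly_def by auto
  from trig_poly.add[OF this] show ?thesis by (rule is_trig_polyI)
qed

lemma is_trig_poly_mult:
  assumes "is_trig_poly P" "is_trig_poly Q"
  shows "is_trig_poly (\<lambda>\<alpha> \<beta> x r. P \<alpha> \<beta> x r * Q \<alpha> \<beta> x r)"
proof -
  obtain M N where "trig_poly P M" "trig_poly Q N" using assms unfolding is_trig_poly_def by auto
  from trig_poly_mult[OF this] show ?thesis unfolding is_trig_poly_def .
qed

lemma is_trig_poly_param:
  assumes "continuous_on ({0..1} \<times> {0..1}) (\<lambda>(x, r). \<Psi> x r)"
  shows "is_trig_poly (\<lambda>\<alpha> \<beta> x r. \<Psi> x r)"
proof -
  have "trig_poly (\<lambda>\<alpha> \<beta> x r. \<Psi> x r * cis2pi (of_int 0 * \<alpha> + of_int 0 * \<beta>)) \<Psi>"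
    using trig_poly.base[OF assms, of 0 0] by (simp only: simp_thms if_True)
  then have "trig_poly (\<lambda>\<alpha> \<beta> x r. \<Psi> x r) \<Psi>" by (simp only: of_int_0 mult_zero_left add_0_left cis2pi_0 mult_1_right)
  then show ?thesis by (rule is_trig_polyI)
qed

lemma is_trig_poly_char: "is_trig_poly (\<lambda>\<alpha> \<beta> x r. z * cis2pi (of_int c1 * \<alpha> + of_int c2 * \<beta>))"
proof -
  have "continuous_on ({0..1} \<times> {0..1}) (\<lambda>(x::real, r::real). z)" by (simp add: case_prod_unfold)
  from trig_poly.base[OF this, of c1 c2] show ?thesis by (rule is_trig_polyI)
qed

lemma is_trig_poly_const: "is_trig_poly (\<lambda>\<alpha> \<beta> x r. z)"
  by (rule is_trig_poly_param) (simp add: case_prod_unfold)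

text \<open>Polynomials on \<open>torus4\<close> are dense by Stone-Weierstrass, and each is a trigonometric polynomial.\<close>

lemma is_trig_poly_real_polynomial:
  assumes "real_polynomial_function p"
  shows "is_trig_poly (\<lambda>\<alpha> \<beta> x r. complex_of_real (p (cis2pi \<alpha>, cis2pi \<beta>, x, r)))"
  using assms
proof induction
  case (linear f)
  interpret bounded_linear f by fact
  have re: "complex_of_real (Re (cis2pi t)) = (1/2) * cis2pi (of_int 1 * t + of_int 0 * s) + (1/2) * cis2pi (of_int (-1) * t + of_int 0 * s)"
    and re': "complex_of_real (Re (cis2pi t)) = (1/2) * cis2pi (of_int 0 * s + of_int 1 * t) + (1/2) * cis2pi (of_int 0 * s + of_int (-1) * t)"
    and im: "complex_of_real (Im (cis2pi t)) = (-\<i>/2) * cis2pi (of_int 1 * t + of_int 0 * s) + (\<i>/2) * cis2pi (of_int (-1) * t + of_int 0 * s)"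
    and im': "complex_of_real (Im (cis2pi t)) = (-\<i>/2) * cis2pi (of_int 0 * s + of_int 1 * t) + (\<i>/2) * cis2pi (of_int 0 * s + of_int (-1) * t)" for t s
    by (simp_all add: cis2pi_def complex_eq_iff)
  have expand: "f (z1, z2, x, r) = Re z1 * f (1, 0, 0, 0) + Im z1 * f (\<i>, 0, 0, 0) + (Re z2 * f (0, 1, 0, 0) + Im z2 * f (0, \<i>, 0, 0))
     + (x * f (0, 0, 1, 0) + r * f (0, 0, 0, 1))" for z1 z2 x r
  proof -
    have "(z1, z2, x, r) = Re z1 *\<^sub>R (1, 0, 0, 0) + Im z1 *\<^sub>R (\<i>, 0, 0, 0) + (Re z2 *\<^sub>R (0, 1, 0, 0) + Im z2 *\<^sub>R (0, \<i>, 0, 0))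
     + (x *\<^sub>R (0, 0, 1, 0) + r *\<^sub>R (0, 0, 0, 1))"
      by (simp add: complex_eq_iff)
    then have "f (z1, z2, x, r) = f (Re z1 *\<^sub>R (1, 0, 0, 0) + Im z1 *\<^sub>R (\<i>, 0, 0, 0) + (Re z2 *\<^sub>R (0, 1, 0, 0) + Im z2 *\<^sub>R (0, \<i>, 0, 0))
     + (x *\<^sub>R (0, 0, 1, 0) + r *\<^sub>R (0, 0, 0, 1)))" by (rule arg_cong)
    then show ?thesis by (simp only: add scaleR real_scaleR_def)
  qed
  have tr: "is_trig_poly P" if "\<And>\<alpha> \<beta> x r. P \<alpha> \<beta> x r = z * cis2pi (of_int c1 * \<alpha> + of_int c2 * \<beta>) + z' * cis2pi (of_int d1 * \<alpha> + of_int d2 * \<beta>)"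
    for P z z' c1 c2 d1 d2
    unfolding that by (intro is_trig_poly_add is_trig_poly_char)
  have 1: "is_trig_poly (\<lambda>\<alpha> \<beta> x r. complex_of_real (Re (cis2pi \<alpha>)))" "is_trig_poly (\<lambda>\<alpha> \<beta> x r. complex_of_real (Im (cis2pi \<alpha>)))"
    by (rule tr, rule re, rule tr, rule im)
  have 2: "is_trig_poly (\<lambda>\<alpha> \<beta> x r. complex_of_real (Re (cis2pi \<beta>)))" "is_trig_poly (\<lambda>\<alpha> \<beta> x r. complex_of_real (Im (cis2pi \<beta>)))"
    by (rule tr, rule re', rule tr, rule im')
  have 3: "is_trig_poly (\<lambda>\<alpha> \<beta> x r. complex_of_real x)"
    by (rule is_trig_poly_param[where \<Psi> = "\<lambda>x r. complex_of_real x"]) (auto intro!: continuous_intros simp: case_prod_beta)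
  have 4: "is_trig_poly (\<lambda>\<alpha> \<beta> x r. complex_of_real r)"
    by (rule is_trig_poly_param[where \<Psi> = "\<lambda>x r. complex_of_real r"]) (auto intro!: continuous_intros simp: case_prod_beta)
  define e where "e i = complex_of_real (f ([(1, 0, 0, 0), (\<i>, 0, 0, 0), (0, 1, 0, 0), (0, \<i>, 0, 0), (0, 0, 1, 0), (0, 0, 0, 1)] ! i))" for i
  have eq: "complex_of_real (f (cis2pi \<alpha>, cis2pi \<beta>, x, r)) =
      complex_of_real (Re (cis2pi \<alpha>)) * e 0 + complex_of_real (Im (cis2pi \<alpha>)) * e 1 +
      (complex_of_real (Re (cis2pi \<beta>)) * e 2 + complex_of_real (Im (cis2pi \<beta>)) * e 3) +
      (complex_of_real x * e 4 + complex_of_real r * e 5)" for \<alpha> \<beta> x r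
    by (subst expand) (simp add: e_def)
  show ?case
    unfolding eq by (intro is_trig_poly_add is_trig_poly_mult 1 2 3 4 is_trig_poly_const)
next
  case (const c)
  show ?case by (rule is_trig_poly_const)
next
  case (add f g)
  then show ?case unfolding of_real_add by (intro is_trig_poly_add)
next
  case (mult f g)
  then show ?case unfolding of_real_mult by (intro is_trig_poly_mult)
qed

text \<open>The torus is embedded in \<open>\<complex>^2\<close>, so that approximation by polynomials applies to periodic functions.\<close>

definition torus4 :: "(complex \<times> complex \<times> real \<times> real) set" where
  "torus4 = sphere 0 1 \<times> sphere 0 1 \<times> {0..1} \<times> {0..1}"

lemma compact_torus4: "compact torus4"
  unfolding torus4_def by (intro compact_Times) auto

lemma cis2pi_in_torus: "x \<in> {0..1} \<Longrightarrow> r \<in> {0..1} \<Longrightarrow> (cis2pi \<alpha>, cis2pi \<beta>, x, r) \<in> torus4"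
  by (simp add: torus4_def)

lemma torus_mean_diff_le:
  fixes P Q :: "real \<Rightarrow> real \<Rightarrow> 'a::banach"
  assumes "continuous_on (cbox (0, 0) (1, 1)) (\<lambda>(\<alpha>, \<beta>). P \<alpha> \<beta>)" "continuous_on (cbox (0, 0) (1, 1)) (\<lambda>(\<alpha>, \<beta>). Q \<alpha> \<beta>)"
    and "\<And>\<alpha> \<beta>. norm (P \<alpha> \<beta> - Q \<alpha> \<beta>) \<le> \<epsilon>" "\<epsilon> \<ge> 0"
  shows "norm (torus_mean P - torus_mean Q) \<le> \<epsilon>"
proof -
  have "torus_mean P - torus_mean Q = integral (cbox (0, 0) (1, 1)) (\<lambda>p. (\<lambda>(\<alpha>, \<beta>). P \<alpha> \<beta>) p - (\<lambda>(\<alpha>, \<beta>). Q \<alpha> \<beta>) p)"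
    unfolding torus_mean_def by (rule integral_diff[OF torus_mean_cont[OF assms(1)] torus_mean_cont[OF assms(2)], symmetric])
  also have "norm \<dots> \<le> \<epsilon> * measure lborel (cbox (0, 0) (1, 1) :: (real \<times> real) set)"
  proof (rule integrable_bound)
    show "(\<lambda>p. (\<lambda>(\<alpha>, \<beta>). P \<alpha> \<beta>) p - (\<lambda>(\<alpha>, \<beta>). Q \<alpha> \<beta>) p) integrable_on cbox (0, 0) (1, 1)"
      by (rule integrable_diff[OF torus_mean_cont[OF assms(1)] torus_mean_cont[OF assms(2)]])
  qed (use assms in auto)
  also have "measure lborel (cbox (0, 0) (1, 1) :: (real \<times> real) set) = 1"
    by (simp add: content_Pair)
  finally show ?thesis by simp
qed

context shifted_lattice
begin

text \<open>The phases of the affine lattice relative to the basis \<open>(n, a + n)\<close>: \<open>\<zeta> = phase1 * n + phase2 * (a + n)\<close>.\<close>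

definition phase1 :: "complex \<Rightarrow> complex \<Rightarrow> real" where "phase1 a n = wd \<zeta> (a + n)"
definition phase2 :: "complex \<Rightarrow> complex \<Rightarrow> real" where "phase2 a n = wd n \<zeta>"
text \<open>The component of \<open>n\<close> along \<open>a + n\<close>.\<close>

definition shear :: "complex \<Rightarrow> complex \<Rightarrow> real" where "shear a n = proj_ratio 0 1 1 1 a n"

lemma shear_eq: "shear a n = ip n (a + n) / (norm (a + n))^2"
  by (simp add: shear_def proj_ratio_def mvec_def)

lemma shear_in: "(a, n) \<in> cone1 T \<Longrightarrow> shear a n \<in> {0..1}"
  unfolding shear_def using proj_ratio_in_cell(2)[of a n 1 1 1 T 0 1] by simp

lemma rho_in: "(a, n) \<in> cone1 T \<Longrightarrow> norm (a + n) / T \<in> {0..1}"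
  using cone_mvec(3,4)[of a n 1 1 1 T] by (simp add: mvec_def)

lemma trig_poly_equidistribution:
  assumes "trig_poly P M"
  shows "qbound (\<lambda>T. \<Sum>(a, n)\<in>cone1 T. P (phase1 a n) (phase2 a n) (shear a n) (norm (a + n) / T) - M (shear a n) (norm (a + n) / T)) 0"
  using assms
proof induction
  case (base \<Psi> c1 c2)
  show ?case
  proof (cases "c1 = 0 \<and> c2 = 0")
    case True
    then show ?thesis by (simp add: case_prod_beta)
  next
    case False
    have eq: "cis2pi (of_int c1 * phase1 a n + of_int c2 * phase2 a n) = chi c1 (c1 - c2) a n" for a n
    proof -
      have "wd n \<zeta> = - wd \<zeta> n" by (rule wd_swap)
      then have "of_int c1 * phase1 a n + of_int c2 * phase2 a n = wd \<zeta> (of_int c1 * a + of_int (c1 - c2) * n)"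
        unfolding wd_add_right wd_of_int_right phase1_def phase2_def by (simp add: algebra_simps)
      then show ?thesis by (simp add: chi_def)
    qed
    have "c1 \<noteq> 0 \<or> c1 - c2 \<noteq> 0" using False by auto
    from radial_character_sum[OF base this] show ?thesis
      by (simp only: if_not_P[OF False] eq shear_def diff_zero)
  qed
next
  case (add P M Q N)
  have "(\<lambda>T. \<Sum>(a, n)\<in>cone1 T. P (phase1 a n) (phase2 a n) (shear a n) (norm (a + n) / T) + Q (phase1 a n) (phase2 a n) (shear a n) (norm (a + n) / T)
     - (M (shear a n) (norm (a + n) / T) + N (shear a n) (norm (a + n) / T))) =
     (\<lambda>T. (\<Sum>(a, n)\<in>cone1 T. P (phase1 a n) (phase2 a n) (shear a n) (norm (a + n) / T) - M (shear a n) (norm (a + n) / T)) +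
          (\<Sum>(a, n)\<in>cone1 T. Q (phase1 a n) (phase2 a n) (shear a n) (norm (a + n) / T) - N (shear a n) (norm (a + n) / T)))"
  proof
    fix T
    show "(\<Sum>(a, n)\<in>cone1 T. P (phase1 a n) (phase2 a n) (shear a n) (norm (a + n) / T) + Q (phase1 a n) (phase2 a n) (shear a n) (norm (a + n) / T)
     - (M (shear a n) (norm (a + n) / T) + N (shear a n) (norm (a + n) / T))) =
     ((\<Sum>(a, n)\<in>cone1 T. P (phase1 a n) (phase2 a n) (shear a n) (norm (a + n) / T) - M (shear a n) (norm (a + n) / T)) +
          (\<Sum>(a, n)\<in>cone1 T. Q (phase1 a n) (phase2 a n) (shear a n) (norm (a + n) / T) - N (shear a n) (norm (a + n) / T)))"
      unfolding sum.distrib[symmetric] by (rule sum.cong) auto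
  qed
  then show ?case using qbound_add[OF add.IH] by (simp only: add_0)
qed

theorem torus_equidistribution:
  fixes g :: "complex \<times> complex \<times> real \<times> real \<Rightarrow> real"
  assumes g: "continuous_on torus4 g"
  shows "qbound (\<lambda>T. \<Sum>(a, n)\<in>cone1 T. complex_of_real (g (cis2pi (phase1 a n), cis2pi (phase2 a n), shear a n, norm (a + n) / T))
      - torus_mean (\<lambda>\<alpha> \<beta>. complex_of_real (g (cis2pi \<alpha>, cis2pi \<beta>, shear a n, norm (a + n) / T)))) 0"
proof (rule qbound_limit)
  fix d :: real assume d: "d > 0"
  define \<epsilon> where "\<epsilon> = d / (2 * cone_const)"
  have \<epsilon>: "\<epsilon> > 0" using d cone_const_pos by (simp add: \<epsilon>_def)
  obtain p where p: "real_polynomial_function p" and close: "\<And>x. x \<in> torus4 \<Longrightarrow> \<bar>g x - p x\<bar> < \<epsilon>"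
    using Stone_Weierstrass_real_polynomial_function[OF compact_torus4 g \<epsilon>] by blast
  define P where "P \<alpha> \<beta> x r = complex_of_real (p (cis2pi \<alpha>, cis2pi \<beta>, x, r))" for \<alpha> \<beta> x r
  define G where "G \<alpha> \<beta> x r = complex_of_real (g (cis2pi \<alpha>, cis2pi \<beta>, x, r))" for \<alpha> \<beta> x r
  obtain M where M: "trig_poly P M" using is_trig_poly_real_polynomial[OF p] unfolding is_trig_poly_def P_def by blast
  have PG: "norm (G \<alpha> \<beta> x r - P \<alpha> \<beta> x r) \<le> \<epsilon>" if "x \<in> {0..1}" "r \<in> {0..1}" for \<alpha> \<beta> x r
    using close[OF cis2pi_in_torus[OF that, of \<alpha> \<beta>]]
    unfolding G_def P_def of_real_diff[symmetric] norm_of_real by simp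
  have mean: "norm (torus_mean (\<lambda>\<alpha> \<beta>. G \<alpha> \<beta> x r) - M x r) \<le> \<epsilon>" if h: "x \<in> {0..1}" "r \<in> {0..1}" for x r
  proof -
    have "norm (torus_mean (\<lambda>\<alpha> \<beta>. G \<alpha> \<beta> x r) - torus_mean (\<lambda>\<alpha> \<beta>. P \<alpha> \<beta> x r)) \<le> \<epsilon>"
    proof (rule torus_mean_diff_le)
      have "continuous_on (cbox (0, 0) (1, 1)) (\<lambda>q. g ((\<lambda>(\<alpha>, \<beta>). (cis2pi \<alpha>, cis2pi \<beta>, x, r)) q))"
        by (rule continuous_on_compose2[OF g]) (use h cis2pi_in_torus in \<open>auto intro!: continuous_intros simp: case_prod_beta\<close>)
      then show "continuous_on (cbox (0, 0) (1, 1)) (\<lambda>(\<alpha>, \<beta>). G \<alpha> \<beta> x r)"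
        unfolding G_def by (auto intro!: continuous_intros simp: case_prod_beta)
      show "continuous_on (cbox (0, 0) (1, 1)) (\<lambda>(\<alpha>, \<beta>). P \<alpha> \<beta> x r)"
        using trig_poly_mean[OF M, of x r] by (auto intro: continuous_on_subset)
    qed (use PG h \<epsilon> in auto)
    then show ?thesis using trig_poly_mean[OF M, of x r] by simp
  qed
  define E where "E T = (\<Sum>(a, n)\<in>cone1 T. P (phase1 a n) (phase2 a n) (shear a n) (norm (a + n) / T) - M (shear a n) (norm (a + n) / T))" for T
  define F where "F T = (\<Sum>(a, n)\<in>cone1 T. G (phase1 a n) (phase2 a n) (shear a n) (norm (a + n) / T) - torus_mean (\<lambda>\<alpha> \<beta>. G \<alpha> \<beta> (shear a n) (norm (a + n) / T)))" for T
  have E: "qbound E 0" unfolding E_def by (rule trig_poly_equidistribution[OF M])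
  have "qbound (\<lambda>T. F T - E T) d"
  proof (rule qboundI)
    fix e :: real assume "e > 0"
    show "\<forall>\<^sub>F T in at_top. norm (F T - E T) \<le> (d + e) * T^2"
      using card_cone1
    proof eventually_elim
      case (elim T)
      have eq: "F T - E T = (\<Sum>(a, n)\<in>cone1 T. (G (phase1 a n) (phase2 a n) (shear a n) (norm (a + n) / T) - P (phase1 a n) (phase2 a n) (shear a n) (norm (a + n) / T))
         - (torus_mean (\<lambda>\<alpha> \<beta>. G \<alpha> \<beta> (shear a n) (norm (a + n) / T)) - M (shear a n) (norm (a + n) / T)))"
        unfolding F_def E_def sum_subtractf[symmetric] by (rule sum.cong) auto
      have "norm (F T - E T) \<le> (\<Sum>x\<in>cone1 T. \<epsilon> + \<epsilon>)"
        unfolding eq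
      proof (rule sum_norm_le, clarify)
        fix a n assume an: "(a, n) \<in> cone1 T"
        show "norm (G (phase1 a n) (phase2 a n) (shear a n) (norm (a + n) / T) - P (phase1 a n) (phase2 a n) (shear a n) (norm (a + n) / T)
         - (torus_mean (\<lambda>\<alpha> \<beta>. G \<alpha> \<beta> (shear a n) (norm (a + n) / T)) - M (shear a n) (norm (a + n) / T))) \<le> \<epsilon> + \<epsilon>"
          by (rule order_trans[OF norm_triangle_ineq4], rule add_mono)
             (use PG mean shear_in[OF an] rho_in[OF an] in auto)
      qed
      also have "\<dots> = 2 * \<epsilon> * real (card (cone1 T))" unfolding sum_constant mult_2 by (rule mult.commute)
      also have "\<dots> \<le> 2 * \<epsilon> * (cone_const * T^2)" by (rule mult_left_mono[OF elim]) (use \<epsilon> in simp)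
      also have "\<dots> = d * T^2"
      proof -
        have "2 * \<epsilon> * cone_const = d" using cone_const_pos by (simp add: \<epsilon>_def)
        then show ?thesis by (simp only: mult.assoc[symmetric])
      qed
      also have "\<dots> \<le> (d + e) * T^2" using \<open>e > 0\<close> by (intro mult_right_mono) auto
      finally show ?case .
    qed
  qed
  from qbound_add[OF this E] show "qbound (\<lambda>T. \<Sum>(a, n)\<in>cone1 T. complex_of_real (g (cis2pi (phase1 a n), cis2pi (phase2 a n), shear a n, norm (a + n) / T))
      - torus_mean (\<lambda>\<alpha> \<beta>. complex_of_real (g (cis2pi \<alpha>, cis2pi \<beta>, shear a n, norm (a + n) / T)))) (0 + d)"
    unfolding F_def G_def by (simp only: diff_add_cancel add.commute[of 0] add_0_right)
qed

end

section \<open>Equidistribution of affine lattice points in strips\<close>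

lemma integral_vanishing_outside:
  fixes h :: "real \<Rightarrow> real"
  assumes "continuous_on UNIV h" "\<And>x. \<bar>x\<bar> > B \<Longrightarrow> h x = 0" "p \<le> - B" "B \<le> q"
  shows "integral {p..q} h = integral {-B..B} h"
proof (rule integral_unique)
  have "h integrable_on {-B..B}" by (rule integrable_continuous_real) (rule continuous_on_subset[OF assms(1)], simp)
  then have "(h has_integral integral {-B..B} h) {-B..B}" by (rule integrable_integral)
  then show "(h has_integral integral {-B..B} h) {p..q}"
  proof (rule has_integral_on_superset)
    fix x assume "x \<notin> {-B..B}"
    then show "h x = 0" by (intro assms(2)) auto
  qed (use assms in auto)
qed

lemma integral_unit_shift:
  fixes h :: "real \<Rightarrow> real"
  shows "integral {0..1} (\<lambda>x. h (c + x)) = integral {c..c + 1} h"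
  using integral_shift_Icc_real[of 0 1 h c] by (simp add: o_def add.commute)

lemma periodize_integral:
  fixes h :: "real \<Rightarrow> real"
  assumes h: "continuous_on UNIV h"
  shows "(\<Sum>t = - int D..int D. integral {0..1} (\<lambda>x. h (of_int t + x + s))) = integral {- real D + s..real D + 1 + s} h"
proof -
  have I: "integral {0..1} (\<lambda>x. h (of_int t + x + s)) = integral {of_int t + s..of_int t + s + 1} h" for t :: int
    using integral_unit_shift[of h "of_int t + s"] by (simp add: add_ac)
  have int: "h integrable_on {p..q}" for p q
    by (rule integrable_continuous_real) (rule continuous_on_subset[OF h], simp)
  have comb: "integral {p..q} h + integral {q..r} h = integral {p..r} h" if "p \<le> q" "q \<le> r" for p q r
    by (rule Henstock_Kurzweil_Integration.integral_combine[OF that int])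
  show ?thesis unfolding I
  proof (induction D)
    case 0 then show ?case by (simp add: add_ac)
  next
    case (Suc D)
    have "{- int (Suc D)..int (Suc D)} = insert (- int (Suc D)) (insert (int (Suc D)) {- int D..int D})" by auto
    then have "(\<Sum>t = - int (Suc D)..int (Suc D). integral {of_int t + s..of_int t + s + 1} h) =
      integral {- real (Suc D) + s..- real (Suc D) + s + 1} h + (integral {real (Suc D) + s..real (Suc D) + s + 1} h +
        integral {- real D + s..real D + 1 + s} h)"
      using Suc by simp
    also have "\<dots> = integral {- real (Suc D) + s..- real D + s} h + integral {- real D + s..real D + 1 + s} h
        + integral {real D + 1 + s..real (Suc D) + 1 + s} h"
      by (simp add: add_ac)
    also have "\<dots> = integral {- real (Suc D) + s..real (Suc D) + 1 + s} h"
      by (subst comb, simp, simp, subst comb) auto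
    finally show ?case .
  qed
qed

lemma sum_int_shift:
  fixes \<phi> :: "int \<Rightarrow> real"
  assumes "\<phi> (- D) = 0" "\<phi> (D + 1) = 0" "D \<ge> 0"
  shows "(\<Sum>j = - D..D. \<phi> (j + 1)) = (\<Sum>j = - D..D. \<phi> j)"
proof -
  have "(\<Sum>j = - D..D. \<phi> (j + 1)) = (\<Sum>j = - D + 1..D + 1. \<phi> j)"
    by (rule sum.reindex_bij_witness[of _ "\<lambda>j. j - 1" "\<lambda>j. j + 1"]) auto
  also have "\<dots> = (\<Sum>j\<in>insert (- D) {- D + 1..D + 1}. \<phi> j)"
    using assms by simp
  also have "insert (- D) {- D + 1..D + 1} = insert (D + 1) {- D..D}" using assms by auto
  also have "(\<Sum>j\<in>insert (D + 1) {- D..D}. \<phi> j) = (\<Sum>j = - D..D. \<phi> j)"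
    using assms by simp
  finally show ?thesis .
qed

lemma cis2pi_frac: "cis2pi (frac x) = cis2pi x"
proof -
  have "cis2pi x = cis2pi (frac x + of_int \<lfloor>x\<rfloor>)" by (simp add: frac_def)
  then show ?thesis by (simp add: cis2pi_add)
qed

lemma Arg2pi_cis2pi: "0 \<le> t \<Longrightarrow> t < 1 \<Longrightarrow> Arg2pi (cis2pi t) / (2 * pi) = t"
proof -
  assume "0 \<le> t" "t < 1"
  then have "Arg2pi (cis2pi t) = 2 * pi * t"
    by (intro Arg2pi_unique[of 1]) (auto simp: cis2pi_def cis_conv_exp)
  then show ?thesis by simp
qed

locale test_function =
  fixes H :: "real \<Rightarrow> real \<Rightarrow> real \<Rightarrow> real" and B :: real
  assumes H_cont: "continuous_on UNIV (\<lambda>(w, t, r). H w t r)"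
    and H_supp: "\<And>w t r. \<bar>w\<bar> > B \<or> \<bar>t\<bar> > B \<Longrightarrow> H w t r = 0"
    and B_pos: "B > 0"
begin

definition D :: int where "D = \<lceil>2 * B + 2\<rceil>"

lemma D_ge: "of_int D \<ge> 2 * B + 2" "D \<ge> 0"
proof -
  show "of_int D \<ge> 2 * B + 2" by (simp add: D_def)
  then show "D \<ge> 0" using B_pos by linarith
qed

text \<open>The sum of \<open>H\<close> over the points of a translated lattice, as a function of the phases \<open>\<alpha>\<close>, \<open>\<beta>\<close> and of the shear \<open>x\<close>. The range \<open>-D..D\<close> contains the support for phases in the unit interval.\<close>

definition periodized :: "real \<Rightarrow> real \<Rightarrow> real \<Rightarrow> real \<Rightarrow> real" where
  "periodized \<alpha> \<beta> x r = (\<Sum>j = - D..D. \<Sum>t = - D..D. H (of_int j + \<alpha>) (of_int t + \<beta> + x * (of_int j + \<alpha>)) r)"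

lemma H_cont_comp:
  assumes "continuous_on S f" "continuous_on S g" "continuous_on S k"
  shows "continuous_on S (\<lambda>p. H (f p) (g p) (k p))"
proof -
  have "continuous_on S (\<lambda>p. (f p, g p, k p))" by (intro continuous_on_Pair assms)
  from continuous_on_compose2[OF H_cont this] show ?thesis by simp
qed

lemma periodized_cont: "continuous_on S (\<lambda>(\<alpha>, \<beta>, x, r). periodized \<alpha> \<beta> x r)"
  unfolding periodized_def case_prod_unfold
  by (intro continuous_intros H_cont_comp)

lemma shift_small: "\<bar>x * w\<bar> \<le> B" if "x \<in> {0..1}" "\<bar>w\<bar> \<le> B" for x w
proof -
  have "\<bar>x * w\<bar> = \<bar>x\<bar> * \<bar>w\<bar>" by (simp add: abs_mult)
  also have "\<dots> \<le> 1 * B" using that by (intro mult_mono) auto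
  finally show ?thesis by simp
qed

lemma periodized_wrap_left: "periodized 1 \<beta> x r = periodized 0 \<beta> x r"
proof -
  define \<phi> where "\<phi> j = (\<Sum>t = - D..D. H (of_int j) (of_int t + \<beta> + x * of_int j) r)" for j :: int
  have "\<phi> (- D) = 0" "\<phi> (D + 1) = 0"
    unfolding \<phi>_def using D_ge B_pos by (auto intro!: sum.neutral H_supp)
  from sum_int_shift[OF this D_ge(2)] show ?thesis
    unfolding periodized_def \<phi>_def by simp
qed

lemma periodized_wrap_right:
  assumes "x \<in> {0..1}"
  shows "periodized \<alpha> 1 x r = periodized \<alpha> 0 x r"
  unfolding periodized_def
proof (rule sum.cong[OF refl])
  fix j
  define \<psi> where "\<psi> t = H (of_int j + \<alpha>) (of_int t + x * (of_int j + \<alpha>)) r" for t :: int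
  have z: "\<psi> t = 0" if "t = - D \<or> t = D + 1" for t
  proof (cases "\<bar>of_int j + \<alpha>\<bar> \<le> B")
    case True
    have "\<bar>x * (of_int j + \<alpha>)\<bar> \<le> B" using shift_small[OF assms True] .
    moreover have "real_of_int t = - of_int D \<or> real_of_int t = of_int D + 1" using that by auto
    ultimately have "\<bar>of_int t + x * (of_int j + \<alpha>)\<bar> > B" using D_ge B_pos by linarith
    then show ?thesis unfolding \<psi>_def by (intro H_supp) auto
  qed (auto simp: \<psi>_def intro!: H_supp)
  have "(\<Sum>t = - D..D. \<psi> (t + 1)) = (\<Sum>t = - D..D. \<psi> t)"
    by (rule sum_int_shift) (use z D_ge in auto)
  then show "(\<Sum>t = - D..D. H (of_int j + \<alpha>) (of_int t + 1 + x * (of_int j + \<alpha>)) r) =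
    (\<Sum>t = - D..D. H (of_int j + \<alpha>) (of_int t + 0 + x * (of_int j + \<alpha>)) r)"
    by (simp add: \<psi>_def)
qed

text \<open>Composition with \<open>Arg2pi\<close>, which jumps at 1, is continuous here since \<open>periodized\<close> takes equal values at opposite sides of the unit square.\<close>

definition on_torus :: "complex \<times> complex \<times> real \<times> real \<Rightarrow> real" where
  "on_torus = (\<lambda>(z1, z2, x, r). periodized (Arg2pi z1 / (2 * pi)) (Arg2pi z2 / (2 * pi)) x r)"

lemma cis2pi_1: "cis2pi 1 = cis2pi 0"
  using cis2pi_of_int[of 1] by simp

lemma on_torus_cis2pi:
  assumes "\<alpha> \<in> {0..1}" "\<beta> \<in> {0..1}" "x \<in> {0..1}"
  shows "on_torus (cis2pi \<alpha>, cis2pi \<beta>, x, r) = periodized \<alpha> \<beta> x r"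
proof -
  have 1: "periodized (Arg2pi (cis2pi \<alpha>) / (2 * pi)) b x r = periodized \<alpha> b x r" for b
  proof (cases "\<alpha> = 1")
    case True
    then show ?thesis using Arg2pi_cis2pi[of 0] by (simp add: cis2pi_1 periodized_wrap_left del: cis2pi_0)
  next
    case False
    then show ?thesis using Arg2pi_cis2pi[of \<alpha>] assms by simp
  qed
  have 2: "periodized a (Arg2pi (cis2pi \<beta>) / (2 * pi)) x r = periodized a \<beta> x r" for a
  proof (cases "\<beta> = 1")
    case True
    then show ?thesis using Arg2pi_cis2pi[of 0] assms by (simp add: cis2pi_1 periodized_wrap_right del: cis2pi_0)
  next
    case False
    then show ?thesis using Arg2pi_cis2pi[of \<beta>] assms by simp
  qed
  show ?thesis by (simp only: on_torus_def case_prod_conv 1 2)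
qed

lemma on_torus_cont: "continuous_on torus4 on_torus"
proof -
  define K :: "(real \<times> real \<times> real \<times> real) set" where "K = {0..1} \<times> {0..1} \<times> {0..1} \<times> {0..1}"
  define q where "q = (\<lambda>(\<alpha>::real, \<beta>::real, x::real, r::real). (cis2pi \<alpha>, cis2pi \<beta>, x, r))"
  have K: "compact K" unfolding K_def by (intro compact_Times) auto
  have qc: "continuous_on K q" unfolding q_def case_prod_unfold by (intro continuous_intros)
  have circ: "\<exists>t\<in>{0..1}. z = cis2pi t" if "norm z = 1" for z
  proof (rule bexI[of _ "Arg2pi z / (2 * pi)"])
    show "Arg2pi z / (2 * pi) \<in> {0..1}" using Arg2pi[of z] by (simp add: field_simps)
    have "z = of_real (norm z) * exp (\<i> * of_real (Arg2pi z))" using Arg2pi_eq[of z] by metis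
    then show "z = cis2pi (Arg2pi z / (2 * pi))" using that by (simp add: cis2pi_def cis_conv_exp)
  qed
  have qim: "q ` K = torus4"
  proof (intro equalityI subsetI)
    fix p assume "p \<in> torus4"
    then obtain z1 z2 x r where p: "p = (z1, z2, x, r)" "norm z1 = 1" "norm z2 = 1" "x \<in> {0..1}" "r \<in> {0..1}"
      by (auto simp: torus4_def)
    obtain s t where st: "s \<in> {0..1}" "t \<in> {0..1}" "z1 = cis2pi s" "z2 = cis2pi t" using circ[OF p(2)] circ[OF p(3)] by auto
    show "p \<in> q ` K"
      by (rule image_eqI[of _ _ "(s, t, x, r)"]) (use p st in \<open>auto simp: q_def K_def\<close>)
  qed (auto simp: q_def K_def torus4_def)
  have comp: "continuous_on K (on_torus \<circ> q)"
  proof -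
    have "continuous_on K (\<lambda>(\<alpha>, \<beta>, x, r). periodized \<alpha> \<beta> x r)" by (rule periodized_cont)
    moreover have "(on_torus \<circ> q) p = (case p of (\<alpha>, \<beta>, x, r) \<Rightarrow> periodized \<alpha> \<beta> x r)" if "p \<in> K" for p
      using that by (auto simp: K_def q_def on_torus_cis2pi)
    ultimately show ?thesis using continuous_on_cong by metis
  qed
  show ?thesis
    unfolding continuous_on_closed_invariant
  proof (intro allI impI)
    fix C :: "real set" assume C: "closed C"
    have "closedin (top_of_set K) (K \<inter> (on_torus \<circ> q) -` C)"
      using comp C by (simp add: continuous_closedin_preimage)
    then have "compact (K \<inter> (on_torus \<circ> q) -` C)" using K closedin_compact by blast
    then have "compact (q ` (K \<inter> (on_torus \<circ> q) -` C))"
      by (rule compact_continuous_image[rotated]) (rule continuous_on_subset[OF qc], auto)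
    moreover have "q ` (K \<inter> (on_torus \<circ> q) -` C) = on_torus -` C \<inter> torus4"
      unfolding qim[symmetric] by auto
    ultimately have "closed (on_torus -` C \<inter> torus4)" by (simp add: compact_imp_closed)
    then show "\<exists>A. closed A \<and> A \<inter> torus4 = on_torus -` C \<inter> torus4"
      by (intro exI[of _ "on_torus -` C \<inter> torus4"]) auto
  qed
qed

definition mean :: "real \<Rightarrow> real" where
  "mean r = integral {-B..B} (\<lambda>w. integral {-B..B} (\<lambda>t. H w t r))"

text \<open>Unfolding: integrating the periodization over the unit square integrates \<open>H\<close> over the plane, and the shear preserves area.\<close>

lemma torus_mean_periodized:
  assumes x: "x \<in> {0..1}"
  shows "torus_mean (\<lambda>\<alpha> \<beta>. periodized \<alpha> \<beta> x r) = mean r"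
proof -
  define K where "K w = integral {-B..B} (\<lambda>t. H w t r)" for w
  define N where "N = nat D"
  have N: "int N = D" "real N = of_int D" using D_ge(2) by (auto simp: N_def)
  have Kc: "continuous_on UNIV K"
    unfolding K_def interval_cbox
    by (rule integral_continuous_on_param) (auto simp: case_prod_unfold intro!: H_cont_comp continuous_intros)
  have K0: "K w = 0" if "\<bar>w\<bar> > B" for w unfolding K_def using that H_supp by simp
  have cH: "continuous_on UNIV (\<lambda>t. H w t r)" for w by (intro H_cont_comp continuous_intros)
  have inner: "(\<Sum>t = - D..D. integral {0..1} (\<lambda>\<beta>. H w (of_int t + \<beta> + x * w) r)) = K w" for w
  proof (cases "\<bar>w\<bar> \<le> B")
    case True
    have s: "\<bar>x * w\<bar> \<le> B" by (rule shift_small[OF x True])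
    have "(\<Sum>t = - D..D. integral {0..1} (\<lambda>\<beta>. H w (of_int t + \<beta> + x * w) r)) =
       integral {- real N + x * w..real N + 1 + x * w} (\<lambda>t. H w t r)"
      using periodize_integral[OF cH[of w], where D = N and s = "x * w"] by (simp add: N)
    also have "\<dots> = K w"
      unfolding K_def
    proof (rule integral_vanishing_outside[OF cH[of w]])
      show "H w t r = 0" if "\<bar>t\<bar> > B" for t using that by (intro H_supp) simp
      show "- real N + x * w \<le> - B" "B \<le> real N + 1 + x * w" using s D_ge(1) B_pos N(2) by linarith+
    qed
    finally show ?thesis .
  next
    case False
    then have w: "\<bar>w\<bar> > B" by simp
    then have "H w t r = 0" for t by (intro H_supp) simp
    then show ?thesis using K0[OF w] by simp
  qed
  have c4: "continuous_on (cbox (0, 0) (1, 1)) (\<lambda>(\<alpha>, \<beta>). periodized \<alpha> \<beta> x r)"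
    unfolding periodized_def case_prod_unfold by (intro continuous_intros H_cont_comp)
  have "torus_mean (\<lambda>\<alpha> \<beta>. periodized \<alpha> \<beta> x r) = integral {0..1} (\<lambda>\<alpha>. integral {0..1} (\<lambda>\<beta>. periodized \<alpha> \<beta> x r))"
    unfolding torus_mean_def using integral_prod_continuous[OF c4] by simp
  also have "\<dots> = integral {0..1} (\<lambda>\<alpha>. \<Sum>j = - D..D. K (of_int j + \<alpha>))"
  proof (rule integral_cong)
    fix \<alpha> :: real
    have i: "(\<lambda>\<beta>. H (of_int j + \<alpha>) (of_int t + \<beta> + x * (of_int j + \<alpha>)) r) integrable_on {0..1}" for j t
      by (intro integrable_continuous_real H_cont_comp continuous_intros)
    have "integral {0..1} (\<lambda>\<beta>. periodized \<alpha> \<beta> x r) =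
      (\<Sum>j = - D..D. \<Sum>t = - D..D. integral {0..1} (\<lambda>\<beta>. H (of_int j + \<alpha>) (of_int t + \<beta> + x * (of_int j + \<alpha>)) r))"
    proof -
      have "integral {0..1} (\<lambda>\<beta>. \<Sum>t = - D..D. H (of_int j + \<alpha>) (of_int t + \<beta> + x * (of_int j + \<alpha>)) r) =
        (\<Sum>t = - D..D. integral {0..1} (\<lambda>\<beta>. H (of_int j + \<alpha>) (of_int t + \<beta> + x * (of_int j + \<alpha>)) r))" for j
        by (rule integral_sum) (use i in auto)
      moreover have "integral {0..1} (\<lambda>\<beta>. periodized \<alpha> \<beta> x r) = (\<Sum>j = - D..D. integral {0..1} (\<lambda>\<beta>. \<Sum>t = - D..D. H (of_int j + \<alpha>) (of_int t + \<beta> + x * (of_int j + \<alpha>)) r))"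
        unfolding periodized_def by (rule integral_sum) (auto intro!: integrable_sum i)
      ultimately show ?thesis by simp
    qed
    also have "\<dots> = (\<Sum>j = - D..D. K (of_int j + \<alpha>))" by (simp only: inner)
    finally show "integral {0..1} (\<lambda>\<beta>. periodized \<alpha> \<beta> x r) = (\<Sum>j = - D..D. K (of_int j + \<alpha>))" .
  qed
  also have "\<dots> = (\<Sum>j = - D..D. integral {0..1} (\<lambda>\<alpha>. K (of_int j + \<alpha>)))"
  proof (rule integral_sum)
    fix j
    have "continuous_on {0..1} (\<lambda>\<alpha>. K (of_int j + \<alpha>))"
      by (rule continuous_on_compose2[OF Kc]) (auto intro!: continuous_intros)
    then show "(\<lambda>\<alpha>. K (of_int j + \<alpha>)) integrable_on {0..1}" by (rule integrable_continuous_real)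
  qed simp
  also have "\<dots> = integral {- real N + 0..real N + 1 + 0} K"
    using periodize_integral[OF Kc, where D = N and s = 0] by (simp add: N)
  also have "\<dots> = integral {-B..B} K"
  proof (rule integral_vanishing_outside[OF Kc])
    show "- real N + 0 \<le> - B" "B \<le> real N + 1 + 0" using D_ge(1) B_pos N(2) by linarith+
  qed (rule K0)
  finally show ?thesis by (simp add: mean_def K_def[abs_def])
qed

lemma torus_mean_of_real:
  assumes x: "x \<in> {0..1}"
  shows "torus_mean (\<lambda>\<alpha> \<beta>. complex_of_real (on_torus (cis2pi \<alpha>, cis2pi \<beta>, x, r))) = complex_of_real (mean r)"
proof -
  have c4: "continuous_on (cbox (0, 0) (1, 1)) (\<lambda>(\<alpha>, \<beta>). periodized \<alpha> \<beta> x r)"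
    unfolding periodized_def case_prod_unfold by (intro continuous_intros H_cont_comp)
  have "((\<lambda>(\<alpha>, \<beta>). periodized \<alpha> \<beta> x r) has_integral mean r) (cbox (0, 0) (1, 1))"
    using integrable_integral[OF torus_mean_cont[OF c4]] torus_mean_periodized[OF x, of r] unfolding torus_mean_def by simp
  from has_integral_of_real[OF this, where 'b = complex]
  have "((\<lambda>(\<alpha>, \<beta>). complex_of_real (periodized \<alpha> \<beta> x r)) has_integral complex_of_real (mean r)) (cbox (0, 0) (1, 1))"
    by (simp add: case_prod_unfold)
  moreover have "torus_mean (\<lambda>\<alpha> \<beta>. complex_of_real (on_torus (cis2pi \<alpha>, cis2pi \<beta>, x, r))) = integral (cbox (0, 0) (1, 1)) (\<lambda>(\<alpha>, \<beta>). complex_of_real (periodized \<alpha> \<beta> x r))"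
    unfolding torus_mean_def by (rule integral_cong) (use x in \<open>auto simp: on_torus_cis2pi\<close>)
  ultimately show ?thesis by (simp add: integral_unique)
qed

end

context shifted_lattice
begin

text \<open>A rectangle around the origin with one side along \<open>m\<close>, in the coordinates \<open>wd y m\<close> and \<open>ip y m / (norm m)^2\<close>.\<close>

definition strip :: "real \<Rightarrow> complex \<Rightarrow> complex set" where
  "strip B m = {y. y - \<zeta> \<in> lattice \<and> \<bar>wd y m\<bar> \<le> B \<and> \<bar>ip y m\<bar> \<le> B * (norm m)^2}"

lemma strip_sum:
  assumes "test_function H B" and an: "(a, n) \<in> cone1 T"
  shows "(\<Sum>y\<in>strip B (a + n). H (wd y (a + n)) (ip y (a + n) / (norm (a + n))^2) r)
    = test_function.on_torus H B (cis2pi (phase1 a n), cis2pi (phase2 a n), shear a n, r)" "finite (strip B (a + n))"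
proof -
  interpret test_function H B by fact
  define m where "m = a + n"
  have a: "a \<in> lattice" "n \<in> lattice" "wd n a = 1" using an by (auto simp: cone_def)
  have m: "wd n m = 1" "m \<in> lattice" "m \<noteq> 0"
    using a cone_mvec(1)[OF an] by (auto simp: m_def wd_simps mvec_def)
  have m0: "(norm m)^2 > 0" using m by simp
  define \<alpha> \<beta> where "\<alpha> = frac (phase1 a n)" and "\<beta> = frac (phase2 a n)"
  have fr: "0 \<le> \<alpha>" "\<alpha> < 1" "0 \<le> \<beta>" "\<beta> < 1" by (auto simp: \<alpha>_def \<beta>_def frac_lt_1)
  obtain i1 i2 :: int where i: "phase1 a n = of_int i1 + \<alpha>" "phase2 a n = of_int i2 + \<beta>"
    unfolding \<alpha>_def \<beta>_def frac_def by (metis add.commute diff_add_cancel)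
  have phase1: "phase1 a n = wd \<zeta> m" and phase2: "phase2 a n = wd n \<zeta>" by (simp_all add: phase1_def phase2_def m_def)
  define Y where "Y = (\<lambda>(j::int, t::int). of_real (of_int j + \<alpha>) * n + of_real (of_int t + \<beta>) * m)"
  have wY: "wd (Y (j, t)) m = of_int j + \<alpha>" "wd n (Y (j, t)) = of_int t + \<beta>" for j t
    unfolding Y_def case_prod_conv wd_simps by (simp_all add: m)
  have l: "shear a n = ip n m / (norm m)^2" by (simp add: shear_eq m_def)
  have lx: "shear a n \<in> {0..1}" by (rule shear_in[OF an])
  have iY: "ip (Y (j, t)) m / (norm m)^2 = of_int t + \<beta> + shear a n * (of_int j + \<alpha>)" for j t
  proof -
    have "ip (Y (j, t)) m = (of_int j + \<alpha>) * ip n m + (of_int t + \<beta>) * (norm m)^2"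
      unfolding Y_def case_prod_conv ip_simps ip_self ..
    then show ?thesis using m0 by (simp add: l field_simps)
  qed
  have Yin: "Y (j, t) - \<zeta> \<in> lattice" for j t
  proof -
    have "\<zeta> = of_real (wd \<zeta> m) * n + of_real (wd n \<zeta>) * m" by (rule cramer_wd[OF m(1)])
    then have z: "\<zeta> = of_real (of_int i1 + \<alpha>) * n + of_real (of_int i2 + \<beta>) * m" using i phase1 phase2 by simp
    have eq: "Y (j, t) - \<zeta> = of_int (j - i1) * n + of_int (t - i2) * m"
      by (subst z) (simp add: Y_def algebra_simps)
    show ?thesis unfolding eq by (intro lattice_add lattice_of_int a m)
  qed
  have surj: "\<exists>j t. y = Y (j, t)" if y: "y - \<zeta> \<in> lattice" for y
  proof -
    obtain j0 where j0: "wd (y - \<zeta>) m = of_int j0" using wd_lattice[OF y m(2)] .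
    obtain t0 where t0: "wd n (y - \<zeta>) = of_int t0" using wd_lattice[OF a(2) y] .
    have "wd y m = of_int (j0 + i1) + \<alpha>" using j0 i phase1 by (simp add: wd_simps)
    moreover have "wd n y = of_int (t0 + i2) + \<beta>" using t0 i phase2 by (simp add: wd_simps)
    ultimately have "y = Y (j0 + i1, t0 + i2)" using cramer_wd[OF m(1), of y] by (simp add: Y_def)
    then show ?thesis by blast
  qed
  define J where "J = {(j, t). \<bar>of_int j + \<alpha>\<bar> \<le> B \<and> \<bar>of_int t + \<beta> + shear a n * (of_int j + \<alpha>)\<bar> \<le> B}"
  have strip_iff: "Y (j, t) \<in> strip B m \<longleftrightarrow> (j, t) \<in> J" for j t
  proof -
    have "\<bar>ip (Y (j, t)) m\<bar> \<le> B * (norm m)^2 \<longleftrightarrow> \<bar>ip (Y (j, t)) m / (norm m)^2\<bar> \<le> B"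
      using m0 by (simp add: abs_divide pos_divide_le_eq)
    then show ?thesis unfolding strip_def J_def by (simp add: wY iY Yin)
  qed
  have injY: "inj Y"
  proof (rule injI)
    fix p q assume "Y p = Y q"
    moreover obtain j t j' t' where "p = (j, t)" "q = (j', t')" by (metis surj_pair)
    ultimately show "p = q" using wY[of j t] wY[of j' t'] by simp
  qed
  have strip_eq: "strip B m = Y ` J"
  proof (intro equalityI subsetI)
    fix y assume y: "y \<in> strip B m"
    then obtain j t where "y = Y (j, t)" using surj unfolding strip_def by blast
    then show "y \<in> Y ` J" using y strip_iff by auto
  qed (use strip_iff in auto)
  have JD: "J \<subseteq> {-D..D} \<times> {-D..D}"
  proof clarify
    fix j t assume "(j, t) \<in> J"
    then have h: "\<bar>of_int j + \<alpha>\<bar> \<le> B" "\<bar>of_int t + \<beta> + shear a n * (of_int j + \<alpha>)\<bar> \<le> B" by (auto simp: J_def)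
    have s: "\<bar>shear a n * (of_int j + \<alpha>)\<bar> \<le> B" by (rule shift_small[OF lx h(1)])
    have "\<bar>real_of_int j\<bar> \<le> of_int D" "\<bar>real_of_int t\<bar> \<le> of_int D" using h s fr D_ge(1) B_pos by linarith+
    then show "j \<in> {-D..D} \<and> t \<in> {-D..D}" by auto
  qed
  then have finJ: "finite J" by (rule finite_subset) simp
  show "finite (strip B (a + n))" using strip_eq finJ by (simp add: m_def)
  have "(\<Sum>y\<in>strip B m. H (wd y m) (ip y m / (norm m)^2) r) = (\<Sum>p\<in>J. H (wd (Y p) m) (ip (Y p) m / (norm m)^2) r)"
    unfolding strip_eq by (subst sum.reindex) (auto intro: inj_on_subset[OF injY])
  also have "\<dots> = (\<Sum>(j, t)\<in>J. H (of_int j + \<alpha>) (of_int t + \<beta> + shear a n * (of_int j + \<alpha>)) r)"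
    by (rule sum.cong[OF refl]) (auto simp: wY iY)
  also have "\<dots> = (\<Sum>(j, t)\<in>{-D..D} \<times> {-D..D}. H (of_int j + \<alpha>) (of_int t + \<beta> + shear a n * (of_int j + \<alpha>)) r)"
  proof (rule sum.mono_neutral_left)
    show "\<forall>p\<in>{-D..D} \<times> {-D..D} - J. (case p of (j, t) \<Rightarrow> H (of_int j + \<alpha>) (of_int t + \<beta> + shear a n * (of_int j + \<alpha>)) r) = 0"
    proof clarify
      fix j t assume "(j, t) \<notin> J"
      then show "H (of_int j + \<alpha>) (of_int t + \<beta> + shear a n * (of_int j + \<alpha>)) r = 0"
        by (intro H_supp) (auto simp: J_def not_le)
    qed
  qed (use JD in auto)
  also have "\<dots> = periodized \<alpha> \<beta> (shear a n) r"
    unfolding periodized_def by (simp add: sum.cartesian_product)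
  also have "\<dots> = on_torus (cis2pi \<alpha>, cis2pi \<beta>, shear a n, r)"
    by (rule on_torus_cis2pi[symmetric]) (use fr lx in auto)
  also have "\<dots> = on_torus (cis2pi (phase1 a n), cis2pi (phase2 a n), shear a n, r)"
    by (simp add: \<alpha>_def \<beta>_def cis2pi_frac)
  finally show "(\<Sum>y\<in>strip B (a + n). H (wd y (a + n)) (ip y (a + n) / (norm (a + n))^2) r)
    = on_torus (cis2pi (phase1 a n), cis2pi (phase2 a n), shear a n, r)" by (simp add: m_def)
qed

text \<open>For \<open>m = a + n\<close>, the sum over the strip is the value of \<open>on_torus\<close> at the phases of \<open>\<zeta>\<close>, so equidistribution of the phases replaces it by the mean over the torus, on average over \<open>m\<close>.\<close>

theorem affine_equidistribution:
  assumes H: "test_function H B"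
  shows "qbound (\<lambda>T. \<Sum>(a, n)\<in>cone1 T. (\<Sum>y\<in>strip B (a + n). H (wd y (a + n)) (ip y (a + n) / (norm (a + n))^2) (norm (a + n) / T))
     - test_function.mean H B (norm (a + n) / T)) 0"
proof -
  interpret test_function H B by fact
  have eq: "complex_of_real (\<Sum>(a, n)\<in>cone1 T. (\<Sum>y\<in>strip B (a + n). H (wd y (a + n)) (ip y (a + n) / (norm (a + n))^2) (norm (a + n) / T))
     - mean (norm (a + n) / T)) =
    (\<Sum>(a, n)\<in>cone1 T. complex_of_real (on_torus (cis2pi (phase1 a n), cis2pi (phase2 a n), shear a n, norm (a + n) / T))
      - torus_mean (\<lambda>\<alpha> \<beta>. complex_of_real (on_torus (cis2pi \<alpha>, cis2pi \<beta>, shear a n, norm (a + n) / T))))" for T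
    unfolding of_real_sum
  proof (rule sum.cong[OF refl], clarify)
    fix a n assume an: "(a, n) \<in> cone1 T"
    show "complex_of_real ((\<Sum>y\<in>strip B (a + n). H (wd y (a + n)) (ip y (a + n) / (norm (a + n))^2) (norm (a + n) / T))
     - mean (norm (a + n) / T)) = complex_of_real (on_torus (cis2pi (phase1 a n), cis2pi (phase2 a n), shear a n, norm (a + n) / T))
      - torus_mean (\<lambda>\<alpha> \<beta>. complex_of_real (on_torus (cis2pi \<alpha>, cis2pi \<beta>, shear a n, norm (a + n) / T)))"
      unfolding strip_sum(1)[OF H an] torus_mean_of_real[OF shear_in[OF an]] by simp
  qed
  show ?thesis
    using torus_equidistribution[OF on_torus_cont] unfolding eq[symmetric] qbound_def norm_of_real real_norm_def .
qed

end

section \<open>Pairs with a short difference\<close>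

text \<open>The condition with the sup or sum norm of the coordinates is equivalent to this one after changing \<open>C\<close>; every exponent may be enlarged to one that is at least 2.\<close>

locale diophantine_lattice = unimodular_lattice +
  fixes \<zeta> :: complex and C \<kappa> :: real
  assumes C_pos: "C > 0" and \<kappa>_ge: "\<kappa> \<ge> 2"
    and dioph: "\<And>m l. m \<in> lattice \<Longrightarrow> m \<noteq> 0 \<Longrightarrow> C * norm m powr (- \<kappa>) \<le> \<bar>wd \<zeta> m + of_int l\<bar>"
begin

sublocale shifted_lattice
proof
  fix h :: int assume h: "h \<noteq> 0"
  have u: "u \<noteq> 0" using wd_basis by auto
  show "\<exists>b\<in>lattice. of_int h * wd \<zeta> b \<notin> \<int>"
  proof (intro bexI notI)
    assume "of_int h * wd \<zeta> u \<in> \<int>"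
    then obtain k where "of_int h * wd \<zeta> u = of_int k" by (auto elim: Ints_cases)
    then have "wd \<zeta> (of_int h * u) + of_int (- k) = 0" by (simp add: wd_simps)
    moreover have "C * norm (of_int h * u) powr (- \<kappa>) \<le> \<bar>wd \<zeta> (of_int h * u) + of_int (- k)\<bar>"
      by (rule dioph) (use h u in auto)
    moreover have "0 < C * norm (of_int h * u) powr (- \<kappa>)" using C_pos h u by simp
    ultimately show False by simp
  qed simp
qed

definition near_const :: real where
  "near_const = 49 * (2 / C) powr (2 / \<kappa>)"

lemma near_const_pos: "near_const > 0"
  using C_pos by (simp add: near_const_def)

text \<open>Two such vectors differ by a vector with the same property for \<open>2 \<delta>\<close>, which the Diophantine condition forces to be long. So they are separated and few.\<close>

lemma card_near_integer:
  assumes "\<delta> > 0" "R > 0"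
  shows "real (card {m \<in> pdisc R. \<exists>l::int. \<bar>wd \<zeta> m + of_int l\<bar> < \<delta>}) \<le> near_const * R^2 * \<delta> powr (2 / \<kappa>)"
proof -
  define S where "S = {m \<in> pdisc R. \<exists>l::int. \<bar>wd \<zeta> m + of_int l\<bar> < \<delta>}"
  define s where "s = (C / (2 * \<delta>)) powr (1 / \<kappa>)"
  have s: "s > 0" using assms C_pos by (simp add: s_def)
  have far: "s \<le> norm m" if m: "m \<in> lattice" "m \<noteq> 0" "\<bar>wd \<zeta> m + of_int l\<bar> < 2 * \<delta>" for m l
  proof -
    have "C * norm m powr (- \<kappa>) < 2 * \<delta>" using dioph[OF m(1,2), of l] m(3) by linarith
    then have "C / (2 * \<delta>) \<le> norm m powr \<kappa>"
      using assms m by (simp add: powr_minus field_simps)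
    then have "s \<le> (norm m powr \<kappa>) powr (1 / \<kappa>)"
      unfolding s_def using C_pos assms \<kappa>_ge by (intro powr_mono2) auto
    also have "\<dots> = norm m" using m \<kappa>_ge by (simp add: powr_powr)
    finally show ?thesis .
  qed
  show ?thesis
  proof (cases "S = {}")
    case True
    then show ?thesis unfolding S_def[symmetric] using near_const_pos by simp
  next
    case False
    then obtain m l where m: "m \<in> pdisc R" "\<bar>wd \<zeta> m + of_int l\<bar> < \<delta>" by (auto simp: S_def)
    have "s \<le> norm m" by (rule far[of m l]) (use m assms in \<open>auto simp: pdisc_def\<close>)
    moreover have "norm m < R" using m(1) by (simp add: pdisc_def)
    ultimately have sR: "s \<le> R" by linarith
    have "real (card S) \<le> 49 * (R / s)^2"
    proof (rule card_separated_disc)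
      fix z w assume zw: "z \<in> S" "w \<in> S" "z \<noteq> w"
      then obtain k l :: int where kl: "\<bar>wd \<zeta> z + of_int k\<bar> < \<delta>" "\<bar>wd \<zeta> w + of_int l\<bar> < \<delta>" unfolding S_def by blast
      have "wd \<zeta> (z - w) + of_int (k - l) = (wd \<zeta> z + of_int k) - (wd \<zeta> w + of_int l)" by (simp add: wd_simps)
      then have "\<bar>wd \<zeta> (z - w) + of_int (k - l)\<bar> < 2 * \<delta>" using kl by linarith
      moreover have "z - w \<in> lattice" "z - w \<noteq> 0" using zw by (auto simp: S_def pdisc_def)
      ultimately show "s \<le> norm (z - w)" using far by blast
    qed (use s sR in \<open>auto simp: S_def pdisc_def\<close>)
    also have "\<dots> = near_const * R^2 * \<delta> powr (2 / \<kappa>)"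
    proof -
      have "1 / s^2 = (2 * \<delta> / C) powr (2 / \<kappa>)"
      proof -
        define X where "X = C / (2 * \<delta>)"
        have "s^2 = s powr 2" using s by simp
        also have "\<dots> = X powr (2 / \<kappa>)" by (simp add: s_def X_def powr_powr)
        finally have "1 / s^2 = (1 / X) powr (2 / \<kappa>)" by (simp only: powr_divide powr_one_eq_one)
        also have "1 / X = 2 * \<delta> / C" by (simp add: X_def)
        finally show ?thesis .
      qed
      also have "\<dots> = (2 / C) powr (2 / \<kappa>) * \<delta> powr (2 / \<kappa>)"
      proof -
        have "2 * \<delta> / C = (2 / C) * \<delta>" by simp
        then show ?thesis using C_pos assms by (simp only: powr_mult)
      qed
      finally have e: "1 / s^2 = (2 / C) powr (2 / \<kappa>) * \<delta> powr (2 / \<kappa>)" .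
      have "49 * (R / s)^2 = 49 * R^2 * (1 / s^2)" by (simp add: power_divide)
      then show ?thesis unfolding e by (simp add: near_const_def)
    qed
    finally show ?thesis unfolding S_def .
  qed
qed

definition line_points :: "complex \<Rightarrow> real \<Rightarrow> real \<Rightarrow> complex set" where
  "line_points m w T = {y. y - \<zeta> \<in> lattice \<and> wd y m = w \<and> norm y < T}"

lemma card_line_points:
  assumes m: "primitive m" "norm m \<le> T"
  shows "finite (line_points m w T)" "real (card (line_points m w T)) \<le> 4 * T / norm m"
proof -
  obtain k where k: "m \<in> lattice" "k \<in> lattice" "wd k m = 1" by (rule primitiveE[OF m(1)])
  have m0: "norm m > 0" using primitive_nonzero[OF m(1)] by simp
  define q where "q y = \<lfloor>ip y m / (norm m)^2\<rfloor>" for y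
  define X where "X = \<lfloor>T / norm m\<rfloor>"
  have inj: "inj_on q (line_points m w T)"
  proof (rule inj_onI)
    fix y z assume yz: "y \<in> line_points m w T" "z \<in> line_points m w T" "q y = q z"
    have "(y - \<zeta>) - (z - \<zeta>) \<in> lattice" using yz unfolding line_points_def by blast
    then have l: "y - z \<in> lattice" by simp
    obtain t where t: "wd k (y - z) = of_int t" using wd_lattice[OF k(2) l] .
    have "wd (y - z) m = 0" using yz by (simp add: line_points_def wd_simps)
    then have yz': "y - z = of_int t * m" using cramer_wd[OF k(3), of "y - z"] t by simp
    have "ip (y - z) m / (norm m)^2 = of_int t" unfolding yz' ip_simps ip_self using m0 by simp
    then have "ip y m / (norm m)^2 - ip z m / (norm m)^2 = of_int t"
      by (simp add: ip_simps diff_divide_distrib)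
    moreover have "\<bar>ip y m / (norm m)^2 - ip z m / (norm m)^2\<bar> < 1" using yz(3) unfolding q_def by linarith
    ultimately have "t = 0" by linarith
    then show "y = z" using yz' by simp
  qed
  have sub: "q ` line_points m w T \<subseteq> {- X - 1..X}"
  proof clarify
    fix y assume y: "y \<in> line_points m w T"
    have "\<bar>ip y m / (norm m)^2\<bar> = \<bar>ip y m\<bar> / (norm m)^2" by (simp add: abs_divide)
    also have "\<dots> \<le> (norm y * norm m) / (norm m)^2" by (intro divide_right_mono abs_ip_le) simp
    also have "\<dots> = norm y / norm m" using m0 by (simp add: power2_eq_square)
    also have "\<dots> \<le> T / norm m" using y m0 by (intro divide_right_mono) (auto simp: line_points_def)
    finally have b: "\<bar>ip y m / (norm m)^2\<bar> \<le> T / norm m" .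
    show "q y \<in> {- X - 1..X}"
      using b unfolding q_def X_def atLeastAtMost_iff by linarith
  qed
  then have "finite (q ` line_points m w T)" by (rule finite_subset) simp
  then show "finite (line_points m w T)" using inj by (simp add: finite_image_iff)
  have T: "1 \<le> T / norm m" using m m0 by simp
  then have X: "X \<ge> 1" by (simp add: X_def)
  have "card (line_points m w T) = card (q ` line_points m w T)" using inj by (simp add: card_image)
  also have "\<dots> \<le> card {- X - 1..X}" using sub by (intro card_mono) auto
  finally have "real (card (line_points m w T)) \<le> 2 * of_int X + 2" using X by simp
  also have "\<dots> \<le> 2 * (T / norm m) + 2 * (T / norm m)"
    using T by (intro add_mono mult_left_mono) (auto simp: X_def)
  finally show "real (card (line_points m w T)) \<le> 4 * T / norm m" by simp
qed

text \<open>Pairs \<open>(y, y + d m)\<close> of points in the disc such that the triangle with vertices \<open>0\<close>, \<open>y\<close>, \<open>y + d m\<close> has area at most \<open>W / 2\<close>.\<close>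

definition close_pairs :: "real \<Rightarrow> real \<Rightarrow> complex \<Rightarrow> (complex \<times> nat) set" where
  "close_pairs W T m = {(y, d). d \<ge> 1 \<and> y - \<zeta> \<in> lattice \<and> norm y < T \<and> norm (y + of_nat d * m) < T \<and> real d * \<bar>wd y m\<bar> \<le> W}"

lemma card_close_pairs_aux:
  assumes m: "primitive m" "norm m \<le> T" and W: "W \<ge> 0" and M: "M \<ge> 0"
    and le: "\<And>y d. (y, d) \<in> close_pairs W T m \<Longrightarrow> real d \<le> M"
  shows "finite (close_pairs W T m)" "real (card (close_pairs W T m)) \<le> (2 * W + 1) * (4 * T / norm m) * M"
proof -
  obtain k where k: "m \<in> lattice" "k \<in> lattice" "wd k m = 1" by (rule primitiveE[OF m(1)])
  have T: "T \<ge> 0" using m(2) norm_ge_zero[of m] by linarith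
  define J where "J = {j::int. \<bar>of_int j + wd \<zeta> m\<bar> \<le> W}"
  define Ds where "Ds = {1..nat \<lfloor>M\<rfloor>}"
  define a where "a = \<lceil>- W - wd \<zeta> m\<rceil>"
  define b where "b = \<lfloor>W - wd \<zeta> m\<rfloor>"
  have J: "J = {a..b}"
    unfolding J_def a_def b_def by (auto simp: abs_le_iff ceiling_le_iff le_floor_iff)
  have cJ: "real (card J) \<le> 2 * W + 1"
  proof -
    have "real_of_int (b - a) \<le> 2 * W" unfolding a_def b_def by linarith
    then show ?thesis unfolding J using W by simp
  qed
  have cD: "real (card Ds) \<le> M" using M by (simp add: Ds_def)
  have sub: "close_pairs W T m \<subseteq> (\<Union>j\<in>J. line_points m (of_int j + wd \<zeta> m) T) \<times> Ds"
  proof clarify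
    fix y d assume h: "(y, d) \<in> close_pairs W T m"
    then have y: "y - \<zeta> \<in> lattice" "norm y < T" "d \<ge> 1" "real d * \<bar>wd y m\<bar> \<le> W" unfolding close_pairs_def by simp_all
    obtain j where "wd (y - \<zeta>) m = of_int j" using wd_lattice[OF y(1) k(1)] .
    then have j: "wd y m = of_int j + wd \<zeta> m" by (simp add: wd_simps)
    have "1 * \<bar>wd y m\<bar> \<le> real d * \<bar>wd y m\<bar>" using y(3) by (intro mult_right_mono) auto
    then have "j \<in> J" using y(4) j by (simp add: J_def)
    moreover have "y \<in> line_points m (of_int j + wd \<zeta> m) T" using y j by (simp add: line_points_def)
    moreover have "d \<in> Ds" using y(3) le[OF h] by (auto simp: Ds_def le_nat_floor)
    ultimately show "y \<in> (\<Union>j\<in>J. line_points m (of_int j + wd \<zeta> m) T) \<and> d \<in> Ds" by blast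
  qed
  have finU: "finite (\<Union>j\<in>J. line_points m (of_int j + wd \<zeta> m) T)"
    using card_line_points(1)[OF m] by (auto simp: J)
  then have finP: "finite ((\<Union>j\<in>J. line_points m (of_int j + wd \<zeta> m) T) \<times> Ds)" by (simp add: Ds_def)
  then show "finite (close_pairs W T m)" using sub by (rule finite_subset[rotated])
  have "real (card (\<Union>j\<in>J. line_points m (of_int j + wd \<zeta> m) T)) \<le> (\<Sum>j\<in>J. real (card (line_points m (of_int j + wd \<zeta> m) T)))"
  proof -
    have "card (\<Union>j\<in>J. line_points m (of_int j + wd \<zeta> m) T) \<le> (\<Sum>j\<in>J. card (line_points m (of_int j + wd \<zeta> m) T))"
      by (rule card_UN_le) (simp add: J)
    then show ?thesis by (metis of_nat_mono of_nat_sum)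
  qed
  also have "\<dots> \<le> (\<Sum>j\<in>J. 4 * T / norm m)" by (intro sum_mono card_line_points(2)[OF m])
  also have "\<dots> = real (card J) * (4 * T / norm m)" by simp
  also have "\<dots> \<le> (2 * W + 1) * (4 * T / norm m)" using cJ T by (intro mult_right_mono) auto
  finally have U: "real (card (\<Union>j\<in>J. line_points m (of_int j + wd \<zeta> m) T)) \<le> (2 * W + 1) * (4 * T / norm m)" .
  have "card (close_pairs W T m) \<le> card ((\<Union>j\<in>J. line_points m (of_int j + wd \<zeta> m) T) \<times> Ds)"
    using sub finP by (rule card_mono[rotated])
  then have "real (card (close_pairs W T m)) \<le> real (card (\<Union>j\<in>J. line_points m (of_int j + wd \<zeta> m) T)) * real (card Ds)"
    unfolding card_cartesian_product by (metis of_nat_mono of_nat_mult)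
  also have "\<dots> \<le> (2 * W + 1) * (4 * T / norm m) * M"
    using U cD W T by (intro mult_mono) auto
  finally show "real (card (close_pairs W T m)) \<le> (2 * W + 1) * (4 * T / norm m) * M" .
qed

text \<open>The wedge \<open>wd y m\<close> takes values in \<open>wd \<zeta> m + \<int>\<close>, on each level there are \<open>O(T / norm m)\<close> points, and \<open>d\<close> is bounded either by \<open>2 T / norm m\<close> or, if \<open>wd y m\<close> stays away from 0, by \<open>W / \<delta>\<close>.\<close>

lemma card_close_pairs:
  assumes m: "primitive m" "norm m \<le> T" and W: "W \<ge> 0"
  shows "finite (close_pairs W T m)"
    "real (card (close_pairs W T m)) \<le> (2 * W + 1) * (4 * T / norm m) * (2 * T / norm m)"
    "\<delta> > 0 \<Longrightarrow> \<forall>l::int. \<delta> \<le> \<bar>wd \<zeta> m + of_int l\<bar> \<Longrightarrow>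
      real (card (close_pairs W T m)) \<le> (2 * W + 1) * (4 * T / norm m) * (W / \<delta>)"
proof -
  have m0: "norm m > 0" using primitive_nonzero[OF m(1)] by simp
  have T: "T > 0" using m0 m by linarith
  have d1: "real d \<le> 2 * T / norm m" if "(y, d) \<in> close_pairs W T m" for y d
  proof -
    have "real d * norm m = norm ((y + of_nat d * m) - y)" by (simp add: norm_mult)
    also have "\<dots> \<le> norm (y + of_nat d * m) + norm y" by (rule norm_triangle_ineq4)
    also have "\<dots> \<le> 2 * T" using that by (auto simp: close_pairs_def)
    finally show ?thesis using m0 by (simp add: pos_le_divide_eq)
  qed
  have M: "2 * T / norm m \<ge> 0" using T by simp
  show "finite (close_pairs W T m)" "real (card (close_pairs W T m)) \<le> (2 * W + 1) * (4 * T / norm m) * (2 * T / norm m)"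
    using card_close_pairs_aux[OF m W M d1] by auto
  assume \<delta>: "\<delta> > 0" "\<forall>l::int. \<delta> \<le> \<bar>wd \<zeta> m + of_int l\<bar>"
  have d2: "real d \<le> W / \<delta>" if h: "(y, d) \<in> close_pairs W T m" for y d
  proof -
    obtain k where k: "m \<in> lattice" "k \<in> lattice" "wd k m = 1" by (rule primitiveE[OF m(1)])
    have y: "y - \<zeta> \<in> lattice" using h by (simp add: close_pairs_def)
    obtain j where "wd (y - \<zeta>) m = of_int j" using wd_lattice[OF y k(1)] .
    then have "wd y m = wd \<zeta> m + of_int j" by (simp add: wd_simps)
    then have "\<delta> \<le> \<bar>wd y m\<bar>" using \<delta> by simp
    then have "real d * \<delta> \<le> real d * \<bar>wd y m\<bar>" by (intro mult_left_mono) auto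
    also have "\<dots> \<le> W" using h by (simp add: close_pairs_def)
    finally show ?thesis using \<delta> by (simp add: pos_le_divide_eq)
  qed
  have M2: "W / \<delta> \<ge> 0" using W \<delta> by simp
  show "real (card (close_pairs W T m)) \<le> (2 * W + 1) * (4 * T / norm m) * (W / \<delta>)"
    using card_close_pairs_aux[OF m W M2 d2] by auto
qed

text \<open>On each dyadic shell, the vectors \<open>m\<close> with \<open>wd \<zeta> m\<close> within \<open>\<delta>\<close> of an integer are rare, and for the others the factor \<open>d\<close> is bounded by \<open>W / \<delta>\<close>.\<close>

lemma short_differences_rare:
  assumes W: "W \<ge> 0"
  shows "\<exists>K\<ge>0. \<forall>T>0. \<forall>X>0. X \<le> T \<longrightarrow>
     (\<Sum>m\<in>{m \<in> pdisc X. primitive m}. real (card (close_pairs W T m))) \<le> K * T^2 * (X / T) powr (1 / \<kappa>)"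
proof -
  define p where "p = 1 / \<kappa>"
  have p: "0 < p" "p \<le> 1 / 2" using \<kappa>_ge by (auto simp: p_def field_simps)
  define K0 where "K0 = (2 * W + 1) * (16 * W * disc_const + 32 * near_const)"
  have K0: "K0 \<ge> 0" using W disc_const_pos near_const_pos by (simp add: K0_def)
  define g where "g T m = (if primitive m then real (card (close_pairs W T m)) else 0)" for T m
  have shell: "(\<Sum>m\<in>pdisc R - pdisc (R / 2). g T m) \<le> K0 * T^2 * T powr (- p) * R powr p" if R: "0 < R" "R \<le> T" for R T
  proof -
    have T: "T > 0" using R by simp
    \<comment> \<open>The two cases then contribute at most \<open>T^2 (R / T) powr (1 / \<kappa>)\<close> and \<open>T^2 (R / T) powr (1 / 2)\<close>, up to constants.\<close>
    define \<delta> where "\<delta> = sqrt (R / T)"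
    have \<delta>: "\<delta> > 0" using R T by (simp add: \<delta>_def)
    define A where "A = {m \<in> pdisc R. \<exists>l::int. \<bar>wd \<zeta> m + of_int l\<bar> < \<delta>}"
    define c1 where "c1 = (2 * W + 1) * (8 * T / R) * (W / \<delta>)"
    define c2 where "c2 = (2 * W + 1) * (8 * T / R) * (4 * T / R)"
    have c: "c1 \<ge> 0" "c2 \<ge> 0" using W R T \<delta> by (auto simp: c1_def c2_def)
    have pt: "g T m \<le> c1 + (if m \<in> A then c2 else 0)" if m: "m \<in> pdisc R - pdisc (R / 2)" for m
    proof (cases "primitive m")
      case False then show ?thesis using c by (simp add: g_def)
    next
      case True
      have nm: "R / 2 \<le> norm m" "norm m < R" "norm m > 0" using m R by (auto simp: pdisc_def)
      have Tm: "norm m \<le> T" using nm R by simp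
      have b: "4 * T / norm m \<le> 8 * T / R" "2 * T / norm m \<le> 4 * T / R"
        using nm R T by (auto simp: field_simps)
      show ?thesis
      proof (cases "m \<in> A")
        case A: True
        have "g T m \<le> (2 * W + 1) * (4 * T / norm m) * (2 * T / norm m)"
          using card_close_pairs(2)[OF True Tm W] True by (simp add: g_def)
        also have "\<dots> \<le> c2" unfolding c2_def using b W T nm R by (intro mult_mono) auto
        finally show ?thesis using A c by simp
      next
        case A: False
        have "\<forall>l::int. \<delta> \<le> \<bar>wd \<zeta> m + of_int l\<bar>" using A m by (auto simp: A_def not_less)
        then have "g T m \<le> (2 * W + 1) * (4 * T / norm m) * (W / \<delta>)"
          using card_close_pairs(3)[OF True Tm W \<delta>] True by (simp add: g_def)
        also have "\<dots> \<le> c1" unfolding c1_def using b W T nm \<delta> R by (intro mult_mono) auto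
        finally show ?thesis using A by simp
      qed
    qed
    have "(\<Sum>m\<in>pdisc R - pdisc (R / 2). g T m) \<le> (\<Sum>m\<in>pdisc R - pdisc (R / 2). c1 + (if m \<in> A then c2 else 0))"
      by (intro sum_mono pt)
    also have "\<dots> \<le> (\<Sum>m\<in>pdisc R. c1 + (if m \<in> A then c2 else 0))"
      by (intro sum_mono2) (use c in auto)
    also have "\<dots> = real (card (pdisc R)) * c1 + real (card A) * c2"
    proof -
      have "A \<subseteq> pdisc R" by (auto simp: A_def)
      then have "pdisc R \<inter> A = A" by auto
      then show ?thesis by (simp add: sum.distrib sum.If_cases)
    qed
    also have "\<dots> \<le> (disc_const * R^2) * c1 + (near_const * R^2 * \<delta> powr (2 / \<kappa>)) * c2"
      using card_pdisc[of R] card_near_integer[OF \<delta> R(1)] c unfolding A_def by (intro add_mono mult_right_mono) auto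
    also have "\<dots> \<le> K0 * T^2 * (R / T) powr p"
    proof -
      have dp: "\<delta> powr (2 / \<kappa>) = (R / T) powr p"
      proof -
        have "\<delta> = (R / T) powr (1 / 2)" using R T by (simp add: \<delta>_def powr_half_sqrt)
        then show ?thesis by (simp add: powr_powr p_def)
      qed
      have "R^2 * (8 * T / R) * (1 / \<delta>) \<le> 8 * T^2 * (R / T) powr p"
      proof -
        have "\<delta> * \<delta> = R / T" using R T by (simp add: \<delta>_def)
        then have "R * (1 / \<delta>) = T * \<delta>" using R T \<delta> by (simp add: field_simps)
        moreover have "R^2 * (8 * T / R) * (1 / \<delta>) = 8 * T * (R * (1 / \<delta>))" using R by (simp add: power2_eq_square)
        ultimately have "R^2 * (8 * T / R) * (1 / \<delta>) = 8 * T * (T * \<delta>)" by (simp only:)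
        then have "R^2 * (8 * T / R) * (1 / \<delta>) = 8 * T^2 * \<delta>" by (simp add: power2_eq_square)
        moreover have "\<delta> \<le> (R / T) powr p"
        proof -
          have "\<delta> = (R / T) powr (1 / 2)" using R T by (simp add: \<delta>_def powr_half_sqrt)
          also have "\<dots> \<le> (R / T) powr p" using R T p by (intro powr_mono') auto
          finally show ?thesis .
        qed
        ultimately show ?thesis by (simp add: mult_left_mono)
      qed
      then have "(disc_const * ((2 * W + 1) * W)) * (R^2 * (8 * T / R) * (1 / \<delta>)) \<le> (disc_const * ((2 * W + 1) * W)) * (8 * T^2 * (R / T) powr p)"
        using W disc_const_pos by (intro mult_left_mono) auto
      then have 1: "(disc_const * R^2) * c1 \<le> (2 * W + 1) * (16 * W * disc_const) * T^2 * (R / T) powr p"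
      proof -
        assume h: "(disc_const * ((2 * W + 1) * W)) * (R^2 * (8 * T / R) * (1 / \<delta>)) \<le> (disc_const * ((2 * W + 1) * W)) * (8 * T^2 * (R / T) powr p)"
        have "(disc_const * R^2) * c1 = (disc_const * ((2 * W + 1) * W)) * (R^2 * (8 * T / R) * (1 / \<delta>))"
          by (simp add: c1_def)
        also note h
        also have "(disc_const * ((2 * W + 1) * W)) * (8 * T^2 * (R / T) powr p) \<le> 2 * ((disc_const * ((2 * W + 1) * W)) * (8 * T^2 * (R / T) powr p))"
          using W disc_const_pos by simp
        finally show ?thesis by (simp add: mult_ac)
      qed
      have 2: "(near_const * R^2 * \<delta> powr (2 / \<kappa>)) * c2 = (2 * W + 1) * (32 * near_const) * T^2 * (R / T) powr p"
        using R by (simp add: dp c2_def power2_eq_square)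
      show ?thesis using 1 2 by (simp add: K0_def algebra_simps)
    qed
    also have "(R / T) powr p = T powr (- p) * R powr p"
    proof -
      have "(R / T) powr p = R powr p / T powr p" using R T by (simp add: powr_divide)
      then show ?thesis by (simp add: powr_minus_divide)
    qed
    finally show ?thesis by (simp add: mult.assoc)
  qed
  define K where "K = K0 / (1 - 2 powr (- p))"
  have "(2::real) powr (- p) < 2 powr 0" using p by (intro powr_less_mono) auto
  then have r: "(2::real) powr (- p) < 1" by simp
  show ?thesis
  proof (intro exI[of _ K] conjI allI impI)
    show "K \<ge> 0" using K0 r by (simp add: K_def)
    fix T X :: real assume TX: "T > 0" "X > 0" "X \<le> T"
    have "(\<Sum>m\<in>{m \<in> pdisc X. primitive m}. real (card (close_pairs W T m))) = (\<Sum>m\<in>pdisc X. g T m)"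
      by (simp add: g_def sum.If_cases Int_def)
    also have "\<dots> \<le> (K0 * T^2 * T powr (- p)) / (1 - 2 powr (- p)) * X powr p"
    proof (rule dyadic_sum)
      fix R :: real assume "0 < R" "R \<le> X"
      then show "(\<Sum>m\<in>pdisc R - pdisc (R / 2). g T m) \<le> K0 * T^2 * T powr (- p) * R powr p"
        using shell[of R T] TX by simp
    qed (use p TX K0 in auto)
    also have "\<dots> = K * T^2 * (X / T) powr p"
    proof -
      have "(X / T) powr p = X powr p / T powr p" using TX by (simp add: powr_divide)
      then show ?thesis by (simp add: K_def powr_minus_divide)
    qed
    finally show "(\<Sum>m\<in>{m \<in> pdisc X. primitive m}. real (card (close_pairs W T m))) \<le> K * T^2 * (X / T) powr (1 / \<kappa>)"
      by (simp add: p_def)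
  qed
qed

end

context unimodular_lattice
begin

lemma sum_three_halves:
  "\<exists>K\<ge>0. \<forall>T>0. \<forall>X>0. (\<Sum>m\<in>pdisc X. (T / norm m) powr (3 / 2)) \<le> K * T^2 * (X / T) powr (1 / 2)"
proof -
  have r: "(2::real) powr (- (1/2)) < 1"
  proof -
    have "(2::real) powr (- (1/2)) < 2 powr 0" by (intro powr_less_mono) auto
    then show ?thesis by simp
  qed
  define K0 where "K0 = 4 * disc_const"
  have K0: "K0 \<ge> 0" using disc_const_pos by (simp add: K0_def)
  show ?thesis
  proof (intro exI[of _ "K0 / (1 - 2 powr (- (1/2)))"] conjI allI impI)
    show "0 \<le> K0 / (1 - 2 powr (- (1/2)))" using r K0 by simp
    fix T X :: real assume TX: "T > 0" "X > 0"
    have "(\<Sum>m\<in>pdisc X. (T / norm m) powr (3 / 2)) \<le> (K0 * T powr (3/2)) / (1 - 2 powr (- (1/2))) * X powr (1/2)"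
    proof (rule dyadic_sum)
      fix R :: real assume R: "0 < R" "R \<le> X"
      have "(\<Sum>m\<in>pdisc R - pdisc (R / 2). (T / norm m) powr (3 / 2)) \<le> (\<Sum>m\<in>pdisc R - pdisc (R / 2). (2 * T / R) powr (3 / 2))"
      proof (rule sum_mono)
        fix m assume "m \<in> pdisc R - pdisc (R / 2)"
        then have "R / 2 \<le> norm m" by (auto simp: pdisc_def)
        then have "T / norm m \<le> T / (R / 2)" using R TX by (intro divide_left_mono mult_pos_pos) auto
        then have "T / norm m \<le> 2 * T / R" by (simp add: mult.commute)
        then show "(T / norm m) powr (3 / 2) \<le> (2 * T / R) powr (3 / 2)" using TX by (intro powr_mono2) auto
      qed
      also have "\<dots> = real (card (pdisc R - pdisc (R / 2))) * (2 * T / R) powr (3 / 2)" by simp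
      also have "\<dots> \<le> real (card (pdisc R)) * (2 * T / R) powr (3 / 2)"
        by (intro mult_right_mono of_nat_mono card_mono) auto
      also have "\<dots> \<le> (disc_const * R^2) * (2 * T / R) powr (3 / 2)"
        by (intro mult_right_mono card_pdisc) auto
      also have "\<dots> = disc_const * 2 powr (3/2) * T powr (3/2) * R powr (1/2)"
      proof -
        have "(2 * T / R) powr (3 / 2) = 2 powr (3/2) * T powr (3/2) / R powr (3/2)"
          using R TX by (simp add: powr_divide powr_mult)
        moreover have "R^2 = R powr (1/2) * R powr (3/2)"
        proof -
          have "R powr (1/2) * R powr (3/2) = R powr (1/2 + 3/2)" by (simp only: powr_add)
          then show ?thesis using R by simp
        qed
        ultimately show ?thesis using R by simp
      qed
      also have "\<dots> \<le> disc_const * 4 * T powr (3/2) * R powr (1/2)"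
      proof -
        have "(2::real) powr (3/2) \<le> 2 powr 2" by (intro powr_mono) auto
        then have "(2::real) powr (3/2) \<le> 4" by simp
        then show ?thesis using disc_const_pos by (intro mult_right_mono mult_left_mono) auto
      qed
      finally show "(\<Sum>m\<in>pdisc R - pdisc (R / 2). (T / norm m) powr (3 / 2)) \<le> K0 * T powr (3/2) * R powr (1/2)"
        by (simp add: K0_def)
    qed (use TX K0 in auto)
    also have "T powr (3/2) = T^2 / T powr (1/2)"
    proof -
      have "T powr (3/2) * T powr (1/2) = T powr (3/2 + 1/2)" by (simp only: powr_add)
      then have "T powr (3/2) * T powr (1/2) = T^2" using TX by simp
      moreover have "T powr (1/2) > 0" using TX by simp
      ultimately show ?thesis by (simp add: nonzero_eq_divide_eq)
    qed
    also have "(K0 * (T^2 / T powr (1/2))) / (1 - 2 powr (- (1/2))) * X powr (1/2) = K0 / (1 - 2 powr (- (1/2))) * T^2 * (X / T) powr (1/2)"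
      using TX by (simp add: powr_divide)
    finally show "(\<Sum>m\<in>pdisc X. (T / norm m) powr (3 / 2)) \<le> K0 / (1 - 2 powr (- (1/2))) * T^2 * (X / T) powr (1/2)" .
  qed
qed

end

section \<open>The radial sum over lattice vectors\<close>

text \<open>The integral of \<open>2 \<rho>^2 \<tau> (\<tau> + d) / d\<close> over \<open>0 \<le> \<tau> \<le> 1 / \<rho> - d\<close> depends on \<open>r = d \<rho>\<close> only and has this value.\<close>

definition radial_profile :: "real \<Rightarrow> real" where
  "radial_profile r = 2 / (3 * r) - 1 + r^2 / 3"

lemma radial_profile_bounds:
  assumes "0 < r" "r \<le> 1"
  shows "0 \<le> radial_profile r" "radial_profile r \<le> 1 / r"
proof -
  have eq: "radial_profile r = (1 - r)^2 * (2 + r) / (3 * r)"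
    using assms by (simp add: radial_profile_def power2_eq_square field_simps)
  then show "0 \<le> radial_profile r" using assms by simp
  have "r^2 \<le> 1" using assms by (simp add: power_le_one)
  then have "radial_profile r \<le> 2 / (3 * r)" by (simp add: radial_profile_def)
  also have "\<dots> \<le> 1 / r" using assms by (simp add: field_simps)
  finally show "radial_profile r \<le> 1 / r" .
qed

lemma harmonic_le_sqrt: "(\<Sum>d=1..n. 1 / real d) \<le> 2 * sqrt (real n)"
proof (induction n)
  case 0 then show ?case by simp
next
  case (Suc n)
  have "1 / real (Suc n) \<le> 2 * (sqrt (real (Suc n)) - sqrt (real n))"
  proof -
    define a b where "a = sqrt (real (Suc n))" and "b = sqrt (real n)"
    have ab: "a > 0" "b \<ge> 0" "b \<le> a" "a * a = real (Suc n)" "b * b = real n" "1 \<le> a"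
      by (auto simp: a_def b_def)
    have "(a - b) * (a + b) = 1" using ab by (simp add: algebra_simps)
    then have "a - b = 1 / (a + b)" using ab by (simp add: nonzero_eq_divide_eq)
    moreover have "1 / (2 * a) \<le> 1 / (a + b)" using ab by (intro divide_left_mono) auto
    moreover have "1 / (a * a) \<le> 1 / a"
    proof -
      have "a * 1 \<le> a * a" using ab(1,6) by (intro mult_left_mono) auto
      then have "a \<le> a * a" by simp
      then show ?thesis by (rule divide_left_mono) (use ab(1) in \<open>auto intro!: mult_pos_pos\<close>)
    qed
    ultimately have "1 / (a * a) \<le> 2 * (a - b)" by simp
    then have "1 / real (Suc n) \<le> 2 * (a - b)" unfolding ab(4) .
    then show ?thesis unfolding a_def b_def .
  qed
  then show ?case using Suc by simp
qed

lemma mvec_11 [simp]: "mvec (Suc 0) (Suc 0) a n = a + n"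
  by (simp add: mvec_def)

context unimodular_lattice
begin

text \<open>Layer-cake summation: \<open>radial_profile\<close> vanishes at 1, so the sum is an integral of its derivative against the counting function \<open>card (pdisc x) \<sim> \<pi> x^2\<close>.\<close>

lemma radial_sum: "qbound (\<lambda>T. (\<Sum>m\<in>pdisc T. radial_profile (norm m / T)) - pi * T^2 / 2) 0"
proof -
  obtain C where C: "C \<ge> 0" "\<And>T. T \<ge> 0 \<Longrightarrow> \<bar>real (card (disc 0 T)) - pi * T^2\<bar> \<le> C * (T + 1)"
    using card_disc_asymp by blast
  define \<mu> where "\<mu> = min_norm"
  have \<mu>: "\<mu> > 0" using min_norm_pos by (simp add: \<mu>_def)
  define C' where "C' = C + (C + 1) / \<mu>"
  have C': "C' \<ge> 0" using C \<mu> by (simp add: C'_def)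
  have cnt: "\<bar>real (card (pdisc x)) - pi * x^2\<bar> \<le> C' * x" if "x \<ge> \<mu>" for x
  proof -
    have x: "x > 0" using that \<mu> by simp
    have "disc 0 x = insert 0 (pdisc x)" "0 \<notin> pdisc x" using x by (auto simp: disc_def pdisc_def)
    then have "real (card (disc 0 x)) = real (card (pdisc x)) + 1" by simp
    then have "\<bar>real (card (pdisc x)) - pi * x^2\<bar> \<le> C * (x + 1) + 1" using C(2)[of x] x by linarith
    also have "\<dots> = C * x + (C + 1) * 1" by (simp add: algebra_simps)
    also have "\<dots> \<le> C * x + (C + 1) * (x / \<mu>)" using that \<mu> C by (intro add_mono mult_left_mono) (auto simp: field_simps)
    also have "\<dots> = C' * x" by (simp add: C'_def algebra_simps)
    finally show ?thesis .
  qed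
  have bound: "\<bar>(\<Sum>m\<in>pdisc T. radial_profile (norm m / T)) - pi * T^2 / 2\<bar> \<le> (2 * pi * \<mu> + C') * T + C' * T * ln (T / \<mu>)"
    if T: "T \<ge> \<mu>" for T
  proof -
    have T0: "T > 0" using T \<mu> by simp
    define k where "k x = 2 * T / (3 * x^2) - 2 * x / (3 * T^2)" for x
    define \<phi> where "\<phi> x = 2 * T / (3 * x) - 1 + x^2 / (3 * T^2)" for x
    have J\<phi>: "radial_profile (norm m / T) = \<phi> (norm m)" for m
      by (simp add: radial_profile_def \<phi>_def power_divide)
    have der: "((\<lambda>x. - \<phi> x) has_vector_derivative k x) (at x within S)" if "x > 0" for x S
      unfolding has_real_derivative_iff_has_vector_derivative[symmetric] \<phi>_def k_def
      using that T0 by (auto intro!: derivative_eq_intros simp: field_simps power2_eq_square)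
    have int_m: "((\<lambda>x. if norm m < x then k x else 0) has_integral \<phi> (norm m)) {\<mu>..T}" if m: "m \<in> pdisc T" for m
    proof -
      have nm: "\<mu> \<le> norm m" "norm m < T" "0 < norm m" using m min_norm_le by (auto simp: pdisc_def \<mu>_def)
      have "(k has_integral (- \<phi> T) - (- \<phi> (norm m))) {norm m..T}"
      proof (rule fundamental_theorem_of_calculus)
        fix x assume "x \<in> {norm m..T}"
        then have "x > 0" using nm(3) unfolding atLeastAtMost_iff by linarith
        then show "((\<lambda>x. - \<phi> x) has_vector_derivative k x) (at x within {norm m..T})" by (rule der)
      qed (use nm in simp)
      moreover have "\<phi> T = 0" using T0 by (simp add: \<phi>_def)
      ultimately have "(k has_integral \<phi> (norm m)) {norm m..T}" by simp
      moreover have "{norm m..T} \<subseteq> {\<mu>..T}" using nm by auto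
      ultimately have res: "((\<lambda>x. if x \<in> {norm m..T} then k x else 0) has_integral \<phi> (norm m)) {\<mu>..T}"
        unfolding interval_cbox by (rule has_integral_restrict_closed_subinterval)
      show ?thesis
      proof (rule has_integral_spike_finite[OF _ _ res])
        show "finite {norm m}" by simp
        fix x assume "x \<in> {\<mu>..T} - {norm m}"
        then show "(if norm m < x then k x else 0) = (if x \<in> {norm m..T} then k x else 0)" by auto
      qed
    qed
    have sum_int: "((\<lambda>x. k x * real (card (pdisc x))) has_integral (\<Sum>m\<in>pdisc T. radial_profile (norm m / T))) {\<mu>..T}"
    proof -
      have "((\<lambda>x. \<Sum>m\<in>pdisc T. if norm m < x then k x else 0) has_integral (\<Sum>m\<in>pdisc T. \<phi> (norm m))) {\<mu>..T}"
        by (rule has_integral_sum) (use int_m in auto)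
      moreover have "(\<Sum>m\<in>pdisc T. if norm m < x then k x else 0) = k x * real (card (pdisc x))" if "x \<in> {\<mu>..T}" for x
      proof -
        have "{m \<in> pdisc T. norm m < x} = pdisc x" using that by (auto simp: pdisc_def)
        then show ?thesis by (simp add: sum.If_cases Int_def)
      qed
      ultimately show ?thesis unfolding J\<phi> by (rule has_integral_eq[rotated])
    qed
    have main_int: "((\<lambda>x. k x * (pi * x^2)) has_integral (pi * T^2 / 2 - pi * (2 * T * \<mu> / 3 - \<mu> ^ 4 / (6 * T^2)))) {\<mu>..T}"
    proof -
      define \<Phi> where "\<Phi> x = pi * (2 * T * x / 3 - x ^ 4 / (6 * T^2))" for x
      have "((\<lambda>x. k x * (pi * x^2)) has_integral (\<Phi> T - \<Phi> \<mu>)) {\<mu>..T}"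
      proof (rule fundamental_theorem_of_calculus[OF T])
        fix x assume "x \<in> {\<mu>..T}"
        then have x: "x > 0" using \<mu> by auto
        define c where "c = 1 / (6 * T^2)"
        have \<Phi>c: "\<Phi> = (\<lambda>x. pi * (2 * T / 3 * x - c * x ^ 4))" by (simp add: \<Phi>_def c_def fun_eq_iff)
        have "(\<Phi> has_real_derivative pi * (2 * T / 3 - c * (4 * x ^ 3))) (at x within {\<mu>..T})"
          unfolding \<Phi>c by (auto intro!: derivative_eq_intros)
        also have "pi * (2 * T / 3 - c * (4 * x ^ 3)) = k x * (pi * x^2)"
        proof -
          have "k x * x^2 = 2 * T / 3 - c * (4 * x ^ 3)"
            using x T0 by (simp add: k_def c_def left_diff_distrib power2_eq_square power3_eq_cube)
          then show ?thesis by (metis mult.left_commute)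
        qed
        finally show "(\<Phi> has_vector_derivative k x * (pi * x^2)) (at x within {\<mu>..T})"
          by (simp add: has_real_derivative_iff_has_vector_derivative)
      qed
      moreover have \<Phi>T: "\<Phi> T = pi * T^2 / 2"
      proof -
        have q: "T ^ 4 / (6 * T^2) = T * T / 6" using T0 by (simp add: power4_eq_xxxx power2_eq_square)
        show ?thesis unfolding \<Phi>_def q by (simp add: power2_eq_square)
      qed
      ultimately have "((\<lambda>x. k x * (pi * x^2)) has_integral (pi * T^2 / 2 - \<Phi> \<mu>)) {\<mu>..T}" by (simp only: \<Phi>T)
      then show ?thesis unfolding \<Phi>_def .
    qed
    have err_int: "((\<lambda>x. C' * T * (1 / x)) has_integral (C' * T * (ln T - ln \<mu>))) {\<mu>..T}"
    proof -
      have "((\<lambda>x. 1 / x) has_integral (ln T - ln \<mu>)) {\<mu>..T}"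
      proof (rule fundamental_theorem_of_calculus[OF T, where f = ln])
        fix x assume "x \<in> {\<mu>..T}"
        then have "x > 0" using \<mu> by simp
        then have "(ln has_real_derivative 1 / x) (at x within {\<mu>..T})"
          by (auto intro!: derivative_eq_intros simp: divide_inverse)
        then show "(ln has_vector_derivative 1 / x) (at x within {\<mu>..T})"
          by (simp add: has_real_derivative_iff_has_vector_derivative)
      qed
      then show ?thesis by (rule has_integral_mult_right)
    qed
    have "norm ((\<Sum>m\<in>pdisc T. radial_profile (norm m / T)) - (pi * T^2 / 2 - pi * (2 * T * \<mu> / 3 - \<mu> ^ 4 / (6 * T^2)))) \<le> C' * T * (ln T - ln \<mu>)"
      unfolding integral_unique[OF has_integral_diff[OF sum_int main_int], symmetric] integral_unique[OF err_int, symmetric]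
    proof (rule integral_norm_bound_integral)
      show "(\<lambda>x. k x * real (card (pdisc x)) - k x * (pi * x^2)) integrable_on {\<mu>..T}"
        using has_integral_diff[OF sum_int main_int] by (rule has_integral_integrable)
      show "(\<lambda>x. C' * T * (1 / x)) integrable_on {\<mu>..T}"
        using err_int by (rule has_integral_integrable)
      fix x assume x: "x \<in> {\<mu>..T}"
      then have x0: "x > 0" "x \<ge> \<mu>" "x \<le> T" using \<mu> by auto
      have k: "0 \<le> k x" "k x \<le> T / x^2"
      proof -
        have "x^2 \<le> T^2" using x0 by (intro power_mono) auto
        then have "2 * x / (3 * T^2) \<le> 2 * T / (3 * x^2)" using x0 T0 by (intro frac_le) auto
        then show "0 \<le> k x" by (simp add: k_def)
        have "0 \<le> 2 * x / (3 * T^2)" "2 * T / (3 * x^2) \<le> T / x^2" using x0 T0 by (auto simp: field_simps)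
        then show "k x \<le> T / x^2" unfolding k_def by linarith
      qed
      have "norm (k x * real (card (pdisc x)) - k x * (pi * x^2)) = k x * \<bar>real (card (pdisc x)) - pi * x^2\<bar>"
        using k by (simp add: right_diff_distrib[symmetric] abs_mult)
      also have "\<dots> \<le> (T / x^2) * (C' * x)" using k cnt[OF x0(2)] C' by (intro mult_mono) auto
      also have "\<dots> = C' * T * (1 / x)" using x0 by (simp add: power2_eq_square)
      finally show "norm (k x * real (card (pdisc x)) - k x * (pi * x^2)) \<le> C' * T * (1 / x)" .
    qed
    moreover have lneq: "ln (T / \<mu>) = ln T - ln \<mu>" using T0 \<mu> by (simp add: ln_div)
    moreover have "\<bar>pi * (2 * T * \<mu> / 3 - \<mu> ^ 4 / (6 * T^2))\<bar> \<le> 2 * pi * \<mu> * T"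
    proof -
      have "\<mu> ^ 4 \<le> \<mu> * (T * T^2)"
      proof -
        have "\<mu> * (\<mu> * \<mu>^2) \<le> \<mu> * (T * T^2)" using T \<mu> by (intro mult_left_mono mult_mono power_mono) auto
        then show ?thesis by (simp add: power4_eq_xxxx power2_eq_square)
      qed
      then have "\<mu> ^ 4 / (6 * T^2) \<le> \<mu> * (T * T^2) / (6 * T^2)" by (intro divide_right_mono) auto
      also have "\<dots> = \<mu> * T / 6" using T0 by simp
      finally have a: "\<mu> ^ 4 / (6 * T^2) \<le> \<mu> * T / 6" .
      have b: "0 \<le> \<mu> ^ 4 / (6 * T^2)" "0 \<le> \<mu> * T" using T0 \<mu> by auto
      have "2 * T * \<mu> / 3 = 2/3 * (\<mu> * T)" by simp
      then have "\<bar>2 * T * \<mu> / 3 - \<mu> ^ 4 / (6 * T^2)\<bar> \<le> 2 * (\<mu> * T)" using a b by linarith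
      then have "pi * \<bar>2 * T * \<mu> / 3 - \<mu> ^ 4 / (6 * T^2)\<bar> \<le> pi * (2 * (\<mu> * T))" by (intro mult_left_mono) auto
      then show ?thesis by (simp add: abs_mult mult_ac)
    qed
    moreover have "0 \<le> C' * T" using C' T0 by simp
    moreover have "\<bar>S - P\<bar> \<le> A + E + L" if "\<bar>S - (P - Q)\<bar> \<le> L" "\<bar>Q\<bar> \<le> A" "0 \<le> E" for S P Q A E L :: real
      using that by linarith
    ultimately show ?thesis unfolding real_norm_def distrib_right lneq by blast
  qed
  show ?thesis
    unfolding qbound_iff_tendsto
  proof (rule tendsto_sandwich[where f = "\<lambda>_. 0"])
    show "\<forall>\<^sub>F T in at_top. 0 \<le> norm ((\<Sum>m\<in>pdisc T. radial_profile (norm m / T)) - pi * T^2 / 2) / T^2" by simp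
    show "\<forall>\<^sub>F T in at_top. norm ((\<Sum>m\<in>pdisc T. radial_profile (norm m / T)) - pi * T^2 / 2) / T^2 \<le>
      ((2 * pi * \<mu> + C') * T + C' * T * ln (T / \<mu>)) / T^2"
      using eventually_ge_at_top[of \<mu>]
    proof eventually_elim
      case (elim T)
      show ?case unfolding real_norm_def by (rule divide_right_mono[OF bound[OF elim]]) simp
    qed
    have "((\<lambda>T. (2 * pi * \<mu> + C' - C' * ln \<mu>) / T + C' * (ln T / T)) \<longlongrightarrow> 0 + C' * 0) at_top"
    proof (rule tendsto_add)
      show "((\<lambda>T. (2 * pi * \<mu> + C' - C' * ln \<mu>) / T) \<longlongrightarrow> 0) at_top"
        by (rule tendsto_divide_0[OF tendsto_const]) (rule filterlim_at_top_imp_at_infinity[OF filterlim_ident])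
      show "((\<lambda>T. C' * (ln T / T)) \<longlongrightarrow> C' * 0) at_top"
        by (rule tendsto_mult_left[OF ln_x_over_x_tendsto_0])
    qed
    moreover have "\<forall>\<^sub>F T in at_top. (2 * pi * \<mu> + C' - C' * ln \<mu>) / T + C' * (ln T / T) = ((2 * pi * \<mu> + C') * T + C' * T * ln (T / \<mu>)) / T^2"
      using eventually_gt_at_top[of 0]
    proof eventually_elim
      case (elim T)
      then have lneq: "ln (T / \<mu>) = ln T - ln \<mu>" using \<mu> by (simp add: ln_div)
      show ?case unfolding lneq using elim by (simp add: field_simps power2_eq_square)
    qed
    ultimately show "((\<lambda>T. ((2 * pi * \<mu> + C') * T + C' * T * ln (T / \<mu>)) / T^2) \<longlongrightarrow> 0) at_top"
      by (simp add: tendsto_cong)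
  qed simp
qed

definition prims :: "real \<Rightarrow> complex set" where
  "prims X = {m \<in> pdisc X. primitive m}"

lemma finite_prims [simp]: "finite (prims X)"
  by (simp add: prims_def)

lemma sum_over_multiples:
  fixes G :: "complex \<Rightarrow> real"
  shows "(\<Sum>m\<in>pdisc T. G m) = (\<Sum>m\<in>prims T. \<Sum>d\<in>{d::nat. 1 \<le> d \<and> real d * norm m < T}. G (of_nat d * m))"
    "m \<in> prims T \<Longrightarrow> finite {d::nat. 1 \<le> d \<and> real d * norm m < T}"
proof -
  have fin: "finite {d::nat. 1 \<le> d \<and> real d * norm m < T}" if "m \<in> prims T" for m
  proof (rule finite_subset)
    have m: "norm m > 0" using that by (auto simp: prims_def pdisc_def)
    show "{d::nat. 1 \<le> d \<and> real d * norm m < T} \<subseteq> {..nat \<lceil>T / norm m\<rceil>}"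
    proof
      fix d assume "d \<in> {d::nat. 1 \<le> d \<and> real d * norm m < T}"
      then have "real d < T / norm m" using m by (simp add: pos_less_divide_eq)
      then show "d \<in> {..nat \<lceil>T / norm m\<rceil>}" by simp linarith
    qed
  qed simp
  then show "m \<in> prims T \<Longrightarrow> finite {d::nat. 1 \<le> d \<and> real d * norm m < T}" by simp
  let ?S = "SIGMA m:prims T. {d::nat. 1 \<le> d \<and> real d * norm m < T}"
  have "(\<Sum>m\<in>prims T. \<Sum>d\<in>{d::nat. 1 \<le> d \<and> real d * norm m < T}. G (of_nat d * m)) = (\<Sum>(m, d)\<in>?S. G (of_nat d * m))"
    by (rule sum.Sigma) (use fin in auto)
  also have "\<dots> = (\<Sum>x\<in>(\<lambda>(m, d). of_nat d * m) ` ?S. G x)"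
  proof -
    have "inj_on (\<lambda>(m, d). of_nat d * m) ?S"
    proof (rule inj_onI, clarify)
      fix m d m' d'
      assume h: "m \<in> prims T" "m' \<in> prims T" "(1::nat) \<le> d" "1 \<le> d'" "of_nat d * m = of_nat d' * m'"
      then show "m = m' \<and> d = d'"
        using primitive_unique[of m m' d d'] by (auto simp: prims_def)
    qed
    from sum.reindex[OF this, of G] show ?thesis by (simp add: o_def case_prod_unfold)
  qed
  also have "(\<lambda>(m, d). of_nat d * m) ` ?S = pdisc T"
  proof (intro equalityI subsetI)
    fix x assume "x \<in> (\<lambda>(m, d). of_nat d * m) ` ?S"
    then show "x \<in> pdisc T" by (auto simp: prims_def pdisc_def norm_mult)
  next
    fix x assume x: "x \<in> pdisc T"
    then have xl: "x \<in> lattice" "x \<noteq> 0" by (auto simp: pdisc_def)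
    obtain d m where dm: "primitive m" "d \<ge> (1::nat)" "x = of_nat d * m"
      by (rule primitive_decomposition[OF xl])
    have nx: "real d * norm m < T" using x dm by (simp add: pdisc_def norm_mult)
    have "1 * norm m \<le> real d * norm m" using dm by (intro mult_right_mono) auto
    then have "norm m < T" using nx by linarith
    moreover have "m \<noteq> 0" using primitive_nonzero[OF dm(1)] .
    ultimately have "m \<in> prims T" using dm(1) unfolding prims_def pdisc_def primitive_def by simp
    then show "x \<in> (\<lambda>(m, d). of_nat d * m) ` ?S" using dm nx by (intro image_eqI[of _ _ "(m, d)"]) auto
  qed
  finally show "(\<Sum>m\<in>pdisc T. G m) = (\<Sum>m\<in>prims T. \<Sum>d\<in>{d::nat. 1 \<le> d \<and> real d * norm m < T}. G (of_nat d * m))" by simp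
qed

text \<open>A long primitive vector \<open>m\<close> is \<open>a + n\<close> for exactly one pair of the cone: \<open>n\<close> is determined modulo \<open>m\<close> by \<open>wd n m = 1\<close>, and its projection on \<open>m\<close> must lie strictly between 0 and \<open>m\<close>. A projection equal to 0 is possible for short \<open>m\<close> only.\<close>

lemma cone1_prims:
  assumes "X \<ge> 1 / min_norm"
  shows "bij_betw (\<lambda>(a, n). a + n) {(a, n) \<in> cone 1 1 1 T. X < norm (a + n)} {m \<in> prims T. X < norm m}"
  unfolding bij_betw_def
proof
  have mv: "mvec 1 1 a n = a + n" for a n by (simp add: mvec_def)
  show "inj_on (\<lambda>(a, n). a + n) {(a, n) \<in> cone 1 1 1 T. X < norm (a + n)}"
  proof (rule inj_onI, clarify)
    fix a n a' n' assume h: "(a, n) \<in> cone 1 1 1 T" "(a', n') \<in> cone 1 1 1 T" "a + n = a' + n'"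
    define m where "m = a + n"
    have m: "m \<noteq> 0" "a + n = m" "a' + n' = m" using cone_mvec(1)[OF h(1), unfolded mv] h(3) by (simp_all add: m_def)
    have w: "wd n m = 1" "wd n' m = 1"
      using cone_mvec(6)[OF h(1)] cone_mvec(6)[OF h(2)] unfolding mv m(2,3) by auto
    have s: "ip a m + ip n m = (norm m)^2" "ip a' m + ip n' m = (norm m)^2"
      using cone_mvec(7)[OF h(1)] cone_mvec(7)[OF h(2)] unfolding mv m(2,3) by auto
    have "0 < ip a (a + n)" "0 < ip n (a + n)" "0 < ip a' (a' + n')" "0 < ip n' (a' + n')"
      using h(1,2) by (auto simp: cone_def)
    then have p: "0 < ip a m" "0 < ip n m" "0 < ip a' m" "0 < ip n' m" unfolding m(2,3) .
    have nl: "n \<in> lattice" "n' \<in> lattice" using h by (auto simp: cone_def)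
    then have "n - n' \<in> lattice" by auto
    then obtain t where t: "wd n (n - n') = of_int t" using wd_lattice nl by metis
    have "n - n' = of_real (wd (n - n') m) * n + of_real (wd n (n - n')) * m" by (rule cramer_wd[OF w(1)])
    then have nn: "n - n' = of_int t * m" unfolding t wd_diff_left w by simp
    then have "ip (n - n') m = of_int t * (norm m)^2" by (simp add: ip_simps ip_self)
    moreover have "\<bar>ip n m - ip n' m\<bar> < (norm m)^2" using s p by linarith
    ultimately have "\<bar>of_int t * (norm m)^2\<bar> < 1 * (norm m)^2" by (simp add: ip_simps)
    then have "\<bar>real_of_int t\<bar> < 1" using m by (simp add: abs_mult mult_less_cancel_right)
    then have "t = 0" by linarith
    then have "n = n'" using nn by simp
    then show "a = a' \<and> n = n'" using h(3) by simp
  qed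
  show "(\<lambda>(a, n). a + n) ` {(a, n) \<in> cone 1 1 1 T. X < norm (a + n)} = {m \<in> prims T. X < norm m}"
  proof (intro equalityI subsetI)
    fix m assume "m \<in> (\<lambda>(a, n). a + n) ` {(a, n) \<in> cone 1 1 1 T. X < norm (a + n)}"
    then obtain a n where an: "(a, n) \<in> cone 1 1 1 T" "m = a + n" "X < norm m" by auto
    have "wd n m = 1" using cone_mvec(6)[OF an(1)] an(2) by (simp add: mv)
    moreover have "a \<in> lattice" "n \<in> lattice" using an by (auto simp: cone_def)
    ultimately have "primitive m" unfolding primitive_def using an by blast
    moreover have "norm m < T" using cone_mvec(3)[OF an(1)] an by (simp add: mv)
    ultimately show "m \<in> {m \<in> prims T. X < norm m}"
      using an primitive_nonzero by (auto simp: prims_def pdisc_def primitive_def)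
  next
    fix m assume "m \<in> {m \<in> prims T. X < norm m}"
    then have m: "primitive m" "norm m < T" "X < norm m" by (auto simp: prims_def pdisc_def)
    obtain k where k: "m \<in> lattice" "k \<in> lattice" "wd k m = 1" by (rule primitiveE[OF m(1)])
    have m0: "m \<noteq> 0" using primitive_nonzero[OF m(1)] .
    then have nm: "(norm m)^2 > 0" by simp
    define t where "t = \<lfloor>ip k m / (norm m)^2\<rfloor>"
    define n where "n = k - of_int t * m"
    have n: "n \<in> lattice" "wd n m = 1" using k by (auto simp: n_def wd_simps)
    have "ip n m / (norm m)^2 = frac (ip k m / (norm m)^2)"
      using nm by (simp add: n_def ip_simps ip_self diff_divide_distrib frac_def t_def)
    then have fr: "0 \<le> ip n m / (norm m)^2" "ip n m / (norm m)^2 < 1" by (auto simp: frac_lt_1)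
    then have ipn: "0 \<le> ip n m" "ip n m < (norm m)^2" using nm by (auto simp: zero_le_divide_iff)
    have "ip n m \<noteq> 0"
    proof
      assume "ip n m = 0"
      then have "(norm n)^2 * (norm m)^2 = 1" using ip_wd_norm[of n m] n by simp
      then have "(norm n * norm m)^2 = 1^2" by (simp add: power_mult_distrib)
      then have one: "norm n * norm m = 1" by (rule power2_eq_imp_eq) auto
      have "n \<noteq> 0" using n by auto
      then have "min_norm \<le> norm n" using n by (intro min_norm_le)
      then have "min_norm * norm m \<le> 1" unfolding one[symmetric] by (intro mult_right_mono) auto
      then have "norm m \<le> 1 / min_norm" using min_norm_pos by (simp add: pos_le_divide_eq mult.commute)
      then show False using m(3) assms by linarith
    qed
    then have ipn': "0 < ip n m" using ipn by simp
    have mm: "mvec 1 1 (m - n) n = m" by (simp add: mvec_def)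
    have "(m - n, n) \<in> cone 1 1 1 T"
      unfolding cone_def mem_Collect_eq case_prod_conv mm
      using n k ipn ipn' m by (auto simp: wd_simps ip_simps ip_self)
    then show "m \<in> (\<lambda>(a, n). a + n) ` {(a, n) \<in> cone 1 1 1 T. X < norm (a + n)}"
      using m by (intro image_eqI[of _ _ "(m - n, n)"]) auto
  qed
qed

lemma sum_cone1_prims:
  fixes G :: "complex \<Rightarrow> real"
  assumes X: "X \<ge> 1 / min_norm" and G: "\<And>m. norm m \<le> X \<Longrightarrow> G m = 0"
  shows "(\<Sum>(a, n)\<in>cone 1 1 1 T. G (a + n)) = (\<Sum>m\<in>prims T. G m)"
proof -
  have fin: "finite (cone 1 1 1 T)" by (rule finite_cone) auto
  have "(\<Sum>(a, n)\<in>cone 1 1 1 T. G (a + n)) = (\<Sum>(a, n)\<in>{(a, n) \<in> cone 1 1 1 T. X < norm (a + n)}. G (a + n))"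
  proof (rule sum.mono_neutral_right[OF fin])
    show "\<forall>x\<in>cone 1 1 1 T - {(a, n) \<in> cone 1 1 1 T. X < norm (a + n)}. (case x of (a, n) \<Rightarrow> G (a + n)) = 0"
    proof
      fix x assume "x \<in> cone 1 1 1 T - {(a, n) \<in> cone 1 1 1 T. X < norm (a + n)}"
      then have "norm (fst x + snd x) \<le> X" by (auto simp: not_less)
      then show "(case x of (a, n) \<Rightarrow> G (a + n)) = 0" by (simp add: case_prod_unfold G)
    qed
  qed auto
  also have "\<dots> = (\<Sum>x\<in>{(a, n) \<in> cone 1 1 1 T. X < norm (a + n)}. G ((\<lambda>(a, n). a + n) x))"
    by (simp add: case_prod_unfold)
  also have "\<dots> = (\<Sum>m\<in>{m \<in> prims T. X < norm m}. G m)"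
    by (rule sum.reindex_bij_betw[OF cone1_prims[OF X]])
  also have "\<dots> = (\<Sum>m\<in>prims T. G m)"
  proof (rule sum.mono_neutral_left)
    show "\<forall>m\<in>prims T - {m \<in> prims T. X < norm m}. G m = 0"
    proof
      fix m assume "m \<in> prims T - {m \<in> prims T. X < norm m}"
      then show "G m = 0" by (intro G) auto
    qed
  qed auto
  finally show ?thesis .
qed

end

section \<open>Smoothing the summand\<close>

definition clamp :: "real \<Rightarrow> real" where
  "clamp x = max 0 (min 1 x)"

lemma clamp_bounds: "0 \<le> clamp x" "clamp x \<le> 1"
  by (auto simp: clamp_def)

lemma clamp_eq_1: "1 \<le> x \<Longrightarrow> clamp x = 1"
  and clamp_nonzero: "clamp x \<noteq> 0 \<Longrightarrow> 0 < x"
  by (auto simp: clamp_def)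

lemma continuous_on_clamp [continuous_intros]:
  "continuous_on S g \<Longrightarrow> continuous_on S (\<lambda>x. clamp (g x))"
  unfolding clamp_def by (intro continuous_intros)

lemma integral_bump_le:
  fixes g :: "real \<Rightarrow> real"
  assumes g: "continuous_on {p..q} g" "\<And>x. x \<in> {p..q} \<Longrightarrow> 0 \<le> g x" "\<And>x. x \<in> {p..q} \<Longrightarrow> g x \<le> 1"
    "\<And>x. x \<in> {p..q} \<Longrightarrow> g x \<noteq> 0 \<Longrightarrow> x \<in> {a..b}" and ab: "a \<le> b"
  shows "integral {p..q} g \<le> b - a"
proof -
  have "integral {p..q} g = integral ({p..q} \<inter> {a..b}) g"
  proof -
    have "integral {p..q} g = integral {p..q} (\<lambda>x. if x \<in> {a..b} then g x else 0)"
      by (rule integral_cong) (use g(4) in auto)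
    also have "\<dots> = integral ({p..q} \<inter> {a..b}) g"
      unfolding integral_restrict_Int by (simp add: Int_commute)
    finally show ?thesis .
  qed
  also have "{p..q} \<inter> {a..b} = {max p a..min q b}" by auto
  also have "integral {max p a..min q b} g \<le> b - a"
  proof (cases "max p a \<le> min q b")
    case True
    have "integral {max p a..min q b} g \<le> integral {max p a..min q b} (\<lambda>x. 1)"
      by (rule integral_le) (use g in \<open>auto intro!: integrable_continuous_real continuous_on_subset[OF g(1)]\<close>)
    then show ?thesis using True by (simp add: max_def min_def split: if_splits)
  next
    case False
    then show ?thesis using ab by simp
  qed
  finally show ?thesis .
qed

lemma arctan_near_0:
  assumes "e > (0::real)"
  shows "\<exists>r>0. \<forall>x. \<bar>x\<bar> < r \<longrightarrow> \<bar>arctan x - x\<bar> \<le> e * \<bar>x\<bar>"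
proof -
  have "(arctan has_real_derivative 1) (at 0)" using DERIV_arctan[of 0] by simp
  then have "((\<lambda>x. arctan x / x) \<longlongrightarrow> 1) (at 0)"
    by (simp add: has_field_derivative_iff)
  then have "\<forall>\<^sub>F x in at 0. dist (arctan x / x) 1 < e" using assms by (rule tendstoD)
  then obtain r where r: "r > 0" "\<And>x. x \<noteq> 0 \<Longrightarrow> dist x 0 < r \<Longrightarrow> dist (arctan x / x) 1 < e"
    unfolding eventually_at by auto
  show ?thesis
  proof (intro exI[of _ r] conjI allI impI)
    fix x :: real assume x: "\<bar>x\<bar> < r"
    show "\<bar>arctan x - x\<bar> \<le> e * \<bar>x\<bar>"
    proof (cases "x = 0")
      case False
      have "\<bar>arctan x / x - 1\<bar> < e" using r(2)[OF False] x by (simp add: dist_real_def)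
      then have "\<bar>arctan x / x - 1\<bar> * \<bar>x\<bar> \<le> e * \<bar>x\<bar>" by (intro mult_right_mono) auto
      moreover have "\<bar>arctan x / x - 1\<bar> * \<bar>x\<bar> = \<bar>arctan x - x\<bar>"
        unfolding abs_mult[symmetric] using False by (simp add: left_diff_distrib)
      ultimately show ?thesis by simp
    qed simp
  qed (rule r)
qed

lemma uniform_continuity_compact_support:
  fixes f :: "real \<Rightarrow> real"
  assumes "continuous_on UNIV f" "\<And>x. \<bar>x\<bar> \<ge> K \<Longrightarrow> f x = 0" "e > 0"
  shows "\<exists>\<eta>>0. \<forall>x y. \<bar>x - y\<bar> \<le> \<eta> \<longrightarrow> \<bar>f x - f y\<bar> \<le> e"
proof -
  have "uniformly_continuous_on {-K-1..K+1} f"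
    by (intro compact_uniformly_continuous continuous_on_subset[OF assms(1)]) auto
  then obtain d where d: "d > 0" "\<And>x y. x \<in> {-K-1..K+1} \<Longrightarrow> y \<in> {-K-1..K+1} \<Longrightarrow> \<bar>x - y\<bar> < d \<Longrightarrow> \<bar>f x - f y\<bar> < e"
    using assms(3) unfolding uniformly_continuous_on_def dist_real_def by metis
  show ?thesis
  proof (intro exI[of _ "min 1 (d / 2)"] conjI allI impI)
    show "min 1 (d / 2) > 0" using d by simp
    fix x y :: real assume xy: "\<bar>x - y\<bar> \<le> min 1 (d / 2)"
    then have xy': "\<bar>x - y\<bar> \<le> 1" "\<bar>x - y\<bar> < d" using d by auto
    show "\<bar>f x - f y\<bar> \<le> e"
    proof (cases "x \<in> {-K-1..K+1} \<and> y \<in> {-K-1..K+1}")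
      case True then show ?thesis using d(2)[of x y] xy' by simp
    next
      case False
      then have "\<bar>x\<bar> \<ge> K" "\<bar>y\<bar> \<ge> K" using xy' by auto
      then show ?thesis using assms by simp
    qed
  qed
qed

text \<open>Parameters of the smoothing: \<open>\<epsilon>\<close> cuts off short differences, and \<open>k\<close> is the distance from the boundary of the \<open>\<tau>\<close>-range , in units of \<open>T\<close>, below which the summand is replaced by 0.\<close>

locale pair_test =
  fixes f :: "real \<Rightarrow> real" and K M \<epsilon> k :: real
  assumes f_cont: "continuous_on UNIV f" and f_even: "\<And>x. f (- x) = f x"
    and f_supp: "\<And>x. \<bar>x\<bar> \<ge> K \<Longrightarrow> f x = 0" and K_pos: "K > 0" and f_bound: "\<And>x. \<bar>f x\<bar> \<le> M"
    and \<epsilon>_pos: "0 < \<epsilon>" and \<epsilon>_le: "\<epsilon> \<le> 1" and k_pos: "0 < k" and k_le: "k \<le> 1 / 8"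
begin

lemma M_nonneg: "M \<ge> 0"
  using f_bound[of 0] by linarith

definition W :: real where "W = 4 * K"
definition B :: real where "B = 8 * K + 4 / \<epsilon>"
text \<open>Smooth cutoffs: \<open>cut_diff\<close> for the length of \<open>m\<close>, \<open>cut_start\<close> keeping the starting point \<open>y\<close> away from the origin, and \<open>cut_end\<close> keeping the end point \<open>y + d m\<close> away from the boundary of the disc.\<close>

definition cut_diff :: "real \<Rightarrow> real" where "cut_diff \<rho> = clamp (\<rho> / \<epsilon> - 1)"
definition cut_start :: "real \<Rightarrow> real \<Rightarrow> real" where "cut_start \<tau> \<rho> = clamp (\<tau> * \<rho> / k - 1)"
definition cut_end :: "real \<Rightarrow> real \<Rightarrow> real \<Rightarrow> real" where "cut_end d \<tau> \<rho> = clamp ((1 - (\<tau> + d) * \<rho>) / k - 1)"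
text \<open>The limit of the rescaled angle, with its denominator frozen outside the support of the cutoffs so that it is continuous everywhere.\<close>

definition angle_arg :: "real \<Rightarrow> real \<Rightarrow> real \<Rightarrow> real \<Rightarrow> real" where
  "angle_arg d w \<tau> \<rho> = d * w / (2 * max \<tau> k * max (\<tau> + d) k * (max \<rho> \<epsilon>)^2)"
definition main_term :: "real \<Rightarrow> real \<Rightarrow> real \<Rightarrow> real \<Rightarrow> real" where
  "main_term d w \<tau> \<rho> = f (angle_arg d w \<tau> \<rho>) * (cut_start \<tau> \<rho> * cut_end d \<tau> \<rho> * cut_diff \<rho>)"
definition w_bump :: "real \<Rightarrow> real" where "w_bump w = clamp (2 - \<bar>w\<bar> / W)"
definition t_bump :: "real \<Rightarrow> real" where "t_bump \<tau> = clamp (2 - \<bar>\<tau>\<bar> * \<epsilon>)"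
definition edge_bump :: "real \<Rightarrow> real" where "edge_bump x = clamp (2 - \<bar>x\<bar> / (2 * k))"
text \<open>A majorant of the error made by replacing the true summand by \<open>main_term\<close>: \<open>k\<close> on the bulk, and \<open>2 M\<close> on the two zones of width \<open>O(k)\<close> near the ends of the \<open>\<tau>\<close>-range.\<close>

definition err_term :: "real \<Rightarrow> real \<Rightarrow> real \<Rightarrow> real \<Rightarrow> real" where
  "err_term d w \<tau> \<rho> = w_bump w * (k * t_bump \<tau> + 2 * M * (edge_bump (\<tau> * \<rho>) + edge_bump ((\<tau> + d) * \<rho> - 1))) * cut_diff \<rho>"

lemma W_pos: "W > 0" using K_pos by (simp add: W_def)
lemma B_pos: "B > 0" using K_pos \<epsilon>_pos by (simp add: B_def add_pos_pos)

lemma cut_diff_nonzero: "cut_diff \<rho> \<noteq> 0 \<Longrightarrow> \<epsilon> < \<rho>"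
  using clamp_nonzero[of "\<rho> / \<epsilon> - 1"] \<epsilon>_pos by (auto simp: cut_diff_def field_simps)

lemma cut_diff_bounds: "0 \<le> cut_diff \<rho>" "cut_diff \<rho> \<le> 1"
  by (auto simp: cut_diff_def clamp_bounds)

lemma cut_diff_eq_1: "2 * \<epsilon> \<le> \<rho> \<Longrightarrow> cut_diff \<rho> = 1"
  unfolding cut_diff_def using \<epsilon>_pos by (intro clamp_eq_1) (simp add: field_simps)

lemma cut_start_bounds: "0 \<le> cut_start \<tau> \<rho>" "cut_start \<tau> \<rho> \<le> 1" and cut_end_bounds: "0 \<le> cut_end d \<tau> \<rho>" "cut_end d \<tau> \<rho> \<le> 1"
  by (auto simp: cut_start_def cut_end_def clamp_bounds)

lemma cut_start_nonzero: "cut_start \<tau> \<rho> \<noteq> 0 \<Longrightarrow> k < \<tau> * \<rho>"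
  using clamp_nonzero[of "\<tau> * \<rho> / k - 1"] k_pos by (auto simp: cut_start_def field_simps)

lemma cut_end_nonzero: "cut_end d \<tau> \<rho> \<noteq> 0 \<Longrightarrow> (\<tau> + d) * \<rho> < 1 - k"
  using clamp_nonzero[of "(1 - (\<tau> + d) * \<rho>) / k - 1"] k_pos by (auto simp: cut_end_def field_simps)

lemma cut_start_eq_1: "2 * k \<le> \<tau> * \<rho> \<Longrightarrow> cut_start \<tau> \<rho> = 1"
  unfolding cut_start_def using k_pos by (intro clamp_eq_1) (simp add: field_simps)

lemma cut_end_eq_1: "(\<tau> + d) * \<rho> \<le> 1 - 2 * k \<Longrightarrow> cut_end d \<tau> \<rho> = 1"
  unfolding cut_end_def using k_pos by (intro clamp_eq_1) (simp add: field_simps)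

lemma edge_bump_bounds: "0 \<le> edge_bump x" "edge_bump x \<le> 1"
  by (auto simp: edge_bump_def clamp_bounds)

lemma edge_bump_eq_1: "\<bar>x\<bar> \<le> 2 * k \<Longrightarrow> edge_bump x = 1"
  unfolding edge_bump_def using k_pos by (intro clamp_eq_1) (simp add: field_simps)

lemma edge_bump_nonzero: "edge_bump x \<noteq> 0 \<Longrightarrow> \<bar>x\<bar> < 4 * k"
  using clamp_nonzero[of "2 - \<bar>x\<bar> / (2 * k)"] k_pos by (auto simp: edge_bump_def field_simps)

lemma w_bump_bounds: "0 \<le> w_bump x" "w_bump x \<le> 1"
  by (auto simp: w_bump_def clamp_bounds)

lemma w_bump_eq_1: "\<bar>x\<bar> \<le> W \<Longrightarrow> w_bump x = 1"
  unfolding w_bump_def using W_pos by (intro clamp_eq_1) (simp add: field_simps)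

lemma w_bump_nonzero: "w_bump x \<noteq> 0 \<Longrightarrow> \<bar>x\<bar> < 2 * W"
  using clamp_nonzero[of "2 - \<bar>x\<bar> / W"] W_pos by (auto simp: w_bump_def field_simps)

lemma t_bump_bounds: "0 \<le> t_bump x" "t_bump x \<le> 1"
  by (auto simp: t_bump_def clamp_bounds)

lemma t_bump_eq_1: "\<bar>x\<bar> * \<epsilon> \<le> 1 \<Longrightarrow> t_bump x = 1"
  unfolding t_bump_def by (intro clamp_eq_1) simp

lemma t_bump_nonzero: "t_bump x \<noteq> 0 \<Longrightarrow> \<bar>x\<bar> < 2 / \<epsilon>"
  using clamp_nonzero[of "2 - \<bar>x\<bar> * \<epsilon>"] \<epsilon>_pos by (auto simp: t_bump_def field_simps)

lemma cutoffs_nonzero: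
  assumes "cut_start \<tau> \<rho> * cut_end d \<tau> \<rho> * cut_diff \<rho> \<noteq> 0" "1 \<le> d"
  shows "\<epsilon> < \<rho>" "\<rho> < 1" "d * \<rho> < 1" "k < \<tau> * \<rho>" "(\<tau> + d) * \<rho> < 1 - k" "k < \<tau>" "\<tau> < 1 / \<epsilon>" "\<tau> * \<rho> < 1"
proof -
  have nz: "cut_start \<tau> \<rho> \<noteq> 0" "cut_end d \<tau> \<rho> \<noteq> 0" "cut_diff \<rho> \<noteq> 0" using assms by auto
  show \<rho>: "\<epsilon> < \<rho>" by (rule cut_diff_nonzero[OF nz(3)])
  then have \<rho>0: "\<rho> > 0" using \<epsilon>_pos by simp
  show 1: "k < \<tau> * \<rho>" by (rule cut_start_nonzero[OF nz(1)])
  show 2: "(\<tau> + d) * \<rho> < 1 - k" by (rule cut_end_nonzero[OF nz(2)])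
  show d\<rho>: "d * \<rho> < 1" using 1 2 k_pos by (simp add: distrib_right)
  have "1 * \<rho> \<le> d * \<rho>" using assms \<rho>0 by (intro mult_right_mono) auto
  then show \<rho>1: "\<rho> < 1" using d\<rho> by simp
  have \<tau>0: "\<tau> > 0" using 1 k_pos \<rho>0 by (metis less_trans zero_less_mult_pos2)
  have "\<tau> * \<rho> \<le> \<tau> * 1" using \<tau>0 \<rho>1 by (intro mult_left_mono) auto
  then show "k < \<tau>" using 1 by simp
  have "d * \<rho> > 0" using assms \<rho>0 by simp
  then show 3: "\<tau> * \<rho> < 1" using 2 k_pos by (simp add: distrib_right)
  have "\<tau> * \<epsilon> \<le> \<tau> * \<rho>" using \<tau>0 \<rho> by (intro mult_left_mono) auto
  then show "\<tau> < 1 / \<epsilon>" using 3 \<epsilon>_pos by (simp add: pos_less_divide_eq)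
qed

lemma angle_arg_eq:
  assumes "cut_start \<tau> \<rho> * cut_end d \<tau> \<rho> * cut_diff \<rho> \<noteq> 0" "1 \<le> d"
  shows "angle_arg d w \<tau> \<rho> = d * w / (2 * \<tau> * (\<tau> + d) * \<rho>^2)"
  using cutoffs_nonzero[OF assms] assms k_le by (simp add: angle_arg_def max_def)

lemma window_small:
  assumes "\<bar>d * w / (2 * \<tau> * (\<tau> + d) * \<rho>^2)\<bar> < K" "0 < \<tau>" "\<tau> * \<rho> < 1" "(\<tau> + d) * \<rho> < 1" "0 < \<rho>" "1 \<le> d"
  shows "d * \<bar>w\<bar> \<le> 2 * K"
proof -
  have pos: "0 < 2 * \<tau> * (\<tau> + d) * \<rho>^2" using assms by simp
  have "\<bar>d * w\<bar> < K * (2 * \<tau> * (\<tau> + d) * \<rho>^2)"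
    using assms(1) pos by (simp add: abs_divide pos_divide_less_eq)
  also have "\<dots> = 2 * K * ((\<tau> * \<rho>) * ((\<tau> + d) * \<rho>))" by (simp add: power2_eq_square)
  also have "\<dots> \<le> 2 * K * (1 * 1)" using assms K_pos by (intro mult_left_mono mult_mono) auto
  finally show ?thesis using assms by (simp add: abs_mult)
qed

lemma main_term_nonzero:
  assumes "main_term d w \<tau> \<rho> \<noteq> 0" "1 \<le> d"
  shows "cut_start \<tau> \<rho> * cut_end d \<tau> \<rho> * cut_diff \<rho> \<noteq> 0" "d * \<bar>w\<bar> \<le> 2 * K" "\<bar>w\<bar> \<le> 2 * K"
proof -
  show c: "cut_start \<tau> \<rho> * cut_end d \<tau> \<rho> * cut_diff \<rho> \<noteq> 0" using assms by (auto simp: main_term_def)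
  note cn = cutoffs_nonzero[OF c assms(2)]
  have "f (angle_arg d w \<tau> \<rho>) \<noteq> 0" using assms by (auto simp: main_term_def)
  then have "\<bar>angle_arg d w \<tau> \<rho>\<bar> < K" using f_supp by (metis not_less)
  then show 1: "d * \<bar>w\<bar> \<le> 2 * K"
    unfolding angle_arg_eq[OF c assms(2)] by (rule window_small) (use cn k_pos \<epsilon>_pos assms in auto)
  have "1 * \<bar>w\<bar> \<le> d * \<bar>w\<bar>" using assms by (intro mult_right_mono) auto
  then show "\<bar>w\<bar> \<le> 2 * K" using 1 by simp
qed

lemma f_cont_comp: "continuous_on S g \<Longrightarrow> continuous_on S (\<lambda>x. f (g x))"
  by (rule continuous_on_compose2[OF f_cont]) auto

lemma angle_arg_denominator: "2 * max \<tau> k * max (\<tau> + d) k * (max \<rho> \<epsilon>)^2 \<noteq> 0"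
  using k_pos \<epsilon>_pos by (auto simp: max_def)

lemma main_term_test: 
  assumes d: "1 \<le> d"
  shows "test_function (main_term d) B"
proof
  show "continuous_on UNIV (\<lambda>(w, t, r). main_term d w t r)"
    unfolding main_term_def angle_arg_def cut_start_def cut_end_def cut_diff_def case_prod_unfold
    using k_pos \<epsilon>_pos angle_arg_denominator by (intro continuous_intros f_cont_comp) auto
  show "main_term d w t r = 0" if h: "\<bar>w\<bar> > B \<or> \<bar>t\<bar> > B" for w t r
  proof (rule ccontr)
    assume nz: "main_term d w t r \<noteq> 0"
    note c = main_term_nonzero[OF nz d] cutoffs_nonzero[OF main_term_nonzero(1)[OF nz d] d]
    have "0 < K" "0 < 4 / \<epsilon>" "1 / \<epsilon> \<le> 4 / \<epsilon>" using K_pos \<epsilon>_pos by (auto simp: divide_right_mono)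
    moreover have "\<bar>t\<bar> < 1 / \<epsilon>" using c k_pos by simp
    ultimately show False using h c(3) by (auto simp: B_def)
  qed
qed (rule B_pos)

lemma err_term_nonneg: "0 \<le> err_term d w t r"
  unfolding err_term_def using w_bump_bounds t_bump_bounds edge_bump_bounds cut_diff_bounds k_pos M_nonneg by (intro mult_nonneg_nonneg add_nonneg_nonneg) auto

lemma err_term_test:
  assumes d: "1 \<le> d" "d \<le> 1 / \<epsilon>"
  shows "test_function (err_term d) B"
proof
  show "continuous_on UNIV (\<lambda>(w, t, r). err_term d w t r)"
    unfolding err_term_def w_bump_def t_bump_def edge_bump_def cut_diff_def case_prod_unfold
    using k_pos \<epsilon>_pos W_pos by (intro continuous_intros) auto
  show "err_term d w t r = 0" if h: "\<bar>w\<bar> > B \<or> \<bar>t\<bar> > B" for w t r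
  proof (rule ccontr)
    assume "err_term d w t r \<noteq> 0"
    then have nz: "w_bump w \<noteq> 0" "cut_diff r \<noteq> 0" "t_bump t \<noteq> 0 \<or> edge_bump (t * r) \<noteq> 0 \<or> edge_bump ((t + d) * r - 1) \<noteq> 0"
      by (auto simp: err_term_def)
    have r: "\<epsilon> < r" by (rule cut_diff_nonzero[OF nz(2)])
    have w: "\<bar>w\<bar> < 8 * K" using w_bump_nonzero[OF nz(1)] by (simp add: W_def)
    have e4: "\<bar>x\<bar> < y / \<epsilon>" if "\<bar>x * r\<bar> < y" for x y
    proof -
      have "\<bar>x\<bar> * \<epsilon> \<le> \<bar>x\<bar> * r" using r by (intro mult_left_mono) auto
      also have "\<dots> = \<bar>x * r\<bar>" using r \<epsilon>_pos by (simp add: abs_mult)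
      finally show ?thesis using that \<epsilon>_pos by (simp add: pos_less_divide_eq)
    qed
    have t: "\<bar>t\<bar> < 4 / \<epsilon>"
      using nz(3)
    proof (elim disjE)
      assume "t_bump t \<noteq> 0"
      then have "\<bar>t\<bar> < 2 / \<epsilon>" by (rule t_bump_nonzero)
      also have "\<dots> \<le> 4 / \<epsilon>" using \<epsilon>_pos by (intro divide_right_mono) auto
      finally show ?thesis .
    next
      assume "edge_bump (t * r) \<noteq> 0"
      then have "\<bar>t * r\<bar> < 4" using edge_bump_nonzero k_le by fastforce
      then show ?thesis by (rule e4)
    next
      assume "edge_bump ((t + d) * r - 1) \<noteq> 0"
      then have "\<bar>(t + d) * r - 1\<bar> < 4 * k" by (rule edge_bump_nonzero)
      then have "\<bar>(t + d) * r\<bar> < 3" using k_le by linarith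
      then have "\<bar>t + d\<bar> < 3 / \<epsilon>" by (rule e4)
      then have "\<bar>t\<bar> < 3 / \<epsilon> + 1 / \<epsilon>" using d by linarith
      then show ?thesis by (simp add: add_divide_distrib[symmetric])
    qed
    show False using h w t K_pos \<epsilon>_pos by (auto simp: B_def add_pos_pos)
  qed
qed (rule B_pos)

lemma edge_bump_integral:
  assumes "\<rho> > 0"
  shows "integral {p..q} (\<lambda>t. edge_bump ((t + d) * \<rho> - c)) \<le> 8 * k / \<rho>"
proof -
  have "integral {p..q} (\<lambda>t. edge_bump ((t + d) * \<rho> - c)) \<le> ((c + 4 * k) / \<rho> - d) - ((c - 4 * k) / \<rho> - d)"
  proof (rule integral_bump_le)
    show "continuous_on {p..q} (\<lambda>t. edge_bump ((t + d) * \<rho> - c))"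
      unfolding edge_bump_def using k_pos by (intro continuous_intros) auto
    fix t assume "edge_bump ((t + d) * \<rho> - c) \<noteq> 0"
    then have "\<bar>(t + d) * \<rho> - c\<bar> < 4 * k" by (rule edge_bump_nonzero)
    then have "(t + d) * \<rho> < c + 4 * k" "c - 4 * k < (t + d) * \<rho>" by linarith+
    then have "t + d < (c + 4 * k) / \<rho>" "(c - 4 * k) / \<rho> < t + d"
      using assms by (simp_all add: pos_less_divide_eq pos_divide_less_eq)
    then show "t \<in> {(c - 4 * k) / \<rho> - d..(c + 4 * k) / \<rho> - d}" by simp
  next
    have "(c - 4 * k) / \<rho> \<le> (c + 4 * k) / \<rho>" using assms k_pos by (intro divide_right_mono) auto
    then show "(c - 4 * k) / \<rho> - d \<le> (c + 4 * k) / \<rho> - d" by simp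
  qed (auto simp: edge_bump_bounds)
  also have "\<dots> = 8 * k / \<rho>" using assms by (simp add: field_simps)
  finally show ?thesis .
qed

lemma edge_bump_integral': "\<rho> > 0 \<Longrightarrow> integral {p..q} (\<lambda>t. edge_bump (t * \<rho>)) \<le> 8 * k / \<rho>"
  using edge_bump_integral[of \<rho> p q 0 0] by simp

lemma continuous_on_edge_bump [continuous_intros]: "continuous_on S g \<Longrightarrow> continuous_on S (\<lambda>x. edge_bump (g x))"
  unfolding edge_bump_def using k_pos by (intro continuous_intros) auto

lemma err_term_mean:
  assumes "1 \<le> d" "d \<le> 1 / \<epsilon>"
  shows "test_function.mean (err_term d) B \<rho> \<le> 16 * K * ((4 + 32 * M) * k / \<epsilon>)"
proof -
  define X where "X = k * integral {-B..B} t_bump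
    + 2 * M * (integral {-B..B} (\<lambda>t. edge_bump (t * \<rho>)) + integral {-B..B} (\<lambda>t. edge_bump ((t + d) * \<rho> - 1)))"
  have t_bump_c: "continuous_on S t_bump" for S unfolding t_bump_def by (intro continuous_intros)
  have inner: "integral {-B..B} (\<lambda>t. err_term d w t \<rho>) = w_bump w * (cut_diff \<rho> * X)" for w
  proof -
    have h: "((\<lambda>t. k * t_bump t + 2 * M * (edge_bump (t * \<rho>) + edge_bump ((t + d) * \<rho> - 1))) has_integral X) {-B..B}"
      unfolding X_def
      by (intro has_integral_add has_integral_mult_right integrable_integral integrable_continuous_real
          continuous_intros t_bump_c)
    have eq: "(\<lambda>t. err_term d w t \<rho>) = (\<lambda>t. (w_bump w * cut_diff \<rho>) * (k * t_bump t + 2 * M * (edge_bump (t * \<rho>) + edge_bump ((t + d) * \<rho> - 1))))"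
      by (simp add: err_term_def mult_ac)
    show ?thesis unfolding eq integral_unique[OF has_integral_mult_right[OF h]] by (simp only: mult.assoc)
  qed
  have mean: "test_function.mean (err_term d) B \<rho> = integral {-B..B} w_bump * (cut_diff \<rho> * X)"
    unfolding test_function.mean_def[OF err_term_test[OF assms]] inner by simp
  have w_bump_c: "continuous_on S w_bump" for S unfolding w_bump_def using W_pos by (intro continuous_intros) auto
  have w_bump_i: "integral {-B..B} w_bump \<le> 2 * W - (- 2 * W)"
  proof (rule integral_bump_le)
    fix x assume "w_bump x \<noteq> 0"
    then have "\<bar>x\<bar> < 2 * W" by (rule w_bump_nonzero)
    then show "x \<in> {- 2 * W..2 * W}" by auto
  qed (use W_pos in \<open>auto simp: w_bump_bounds w_bump_c\<close>)
  have w_bump_0: "0 \<le> integral {-B..B} w_bump" by (intro integral_nonneg integrable_continuous_real w_bump_c) (auto simp: w_bump_bounds)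
  have t_bump_i: "integral {-B..B} t_bump \<le> 2 / \<epsilon> - (- 2 / \<epsilon>)"
  proof (rule integral_bump_le)
    fix x assume "t_bump x \<noteq> 0"
    then have "\<bar>x\<bar> < 2 / \<epsilon>" by (rule t_bump_nonzero)
    then show "x \<in> {- 2 / \<epsilon>..2 / \<epsilon>}" by auto
  qed (use \<epsilon>_pos in \<open>auto simp: t_bump_bounds t_bump_c\<close>)
  have X0: "0 \<le> X" unfolding X_def
    by (intro add_nonneg_nonneg mult_nonneg_nonneg integral_nonneg integrable_continuous_real continuous_intros t_bump_c)
      (use k_pos M_nonneg in \<open>auto simp: edge_bump_bounds t_bump_bounds\<close>)
  have "cut_diff \<rho> * X \<le> (4 + 32 * M) * k / \<epsilon>"
  proof (cases "\<epsilon> < \<rho>")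
    case False
    then have "cut_diff \<rho> = 0" using cut_diff_nonzero by blast
    then show ?thesis using M_nonneg k_pos \<epsilon>_pos by simp
  next
    case True
    then have \<rho>: "\<rho> > 0" using \<epsilon>_pos by simp
    have "8 * k / \<rho> \<le> 8 * k / \<epsilon>" using True \<epsilon>_pos k_pos by (intro divide_left_mono) auto
    then have b: "integral {-B..B} (\<lambda>t. edge_bump (t * \<rho>)) \<le> 8 * k / \<epsilon>" "integral {-B..B} (\<lambda>t. edge_bump ((t + d) * \<rho> - 1)) \<le> 8 * k / \<epsilon>"
      using edge_bump_integral'[OF \<rho>, of "-B" B] edge_bump_integral[OF \<rho>, of "-B" B d 1] by linarith+
    have "cut_diff \<rho> * X \<le> 1 * X" using X0 cut_diff_bounds by (intro mult_right_mono) auto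
    also have "\<dots> \<le> k * (2 / \<epsilon> - (- 2 / \<epsilon>)) + 2 * M * (8 * k / \<epsilon> + 8 * k / \<epsilon>)"
      unfolding X_def mult_1 using b t_bump_i k_pos M_nonneg by (intro add_mono mult_left_mono) auto
    also have "\<dots> = (4 + 32 * M) * k / \<epsilon>" using \<epsilon>_pos by (simp add: field_simps)
    finally show ?thesis .
  qed
  then have "integral {-B..B} w_bump * (cut_diff \<rho> * X) \<le> (4 * W) * ((4 + 32 * M) * k / \<epsilon>)"
    using w_bump_i w_bump_0 X0 cut_diff_bounds W_pos by (intro mult_mono) auto
  then show ?thesis unfolding mean by (simp add: W_def)
qed

lemma cutoffs_defect:
  assumes "0 \<le> \<tau>" "0 < \<rho>" "(\<tau> + d) * \<rho> \<le> 1"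
  shows "\<bar>1 - cut_start \<tau> \<rho> * cut_end d \<tau> \<rho>\<bar> \<le> edge_bump (\<tau> * \<rho>) + edge_bump ((\<tau> + d) * \<rho> - 1)"
proof -
  have c: "0 \<le> cut_start \<tau> \<rho> * cut_end d \<tau> \<rho>" "cut_start \<tau> \<rho> * cut_end d \<tau> \<rho> \<le> 1"
    using cut_start_bounds cut_end_bounds by (auto intro: mult_le_one)
  consider "\<tau> * \<rho> \<le> 2 * k" | "(\<tau> + d) * \<rho> \<ge> 1 - 2 * k" | "2 * k \<le> \<tau> * \<rho>" "(\<tau> + d) * \<rho> \<le> 1 - 2 * k" by linarith
  then show ?thesis
  proof cases
    case 1
    then have "edge_bump (\<tau> * \<rho>) = 1" using assms by (intro edge_bump_eq_1) auto
    then show ?thesis using c edge_bump_bounds[of "(\<tau> + d) * \<rho> - 1"] by linarith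
  next
    case 2
    then have "edge_bump ((\<tau> + d) * \<rho> - 1) = 1" using assms by (intro edge_bump_eq_1) auto
    then show ?thesis using c edge_bump_bounds[of "\<tau> * \<rho>"] by linarith
  next
    case 3
    then show ?thesis using edge_bump_bounds by (simp add: cut_start_eq_1 cut_end_eq_1)
  qed
qed

text \<open>Integrating over \<open>w\<close> first turns \<open>f\<close> into its integral times the Jacobian \<open>2 \<tau> (\<tau> + d) \<rho>^2 / d\<close>, whose integral over the \<open>\<tau>\<close>-range is \<open>radial_profile\<close>. The cutoffs cost the zones of width \<open>O(k / \<rho>)\<close>.\<close>

lemma main_term_mean:
  assumes d: "1 \<le> d" and \<rho>: "0 < \<rho>"
  defines "I \<equiv> integral {-K..K} f"
  shows "\<bar>test_function.mean (main_term d) B \<rho> - cut_diff \<rho> * I * (if d * \<rho> < 1 then radial_profile (d * \<rho>) else 0)\<bar>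
    \<le> cut_diff \<rho> * \<bar>I\<bar> * (32 * k / (d * \<rho>))"
proof (cases "cut_diff \<rho> = 0 \<or> d * \<rho> \<ge> 1")
  case True
  have "main_term d w \<tau> \<rho> = 0" for w \<tau>
    using main_term_nonzero(1)[OF _ d, of w \<tau> \<rho>] cutoffs_nonzero(3)[OF _ d, of \<tau> \<rho>] True by fastforce
  then have "test_function.mean (main_term d) B \<rho> = 0"
    unfolding test_function.mean_def[OF main_term_test[OF d]] by simp
  then show ?thesis using True cut_diff_bounds[of \<rho>] d \<rho> k_pos by auto
next
  case False
  then have c0: "cut_diff \<rho> \<noteq> 0" and d\<rho>: "d * \<rho> < 1" by auto
  have \<epsilon>\<rho>: "\<epsilon> < \<rho>" by (rule cut_diff_nonzero[OF c0])
  define q where "q \<tau> = 2 * \<rho>^2 / d * (\<tau> * \<tau> + d * \<tau>)" for \<tau>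
  define L where "L = 1 / \<rho> - d"
  have L: "0 < L" "L \<le> B"
  proof -
    show "0 < L" using d\<rho> \<rho> by (simp add: L_def field_simps)
    have "1 / \<rho> \<le> 1 / \<epsilon>" using \<epsilon>\<rho> \<epsilon>_pos by (intro divide_left_mono) auto
    also have "1 / \<epsilon> \<le> 4 / \<epsilon>" using \<epsilon>_pos by (intro divide_right_mono) auto
    finally show "L \<le> B" using d K_pos by (simp add: L_def B_def)
  qed
  have range: "0 < \<tau>" "\<tau> < L" if "cut_start \<tau> \<rho> * cut_end d \<tau> \<rho> \<noteq> 0" for \<tau>
  proof -
    have "cut_start \<tau> \<rho> * cut_end d \<tau> \<rho> * cut_diff \<rho> \<noteq> 0" using that c0 by simp
    note c = cutoffs_nonzero[OF this d]
    show "0 < \<tau>" using c(6) k_pos by simp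
    have "(\<tau> + d) * \<rho> < 1" using c(5) k_pos by simp
    then have "\<tau> + d < 1 / \<rho>" using \<rho> by (simp add: pos_less_divide_eq)
    then show "\<tau> < L" by (simp add: L_def)
  qed
  have q_bounds: "0 \<le> q \<tau>" "q \<tau> \<le> 2 / d" if "0 \<le> \<tau>" "\<tau> \<le> L" for \<tau>
  proof -
    show "0 \<le> q \<tau>" unfolding q_def using that d by auto
    have 2: "(\<tau> + d) * \<rho> \<le> 1" using that \<rho> by (simp add: L_def field_simps)
    have "\<tau> * \<rho> \<le> (\<tau> + d) * \<rho>" using d \<rho> by (intro mult_right_mono) auto
    then have 1: "\<tau> * \<rho> \<le> 1" using 2 by linarith
    have "q \<tau> = 2 / d * ((\<tau> * \<rho>) * ((\<tau> + d) * \<rho>))" unfolding q_def using d by (simp add: power2_eq_square field_simps)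
    also have "\<dots> \<le> 2 / d * (1 * 1)" using 1 2 that d \<rho> by (intro mult_left_mono mult_mono) auto
    finally show "q \<tau> \<le> 2 / d" by simp
  qed
  have fI: "(f has_integral I) {-K..K}"
    unfolding I_def by (intro integrable_integral integrable_continuous_real continuous_on_subset[OF f_cont]) auto
  have f_stretch: "integral {-B..B} (\<lambda>w. f (s * w)) = I / s" if s: "s > 0" "K / s \<le> B" for s
  proof -
    have "((\<lambda>w. f (s * w)) has_integral (1 / s) * I) ((\<lambda>x. x / s) ` {-K..K})"
      using has_integral_stretch_real[OF fI, of s] s by simp
    moreover have "(\<lambda>x. x / s) ` {-K..K} = {-(K / s)..K / s}"
      using image_divide_atLeastAtMost[of s "-K" K] s K_pos by simp
    ultimately have "((\<lambda>w. f (s * w)) has_integral I / s) {-(K / s)..K / s}" by simp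
    then have "((\<lambda>w. if w \<in> {-(K / s)..K / s} then f (s * w) else 0) has_integral I / s) {-B..B}"
      unfolding interval_cbox by (rule has_integral_restrict_closed_subinterval) (use s in auto)
    moreover have "(\<lambda>w. if w \<in> {-(K / s)..K / s} then f (s * w) else 0) = (\<lambda>w. f (s * w))"
    proof
      fix w
      have "f (s * w) = 0" if w: "w \<notin> {-(K / s)..K / s}"
      proof (rule f_supp)
        have "K / s < \<bar>w\<bar>" using w by auto
        then show "K \<le> \<bar>s * w\<bar>" using s by (simp add: pos_divide_less_eq abs_mult mult.commute)
      qed
      then show "(if w \<in> {-(K / s)..K / s} then f (s * w) else 0) = f (s * w)" by auto
    qed
    ultimately show ?thesis by (simp add: integral_unique)
  qed
  have inner: "integral {-B..B} (\<lambda>w. main_term d w \<tau> \<rho>) = (I * cut_diff \<rho>) * (cut_start \<tau> \<rho> * cut_end d \<tau> \<rho> * q \<tau>)" for \<tau>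
  proof (cases "cut_start \<tau> \<rho> * cut_end d \<tau> \<rho> = 0")
    case True
    then have "main_term d w \<tau> \<rho> = 0" for w by (auto simp: main_term_def)
    then show ?thesis using True by auto
  next
    case nz: False
    have \<tau>: "0 < \<tau>" "\<tau> < L" using range[OF nz] by auto
    have cc: "cut_start \<tau> \<rho> * cut_end d \<tau> \<rho> * cut_diff \<rho> \<noteq> 0" using nz c0 by simp
    have q0: "0 < q \<tau>" unfolding q_def using \<tau> d \<rho> by (intro mult_pos_pos divide_pos_pos add_pos_pos) auto
    have "main_term d w \<tau> \<rho> = f (1 / q \<tau> * w) * (cut_start \<tau> \<rho> * cut_end d \<tau> \<rho> * cut_diff \<rho>)" for w
    proof -
      have "2 * \<tau> * (\<tau> + d) * \<rho>^2 = d * q \<tau>" using d by (simp add: q_def field_simps power2_eq_square)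
      then show ?thesis unfolding main_term_def angle_arg_eq[OF cc d] using d by simp
    qed
    then have "integral {-B..B} (\<lambda>w. main_term d w \<tau> \<rho>) = integral {-B..B} (\<lambda>w. f (1 / q \<tau> * w)) * (cut_start \<tau> \<rho> * cut_end d \<tau> \<rho> * cut_diff \<rho>)"
      by simp
    also have "integral {-B..B} (\<lambda>w. f (1 / q \<tau> * w)) = I / (1 / q \<tau>)"
    proof (rule f_stretch)
      have "2 / d \<le> 2" using d by (simp add: field_simps)
      then have "q \<tau> \<le> 2" using q_bounds(2)[of \<tau>] \<tau> by simp
      then have "K * q \<tau> \<le> K * 2" using K_pos by (intro mult_left_mono) auto
      moreover have "0 < 4 / \<epsilon>" using \<epsilon>_pos by simp
      moreover have "K / (1 / q \<tau>) = K * q \<tau>" by simp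
      ultimately show "K / (1 / q \<tau>) \<le> B" using K_pos unfolding B_def by linarith
    qed (use q0 in simp)
    finally show ?thesis by simp
  qed
  have c_cont: "continuous_on S (\<lambda>\<tau>. cut_start \<tau> \<rho> * cut_end d \<tau> \<rho> * q \<tau>)" for S
    unfolding cut_start_def cut_end_def q_def using k_pos d by (intro continuous_intros) auto
  have q_cont: "continuous_on S q" for S unfolding q_def using d by (intro continuous_intros) auto
  have swap: "test_function.mean (main_term d) B \<rho> = integral {-B..B} (\<lambda>\<tau>. integral {-B..B} (\<lambda>w. main_term d w \<tau> \<rho>))"
  proof -
    have "continuous_on (cbox (-B, -B) (B, B)) (\<lambda>(w, \<tau>). main_term d w \<tau> \<rho>)"
      using continuous_on_compose2[OF test_function.H_cont[OF main_term_test[OF d]], of "cbox (-B, -B) (B, B)" "\<lambda>x. (fst x, snd x, \<rho>)"]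
      by (simp add: case_prod_unfold continuous_intros)
    from integral_swap_continuous[OF this] show ?thesis
      unfolding test_function.mean_def[OF main_term_test[OF d]] interval_cbox .
  qed
  have restr: "integral {-B..B} (\<lambda>\<tau>. cut_start \<tau> \<rho> * cut_end d \<tau> \<rho> * q \<tau>) = integral {0..L} (\<lambda>\<tau>. cut_start \<tau> \<rho> * cut_end d \<tau> \<rho> * q \<tau>)"
  proof -
    have "(\<lambda>\<tau>. cut_start \<tau> \<rho> * cut_end d \<tau> \<rho> * q \<tau>) = (\<lambda>\<tau>. if \<tau> \<in> {0..L} then cut_start \<tau> \<rho> * cut_end d \<tau> \<rho> * q \<tau> else 0)"
    proof
      fix \<tau>
      have "cut_start \<tau> \<rho> * cut_end d \<tau> \<rho> = 0" if "\<tau> \<notin> {0..L}" using range[of \<tau>] that by fastforce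
      then show "cut_start \<tau> \<rho> * cut_end d \<tau> \<rho> * q \<tau> = (if \<tau> \<in> {0..L} then cut_start \<tau> \<rho> * cut_end d \<tau> \<rho> * q \<tau> else 0)" by simp
    qed
    then have "integral {-B..B} (\<lambda>\<tau>. cut_start \<tau> \<rho> * cut_end d \<tau> \<rho> * q \<tau>) =
      integral {-B..B} (\<lambda>\<tau>. if \<tau> \<in> {0..L} then cut_start \<tau> \<rho> * cut_end d \<tau> \<rho> * q \<tau> else 0)" by (rule arg_cong)
    also have "\<dots> = integral ({0..L} \<inter> {-B..B}) (\<lambda>\<tau>. cut_start \<tau> \<rho> * cut_end d \<tau> \<rho> * q \<tau>)" by (rule integral_restrict_Int)
    also have "{0..L} \<inter> {-B..B} = {0..L}" using L B_pos by auto
    finally show ?thesis .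
  qed
  have q_int: "(q has_integral radial_profile (d * \<rho>)) {0..L}"
  proof -
    define Q where "Q \<tau> = 2 * \<rho>^2 / d * (1 / 3 * (\<tau> * \<tau> * \<tau>) + d / 2 * (\<tau> * \<tau>))" for \<tau>
    have "(q has_integral Q L - Q 0) {0..L}"
    proof (rule fundamental_theorem_of_calculus[where f = Q])
      fix x assume "x \<in> {0..L}"
      have "(Q has_real_derivative q x) (at x within {0..L})"
        unfolding Q_def q_def using d by (auto intro!: derivative_eq_intros simp: field_simps)
      then show "(Q has_vector_derivative q x) (at x within {0..L})"
        by (simp add: has_real_derivative_iff_has_vector_derivative)
    qed (use L in simp)
    moreover have "Q L - Q 0 = radial_profile (d * \<rho>)"
    proof -
      define r where "r = d * \<rho>"
      have r: "0 < r" using d \<rho> by (simp add: r_def)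
      have L\<rho>: "L * \<rho> = 1 - r" using \<rho> by (simp add: L_def r_def field_simps)
      have "Q L - Q 0 = (2 / 3 * ((L * \<rho>) * (L * \<rho>) * (L * \<rho>)) + r * ((L * \<rho>) * (L * \<rho>))) / r"
        unfolding Q_def r_def using d \<rho> by (simp add: field_simps power2_eq_square)
      also have "\<dots> = (2 / 3 - r + r * r * r / 3) / r"
      proof -
        have "2 / 3 * ((1 - r) * (1 - r) * (1 - r)) + r * ((1 - r) * (1 - r)) = 2 / 3 - r + r * r * r / 3"
          by (simp add: algebra_simps)
        then show ?thesis unfolding L\<rho> by (rule arg_cong)
      qed
      also have "\<dots> = radial_profile r" using r unfolding radial_profile_def by (simp add: add_divide_distrib diff_divide_distrib power2_eq_square)
      finally show ?thesis unfolding r_def .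
    qed
    ultimately show ?thesis by simp
  qed
  have err: "\<bar>integral {0..L} (\<lambda>\<tau>. cut_start \<tau> \<rho> * cut_end d \<tau> \<rho> * q \<tau>) - radial_profile (d * \<rho>)\<bar> \<le> 32 * k / (d * \<rho>)"
  proof -
    have "\<bar>integral {0..L} (\<lambda>\<tau>. cut_start \<tau> \<rho> * cut_end d \<tau> \<rho> * q \<tau>) - radial_profile (d * \<rho>)\<bar>
      = norm (integral {0..L} (\<lambda>\<tau>. cut_start \<tau> \<rho> * cut_end d \<tau> \<rho> * q \<tau> - q \<tau>))"
      unfolding integral_unique[OF q_int, symmetric] real_norm_def
      by (subst integral_diff) (auto intro!: integrable_continuous_real c_cont q_cont)
    also have "\<dots> \<le> integral {0..L} (\<lambda>\<tau>. 2 / d * (edge_bump (\<tau> * \<rho>) + edge_bump ((\<tau> + d) * \<rho> - 1)))"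
    proof (rule integral_norm_bound_integral)
      fix \<tau> assume "\<tau> \<in> {0..L}"
      then have \<tau>: "0 \<le> \<tau>" "\<tau> \<le> L" by auto
      have 2: "(\<tau> + d) * \<rho> \<le> 1" using \<tau> \<rho> by (simp add: L_def field_simps)
      have "norm (cut_start \<tau> \<rho> * cut_end d \<tau> \<rho> * q \<tau> - q \<tau>) = q \<tau> * \<bar>1 - cut_start \<tau> \<rho> * cut_end d \<tau> \<rho>\<bar>"
      proof -
        have "cut_start \<tau> \<rho> * cut_end d \<tau> \<rho> * q \<tau> - q \<tau> = - (q \<tau> * (1 - cut_start \<tau> \<rho> * cut_end d \<tau> \<rho>))" by (simp add: algebra_simps)
        then show ?thesis using q_bounds(1)[OF \<tau>] by (simp only: real_norm_def abs_minus_cancel abs_mult abs_of_nonneg)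
      qed
      also have "\<dots> \<le> 2 / d * (edge_bump (\<tau> * \<rho>) + edge_bump ((\<tau> + d) * \<rho> - 1))"
        using q_bounds[OF \<tau>] d by (intro mult_mono cutoffs_defect \<tau> \<rho> 2) auto
      finally show "norm (cut_start \<tau> \<rho> * cut_end d \<tau> \<rho> * q \<tau> - q \<tau>) \<le> 2 / d * (edge_bump (\<tau> * \<rho>) + edge_bump ((\<tau> + d) * \<rho> - 1))" .
    qed (use d in \<open>auto intro!: integrable_continuous_real continuous_intros c_cont q_cont\<close>)
    also have "\<dots> = 2 / d * (integral {0..L} (\<lambda>\<tau>. edge_bump (\<tau> * \<rho>)) + integral {0..L} (\<lambda>\<tau>. edge_bump ((\<tau> + d) * \<rho> - 1)))"
      unfolding integral_mult_right
      by (subst integral_add) (auto intro!: integrable_continuous_real continuous_intros)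
    also have "\<dots> \<le> 2 / d * (8 * k / \<rho> + 8 * k / \<rho>)"
      using d edge_bump_integral[OF \<rho>] edge_bump_integral'[OF \<rho>] by (intro mult_left_mono add_mono) auto
    also have "\<dots> = 32 * k / (d * \<rho>)" using d \<rho> by (simp add: field_simps)
    finally show ?thesis .
  qed
  have "test_function.mean (main_term d) B \<rho> - cut_diff \<rho> * I * (if d * \<rho> < 1 then radial_profile (d * \<rho>) else 0)
    = (I * cut_diff \<rho>) * (integral {0..L} (\<lambda>\<tau>. cut_start \<tau> \<rho> * cut_end d \<tau> \<rho> * q \<tau>) - radial_profile (d * \<rho>))"
    unfolding swap inner integral_mult_right restr using d\<rho> by (simp add: algebra_simps)
  also have "\<bar>\<dots>\<bar> \<le> (cut_diff \<rho> * \<bar>I\<bar>) * (32 * k / (d * \<rho>))"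
  proof -
    have "\<bar>(I * cut_diff \<rho>) * x\<bar> = (cut_diff \<rho> * \<bar>I\<bar>) * \<bar>x\<bar>" for x
      using cut_diff_bounds[of \<rho>] by (simp add: abs_mult)
    then show ?thesis using mult_left_mono[OF err, of "cut_diff \<rho> * \<bar>I\<bar>"] cut_diff_bounds[of \<rho>] by simp
  qed
  finally show ?thesis .
qed

end

section \<open>Linearization of the angle\<close>

lemma eventually_small_inverse_square:
  assumes "c \<ge> (0::real)" "e > 0"
  shows "\<forall>\<^sub>F T::real in at_top. c / T^2 < e"
proof -
  have "((\<lambda>T::real. c / T^2) \<longlongrightarrow> 0) at_top"
    by (rule tendsto_divide_0[OF tendsto_const])
      (rule filterlim_at_top_imp_at_infinity[OF filterlim_pow_at_top[OF _ filterlim_ident]], simp)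
  then show ?thesis by (rule order_tendstoD) (rule assms)
qed

context pair_test
begin

text \<open>The angle is \<open>arctan x\<close> with \<open>x = O(1 / T^2)\<close> uniformly, so \<open>arctan x\<close> may be replaced by \<open>x\<close> and then \<open>N\<close> by \<open>\<pi> T^2\<close>; uniform continuity of \<open>f\<close> does the rest.\<close>

lemma angle_linearization:
  assumes N: "((\<lambda>T. N T / (pi * T^2)) \<longlongrightarrow> 1) at_top"
  shows "\<forall>\<^sub>F T in at_top. \<forall>w \<tau> \<rho> d. k \<le> \<tau> \<longrightarrow> \<epsilon> \<le> \<rho> \<longrightarrow> 1 \<le> d \<longrightarrow> \<bar>w\<bar> \<le> W \<longrightarrow>
    \<bar>f (N T / (2 * pi) * arctan (d * (w / (\<rho> * T)^2) / (\<tau> * (\<tau> + d) + (w / (\<rho> * T)^2)^2)))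
      - f (d * w / (2 * \<tau> * (\<tau> + d) * \<rho>^2))\<bar> \<le> k"
proof -
  obtain \<eta> where \<eta>: "\<eta> > 0" "\<And>x y. \<bar>x - y\<bar> \<le> \<eta> \<Longrightarrow> \<bar>f x - f y\<bar> \<le> k"
    using uniform_continuity_compact_support[OF f_cont f_supp k_pos] by blast
  define Y where "Y = W / (k * \<epsilon>^2)"
  have Y: "Y > 0" using W_pos k_pos \<epsilon>_pos by (simp add: Y_def)
  define e where "e = min 1 (\<eta> / (3 * Y))"
  have e: "e > 0" "e \<le> 1" "3 * Y * e \<le> \<eta>"
  proof -
    show "e > 0" "e \<le> 1" using \<eta> Y by (auto simp: e_def)
    have "3 * Y * e \<le> 3 * Y * (\<eta> / (3 * Y))" using Y by (intro mult_left_mono) (auto simp: e_def)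
    then show "3 * Y * e \<le> \<eta>" using Y by simp
  qed
  obtain r where r: "r > 0" "\<And>x. \<bar>x\<bar> < r \<Longrightarrow> \<bar>arctan x - x\<bar> \<le> e * \<bar>x\<bar>"
    using arctan_near_0[OF e(1)] by blast
  have "\<forall>\<^sub>F T in at_top. dist (N T / (pi * T^2)) 1 < e" by (rule tendstoD[OF N e(1)])
  moreover have "\<forall>\<^sub>F T in at_top. Y / T^2 < r" using Y r by (intro eventually_small_inverse_square) auto
  moreover have "\<forall>\<^sub>F T in at_top. (W / \<epsilon>^2) / T^2 < min 1 (e * k^2)"
    using W_pos \<epsilon>_pos e k_pos by (intro eventually_small_inverse_square) auto
  moreover have "\<forall>\<^sub>F T::real in at_top. T > 0" by (rule eventually_gt_at_top)
  ultimately show ?thesis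
  proof eventually_elim
    case (elim T)
    show ?case
    proof (intro allI impI)
      fix w \<tau> \<rho> d :: real
      assume h: "k \<le> \<tau>" "\<epsilon> \<le> \<rho>" "1 \<le> d" "\<bar>w\<bar> \<le> W"
      define \<delta> where "\<delta> = w / (\<rho> * T)^2"
      define Q where "Q = \<tau> * (\<tau> + d)"
      define x where "x = d * \<delta> / (Q + \<delta>^2)"
      define s where "s = d * w / (\<rho>^2 * Q)"
      define \<nu> where "\<nu> = N T / (pi * T^2)"
      have T: "T > 0" and \<rho>: "\<rho> > 0" and \<tau>: "\<tau> > 0" using elim h k_pos \<epsilon>_pos by auto
      have "k * k \<le> \<tau> * (\<tau> + d)" using h k_pos by (intro mult_mono) auto
      then have Q: "k^2 \<le> Q" "0 < Q" using k_pos \<tau> h by (auto simp: Q_def power2_eq_square)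
      have \<nu>: "\<bar>\<nu> - 1\<bar> \<le> e" using elim by (simp add: \<nu>_def dist_real_def)
      have \<delta>: "\<bar>\<delta>\<bar> \<le> W / \<epsilon>^2 / T^2"
      proof -
        have "\<bar>\<delta>\<bar> = \<bar>w\<bar> / \<rho>^2 / T^2" by (simp add: \<delta>_def power_mult_distrib)
        also have "\<dots> \<le> W / \<epsilon>^2 / T^2"
          using h W_pos \<epsilon>_pos by (intro divide_right_mono frac_le power_mono) auto
        finally show ?thesis .
      qed
      then have \<delta>1: "\<bar>\<delta>\<bar> < 1" "\<bar>\<delta>\<bar> < e * k^2" using elim by auto
      have "\<bar>\<delta>\<bar> * \<bar>\<delta>\<bar> \<le> \<bar>\<delta>\<bar> * 1" using \<delta>1 by (intro mult_left_mono) auto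
      then have \<delta>2: "\<delta>^2 \<le> e * k^2" using \<delta>1 by (simp add: power2_eq_square)
      have s: "\<bar>s\<bar> \<le> Y"
      proof -
        have "d \<le> \<tau> + d" using \<tau> by simp
        then have "d * k \<le> (\<tau> + d) * \<tau>" using h k_pos by (intro mult_mono) auto
        then have dQ: "d / Q \<le> 1 / k" using Q k_pos by (simp add: Q_def divide_simps mult.commute)
        have "\<bar>s\<bar> = (d / Q) * (\<bar>w\<bar> / \<rho>^2)" using h Q by (simp add: s_def abs_mult)
        also have "\<dots> \<le> (1 / k) * (W / \<epsilon>^2)"
        proof (rule mult_mono[OF dQ])
          show "\<bar>w\<bar> / \<rho>^2 \<le> W / \<epsilon>^2" using h W_pos \<epsilon>_pos by (intro frac_le power_mono) auto
        qed (use k_pos in auto)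
        finally show ?thesis by (simp add: Y_def)
      qed
      have xs: "T^2 * x = s * (Q / (Q + \<delta>^2))"
      proof -
        have "T^2 * \<delta> = w / \<rho>^2" using T by (simp add: \<delta>_def power_mult_distrib)
        then have "T^2 * x = d * (w / \<rho>^2) / (Q + \<delta>^2)" by (simp add: x_def mult.left_commute)
        also have "\<dots> = s * (Q / (Q + \<delta>^2))" using Q by (simp add: s_def)
        finally show ?thesis .
      qed
      have Q\<delta>: "0 \<le> Q / (Q + \<delta>^2)" "Q / (Q + \<delta>^2) \<le> 1" "1 - Q / (Q + \<delta>^2) \<le> e"
      proof -
        have p: "Q + \<delta>^2 > 0" using Q by (simp add: add_pos_nonneg)
        then show "0 \<le> Q / (Q + \<delta>^2)" "Q / (Q + \<delta>^2) \<le> 1" using Q by auto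
        have "e * k^2 \<le> e * (Q + \<delta>^2)" using Q e by (intro mult_left_mono) (auto intro: add_increasing2)
        then have "\<delta>^2 \<le> e * (Q + \<delta>^2)" using \<delta>2 by simp
        then have "\<delta>^2 / (Q + \<delta>^2) \<le> e" using p by (simp add: pos_divide_le_eq)
        moreover have "1 - Q / (Q + \<delta>^2) = \<delta>^2 / (Q + \<delta>^2)" using p by (simp add: diff_divide_eq_iff)
        ultimately show "1 - Q / (Q + \<delta>^2) \<le> e" by simp
      qed
      have Tx: "T^2 * \<bar>x\<bar> \<le> Y"
      proof -
        have "T^2 * \<bar>x\<bar> = \<bar>s\<bar> * (Q / (Q + \<delta>^2))"
          using arg_cong[OF xs, of abs] Q\<delta>(1) by (simp only: abs_mult abs_of_nonneg zero_le_power2)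
        also have "\<dots> \<le> Y * 1" using s Q\<delta> Y by (intro mult_mono) auto
        finally show ?thesis by simp
      qed
      have T2: "T^2 > 0" using T by simp
      have "\<bar>x\<bar> \<le> Y / T^2" using Tx T2 by (simp add: pos_le_divide_eq mult.commute)
      then have "\<bar>x\<bar> < r" using elim by linarith
      then have ax: "\<bar>arctan x - x\<bar> \<le> e * \<bar>x\<bar>" by (rule r)
      define A where "A = T^2 * arctan x"
      have A1: "\<bar>A - T^2 * x\<bar> \<le> e * Y"
      proof -
        have "\<bar>A - T^2 * x\<bar> = T^2 * \<bar>arctan x - x\<bar>"
          unfolding A_def right_diff_distrib[symmetric] abs_mult by simp
        also have "\<dots> \<le> T^2 * (e * \<bar>x\<bar>)" using ax by (intro mult_left_mono) auto
        also have "\<dots> = e * (T^2 * \<bar>x\<bar>)" by simp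
        also have "\<dots> \<le> e * Y" using Tx e by (intro mult_left_mono) auto
        finally show ?thesis .
      qed
      have A2: "\<bar>T^2 * x - s\<bar> \<le> e * Y"
      proof -
        have "T^2 * x - s = - (s * (1 - Q / (Q + \<delta>^2)))" unfolding xs by (simp add: algebra_simps)
        then have "\<bar>T^2 * x - s\<bar> = \<bar>s\<bar> * (1 - Q / (Q + \<delta>^2))" using Q\<delta> by (simp add: abs_mult)
        also have "\<dots> \<le> Y * e" using s Q\<delta> Y by (intro mult_mono) auto
        finally show ?thesis by (simp add: mult.commute)
      qed
      have A3: "\<bar>A\<bar> \<le> 2 * Y"
      proof -
        have "T^2 * x \<le> Y" "- (T^2 * x) \<le> Y"
          using Tx mult_left_mono[OF abs_ge_self[of x], of "T^2"] mult_left_mono[OF abs_ge_minus_self[of x], of "T^2"]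
          by auto
        moreover have "e * Y \<le> 1 * Y" using e Y by (intro mult_right_mono) auto
        ultimately show ?thesis using A1 by linarith
      qed
      have A4: "\<bar>\<nu> * A - A\<bar> \<le> e * (2 * Y)"
      proof -
        have "\<bar>\<nu> * A - A\<bar> = \<bar>\<nu> - 1\<bar> * \<bar>A\<bar>" unfolding abs_mult[symmetric] by (simp add: left_diff_distrib)
        also have "\<dots> \<le> e * (2 * Y)" using \<nu> A3 e by (intro mult_mono) auto
        finally show ?thesis .
      qed
      have NA: "N T / (2 * pi) * arctan x = \<nu> * A / 2"
        using T2 by (simp add: \<nu>_def A_def)
      have "\<bar>\<nu> * A / 2 - s / 2\<bar> \<le> \<eta>"
      proof -
        have "\<bar>\<nu> * A - s\<bar> \<le> 4 * (e * Y)" using A1 A2 A4 by linarith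
        moreover have "3 * (e * Y) \<le> \<eta>" using e(3) by (simp add: mult_ac)
        moreover have "0 \<le> e * Y" using e Y by simp
        ultimately show ?thesis by linarith
      qed
      then have "\<bar>f (\<nu> * A / 2) - f (s / 2)\<bar> \<le> k" by (rule \<eta>)
      moreover have "s / 2 = d * w / (2 * \<tau> * (\<tau> + d) * \<rho>^2)" by (simp add: s_def Q_def mult_ac)
      ultimately have "\<bar>f (N T / (2 * pi) * arctan x) - f (d * w / (2 * \<tau> * (\<tau> + d) * \<rho>^2))\<bar> \<le> k"
        unfolding NA by simp
      then show "\<bar>f (N T / (2 * pi) * arctan (d * (w / (\<rho> * T)^2) / (\<tau> * (\<tau> + d) + (w / (\<rho> * T)^2)^2)))
        - f (d * w / (2 * \<tau> * (\<tau> + d) * \<rho>^2))\<bar> \<le> k"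
        unfolding x_def Q_def \<delta>_def .
    qed
  qed
qed

text \<open>A nonzero summand forces the angle below \<open>4 K / T^2\<close>, so the area of the triangle is bounded, and the third side is shorter than \<open>T\<close> since the angle is below \<open>\<pi> / 3\<close>.\<close>

lemma window_of_near_directions:
  assumes N: "((\<lambda>T. N T / (pi * T^2)) \<longlongrightarrow> 1) at_top"
  shows "\<forall>\<^sub>F T in at_top. \<forall>y z. norm y < T \<longrightarrow> norm z < T \<longrightarrow> y \<noteq> 0 \<longrightarrow> z \<noteq> 0 \<longrightarrow>
    f (N T * Arg (cnj z * y) / (2 * pi)) \<noteq> 0 \<longrightarrow>
    \<bar>wd z y\<bar> \<le> W \<and> 0 < Re (cnj z * y) \<and> norm (z - y) < T"
proof -
  have "\<forall>\<^sub>F T in at_top. dist (N T / (pi * T^2)) 1 < 1 / 2" by (rule tendstoD[OF N]) simp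
  moreover have "\<forall>\<^sub>F T in at_top. (4 * K) / T^2 < 1" using K_pos by (intro eventually_small_inverse_square) auto
  moreover have "\<forall>\<^sub>F T::real in at_top. T > 0" by (rule eventually_gt_at_top)
  ultimately show ?thesis
  proof eventually_elim
    case (elim T)
    show ?case
    proof (intro allI impI)
      fix y z :: complex
      assume h: "norm y < T" "norm z < T" "y \<noteq> 0" "z \<noteq> 0" "f (N T * Arg (cnj z * y) / (2 * pi)) \<noteq> 0"
      define x where "x = cnj z * y"
      define \<theta> where "\<theta> = Arg x"
      have x0: "x \<noteq> 0" using h by (simp add: x_def)
      have nx: "norm x = norm z * norm y" by (simp add: x_def norm_mult)
      have T: "T > 0" "T^2 > 0" using elim by auto
      define \<nu> where "\<nu> = N T / (pi * T^2)"
      have "\<bar>\<nu> - 1\<bar> < 1 / 2" using elim(1) unfolding \<nu>_def dist_real_def .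
      then have \<nu>: "\<nu> > 1 / 2" by linarith
      have eq: "N T * Arg (cnj z * y) / (2 * pi) = \<nu> * T^2 * \<theta> / 2" using T by (simp add: \<nu>_def \<theta>_def x_def)
      have "f (\<nu> * T^2 * \<theta> / 2) \<noteq> 0" using h(5) unfolding eq .
      then have "\<bar>\<nu> * T^2 * \<theta> / 2\<bar> < K" using f_supp by (metis not_less)
      then have "\<nu> * (T^2 * \<bar>\<theta>\<bar>) < 2 * K" using \<nu> T by (simp add: abs_mult)
      moreover have "1 / 2 * (T^2 * \<bar>\<theta>\<bar>) \<le> \<nu> * (T^2 * \<bar>\<theta>\<bar>)" using \<nu> by (intro mult_right_mono) auto
      ultimately have \<theta>: "T^2 * \<bar>\<theta>\<bar> < 4 * K" by linarith
      then have "\<bar>\<theta>\<bar> < 4 * K / T^2" using T by (simp add: pos_less_divide_eq mult.commute)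
      then have \<theta>1: "\<bar>\<theta>\<bar> < 1" using elim by linarith
      have nT: "norm x \<le> T^2" unfolding nx power2_eq_square using h T by (intro mult_mono) auto
      have wd: "\<bar>wd z y\<bar> \<le> W"
      proof -
        have "wd z y = norm x * sin \<theta>" using sin_Arg[OF x0] x0 by (simp add: wd_def x_def \<theta>_def)
        then have "\<bar>wd z y\<bar> = norm x * \<bar>sin \<theta>\<bar>" by (simp add: abs_mult)
        also have "\<dots> \<le> T^2 * \<bar>\<theta>\<bar>" using nT abs_sin_x_le_abs_x[of \<theta>] by (intro mult_mono) auto
        finally show ?thesis using \<theta> by (simp add: W_def)
      qed
      have "cos (pi / 3) \<le> cos \<bar>\<theta>\<bar>"
        using \<theta>1 pi_gt3 by (intro cos_monotone_0_pi_le) auto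
      then have cos: "1 / 2 \<le> cos \<theta>" by (simp add: cos_60)
      have Re: "Re x = norm x * cos \<theta>" using cos_Arg[OF x0] x0 by (simp add: \<theta>_def)
      then have Re2: "norm x / 2 \<le> Re x" using mult_left_mono[OF cos, of "norm x"] by simp
      have pos: "0 < Re x" using Re2 x0 by (smt (verit) zero_less_norm_iff half_gt_zero)
      have "(norm (z - y))^2 = (norm z)^2 + (norm y)^2 - 2 * Re x"
        unfolding x_def cmod_power2 by (simp add: power2_eq_square algebra_simps)
      also have "\<dots> \<le> (norm z)^2 + (norm y)^2 - norm z * norm y" using Re2 nx by simp
      also have "\<dots> < T^2"
      proof -
        have "a^2 + b^2 - a * b < T^2" if ab: "0 \<le> a" "a \<le> b" "b < T" for a b :: real
        proof -
          have "a * a \<le> a * b" using ab by (intro mult_left_mono) auto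
          moreover have "b^2 < T^2" using ab by (intro power_strict_mono) auto
          ultimately show ?thesis by (simp add: power2_eq_square)
        qed
        then show ?thesis using h(1,2) by (cases "norm z \<le> norm y") (smt (verit) norm_ge_zero mult.commute)+
      qed
      finally have "norm (z - y) < T" using T by (simp add: power2_less_imp_less)
      then show "\<bar>wd z y\<bar> \<le> W \<and> 0 < Re (cnj z * y) \<and> norm (z - y) < T"
        using wd pos by (simp add: x_def)
    qed
  qed
qed

text \<open>In the coordinates \<open>(w, \<tau>, \<rho>)\<close>, with \<open>\<delta>\<close> the distance of \<open>y\<close> from the line through \<open>m\<close> in units of \<open>norm m\<close>. For large \<open>T\<close>, \<open>\<delta>\<close> is negligible, so the true conditions on the pair differ from \<open>0 < \<tau>\<close>, \<open>(\<tau> + d) \<rho> < 1\<close> only in the zones covered by \<open>edge_bump\<close>.\<close>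

lemma cutoff_error:
  assumes N: "((\<lambda>T. N T / (pi * T^2)) \<longlongrightarrow> 1) at_top"
  shows "\<forall>\<^sub>F T in at_top. \<forall>w \<tau> \<rho> d \<delta> P. 1 \<le> d \<longrightarrow> 0 < \<rho> \<longrightarrow> \<rho> < 1 \<longrightarrow> \<delta> = w / (\<rho> * T)^2 \<longrightarrow> P = \<tau> * (\<tau> + d) + \<delta>^2 \<longrightarrow>
    \<bar>(if d * \<bar>w\<bar> \<le> W \<and> 0 < P \<and> 0 < 2 * \<tau> + d \<and> \<rho>^2 * (\<tau>^2 + \<delta>^2) < 1 \<and> \<rho>^2 * ((\<tau> + d)^2 + \<delta>^2) < 1
      then f (N T / (2 * pi) * arctan (d * \<delta> / P)) else 0) * cut_diff \<rho> - main_term d w \<tau> \<rho>\<bar> \<le> err_term d w \<tau> \<rho>"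
proof -
  have "\<forall>\<^sub>F T in at_top. (W / \<epsilon>^2) / T^2 < k"
    using W_pos \<epsilon>_pos k_pos by (intro eventually_small_inverse_square) auto
  moreover have "\<forall>\<^sub>F T::real in at_top. T > 0" by (rule eventually_gt_at_top)
  ultimately show ?thesis using angle_linearization[OF N]
  proof eventually_elim
    case (elim T)
    show ?case
    proof (intro allI impI)
      fix w \<tau> \<rho> d \<delta> P :: real
      assume h: "1 \<le> d" "0 < \<rho>" "\<rho> < 1" "\<delta> = w / (\<rho> * T)^2" "P = \<tau> * (\<tau> + d) + \<delta>^2"
      let ?c = "d * \<bar>w\<bar> \<le> W \<and> 0 < P \<and> 0 < 2 * \<tau> + d \<and> \<rho>^2 * (\<tau>^2 + \<delta>^2) < 1 \<and> \<rho>^2 * ((\<tau> + d)^2 + \<delta>^2) < 1"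
      let ?F = "f (N T / (2 * pi) * arctan (d * \<delta> / P))"
      have E0: "0 \<le> err_term d w \<tau> \<rho>" by (rule err_term_nonneg)
      show "\<bar>(if ?c then ?F else 0) * cut_diff \<rho> - main_term d w \<tau> \<rho>\<bar> \<le> err_term d w \<tau> \<rho>"
      proof (cases "cut_diff \<rho> = 0")
        case True
        then show ?thesis by (simp add: main_term_def err_term_def)
      next
        case False
        then have \<epsilon>\<rho>: "\<epsilon> < \<rho>" by (rule cut_diff_nonzero)
        have \<delta>: "\<delta>^2 \<le> k * k" if "\<bar>w\<bar> \<le> W"
        proof -
          have "\<bar>\<delta>\<bar> = \<bar>w\<bar> / \<rho>^2 / T^2" using h by (simp add: power_mult_distrib)
          also have "\<dots> \<le> W / \<epsilon>^2 / T^2"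
            using that \<epsilon>\<rho> W_pos \<epsilon>_pos by (intro divide_right_mono frac_le power_mono) auto
          also have "\<dots> \<le> k" using elim by simp
          finally have "\<bar>\<delta>\<bar> * \<bar>\<delta>\<bar> \<le> k * k" using k_pos by (intro mult_mono) auto
          then show ?thesis by (simp add: power2_eq_square)
        qed
        have kk: "k * k \<le> 1 / 8 * k" using k_le k_pos by (intro mult_right_mono) auto
        show ?thesis
        proof (cases ?c)
          case True
          have "1 * \<bar>w\<bar> \<le> d * \<bar>w\<bar>" using h by (intro mult_right_mono) auto
          then have wW: "\<bar>w\<bar> \<le> W" using True by linarith
          have w_bump: "w_bump w = 1" by (rule w_bump_eq_1[OF wW])
          note \<delta>' = \<delta>[OF wW]
          \<comment> \<open>For \<open>\<tau> \<le> 0\<close>, positivity of \<open>P\<close> and \<open>\<tau> + d \<ge> d / 2\<close> give \<open>- \<tau> \<le> 2 \<delta>^2\<close>.\<close>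
          have lower: "- (2 * k) \<le> \<tau> * \<rho>"
          proof (cases "\<tau> \<le> 0")
            case neg: True
            have "1 / 2 \<le> \<tau> + d" using True h by linarith
            then have "(- \<tau>) * (1 / 2) \<le> (- \<tau>) * (\<tau> + d)" using neg by (intro mult_left_mono) auto
            also have "\<dots> \<le> \<delta>^2" using True h by (simp add: algebra_simps)
            finally have t: "- \<tau> \<le> 2 * k" using \<delta>' kk k_pos by linarith
            have "(- \<tau>) * \<rho> \<le> (- \<tau>) * 1" using neg h by (intro mult_left_mono) auto
            then show ?thesis using t by simp
          next
            case False
            then have "0 \<le> \<tau> * \<rho>" using h by simp
            then show ?thesis using k_pos by linarith
          qed
          have upper: "(\<tau> + d) * \<rho> < 1"
          proof -
            have "((\<tau> + d) * \<rho>)^2 = \<rho>^2 * (\<tau> + d)^2" by (simp only: power_mult_distrib mult.commute)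
            then have "((\<tau> + d) * \<rho>)^2 \<le> \<rho>^2 * ((\<tau> + d)^2 + \<delta>^2)" by (simp add: distrib_left)
            then have "((\<tau> + d) * \<rho>)^2 < 1^2" using True by simp
            then show ?thesis by (rule power2_less_imp_less) simp
          qed
          have triv: "\<bar>?F * cut_diff \<rho> - main_term d w \<tau> \<rho>\<bar> \<le> 2 * M * cut_diff \<rho>"
          proof -
            have "\<bar>cut_start \<tau> \<rho> * cut_end d \<tau> \<rho>\<bar> \<le> 1" using cut_start_bounds cut_end_bounds by (auto intro!: mult_le_one simp: abs_mult)
            then have "\<bar>f (angle_arg d w \<tau> \<rho>) * (cut_start \<tau> \<rho> * cut_end d \<tau> \<rho>)\<bar> \<le> M * 1"
              unfolding abs_mult[of "f _"] using f_bound by (intro mult_mono) (auto simp: M_nonneg)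
            then have "\<bar>?F - f (angle_arg d w \<tau> \<rho>) * (cut_start \<tau> \<rho> * cut_end d \<tau> \<rho>)\<bar> \<le> 2 * M"
              using f_bound[of "N T / (2 * pi) * arctan (d * \<delta> / P)"] by linarith
            then have "\<bar>?F - f (angle_arg d w \<tau> \<rho>) * (cut_start \<tau> \<rho> * cut_end d \<tau> \<rho>)\<bar> * cut_diff \<rho> \<le> 2 * M * cut_diff \<rho>"
              using cut_diff_bounds by (intro mult_right_mono) auto
            moreover have "?F * cut_diff \<rho> - main_term d w \<tau> \<rho> = (?F - f (angle_arg d w \<tau> \<rho>) * (cut_start \<tau> \<rho> * cut_end d \<tau> \<rho>)) * cut_diff \<rho>"
              by (simp add: main_term_def algebra_simps)
            ultimately show ?thesis using cut_diff_bounds[of \<rho>] by (simp add: abs_mult)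
          qed
          have edge: ?thesis if b: "edge_bump (\<tau> * \<rho>) + edge_bump ((\<tau> + d) * \<rho> - 1) \<ge> 1"
          proof -
            have "2 * M * 1 \<le> 2 * M * (edge_bump (\<tau> * \<rho>) + edge_bump ((\<tau> + d) * \<rho> - 1))" using b M_nonneg by (intro mult_left_mono) auto
            moreover have "0 \<le> k * t_bump \<tau>" using k_pos t_bump_bounds by simp
            ultimately have "2 * M \<le> k * t_bump \<tau> + 2 * M * (edge_bump (\<tau> * \<rho>) + edge_bump ((\<tau> + d) * \<rho> - 1))" by linarith
            then have "2 * M * cut_diff \<rho> \<le> err_term d w \<tau> \<rho>"
              unfolding err_term_def w_bump mult_1 using cut_diff_bounds by (intro mult_right_mono) auto
            then show ?thesis using triv True by simp
          qed
          consider "\<tau> * \<rho> \<le> 2 * k" | "(\<tau> + d) * \<rho> \<ge> 1 - 2 * k" | "2 * k \<le> \<tau> * \<rho>" "(\<tau> + d) * \<rho> \<le> 1 - 2 * k" by linarith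
          then show ?thesis
          proof cases
            case 1
            then have "edge_bump (\<tau> * \<rho>) = 1" using lower by (intro edge_bump_eq_1) auto
            then show ?thesis using edge_bump_bounds[of "(\<tau> + d) * \<rho> - 1"] by (intro edge) auto
          next
            case 2
            then have "edge_bump ((\<tau> + d) * \<rho> - 1) = 1" using upper by (intro edge_bump_eq_1) auto
            then show ?thesis using edge_bump_bounds[of "\<tau> * \<rho>"] by (intro edge) auto
          next
            case 3
            have c: "cut_start \<tau> \<rho> = 1" "cut_end d \<tau> \<rho> = 1" using 3 by (auto intro: cut_start_eq_1 cut_end_eq_1)
            then have cc: "cut_start \<tau> \<rho> * cut_end d \<tau> \<rho> * cut_diff \<rho> \<noteq> 0" using False by simp
            note cn = cutoffs_nonzero[OF cc h(1)]
            have \<tau>0: "0 \<le> \<tau>" using cn(6) k_pos by simp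
            have "\<bar>?F - f (d * w / (2 * \<tau> * (\<tau> + d) * \<rho>^2))\<bar> \<le> k"
              unfolding h(4,5) using elim(3) cn(6) \<epsilon>\<rho> h(1) wW by (meson less_imp_le)
            then have "\<bar>?F - f (angle_arg d w \<tau> \<rho>)\<bar> \<le> k" unfolding angle_arg_eq[OF cc h(1)] .
            then have "\<bar>?F - f (angle_arg d w \<tau> \<rho>)\<bar> * cut_diff \<rho> \<le> k * cut_diff \<rho>" using cut_diff_bounds by (intro mult_right_mono) auto
            moreover have "?F * cut_diff \<rho> - main_term d w \<tau> \<rho> = (?F - f (angle_arg d w \<tau> \<rho>)) * cut_diff \<rho>"
              by (simp add: main_term_def c algebra_simps)
            ultimately have main: "\<bar>?F * cut_diff \<rho> - main_term d w \<tau> \<rho>\<bar> \<le> k * cut_diff \<rho>" using cut_diff_bounds[of \<rho>] by (simp add: abs_mult)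
            have "\<tau> * \<epsilon> \<le> 1" using cn(7) \<epsilon>_pos by (simp add: pos_less_divide_eq)
            then have t_bump: "t_bump \<tau> = 1" using \<tau>0 by (intro t_bump_eq_1) simp
            have "0 \<le> 2 * M * (edge_bump (\<tau> * \<rho>) + edge_bump ((\<tau> + d) * \<rho> - 1))" using M_nonneg edge_bump_bounds by simp
            then have "k * cut_diff \<rho> \<le> err_term d w \<tau> \<rho>"
              unfolding err_term_def w_bump t_bump mult_1 using cut_diff_bounds by (intro mult_right_mono) auto
            then show ?thesis using main True by simp
          qed
        next
          case nc: False
          have "main_term d w \<tau> \<rho> = 0"
          proof (rule ccontr)
            assume nz: "main_term d w \<tau> \<rho> \<noteq> 0"
            note hn = main_term_nonzero[OF nz h(1)]
            note cn = cutoffs_nonzero[OF hn(1) h(1)]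
            have wW: "\<bar>w\<bar> \<le> W" using hn(3) K_pos by (simp add: W_def)
            have "\<rho>^2 * \<delta>^2 \<le> 1 * (k * k)" using h \<delta>[OF wW] by (intro mult_mono) (auto simp: power_le_one)
            then have \<rho>\<delta>: "\<rho>^2 * \<delta>^2 \<le> 1 / 8 * k" using kk by linarith
            have \<tau>: "0 < \<tau>" using cn(6) k_pos by simp
            have "((\<tau> + d) * \<rho>)^2 \<le> (1 - k)^2" using cn(5) \<tau> h by (intro power_mono) auto
            moreover have "(1 - k)^2 = 1 - 2 * k + k * k" by (simp add: power2_eq_square algebra_simps)
            moreover have "((\<tau> + d) * \<rho>)^2 = \<rho>^2 * (\<tau> + d)^2" by (simp only: power_mult_distrib mult.commute)
            ultimately have 2: "\<rho>^2 * ((\<tau> + d)^2 + \<delta>^2) < 1"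
              unfolding distrib_left using \<rho>\<delta> kk k_pos by linarith
            have "\<rho>^2 * (\<tau>^2 + \<delta>^2) \<le> \<rho>^2 * ((\<tau> + d)^2 + \<delta>^2)"
              using \<tau> h by (intro mult_left_mono add_right_mono power_mono) auto
            then have 1: "\<rho>^2 * (\<tau>^2 + \<delta>^2) < 1" using 2 by linarith
            have "0 < \<tau> * (\<tau> + d)" using \<tau> h by simp
            then have "0 < P" unfolding h(5) by (intro add_pos_nonneg) auto
            then have ?c using hn(2) K_pos \<tau> h(1) 1 2 by (simp add: W_def)
            then show False using nc by simp
          qed
          then show ?thesis using E0 unfolding if_not_P[OF nc] by simp
        qed
      qed
    qed
  qed
qed

end

lemma qbound_eventually_le: "\<forall>\<^sub>F T in at_top. norm (S T) \<le> b * T^2 \<Longrightarrow> qbound S b"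
proof (rule qboundI)
  fix e :: real assume h: "\<forall>\<^sub>F T in at_top. norm (S T) \<le> b * T^2" and e: "e > 0"
  show "\<forall>\<^sub>F T in at_top. norm (S T) \<le> (b + e) * T^2"
    using h
  proof eventually_elim
    case (elim T)
    have "0 \<le> e * T^2" using e by simp
    then show ?case using elim by (simp add: distrib_right)
  qed
qed

context unimodular_lattice
begin

lemma card_disc_limit: "((\<lambda>T. real (card (disc \<zeta> T)) / (pi * T^2)) \<longlongrightarrow> 1) at_top"
proof -
  define num where "num T = real (card (disc \<zeta> T))" for T
  obtain C' where C': "C' \<ge> 0" "\<And>T. T \<ge> 0 \<Longrightarrow> \<bar>num T - pi * T^2\<bar> \<le> C' * (T + 1)"
    unfolding num_def using card_disc_asymp[of \<zeta>] by blast
  have "((\<lambda>T. num T / (pi * T^2) - 1) \<longlongrightarrow> 0) at_top"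
  proof (rule Lim_null_comparison)
    show "\<forall>\<^sub>F T in at_top. norm (num T / (pi * T^2) - 1) \<le> 2 * C' / T"
      using eventually_ge_at_top[of 1]
    proof eventually_elim
      case (elim T)
      have p: "pi * T^2 > 0" using elim by simp
      have "num T / (pi * T^2) - 1 = (num T - pi * T^2) / (pi * T^2)" using p elim by (simp add: diff_divide_distrib)
      then have "norm (num T / (pi * T^2) - 1) = \<bar>num T - pi * T^2\<bar> / (pi * T^2)" using p by (simp add: abs_divide)
      also have "\<dots> \<le> (C' * (2 * T)) / (1 * T^2)"
      proof (rule frac_le)
        have "C' * (T + 1) \<le> C' * (2 * T)" using C' elim by (intro mult_left_mono) auto
        then show "\<bar>num T - pi * T^2\<bar> \<le> C' * (2 * T)" using C'(2)[of T] elim by linarith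
        show "1 * T^2 \<le> pi * T^2" using pi_gt3 by (intro mult_right_mono) auto
      qed (use C' elim in auto)
      also have "\<dots> = 2 * C' / T" using elim by (simp add: power2_eq_square)
      finally show ?case .
    qed
    show "((\<lambda>T. 2 * C' / T) \<longlongrightarrow> 0) at_top"
      by (rule tendsto_divide_0[OF tendsto_const]) (rule filterlim_at_top_imp_at_infinity[OF filterlim_ident])
  qed
  then show ?thesis unfolding num_def by (simp add: LIM_zero_iff)
qed

end

context shifted_lattice
begin

lemma zero_not_in_disc: "0 \<notin> disc \<zeta> T"
proof
  assume "0 \<in> disc \<zeta> T"
  then have z: "- \<zeta> \<in> lattice" by (simp add: disc_def)
  obtain b where b: "b \<in> lattice" "of_int 1 * wd \<zeta> b \<notin> \<int>" using irrational[of 1] by auto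
  obtain j where "wd (- \<zeta>) b = of_int j" using wd_lattice[OF z b(1)] by blast
  then have "wd \<zeta> b = of_int (- j)" by (simp add: wd_simps)
  then show False using b(2) by simp
qed

end

section \<open>The pair sum over primitive differences\<close>

locale pair_count = diophantine_lattice u v \<zeta> C \<kappa> + pair_test f K M \<epsilon> k
  for u v \<zeta> C \<kappa> f K M \<epsilon> k +
  assumes \<epsilon>_half: "\<epsilon> \<le> 1 / 2"
begin

definition num :: "real \<Rightarrow> real" where "num T = real (card (disc \<zeta> T))"
definition pair_val :: "real \<Rightarrow> complex \<Rightarrow> complex \<Rightarrow> real" where
  "pair_val T z y = f (num T * Arg (cnj z * y) / (2 * pi))"
definition pair_sum :: "real \<Rightarrow> real" where
  "pair_sum T = (\<Sum>y\<in>disc \<zeta> T. \<Sum>z\<in>disc \<zeta> T - {y}. pair_val T z y)"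
text \<open>Of the pairs \<open>(y, y + d m)\<close> and \<open>(y + d m, y)\<close>, the one whose second point is farther from the origin.\<close>

definition forward :: "real \<Rightarrow> complex \<Rightarrow> (complex \<times> nat) set" where
  "forward T m = {(y, d) \<in> close_pairs W T m. 0 < 2 * ip y m + real d * (norm m)^2}"
text \<open>The summand written for an arbitrary \<open>y\<close>, with all conditions on the pair built in.\<close>

definition forward_val :: "real \<Rightarrow> nat \<Rightarrow> complex \<Rightarrow> complex \<Rightarrow> real" where
  "forward_val T d y m = (if real d * \<bar>wd y m\<bar> \<le> W \<and> 0 < Re (cnj (y + of_nat d * m) * y) \<and> 0 < 2 * ip y m + real d * (norm m)^2
     \<and> norm y < T \<and> norm (y + of_nat d * m) < T then pair_val T (y + of_nat d * m) y else 0)"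
definition dmax :: nat where "dmax = nat \<lfloor>1 / \<epsilon>\<rfloor>"

lemma num_limit: "((\<lambda>T. num T / (pi * T^2)) \<longlongrightarrow> 1) at_top"
  unfolding num_def by (rule card_disc_limit)

lemma pair_val_bound: "\<bar>pair_val T z y\<bar> \<le> M"
  by (simp add: pair_val_def f_bound)

lemma pair_val_swap: "pair_val T y z = pair_val T z y"
proof -
  have "cnj y * z = cnj (cnj z * y)" by simp
  then have "Arg (cnj y * z) = (if cnj z * y \<in> \<real> then Arg (cnj z * y) else - Arg (cnj z * y))"
    by (metis Arg_cnj)
  then show ?thesis unfolding pair_val_def by (auto simp: f_even)
qed

lemma finite_close_pairs: "m \<in> prims T \<Longrightarrow> finite (close_pairs W T m)"
  by (rule card_close_pairs(1)) (use W_pos in \<open>auto simp: prims_def pdisc_def\<close>)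

lemma prims_uminus: "m \<in> prims T \<Longrightarrow> - m \<in> prims T"
proof -
  assume m: "m \<in> prims T"
  then obtain l where "m \<in> lattice" "l \<in> lattice" "wd l m = 1" "m \<noteq> 0" "norm m < T"
    by (auto simp: prims_def pdisc_def elim: primitiveE)
  then have "- m \<in> lattice" "- l \<in> lattice" "wd (- l) (- m) = 1" by (auto simp: wd_simps)
  then show "- m \<in> prims T" using \<open>m \<noteq> 0\<close> \<open>norm m < T\<close> by (auto simp: prims_def pdisc_def primitive_def)
qed

text \<open>A pair determines \<open>d\<close> and the primitive vector \<open>m\<close> from the difference of its points; the pairs omitted on the right have directions too far apart to contribute.\<close>

lemma pair_sum_eq: "\<forall>\<^sub>F T in at_top. pair_sum T = (\<Sum>m\<in>prims T. \<Sum>(y, d)\<in>close_pairs W T m. pair_val T (y + of_nat d * m) y)"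
  using window_of_near_directions[OF num_limit]
proof eventually_elim
  case (elim T)
  let ?R = "SIGMA m:prims T. close_pairs W T m"
  let ?Q = "SIGMA y:disc \<zeta> T. disc \<zeta> T - {y}"
  define \<phi> :: "complex \<times> complex \<times> nat \<Rightarrow> complex \<times> complex" where "\<phi> = (\<lambda>(m, y, d). (y, y + of_nat d * m))"
  have inj: "inj_on \<phi> ?R"
  proof (rule inj_onI)
    fix x x' assume h: "x \<in> ?R" "x' \<in> ?R" "\<phi> x = \<phi> x'"
    obtain m y d m' y' d' where x: "x = (m, y, d)" "x' = (m', y', d')" by (metis prod.exhaust)
    have y: "y = y'" "of_nat d * m = of_nat d' * m'" using h x by (auto simp: \<phi>_def)
    have "d = d' \<and> m = m'"
      by (rule primitive_unique) (use h x y in \<open>auto simp: prims_def close_pairs_def\<close>)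
    then show "x = x'" using x y by simp
  qed
  have sub: "\<phi> ` ?R \<subseteq> ?Q"
  proof
    fix p assume "p \<in> \<phi> ` ?R"
    then obtain m y d where h: "m \<in> prims T" "(y, d) \<in> close_pairs W T m" "p = (y, y + of_nat d * m)"
      by (auto simp: \<phi>_def)
    have m: "m \<in> lattice" "m \<noteq> 0" using h by (auto simp: prims_def pdisc_def)
    have c: "d \<ge> 1" "y - \<zeta> \<in> lattice" "norm y < T" "norm (y + of_nat d * m) < T"
      using h(2) by (auto simp: close_pairs_def)
    have "y + of_nat d * m - \<zeta> = (y - \<zeta>) + of_int (int d) * m" by simp
    then have "y + of_nat d * m - \<zeta> \<in> lattice" using c(2) m by (metis lattice_add lattice_of_int)
    then show "p \<in> ?Q" using h c m by (auto simp: disc_def)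
  qed
  have "pair_sum T = (\<Sum>(y, z)\<in>?Q. pair_val T z y)"
    unfolding pair_sum_def by (rule sum.Sigma) (auto simp: finite_disc)
  also have "\<dots> = (\<Sum>(y, z)\<in>\<phi> ` ?R. pair_val T z y)"
  proof (rule sum.mono_neutral_right)
    show "finite ?Q" by (auto simp: finite_disc)
    show "\<phi> ` ?R \<subseteq> ?Q" by (rule sub)
    show "\<forall>p\<in>?Q - \<phi> ` ?R. (case p of (y, z) \<Rightarrow> pair_val T z y) = 0"
    proof
      fix p assume p: "p \<in> ?Q - \<phi> ` ?R"
      obtain y z where yz: "p = (y, z)" by (cases p)
      have h: "y \<in> disc \<zeta> T" "z \<in> disc \<zeta> T" "z \<noteq> y" using p yz by auto
      have "pair_val T z y = 0"
      proof (rule ccontr)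
        assume nz: "pair_val T z y \<noteq> 0"
        have l: "norm y < T" "norm z < T" "y \<noteq> 0" "z \<noteq> 0" "y - \<zeta> \<in> lattice" "z - \<zeta> \<in> lattice"
          using h zero_not_in_disc[of T] by (auto simp: disc_def)
        have w: "\<bar>wd z y\<bar> \<le> W" "norm (z - y) < T"
          using elim[rule_format, OF l(1-4)] nz unfolding pair_val_def by auto
        have "z - y = (z - \<zeta>) - (y - \<zeta>)" by simp
        then have zl: "z - y \<in> lattice" using l by (metis lattice_diff)
        have z0: "z - y \<noteq> 0" using h by simp
        obtain d m where dm: "primitive m" "d \<ge> (1::nat)" "z - y = of_nat d * m"
          by (rule primitive_decomposition[OF zl z0])
        have z: "z = y + of_nat d * m" using dm(3) by (simp add: algebra_simps)
        have "1 * norm m \<le> real d * norm m" using dm by (intro mult_right_mono) auto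
        also have "\<dots> = norm (z - y)" unfolding dm(3) by (simp add: norm_mult)
        finally have "norm m < T" using w by simp
        then have mp: "m \<in> prims T" using dm(1) primitive_nonzero by (auto simp: prims_def pdisc_def primitive_def)
        have "wd z y = - (real d * wd y m)" unfolding z using wd_swap[of m y] by (simp add: wd_simps)
        then have "real d * \<bar>wd y m\<bar> \<le> W" using w by (simp add: abs_mult)
        then have "(y, d) \<in> close_pairs W T m" using l dm z by (auto simp: close_pairs_def)
        then have "(m, y, d) \<in> ?R" using mp by simp
        then have "\<phi> (m, y, d) \<in> \<phi> ` ?R" by (rule imageI)
        then have "p \<in> \<phi> ` ?R" unfolding yz z by (simp add: \<phi>_def)
        then show False using p by simp
      qed
      then show "(case p of (y, z) \<Rightarrow> pair_val T z y) = 0" using yz by simp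
    qed
  qed
  also have "\<dots> = (\<Sum>x\<in>?R. (\<lambda>(y, z). pair_val T z y) (\<phi> x))"
    unfolding sum.reindex[OF inj] by (simp add: o_def)
  also have "\<dots> = (\<Sum>(m, p)\<in>?R. (\<lambda>(y, d). pair_val T (y + of_nat d * m) y) p)"
    by (rule sum.cong) (auto simp: \<phi>_def)
  also have "\<dots> = (\<Sum>m\<in>prims T. \<Sum>(y, d)\<in>close_pairs W T m. pair_val T (y + of_nat d * m) y)"
    by (rule sum.Sigma[symmetric]) (auto intro: finite_close_pairs)
  finally show ?case .
qed

lemma norm_coordinates:
  assumes "m \<noteq> 0"
  shows "(norm y)^2 = (norm m)^2 * ((ip y m / (norm m)^2)^2 + (wd y m / (norm m)^2)^2)"
proof -
  have m: "(norm m)^2 > 0" using assms by simp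
  have "(norm m)^2 * ((ip y m / (norm m)^2)^2 + (wd y m / (norm m)^2)^2) = ((ip y m)^2 + (wd y m)^2) / (norm m)^2"
    using m by (simp add: power_divide add_divide_distrib[symmetric] power2_eq_square)
  then show ?thesis unfolding ip_wd_norm using m by simp
qed

lemma pair_product:
  "Re (cnj (y + of_nat d * m) * y) = (norm y)^2 + real d * ip y m"
  "Im (cnj (y + of_nat d * m) * y) = - (real d * wd y m)"
  unfolding cmod_power2 by (simp_all add: ip_def wd_def algebra_simps power2_eq_square)

lemma forward_val_coordinates:
  assumes T: "T > 0" and m: "m \<noteq> 0" and \<rho>: "\<rho> = norm m / T" and \<tau>: "\<tau> = ip y m / (norm m)^2" and w: "w = wd y m"
    and \<delta>: "\<delta> = w / (\<rho> * T)^2" and P: "P = \<tau> * (\<tau> + real d) + \<delta>^2"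
  shows "forward_val T d y m = (if real d * \<bar>w\<bar> \<le> W \<and> 0 < P \<and> 0 < 2 * \<tau> + real d \<and> \<rho>^2 * (\<tau>^2 + \<delta>^2) < 1 \<and> \<rho>^2 * ((\<tau> + real d)^2 + \<delta>^2) < 1
      then f (num T / (2 * pi) * arctan (real d * \<delta> / P)) else 0)"
proof -
  have n: "(norm m)^2 > 0" using m by simp
  have \<delta>': "\<delta> = wd y m / (norm m)^2" using T by (simp add: \<delta> \<rho> w)
  have ip: "ip y m = \<tau> * (norm m)^2" "wd y m = \<delta> * (norm m)^2" using n by (simp_all add: \<tau> \<delta>')
  have ny: "(norm y)^2 = (norm m)^2 * (\<tau>^2 + \<delta>^2)" using norm_coordinates[OF m, of y] by (simp add: \<tau> \<delta>')
  have "ip (y + of_nat d * m) m / (norm m)^2 = \<tau> + real d" "wd (y + of_nat d * m) m / (norm m)^2 = \<delta>"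
    using n by (simp_all add: ip_simps wd_simps ip_self ip add_divide_distrib)
  then have nz: "(norm (y + of_nat d * m))^2 = (norm m)^2 * ((\<tau> + real d)^2 + \<delta>^2)"
    using norm_coordinates[OF m, of "y + of_nat d * m"] by simp
  have small: "norm x < T \<longleftrightarrow> \<rho>^2 * X < 1" if x: "(norm x)^2 = (norm m)^2 * X" for x :: complex and X
  proof -
    have "norm x < T \<longleftrightarrow> (norm x)^2 < T^2" using T by (auto intro: power2_less_imp_less power_strict_mono)
    also have "\<dots> \<longleftrightarrow> (norm x)^2 / T^2 < 1" using T by simp
    also have "(norm x)^2 / T^2 = \<rho>^2 * X" unfolding x \<rho> by (simp add: power_divide)
    finally show ?thesis .
  qed
  have Re: "Re (cnj (y + of_nat d * m) * y) = (norm m)^2 * P"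
    unfolding pair_product ny P ip by (simp add: algebra_simps power2_eq_square)
  have Im: "Im (cnj (y + of_nat d * m) * y) = - ((norm m)^2 * (real d * \<delta>))"
    unfolding pair_product ip by (simp add: mult_ac)
  have sg: "0 < 2 * ip y m + real d * (norm m)^2 \<longleftrightarrow> 0 < 2 * \<tau> + real d"
  proof -
    have "2 * ip y m + real d * (norm m)^2 = (norm m)^2 * (2 * \<tau> + real d)" unfolding ip by (simp add: algebra_simps)
    then show ?thesis using n by (simp add: zero_less_mult_iff)
  qed
  have v: "pair_val T (y + of_nat d * m) y = f (num T / (2 * pi) * arctan (real d * \<delta> / P))" if "0 < P"
  proof -
    have "Re (cnj (y + of_nat d * m) * y) > 0" unfolding Re using n that by simp
    then have "Arg (cnj (y + of_nat d * m) * y) = arctan (- (real d * \<delta> / P))"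
      using arg_conv_arctan[of "cnj (y + of_nat d * m) * y"] n unfolding Re Im by simp
    then have "num T * Arg (cnj (y + of_nat d * m) * y) / (2 * pi) = - (num T / (2 * pi) * arctan (real d * \<delta> / P))"
      by (simp add: arctan_minus)
    then show ?thesis unfolding pair_val_def by (simp only: f_even)
  qed
  have Pn: "0 < (norm m)^2 * P \<longleftrightarrow> 0 < P" using n by (simp add: zero_less_mult_iff)
  show ?thesis unfolding forward_val_def small[OF ny] small[OF nz] Re Pn sg w[symmetric] using v by (cases "0 < P") auto
qed

lemma finite_strip:
  assumes "m \<noteq> 0"
  shows "finite (strip B m)"
proof (rule finite_subset)
  define R where "R = norm m * (B + B / (norm m)^2) + 1"
  have n: "norm m > 0" using assms by simp
  show "strip B m \<subseteq> disc \<zeta> R"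
  proof
    fix y assume y: "y \<in> strip B m"
    have "\<bar>ip y m / (norm m)^2\<bar> \<le> B" "\<bar>wd y m / (norm m)^2\<bar> \<le> B / (norm m)^2"
      using y n by (auto simp: strip_def abs_divide pos_divide_le_eq divide_right_mono)
    then have "\<bar>ip y m / (norm m)^2\<bar> + \<bar>wd y m / (norm m)^2\<bar> \<le> B + B / (norm m)^2" by linarith
    moreover have "norm y \<le> norm m * (\<bar>ip y m / (norm m)^2\<bar> + \<bar>wd y m / (norm m)^2\<bar>)"
    proof (rule power2_le_imp_le)
      have "a^2 + b^2 \<le> (\<bar>a\<bar> + \<bar>b\<bar>)^2" for a b :: real by (simp add: power2_sum)
      then show "(norm y)^2 \<le> (norm m * (\<bar>ip y m / (norm m)^2\<bar> + \<bar>wd y m / (norm m)^2\<bar>))^2"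
        unfolding norm_coordinates[OF assms, of y] power_mult_distrib by (rule mult_left_mono) simp
    qed simp
    ultimately have "norm y < R" unfolding R_def using n
      by (smt (verit) mult_left_mono)
    then show "y \<in> disc \<zeta> R" using y by (simp add: strip_def disc_def)
  qed
qed (rule finite_disc)

lemma ip_reverse: "2 * ip (y + of_nat d * m) (- m) + real d * (norm (- m))^2 = - (2 * ip y m + real d * (norm m)^2)"
proof -
  have "ip (y + of_nat d * m) (- m) = - (ip y m + real d * (norm m)^2)"
    unfolding ip_self[symmetric] by (simp add: ip_def algebra_simps)
  then show ?thesis by simp
qed

lemma close_pairs_reverse:
  assumes "m \<in> lattice"
  shows "(y + of_nat d * m, d) \<in> close_pairs W T (- m) \<longleftrightarrow> (y, d) \<in> close_pairs W T m"
proof -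
  have "y + of_nat d * m - \<zeta> \<in> lattice \<longleftrightarrow> y - \<zeta> \<in> lattice"
  proof
    assume "y + of_nat d * m - \<zeta> \<in> lattice"
    then have "(y + of_nat d * m - \<zeta>) - of_nat d * m \<in> lattice" by (rule lattice_diff) (rule lattice_of_nat[OF assms])
    then show "y - \<zeta> \<in> lattice" by simp
  next
    assume "y - \<zeta> \<in> lattice"
    then have "(y - \<zeta>) + of_nat d * m \<in> lattice" by (rule lattice_add) (rule lattice_of_nat[OF assms])
    then show "y + of_nat d * m - \<zeta> \<in> lattice" by (simp add: algebra_simps)
  qed
  moreover have "\<bar>wd (y + of_nat d * m) (- m)\<bar> = \<bar>wd y m\<bar>" by (simp add: wd_simps)
  ultimately show ?thesis by (auto simp: close_pairs_def)
qed

text \<open>Exchanging the two points of a pair maps \<open>m\<close> to \<open>- m\<close> and reverses the sign of \<open>2 ip y m + d (norm m)^2\<close>, while the summand is unchanged as \<open>f\<close> is even. If this quantity vanishes, \<open>0\<close> projects on the midpoint of the pair, and the two directions are far apart.\<close>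

lemma cut_diff_close_pairs_forward:
  "\<forall>\<^sub>F T in at_top. (\<Sum>m\<in>prims T. cut_diff (norm m / T) * (\<Sum>(y, d)\<in>close_pairs W T m. pair_val T (y + of_nat d * m) y))
    = 2 * (\<Sum>m\<in>prims T. cut_diff (norm m / T) * (\<Sum>(y, d)\<in>forward T m. pair_val T (y + of_nat d * m) y))"
proof -
  have "\<forall>\<^sub>F T in at_top. (W / \<epsilon>^2) / T^2 < 1 / 2"
    using W_pos \<epsilon>_pos by (intro eventually_small_inverse_square) auto
  moreover have "\<forall>\<^sub>F T::real in at_top. T > 0" by (rule eventually_gt_at_top)
  ultimately show ?thesis using window_of_near_directions[OF num_limit]
  proof eventually_elim
    case (elim T)
    note window = elim(3)[rule_format]
    define g where "g m = (\<lambda>(y, d). pair_val T (y + of_nat d * m) y)" for m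
    define bw where "bw m = {(y, d) \<in> close_pairs W T m. 2 * ip y m + real d * (norm m)^2 < 0}" for m
    define fl where "fl m = {(y, d) \<in> close_pairs W T m. 2 * ip y m + real d * (norm m)^2 = 0}" for m
    have split: "(\<Sum>p\<in>close_pairs W T m. g m p) = (\<Sum>p\<in>forward T m. g m p) + (\<Sum>p\<in>bw m. g m p) + (\<Sum>p\<in>fl m. g m p)"
      if m: "m \<in> prims T" for m
    proof -
      have fin: "finite (close_pairs W T m)" by (rule finite_close_pairs[OF m])
      have cp: "close_pairs W T m = (forward T m \<union> bw m) \<union> fl m" "forward T m \<inter> bw m = {}" "(forward T m \<union> bw m) \<inter> fl m = {}"
        by (auto simp: forward_def bw_def fl_def)
      have f3: "finite (forward T m)" "finite (bw m)" "finite (fl m)"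
        using fin unfolding cp(1) by auto
      show ?thesis unfolding cp(1) using f3 cp(2,3) by (subst sum.union_disjoint; simp add: sum.union_disjoint)
    qed
    have flat: "cut_diff (norm m / T) * (\<Sum>p\<in>fl m. g m p) = 0" if m: "m \<in> prims T" for m
    proof (cases "cut_diff (norm m / T) = 0")
      case False
      then have "\<epsilon> < norm m / T" by (rule cut_diff_nonzero)
      then have \<epsilon>m: "\<epsilon> * T < norm m" using elim by (simp add: pos_less_divide_eq)
      then have mpos: "0 < norm m" using elim \<epsilon>_pos by (smt (verit) mult_pos_pos)
      have "g m p = 0" if p: "p \<in> fl m" for p
      proof (rule ccontr)
        assume nz: "g m p \<noteq> 0"
        obtain y d where yd: "p = (y, d)" by (cases p)
        define z where "z = y + of_nat d * m"
        have c: "(y, d) \<in> close_pairs W T m" "2 * ip y m + real d * (norm m)^2 = 0" using p yd by (auto simp: fl_def)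
        have c': "d \<ge> 1" "norm y < T" "norm z < T" "real d * \<bar>wd y m\<bar> \<le> W" "y - \<zeta> \<in> lattice"
          using c(1) by (auto simp: close_pairs_def z_def)
        have "f (num T * Arg (cnj z * y) / (2 * pi)) \<noteq> 0" using nz by (simp add: g_def yd pair_val_def z_def)
        moreover have "y \<noteq> 0" "z \<noteq> 0"
        proof -
          have "m \<in> lattice" using m by (auto simp: prims_def pdisc_def)
          moreover have "z - \<zeta> = (y - \<zeta>) + of_nat d * m" by (simp add: z_def)
          ultimately have "z - \<zeta> \<in> lattice" using c'(5) by (metis lattice_add lattice_of_nat)
          then have "y \<in> disc \<zeta> T" "z \<in> disc \<zeta> T" using c' by (auto simp: disc_def)
          then show "y \<noteq> 0" "z \<noteq> 0" using zero_not_in_disc by auto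
        qed
        ultimately have Re: "0 < Re (cnj z * y)" using window c' by blast
        have "1 * \<bar>wd y m\<bar> \<le> real d * \<bar>wd y m\<bar>" using c' by (intro mult_right_mono) auto
        then have w: "\<bar>wd y m\<bar> \<le> W" using c' by linarith
        have n2: "(norm m)^2 > 0" using mpos by simp
        have "\<bar>wd y m\<bar> / (norm m)^2 \<le> W / (\<epsilon> * T)^2"
          using w W_pos \<epsilon>m elim \<epsilon>_pos by (intro frac_le power_mono) auto
        moreover have "W / (\<epsilon> * T)^2 = (W / \<epsilon>^2) / T^2" by (simp add: power_mult_distrib)
        ultimately have "\<bar>wd y m\<bar> / (norm m)^2 < 1 / 2" using elim(1) by linarith
        then have \<delta>: "\<bar>wd y m / (norm m)^2\<bar> < 1 / 2" by (simp only: abs_divide abs_of_nonneg zero_le_power2)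
        have \<tau>: "ip y m / (norm m)^2 = - real d / 2" using c(2) n2 by (simp add: field_simps)
        have "Re (cnj z * y) = (norm m)^2 * ((- real d / 2)^2 + (wd y m / (norm m)^2)^2) + real d * ip y m"
        proof -
          have "m \<noteq> 0" using mpos by auto
          from norm_coordinates[OF this, of y] show ?thesis unfolding z_def pair_product \<tau> by simp
        qed
        also have "real d * ip y m = (norm m)^2 * (- ((real d)^2) / 2)"
        proof -
          have "ip y m = - (real d * (norm m)^2) / 2" using c(2) by linarith
          then show ?thesis by (simp add: power2_eq_square)
        qed
        also have "(norm m)^2 * ((- real d / 2)^2 + (wd y m / (norm m)^2)^2) + (norm m)^2 * (- ((real d)^2) / 2)
          = (norm m)^2 * ((wd y m / (norm m)^2)^2 - (real d)^2 / 4)"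
          by (simp add: algebra_simps power2_eq_square)
        finally have "0 < (wd y m / (norm m)^2)^2 - (real d)^2 / 4" using Re n2 by (simp add: zero_less_mult_iff)
        moreover have "(wd y m / (norm m)^2)^2 < (1 / 2)^2"
          using power_strict_mono[OF \<delta> abs_ge_zero pos2] by (simp only: power2_abs)
        moreover have "1^2 \<le> (real d)^2" using c' by (intro power_mono) auto
        ultimately show False by (simp add: power2_eq_square)
      qed
      then show ?thesis by simp
    qed simp
    have swap: "(\<Sum>p\<in>bw m. g m p) = (\<Sum>p\<in>forward T (- m). g (- m) p)" if m: "m \<in> prims T" for m
    proof (rule sum.reindex_bij_witness[where j = "\<lambda>(y, d). (y + of_nat d * m, d)" and i = "\<lambda>(y, d). (y - of_nat d * m, d)"])
      have ml: "m \<in> lattice" using m by (auto simp: prims_def pdisc_def)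
      fix p :: "complex \<times> nat"
      obtain y d where yd: "p = (y, d)" by (cases p)
      show "(\<lambda>(y, d). (y - of_nat d * m, d)) ((\<lambda>(y, d). (y + of_nat d * m, d)) p) = p"
        "(\<lambda>(y, d). (y + of_nat d * m, d)) ((\<lambda>(y, d). (y - of_nat d * m, d)) p) = p" using yd by simp_all
      show "g (- m) ((\<lambda>(y, d). (y + of_nat d * m, d)) p) = g m p"
        using pair_val_swap[of T y "y + of_nat d * m"] by (simp add: g_def yd)
      show "(\<lambda>(y, d). (y + of_nat d * m, d)) p \<in> forward T (- m)" if "p \<in> bw m"
        using that close_pairs_reverse[OF ml, of y d T] ip_reverse[of y d m] by (simp add: yd bw_def forward_def)
      show "(\<lambda>(y, d). (y - of_nat d * m, d)) p \<in> bw m" if "p \<in> forward T (- m)"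
        using that close_pairs_reverse[OF ml, of "y - of_nat d * m" d T] ip_reverse[of "y - of_nat d * m" d m]
        by (simp add: yd bw_def forward_def)
    qed
    have "(\<Sum>m\<in>prims T. cut_diff (norm m / T) * (\<Sum>p\<in>bw m. g m p)) = (\<Sum>m\<in>prims T. cut_diff (norm m / T) * (\<Sum>p\<in>forward T (- m). g (- m) p))"
      by (intro sum.cong HOL.refl) (simp add: swap)
    also have "\<dots> = (\<Sum>m\<in>prims T. cut_diff (norm m / T) * (\<Sum>p\<in>forward T m. g m p))"
      by (rule sum.reindex_bij_witness[where i = uminus and j = uminus]) (auto intro: prims_uminus)
    finally have bw_sum: "(\<Sum>m\<in>prims T. cut_diff (norm m / T) * (\<Sum>p\<in>bw m. g m p)) = (\<Sum>m\<in>prims T. cut_diff (norm m / T) * (\<Sum>p\<in>forward T m. g m p))" .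
    have "(\<Sum>m\<in>prims T. cut_diff (norm m / T) * (\<Sum>p\<in>close_pairs W T m. g m p))
      = (\<Sum>m\<in>prims T. cut_diff (norm m / T) * (\<Sum>p\<in>forward T m. g m p) + cut_diff (norm m / T) * (\<Sum>p\<in>bw m. g m p))"
      by (intro sum.cong HOL.refl) (simp add: split distrib_left flat)
    then show ?case unfolding sum.distrib bw_sum unfolding g_def by simp
  qed
qed

end

section \<open>Comparison with the smoothed sum\<close>

context pair_count
begin

lemma dmax_le: "real dmax \<le> 1 / \<epsilon>"
  using \<epsilon>_pos by (simp add: dmax_def)

lemma le_dmax: "real d < 1 / \<epsilon> \<Longrightarrow> d \<le> dmax"
  unfolding dmax_def by (simp add: le_nat_floor)

lemma cut_diff_forward_strip:
  "\<forall>\<^sub>F T in at_top. \<forall>m\<in>prims T. cut_diff (norm m / T) * (\<Sum>(y, d)\<in>forward T m. pair_val T (y + of_nat d * m) y)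
    = (\<Sum>d=1..dmax. \<Sum>y\<in>strip B m. forward_val T d y m * cut_diff (norm m / T))"
proof -
  have "\<forall>\<^sub>F T::real in at_top. T > 0" by (rule eventually_gt_at_top)
  then show ?thesis using window_of_near_directions[OF num_limit]
  proof eventually_elim
    case (elim T)
    note window = elim(2)[rule_format]
    show ?case
    proof
      fix m assume m: "m \<in> prims T"
      then have m0: "m \<noteq> 0" "norm m < T" "m \<in> lattice" by (auto simp: prims_def pdisc_def)
      have fin: "finite (forward T m)" using finite_close_pairs[OF m] by (rule rev_finite_subset) (auto simp: forward_def)
      show "cut_diff (norm m / T) * (\<Sum>(y, d)\<in>forward T m. pair_val T (y + of_nat d * m) y)
        = (\<Sum>d=1..dmax. \<Sum>y\<in>strip B m. forward_val T d y m * cut_diff (norm m / T))"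
      proof (cases "cut_diff (norm m / T) = 0")
        case False
        then have "\<epsilon> < norm m / T" by (rule cut_diff_nonzero)
        then have \<epsilon>m: "\<epsilon> * T < norm m" using elim by (simp add: pos_less_divide_eq)
        define F where "F = {1..dmax} \<times> strip B m"
        have mem: "(d, y) \<in> F" "forward_val T d y m = pair_val T (y + of_nat d * m) y"
          if yd: "(y, d) \<in> forward T m" and nz: "pair_val T (y + of_nat d * m) y \<noteq> 0" for y d
        proof -
          define z where "z = y + of_nat d * m"
          have c: "d \<ge> 1" "norm y < T" "norm z < T" "real d * \<bar>wd y m\<bar> \<le> W" "y - \<zeta> \<in> lattice"
            "0 < 2 * ip y m + real d * (norm m)^2"
            using yd by (auto simp: forward_def close_pairs_def z_def)
          have "z - \<zeta> = (y - \<zeta>) + of_nat d * m" by (simp add: z_def)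
          then have "z - \<zeta> \<in> lattice" using c(5) m0 by (metis lattice_add lattice_of_nat)
          then have "y \<in> disc \<zeta> T" "z \<in> disc \<zeta> T" using c by (auto simp: disc_def)
          then have nzz: "y \<noteq> 0" "z \<noteq> 0" using zero_not_in_disc by auto
          have "f (num T * Arg (cnj z * y) / (2 * pi)) \<noteq> 0" using nz by (simp add: pair_val_def z_def)
          note w = window[OF c(2,3) nzz this]
          then show "forward_val T d y m = pair_val T (y + of_nat d * m) y" using c by (simp add: forward_val_def z_def)
          have "real d * norm m < T" using w by (simp add: z_def norm_mult)
          moreover have "real d * (\<epsilon> * T) \<le> real d * norm m" using \<epsilon>m by (intro mult_left_mono) auto
          ultimately have "(real d * \<epsilon>) * T < 1 * T" by simp
          then have "real d * \<epsilon> < 1" using elim by (simp only: mult_less_cancel_right_pos)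
          then have "real d < 1 / \<epsilon>" using \<epsilon>_pos by (simp add: pos_less_divide_eq)
          then have d: "d \<le> dmax" by (rule le_dmax)
          have "1 * \<bar>wd y m\<bar> \<le> real d * \<bar>wd y m\<bar>" using c by (intro mult_right_mono) auto
          then have "\<bar>wd y m\<bar> \<le> 4 * K" using c(4) unfolding W_def by linarith
          moreover have "0 < 4 / \<epsilon>" using \<epsilon>_pos by simp
          ultimately have wB: "\<bar>wd y m\<bar> \<le> B" using K_pos unfolding B_def by linarith
          have "\<bar>ip y m\<bar> \<le> norm y * norm m" by (rule abs_ip_le)
          also have "\<dots> \<le> T * norm m" using c by (intro mult_right_mono) auto
          also have "\<dots> \<le> (norm m / \<epsilon>) * norm m" using \<epsilon>m \<epsilon>_pos
            by (intro mult_right_mono) (auto simp: pos_le_divide_eq mult.commute)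
          also have "\<dots> = 1 / \<epsilon> * (norm m)^2" by (simp add: power2_eq_square)
          also have "\<dots> \<le> B * (norm m)^2"
          proof (rule mult_right_mono)
            have "1 / \<epsilon> \<le> 4 / \<epsilon>" using \<epsilon>_pos by (intro divide_right_mono) auto
            then show "1 / \<epsilon> \<le> B" using K_pos unfolding B_def by linarith
          qed simp
          finally have "\<bar>ip y m\<bar> \<le> B * (norm m)^2" .
          then show "(d, y) \<in> F" using d c wB by (simp add: F_def strip_def)
        qed
        have mem': "(y, d) \<in> forward T m" "pair_val T (y + of_nat d * m) y = forward_val T d y m"
          if yd: "(d, y) \<in> F" and nz: "forward_val T d y m \<noteq> 0" for y d
          using yd nz by (auto simp: F_def strip_def forward_val_def forward_def close_pairs_def split: if_splits)
        have "(\<Sum>(d, y)\<in>F. forward_val T d y m) = (\<Sum>(d, y)\<in>{(d, y) \<in> F. forward_val T d y m \<noteq> 0}. forward_val T d y m)"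
          by (rule sum.mono_neutral_right) (use finite_strip[OF m0(1)] in \<open>auto simp: F_def\<close>)
        also have "\<dots> = (\<Sum>(y, d)\<in>{(y, d) \<in> forward T m. pair_val T (y + of_nat d * m) y \<noteq> 0}. pair_val T (y + of_nat d * m) y)"
        proof (rule sum.reindex_bij_witness[where i = prod.swap and j = prod.swap])
          fix a assume a: "a \<in> {(d, y) \<in> F. forward_val T d y m \<noteq> 0}"
          obtain d y where dy: "a = (d, y)" "(d, y) \<in> F" "forward_val T d y m \<noteq> 0" using a by auto
          note a' = mem'[OF dy(2,3)]
          show "prod.swap a \<in> {(y, d) \<in> forward T m. pair_val T (y + of_nat d * m) y \<noteq> 0}"
            using a' dy by simp
          show "(case prod.swap a of (y, d) \<Rightarrow> pair_val T (y + of_nat d * m) y) = (case a of (d, y) \<Rightarrow> forward_val T d y m)"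
            using a' dy by simp
        next
          fix b assume b: "b \<in> {(y, d) \<in> forward T m. pair_val T (y + of_nat d * m) y \<noteq> 0}"
          then obtain y d where yd: "b = (y, d)" "(y, d) \<in> forward T m" "pair_val T (y + of_nat d * m) y \<noteq> 0" by auto
          show "prod.swap b \<in> {(d, y) \<in> F. forward_val T d y m \<noteq> 0}" using mem[OF yd(2,3)] yd by simp
        qed auto
        also have "\<dots> = (\<Sum>(y, d)\<in>forward T m. pair_val T (y + of_nat d * m) y)"
          by (rule sum.mono_neutral_left) (use fin in auto)
        finally have "(\<Sum>(d, y)\<in>F. forward_val T d y m) = (\<Sum>(y, d)\<in>forward T m. pair_val T (y + of_nat d * m) y)" .
        then show ?thesis
          unfolding F_def sum.cartesian_product[symmetric] sum_distrib_right[symmetric] by simp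
      qed simp
    qed
  qed
qed

text \<open>The cutoff at \<open>\<epsilon>\<close> removes the short vectors, for which the passage from pairs \<open>(a, n)\<close> to \<open>m = a + n\<close> is not bijective.\<close>

lemma smooth_sum:
  assumes H: "test_function H B" and H0: "\<And>w t r. r \<le> \<epsilon> \<Longrightarrow> H w t r = 0"
  shows "qbound (\<lambda>T. \<Sum>m\<in>prims T. (\<Sum>y\<in>strip B m. H (wd y m) (ip y m / (norm m)^2) (norm m / T))
    - test_function.mean H B (norm m / T)) 0"
proof (rule qbound_mono[OF affine_equidistribution[OF H] order_refl])
  have "\<forall>\<^sub>F T in at_top. T \<ge> max 1 (1 / min_norm / \<epsilon>)" by (rule eventually_ge_at_top)
  then show "\<forall>\<^sub>F T in at_top. norm (\<Sum>m\<in>prims T. (\<Sum>y\<in>strip B m. H (wd y m) (ip y m / (norm m)^2) (norm m / T))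
      - test_function.mean H B (norm m / T))
    \<le> norm (\<Sum>(a, n)\<in>cone1 T. (\<Sum>y\<in>strip B (a + n). H (wd y (a + n)) (ip y (a + n) / (norm (a + n))^2) (norm (a + n) / T))
      - test_function.mean H B (norm (a + n) / T))"
  proof eventually_elim
    case (elim T)
    define G where "G m = (\<Sum>y\<in>strip B m. H (wd y m) (ip y m / (norm m)^2) (norm m / T)) - test_function.mean H B (norm m / T)" for m :: complex
    have T: "T > 0" using elim by simp
    have "(\<Sum>(a, n)\<in>cone1 T. G (a + n)) = (\<Sum>m\<in>prims T. G m)"
    proof (rule sum_cone1_prims)
      have "1 / min_norm / \<epsilon> \<le> T" using elim by simp
      then show "1 / min_norm \<le> \<epsilon> * T" using \<epsilon>_pos by (simp only: pos_divide_le_eq mult.commute)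
      fix m :: complex assume "norm m \<le> \<epsilon> * T"
      then have "norm m / T \<le> \<epsilon>" using T by (simp add: pos_divide_le_eq)
      then show "G m = 0" unfolding G_def test_function.mean_def[OF H] by (simp add: H0)
    qed
    then show ?case unfolding G_def by simp
  qed
qed

lemma forward_vs_smooth:
  "\<forall>\<^sub>F T in at_top. \<bar>(\<Sum>m\<in>prims T. cut_diff (norm m / T) * (\<Sum>(y, d)\<in>forward T m. pair_val T (y + of_nat d * m) y))
     - (\<Sum>d=1..dmax. \<Sum>m\<in>prims T. \<Sum>y\<in>strip B m. main_term (real d) (wd y m) (ip y m / (norm m)^2) (norm m / T))\<bar>
    \<le> (\<Sum>d=1..dmax. \<Sum>m\<in>prims T. \<Sum>y\<in>strip B m. err_term (real d) (wd y m) (ip y m / (norm m)^2) (norm m / T))"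
proof -
  have "\<forall>\<^sub>F T::real in at_top. T > 0" by (rule eventually_gt_at_top)
  then show ?thesis using cut_diff_forward_strip cutoff_error[OF num_limit]
  proof eventually_elim
    case (elim T)
    have pt: "\<bar>forward_val T d y m * cut_diff (norm m / T) - main_term (real d) (wd y m) (ip y m / (norm m)^2) (norm m / T)\<bar>
        \<le> err_term (real d) (wd y m) (ip y m / (norm m)^2) (norm m / T)" if "m \<in> prims T" "d \<in> {1..dmax}" for m d y
    proof -
      have m: "m \<noteq> 0" "norm m < T" using that by (auto simp: prims_def pdisc_def)
      have d: "1 \<le> real d" "0 < norm m / T" "norm m / T < 1" using that m elim(1) by auto
      show ?thesis
        unfolding forward_val_coordinates[OF elim(1) m(1) HOL.refl HOL.refl HOL.refl HOL.refl HOL.refl]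
        by (rule elim(3)[rule_format, OF d HOL.refl HOL.refl])
    qed
    have eq: "(\<Sum>m\<in>prims T. cut_diff (norm m / T) * (\<Sum>(y, d)\<in>forward T m. pair_val T (y + of_nat d * m) y))
      = (\<Sum>d=1..dmax. \<Sum>m\<in>prims T. \<Sum>y\<in>strip B m. forward_val T d y m * cut_diff (norm m / T))"
    proof -
      have "(\<Sum>m\<in>prims T. cut_diff (norm m / T) * (\<Sum>(y, d)\<in>forward T m. pair_val T (y + of_nat d * m) y))
        = (\<Sum>m\<in>prims T. \<Sum>d=1..dmax. \<Sum>y\<in>strip B m. forward_val T d y m * cut_diff (norm m / T))"
        by (intro sum.cong HOL.refl) (use elim(2) in blast)
      then show ?thesis by (rule trans) (rule sum.swap)
    qed
    show ?case
      unfolding eq sum_subtractf[symmetric]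
      by (intro order_trans[OF sum_abs] sum_mono pt)
  qed
qed

text \<open>The vectors \<open>d m\<close> exhaust the nonzero lattice vectors, and \<open>cut_diff\<close> affects only those with \<open>norm m < 2 \<epsilon> T\<close>.\<close>

lemma radial_profile_sum:
  assumes T: "T > 0" and K2: "K2 \<ge> 0" "\<And>X. X > 0 \<Longrightarrow> (\<Sum>m\<in>pdisc X. (T / norm m) powr (3 / 2)) \<le> K2 * T^2 * (X / T) powr (1 / 2)"
  shows "\<bar>(\<Sum>m\<in>pdisc T. radial_profile (norm m / T))
    - (\<Sum>d=1..dmax. \<Sum>m\<in>prims T. cut_diff (norm m / T) * (if real d * (norm m / T) < 1 then radial_profile (real d * (norm m / T)) else 0))\<bar>
    \<le> 2 * K2 * T^2 * (2 * \<epsilon>) powr (1 / 2)"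
proof -
  define A where "A m = (\<Sum>d\<in>{d::nat. 1 \<le> d \<and> real d * norm m < T}. radial_profile (real d * (norm m / T)))" for m :: complex
  have A_bounds: "0 \<le> A m" "A m \<le> 2 * (T / norm m) powr (3 / 2)" if m: "m \<in> prims T" for m
  proof -
    have m0: "norm m > 0" using m by (auto simp: prims_def pdisc_def)
    define r where "r = norm m / T"
    have r: "r > 0" using m0 T by (simp add: r_def)
    have j: "0 \<le> radial_profile (real d * r)" "radial_profile (real d * r) \<le> 1 / r * (1 / real d)" if "1 \<le> d" "real d * norm m < T" for d
    proof -
      have "real d * r \<le> 1" using that T by (simp add: r_def)
      moreover have "0 < real d * r" using that r by (intro mult_pos_pos) auto
      ultimately show "0 \<le> radial_profile (real d * r)" "radial_profile (real d * r) \<le> 1 / r * (1 / real d)"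
        using radial_profile_bounds[of "real d * r"] by (simp_all only: mult.commute[of r] divide_divide_eq_left times_divide_times_eq mult_1_right)
    qed
    show "0 \<le> A m" unfolding A_def r_def[symmetric] by (intro sum_nonneg) (use j in auto)
    define n where "n = nat \<lfloor>1 / r\<rfloor>"
    have sub: "{d::nat. 1 \<le> d \<and> real d * norm m < T} \<subseteq> {1..n}"
    proof
      fix d assume "d \<in> {d::nat. 1 \<le> d \<and> real d * norm m < T}"
      then have d: "1 \<le> d" "real d * norm m < T" by auto
      then have "real d \<le> 1 / r" using m0 by (simp add: r_def pos_le_divide_eq)
      then show "d \<in> {1..n}" using d unfolding n_def by (simp add: le_nat_floor)
    qed
    have "A m \<le> (\<Sum>d\<in>{d::nat. 1 \<le> d \<and> real d * norm m < T}. 1 / r * (1 / real d))"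
      unfolding A_def r_def[symmetric] by (rule sum_mono) (use j in auto)
    also have "\<dots> \<le> (\<Sum>d=1..n. 1 / r * (1 / real d))"
      by (rule sum_mono2[OF _ sub]) (use r in auto)
    also have "\<dots> = 1 / r * (\<Sum>d=1..n. 1 / real d)" by (rule sum_distrib_left[symmetric])
    also have "\<dots> \<le> 1 / r * (2 * sqrt (1 / r))"
    proof (rule mult_left_mono)
      have "real n \<le> 1 / r" using r by (simp add: n_def)
      then have "sqrt (real n) \<le> sqrt (1 / r)" by (rule real_sqrt_le_mono)
      then show "(\<Sum>d=1..n. 1 / real d) \<le> 2 * sqrt (1 / r)" using harmonic_le_sqrt[of n] by linarith
    qed (use r in simp)
    also have "\<dots> = 2 * (T / norm m) powr (3 / 2)"
    proof -
      have "(1 / r) powr (1 + 1 / 2) = 1 / r * sqrt (1 / r)" using r by (simp only: powr_add) (simp add: powr_half_sqrt)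
      then show ?thesis by (simp add: r_def)
    qed
    finally show "A m \<le> 2 * (T / norm m) powr (3 / 2)" .
  qed
  have total: "(\<Sum>m\<in>pdisc T. radial_profile (norm m / T)) = (\<Sum>m\<in>prims T. A m)"
    unfolding sum_over_multiples(1)[where G = "\<lambda>m. radial_profile (norm m / T)"] A_def by (simp add: norm_mult)
  have cut: "(\<Sum>d=1..dmax. cut_diff (norm m / T) * (if real d * (norm m / T) < 1 then radial_profile (real d * (norm m / T)) else 0)) = cut_diff (norm m / T) * A m"
    if m: "m \<in> prims T" for m
  proof (cases "cut_diff (norm m / T) = 0")
    case False
    then have \<epsilon>m: "\<epsilon> < norm m / T" by (rule cut_diff_nonzero)
    have m0: "norm m > 0" using m by (auto simp: prims_def pdisc_def)
    have eq: "{d \<in> {1..dmax}. real d * (norm m / T) < 1} = {d::nat. 1 \<le> d \<and> real d * norm m < T}"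
    proof -
      have "d \<le> dmax" if d: "real d * norm m < T" "1 \<le> d" for d
      proof (rule le_dmax)
        have "real d * (norm m / T) < 1" using d T by simp
        moreover have "real d * \<epsilon> \<le> real d * (norm m / T)" using \<epsilon>m by (intro mult_left_mono) auto
        ultimately have "real d * \<epsilon> < 1" by linarith
        then show "real d < 1 / \<epsilon>" using \<epsilon>_pos by (simp add: pos_less_divide_eq)
      qed
      then show ?thesis using T by auto
    qed
    have "(\<Sum>d=1..dmax. if real d * (norm m / T) < 1 then radial_profile (real d * (norm m / T)) else 0) = A m"
      unfolding A_def eq[symmetric] by (rule sum.inter_filter[symmetric]) simp
    then show ?thesis by (simp only: sum_distrib_left[symmetric])
  qed simp
  have "(\<Sum>d=1..dmax. \<Sum>m\<in>prims T. cut_diff (norm m / T) * (if real d * (norm m / T) < 1 then radial_profile (real d * (norm m / T)) else 0))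
    = (\<Sum>m\<in>prims T. cut_diff (norm m / T) * A m)"
    by (subst sum.swap) (rule sum.cong[OF HOL.refl cut])
  then have "(\<Sum>m\<in>pdisc T. radial_profile (norm m / T))
    - (\<Sum>d=1..dmax. \<Sum>m\<in>prims T. cut_diff (norm m / T) * (if real d * (norm m / T) < 1 then radial_profile (real d * (norm m / T)) else 0))
    = (\<Sum>m\<in>prims T. (1 - cut_diff (norm m / T)) * A m)"
    unfolding total by (simp add: sum_subtractf[symmetric] left_diff_distrib)
  moreover have "\<bar>\<Sum>m\<in>prims T. (1 - cut_diff (norm m / T)) * A m\<bar> \<le> 2 * K2 * T^2 * (2 * \<epsilon>) powr (1 / 2)"
  proof -
    have "\<bar>\<Sum>m\<in>prims T. (1 - cut_diff (norm m / T)) * A m\<bar> \<le> (\<Sum>m\<in>prims T. \<bar>(1 - cut_diff (norm m / T)) * A m\<bar>)" by (rule sum_abs)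
    also have "\<dots> \<le> (\<Sum>m\<in>prims T. if norm m < 2 * \<epsilon> * T then 2 * (T / norm m) powr (3 / 2) else 0)"
    proof (rule sum_mono)
      fix m assume m: "m \<in> prims T"
      show "\<bar>(1 - cut_diff (norm m / T)) * A m\<bar> \<le> (if norm m < 2 * \<epsilon> * T then 2 * (T / norm m) powr (3 / 2) else 0)"
      proof (cases "norm m < 2 * \<epsilon> * T")
        case True
        have "\<bar>(1 - cut_diff (norm m / T)) * A m\<bar> \<le> 1 * A m"
          unfolding abs_mult using cut_diff_bounds[of "norm m / T"] A_bounds[OF m] by (intro mult_mono) auto
        then show ?thesis using A_bounds(2)[OF m] True by simp
      next
        case False
        then have "2 * \<epsilon> \<le> norm m / T" using T by (simp add: pos_le_divide_eq)
        then show ?thesis using False by (simp add: cut_diff_eq_1)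
      qed
    qed
    also have "\<dots> = (\<Sum>m\<in>{m \<in> prims T. norm m < 2 * \<epsilon> * T}. 2 * (T / norm m) powr (3 / 2))"
      by (rule sum.inter_filter[symmetric]) simp
    also have "\<dots> \<le> (\<Sum>m\<in>pdisc (2 * \<epsilon> * T). 2 * (T / norm m) powr (3 / 2))"
      by (rule sum_mono2[OF finite_pdisc]) (auto simp: prims_def pdisc_def)
    also have "\<dots> = 2 * (\<Sum>m\<in>pdisc (2 * \<epsilon> * T). (T / norm m) powr (3 / 2))" by (rule sum_distrib_left[symmetric])
    also have "\<dots> \<le> 2 * (K2 * T^2 * (2 * \<epsilon> * T / T) powr (1 / 2))"
      using K2(2)[of "2 * \<epsilon> * T"] \<epsilon>_pos T by (intro mult_left_mono) auto
    also have "\<dots> = 2 * K2 * T^2 * (2 * \<epsilon>) powr (1 / 2)" using T by simp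
    finally show ?thesis .
  qed
  ultimately show ?thesis by simp
qed

end

context pair_count
begin

text \<open>The first term of the bound comes from short differences, the second from smoothing, the third from the means of the smoothed summand, and the last from short differences in the radial sum. All constants are independent of \<open>\<epsilon>\<close> and \<open>k\<close>.\<close>

lemma pair_sum_asymp_bound:
  assumes K1: "\<And>T X. T > 0 \<Longrightarrow> X > 0 \<Longrightarrow> X \<le> T \<Longrightarrow>
      (\<Sum>m\<in>{m \<in> pdisc X. primitive m}. real (card (close_pairs W T m))) \<le> K1 * T^2 * (X / T) powr (1 / \<kappa>)"
    and K2: "K2 \<ge> 0" "\<And>T X. T > 0 \<Longrightarrow> X > 0 \<Longrightarrow> (\<Sum>m\<in>pdisc X. (T / norm m) powr (3 / 2)) \<le> K2 * T^2 * (X / T) powr (1 / 2)"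
  defines "I \<equiv> integral {-K..K} f"
  shows "qbound (\<lambda>T. pair_sum T - pi * T^2 * I)
    (M * K1 * (2 * \<epsilon>) powr (1 / \<kappa>) + 2 * (1 / \<epsilon> * (disc_const * (16 * K * ((4 + 32 * M) * k / \<epsilon>))))
      + 2 * (1 / \<epsilon> * (\<bar>I\<bar> * (32 * k) * (4 * disc_const))) + 2 * \<bar>I\<bar> * (2 * K2 * (2 * \<epsilon>) powr (1 / 2)))"
proof -
  define cp where "cp T m = (\<Sum>(y, d)\<in>close_pairs W T m. pair_val T (y + of_nat d * m) y)" for T m
  define A where "A T = (\<Sum>m\<in>prims T. (1 - cut_diff (norm m / T)) * cp T m)" for T
  define P where "P T = (\<Sum>m\<in>prims T. cut_diff (norm m / T) * (\<Sum>(y, d)\<in>forward T m. pair_val T (y + of_nat d * m) y))" for T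
  define hs where "hs d T m = (\<Sum>y\<in>strip B m. main_term (real d) (wd y m) (ip y m / (norm m)^2) (norm m / T))" for d T m
  define es where "es d T m = (\<Sum>y\<in>strip B m. err_term (real d) (wd y m) (ip y m / (norm m)^2) (norm m / T))" for d T m
  define mh where "mh d T m = test_function.mean (main_term (real d)) B (norm m / T)" for d T and m :: complex
  define me where "me d T m = test_function.mean (err_term (real d)) B (norm m / T)" for d T and m :: complex
  define HS where "HS T = (\<Sum>d=1..dmax. \<Sum>m\<in>prims T. hs d T m)" for T
  define ES where "ES T = (\<Sum>d=1..dmax. \<Sum>m\<in>prims T. es d T m)" for T
  define MH where "MH T = (\<Sum>d=1..dmax. \<Sum>m\<in>prims T. mh d T m)" for T
  define ME where "ME T = (\<Sum>d=1..dmax. \<Sum>m\<in>prims T. me d T m)" for T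
  define jt where "jt d T m = cut_diff (norm m / T) * (if real d * (norm m / T) < 1 then radial_profile (real d * (norm m / T)) else 0)" for d :: nat and T and m :: complex
  define J where "J T = (\<Sum>d=1..dmax. \<Sum>m\<in>prims T. jt d T m)" for T
  have d_small: "1 \<le> real d" "real d \<le> 1 / \<epsilon>" if "d \<in> {1..dmax}" for d
    using that dmax_le by (auto intro: order_trans)
  have card_prims: "real (card (prims T)) \<le> disc_const * T^2" for T
  proof -
    have "card (prims T) \<le> card (pdisc T)" by (rule card_mono) (auto simp: prims_def)
    then show ?thesis using card_pdisc[of T] by linarith
  qed
  have ev0: "\<forall>\<^sub>F T::real in at_top. T > 0" by (rule eventually_gt_at_top)
  have qA: "qbound A (M * K1 * (2 * \<epsilon>) powr (1 / \<kappa>))"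
  proof (rule qbound_eventually_le)
    show "\<forall>\<^sub>F T in at_top. norm (A T) \<le> M * K1 * (2 * \<epsilon>) powr (1 / \<kappa>) * T^2"
      using ev0
    proof eventually_elim
      case (elim T)
      have "norm (A T) \<le> (\<Sum>m\<in>prims T. \<bar>(1 - cut_diff (norm m / T)) * cp T m\<bar>)"
        unfolding A_def real_norm_def by (rule sum_abs)
      also have "\<dots> \<le> (\<Sum>m\<in>prims T. if norm m < 2 * \<epsilon> * T then M * real (card (close_pairs W T m)) else 0)"
      proof (rule sum_mono)
        fix m assume m: "m \<in> prims T"
        show "\<bar>(1 - cut_diff (norm m / T)) * cp T m\<bar> \<le> (if norm m < 2 * \<epsilon> * T then M * real (card (close_pairs W T m)) else 0)"
        proof (cases "norm m < 2 * \<epsilon> * T")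
          case True
          have "\<bar>cp T m\<bar> \<le> (\<Sum>p\<in>close_pairs W T m. \<bar>case p of (y, d) \<Rightarrow> pair_val T (y + of_nat d * m) y\<bar>)"
            unfolding cp_def by (rule sum_abs)
          also have "\<dots> \<le> (\<Sum>p\<in>close_pairs W T m. M)"
            by (rule sum_mono) (auto simp: pair_val_bound split: prod.splits)
          finally have "\<bar>cp T m\<bar> \<le> M * real (card (close_pairs W T m))" by (simp add: mult.commute)
          moreover have "\<bar>(1 - cut_diff (norm m / T)) * cp T m\<bar> \<le> 1 * \<bar>cp T m\<bar>"
            unfolding abs_mult using cut_diff_bounds[of "norm m / T"] by (intro mult_right_mono) auto
          ultimately show ?thesis using True by simp
        next
          case False
          then have "2 * \<epsilon> \<le> norm m / T" using elim by (simp add: pos_le_divide_eq)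
          then show ?thesis using False by (simp add: cut_diff_eq_1)
        qed
      qed
      also have "\<dots> = (\<Sum>m\<in>{m \<in> prims T. norm m < 2 * \<epsilon> * T}. M * real (card (close_pairs W T m)))"
        by (rule sum.inter_filter[symmetric]) simp
      also have "\<dots> \<le> (\<Sum>m\<in>{m \<in> pdisc (2 * \<epsilon> * T). primitive m}. M * real (card (close_pairs W T m)))"
        by (rule sum_mono2) (use M_nonneg in \<open>auto simp: prims_def pdisc_def intro: rev_finite_subset[OF finite_pdisc[of "2 * \<epsilon> * T"]]\<close>)
      also have "\<dots> = M * (\<Sum>m\<in>{m \<in> pdisc (2 * \<epsilon> * T). primitive m}. real (card (close_pairs W T m)))"
        by (rule sum_distrib_left[symmetric])
      also have "\<dots> \<le> M * (K1 * T^2 * (2 * \<epsilon> * T / T) powr (1 / \<kappa>))"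
      proof (rule mult_left_mono[OF K1 M_nonneg])
        have "2 * \<epsilon> * T \<le> 1 * T" using \<epsilon>_half elim by (intro mult_right_mono) auto
        then show "2 * \<epsilon> * T \<le> T" by simp
      qed (use elim \<epsilon>_pos in auto)
      also have "\<dots> = M * K1 * (2 * \<epsilon>) powr (1 / \<kappa>) * T^2" using elim by simp
      finally show ?case .
    qed
  qed
  have smooth: "qbound (\<lambda>T. \<Sum>d=1..dmax. \<Sum>m\<in>prims T. hs d T m - mh d T m) 0"
    "qbound (\<lambda>T. \<Sum>d=1..dmax. \<Sum>m\<in>prims T. es d T m - me d T m) 0"
  proof -
    have cut_diff_0: "cut_diff r = 0" if "r \<le> \<epsilon>" for r using cut_diff_nonzero[of r] that by fastforce
    show "qbound (\<lambda>T. \<Sum>d=1..dmax. \<Sum>m\<in>prims T. hs d T m - mh d T m) 0"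
      unfolding hs_def mh_def
      by (rule qbound_sum0[OF finite_atLeastAtMost], rule smooth_sum[OF main_term_test]) (auto simp: main_term_def cut_diff_0)
    show "qbound (\<lambda>T. \<Sum>d=1..dmax. \<Sum>m\<in>prims T. es d T m - me d T m) 0"
      unfolding es_def me_def
      by (rule qbound_sum0[OF finite_atLeastAtMost], rule smooth_sum[OF err_term_test]) (use d_small in \<open>auto simp: err_term_def cut_diff_0\<close>)
  qed
  have qE: "qbound ES (1 / \<epsilon> * (disc_const * (16 * K * ((4 + 32 * M) * k / \<epsilon>))))"
  proof (rule qboundI)
    fix e :: real assume e: "e > 0"
    show "\<forall>\<^sub>F T in at_top. norm (ES T) \<le> (1 / \<epsilon> * (disc_const * (16 * K * ((4 + 32 * M) * k / \<epsilon>))) + e) * T^2"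
      using qboundD[OF smooth(2) e]
    proof eventually_elim
      case (elim T)
      define c where "c = 16 * K * ((4 + 32 * M) * k / \<epsilon>)"
      have c: "c \<ge> 0" using K_pos M_nonneg k_pos \<epsilon>_pos by (simp add: c_def)
      have nn: "0 \<le> ES T" unfolding ES_def es_def by (intro sum_nonneg err_term_nonneg)
      have eq: "(\<Sum>d=1..dmax. \<Sum>m\<in>prims T. es d T m - me d T m) = ES T - ME T"
        by (simp add: ES_def ME_def sum_subtractf)
      have "ME T \<le> (\<Sum>d=1..dmax. \<Sum>m\<in>prims T. c)"
        unfolding ME_def me_def c_def by (intro sum_mono err_term_mean d_small)
      also have "\<dots> = real dmax * (real (card (prims T)) * c)" by simp
      also have "\<dots> \<le> (1 / \<epsilon>) * (disc_const * T^2 * c)"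
        using dmax_le card_prims c \<epsilon>_pos by (intro mult_mono mult_right_mono) auto
      finally have "ME T \<le> (1 / \<epsilon>) * (disc_const * c) * T^2" by (simp add: mult_ac)
      moreover have "ES T - ME T \<le> e * T^2" using elim unfolding eq by simp
      ultimately show ?case using nn unfolding c_def[symmetric] by (simp add: distrib_right)
    qed
  qed
  have qPH: "qbound (\<lambda>T. P T - HS T) (1 / \<epsilon> * (disc_const * (16 * K * ((4 + 32 * M) * k / \<epsilon>))))"
  proof (rule qbound_mono[OF qE order_refl])
    show "\<forall>\<^sub>F T in at_top. norm (P T - HS T) \<le> norm (ES T)"
      using forward_vs_smooth
    proof eventually_elim
      case (elim T)
      then have "\<bar>P T - HS T\<bar> \<le> ES T" unfolding P_def HS_def ES_def hs_def es_def .
      then show ?case unfolding real_norm_def by linarith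
    qed
  qed
  have qHM: "qbound (\<lambda>T. HS T - MH T) 0"
    using smooth(1) by (simp add: HS_def MH_def sum_subtractf)
  have qMJ: "qbound (\<lambda>T. MH T - I * J T) (1 / \<epsilon> * (\<bar>I\<bar> * (32 * k) * (4 * disc_const)))"
  proof (rule qbound_eventually_le)
    show "\<forall>\<^sub>F T in at_top. norm (MH T - I * J T) \<le> 1 / \<epsilon> * (\<bar>I\<bar> * (32 * k) * (4 * disc_const)) * T^2"
      using ev0
    proof eventually_elim
      case (elim T)
      have pt: "\<bar>mh d T m - I * jt d T m\<bar> \<le> \<bar>I\<bar> * (32 * k) * (T * (1 / norm m))" if d: "d \<in> {1..dmax}" and m: "m \<in> prims T" for d m
      proof -
        have m0: "norm m > 0" using m by (auto simp: prims_def pdisc_def)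
        have \<rho>: "norm m / T > 0" using m0 elim by simp
        have "\<bar>mh d T m - I * jt d T m\<bar> \<le> cut_diff (norm m / T) * \<bar>I\<bar> * (32 * k / (real d * (norm m / T)))"
          using main_term_mean[OF d_small(1)[OF d] \<rho>] unfolding mh_def jt_def I_def by (simp only: mult_ac)
        also have "\<dots> \<le> 1 * \<bar>I\<bar> * (32 * k / (1 * (norm m / T)))"
        proof (rule mult_mono)
          show "cut_diff (norm m / T) * \<bar>I\<bar> \<le> 1 * \<bar>I\<bar>" using cut_diff_bounds[of "norm m / T"] by (intro mult_right_mono) auto
          have "1 * (norm m / T) \<le> real d * (norm m / T)" using d_small(1)[OF d] \<rho> by (intro mult_right_mono) auto
          then show "32 * k / (real d * (norm m / T)) \<le> 32 * k / (1 * (norm m / T))"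
            using \<rho> k_pos by (intro frac_le) auto
          show "0 \<le> 32 * k / (real d * (norm m / T))" using \<rho> k_pos elim by (intro divide_nonneg_nonneg mult_nonneg_nonneg) auto
        qed simp
        also have "\<dots> = \<bar>I\<bar> * (32 * k) * (T * (1 / norm m))" by simp
        finally show ?thesis .
      qed
      have "\<bar>\<Sum>d=1..dmax. \<Sum>m\<in>prims T. mh d T m - I * jt d T m\<bar> \<le> (\<Sum>d=1..dmax. \<Sum>m\<in>prims T. \<bar>I\<bar> * (32 * k) * (T * (1 / norm m)))"
        by (intro order_trans[OF sum_abs] sum_mono pt)
      also have "\<dots> = real dmax * (\<bar>I\<bar> * (32 * k) * (T * (\<Sum>m\<in>prims T. 1 / norm m)))"
        by (simp only: sum_constant sum_distrib_left card_atLeastAtMost add_diff_cancel_right' Suc_eq_plus1)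
      also have "\<dots> \<le> (1 / \<epsilon>) * (\<bar>I\<bar> * (32 * k) * (T * (4 * disc_const * T)))"
      proof -
        have "(\<Sum>m\<in>prims T. 1 / norm m) \<le> (\<Sum>m\<in>pdisc T. 1 / norm m)" by (rule sum_mono2) (auto simp: prims_def)
        also have "\<dots> \<le> 4 * disc_const * T" using elim by (rule sum_inverse_norm)
        finally have s: "(\<Sum>m\<in>prims T. 1 / norm m) \<le> 4 * disc_const * T" .
        have "0 \<le> (\<Sum>m\<in>prims T. 1 / norm m)" by (intro sum_nonneg) auto
        then show ?thesis using s dmax_le elim k_pos \<epsilon>_pos by (intro mult_mono mult_left_mono) auto
      qed
      also have "\<dots> = 1 / \<epsilon> * (\<bar>I\<bar> * (32 * k) * (4 * disc_const)) * T^2" by (simp add: power2_eq_square mult_ac)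
      finally show ?case unfolding MH_def J_def real_norm_def by (simp add: sum_subtractf sum_distrib_left)
    qed
  qed
  have qJ: "qbound (\<lambda>T. J T - pi * T^2 / 2) (2 * K2 * (2 * \<epsilon>) powr (1 / 2))"
  proof -
    have "qbound (\<lambda>T. (\<Sum>m\<in>pdisc T. radial_profile (norm m / T)) - J T) (2 * K2 * (2 * \<epsilon>) powr (1 / 2))"
    proof (rule qbound_eventually_le)
      show "\<forall>\<^sub>F T in at_top. norm ((\<Sum>m\<in>pdisc T. radial_profile (norm m / T)) - J T) \<le> 2 * K2 * (2 * \<epsilon>) powr (1 / 2) * T^2"
        using ev0
      proof eventually_elim
        case (elim T)
        show ?case using radial_profile_sum[OF elim K2(1) K2(2)[OF elim]] unfolding J_def jt_def real_norm_def
          by (simp only: mult_ac)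
      qed
    qed
    from qbound_diff[OF radial_sum this] show ?thesis by (simp add: algebra_simps)
  qed
  have total: "qbound (\<lambda>T. A T + 2 * (P T - HS T) + 2 * (HS T - MH T) + 2 * (MH T - I * J T) + (2 * I) * (J T - pi * T^2 / 2))
    (M * K1 * (2 * \<epsilon>) powr (1 / \<kappa>) + norm (2::real) * (1 / \<epsilon> * (disc_const * (16 * K * ((4 + 32 * M) * k / \<epsilon>)))) + norm (2::real) * 0
      + norm (2::real) * (1 / \<epsilon> * (\<bar>I\<bar> * (32 * k) * (4 * disc_const))) + norm (2 * I) * (2 * K2 * (2 * \<epsilon>) powr (1 / 2)))"
    by (intro qbound_add qbound_cmult qA qPH qHM qMJ qJ)
  show ?thesis
  proof (rule qbound_mono[OF total])
    show "\<forall>\<^sub>F T in at_top. norm (pair_sum T - pi * T^2 * I)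
      \<le> norm (A T + 2 * (P T - HS T) + 2 * (HS T - MH T) + 2 * (MH T - I * J T) + (2 * I) * (J T - pi * T^2 / 2))"
      using pair_sum_eq cut_diff_close_pairs_forward
    proof eventually_elim
      case (elim T)
      have "pair_sum T = (\<Sum>m\<in>prims T. (1 - cut_diff (norm m / T)) * cp T m + cut_diff (norm m / T) * cp T m)"
        unfolding elim(1) cp_def[symmetric] by (intro sum.cong HOL.refl) (simp add: left_diff_distrib)
      also have "\<dots> = A T + 2 * P T"
        unfolding sum.distrib A_def P_def elim(2)[symmetric] cp_def ..
      finally have "pair_sum T - pi * T^2 * I
        = A T + 2 * (P T - HS T) + 2 * (HS T - MH T) + 2 * (MH T - I * J T) + (2 * I) * (J T - pi * T^2 / 2)"
        by (simp add: algebra_simps)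
      then show ?case by simp
    qed
  qed (simp add: abs_mult)
qed

end

context unimodular_lattice
begin

lemma card_disc_eventually_ge: "\<forall>\<^sub>F T in at_top. real (card (disc \<zeta> T)) \<ge> c"
  proof -
    have "\<forall>\<^sub>F T in at_top. real (card (disc \<zeta> T)) / (pi * T^2) > 1 / 2" using card_disc_limit by (rule order_tendstoD) simp
    moreover have "\<forall>\<^sub>F T::real in at_top. T \<ge> max 1 (c)" by (rule eventually_ge_at_top)
    ultimately show ?thesis
    proof eventually_elim
      case (elim T)
      have T: "T \<ge> 1" "T \<ge> c" using elim by auto
      have p: "pi * T^2 > 0" using T by simp
      then have "1 / 2 * (pi * T^2) < real (card (disc \<zeta> T))" using elim(1) by (simp only: pos_less_divide_eq)
      moreover have "2 * T^2 \<le> pi * T^2" using pi_gt3 by (intro mult_right_mono) auto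
      moreover have "1 * T \<le> T * T" using T by (intro mult_right_mono) auto
      ultimately show ?case using T unfolding power2_eq_square by linarith
    qed
  qed

end

section \<open>Limit of the pair sum\<close>

context diophantine_lattice
begin

definition angle_sum :: "(real \<Rightarrow> real) \<Rightarrow> real \<Rightarrow> real" where
  "angle_sum f T = (\<Sum>y\<in>disc \<zeta> T. \<Sum>z\<in>disc \<zeta> T - {y}. f (real (card (disc \<zeta> T)) * Arg (cnj z * y) / (2 * pi)))"

text \<open>With \<open>k = \<epsilon>\<^sup>3\<close>, all error terms tend to 0 with \<open>\<epsilon>\<close>.\<close>

lemma angle_sum_even:
  fixes f :: "real \<Rightarrow> real"
  assumes f: "continuous_on UNIV f" "\<And>x. f (- x) = f x" "\<And>x. \<bar>x\<bar> \<ge> K \<Longrightarrow> f x = 0" and K: "K > 0"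
  shows "qbound (\<lambda>T. angle_sum f T - pi * T^2 * integral {-K..K} f) 0"
proof -
  define I where "I = integral {-K..K} f"
  have "bounded (f ` {-K..K})"
    by (intro compact_imp_bounded compact_continuous_image continuous_on_subset[OF f(1)]) auto
  then obtain M where "\<forall>y\<in>f ` {-K..K}. norm y \<le> M" unfolding bounded_iff by blast
  then have M: "\<bar>f x\<bar> \<le> M" if "x \<in> {-K..K}" for x using that by auto
  have M0: "M \<ge> 0" using M[of 0] K by (auto intro: order_trans[OF abs_ge_zero])
  have fM: "\<bar>f x\<bar> \<le> M" for x
  proof (cases "\<bar>x\<bar> \<ge> K")
    case True then show ?thesis using f(3)[of x] M0 by simp
  next
    case False then show ?thesis by (intro M) auto
  qed
  obtain K1 where K1: "K1 \<ge> 0" "\<And>T X. T > 0 \<Longrightarrow> X > 0 \<Longrightarrow> X \<le> T \<Longrightarrow>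
     (\<Sum>m\<in>{m \<in> pdisc X. primitive m}. real (card (close_pairs (4 * K) T m))) \<le> K1 * T^2 * (X / T) powr (1 / \<kappa>)"
    using short_differences_rare[of "4 * K"] K by auto
  obtain K2 where K2: "K2 \<ge> 0" "\<And>T X. T > 0 \<Longrightarrow> X > 0 \<Longrightarrow> (\<Sum>m\<in>pdisc X. (T / norm m) powr (3 / 2)) \<le> K2 * T^2 * (X / T) powr (1 / 2)"
    using sum_three_halves by auto
  define a1 where "a1 = 2 * (disc_const * (16 * K * (4 + 32 * M)))"
  define a2 where "a2 = 2 * (\<bar>I\<bar> * 32 * (4 * disc_const))"
  define a3 where "a3 = 2 * \<bar>I\<bar> * (2 * K2)"
  define E where "E \<epsilon> = M * K1 * (2 * \<epsilon>) powr (1 / \<kappa>) + a1 * \<epsilon> + a2 * \<epsilon>^2 + a3 * (2 * \<epsilon>) powr (1 / 2)" for \<epsilon>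
  have bound: "qbound (\<lambda>T. angle_sum f T - pi * T^2 * I) (E \<epsilon>)" if \<epsilon>: "0 < \<epsilon>" "\<epsilon> \<le> 1 / 2" for \<epsilon>
  proof -
    have "\<epsilon> ^ 3 \<le> (1 / 2) ^ 3" using \<epsilon> by (intro power_mono) auto
    then have k: "\<epsilon> ^ 3 \<le> 1 / 8" by (simp add: power3_eq_cube)
    interpret pair_count u v \<zeta> C \<kappa> f K M \<epsilon> "\<epsilon> ^ 3"
      by unfold_locales (use f K fM \<epsilon> k in auto)
    have "qbound (\<lambda>T. pair_sum T - pi * T^2 * integral {-K..K} f)
      (M * K1 * (2 * \<epsilon>) powr (1 / \<kappa>) + 2 * (1 / \<epsilon> * (disc_const * (16 * K * ((4 + 32 * M) * \<epsilon> ^ 3 / \<epsilon>))))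
      + 2 * (1 / \<epsilon> * (\<bar>integral {-K..K} f\<bar> * (32 * \<epsilon> ^ 3) * (4 * disc_const))) + 2 * \<bar>integral {-K..K} f\<bar> * (2 * K2 * (2 * \<epsilon>) powr (1 / 2)))"
      by (rule pair_sum_asymp_bound) (use K1 K2 in \<open>auto simp: W_def\<close>)
    moreover have "M * K1 * (2 * \<epsilon>) powr (1 / \<kappa>) + 2 * (1 / \<epsilon> * (disc_const * (16 * K * ((4 + 32 * M) * \<epsilon> ^ 3 / \<epsilon>))))
      + 2 * (1 / \<epsilon> * (\<bar>I\<bar> * (32 * \<epsilon> ^ 3) * (4 * disc_const))) + 2 * \<bar>I\<bar> * (2 * K2 * (2 * \<epsilon>) powr (1 / 2)) = E \<epsilon>"
      using \<epsilon> by (simp add: E_def a1_def a2_def a3_def power3_eq_cube power2_eq_square)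
    ultimately show ?thesis
      unfolding I_def[symmetric] by (simp only: pair_sum_def[abs_def] pair_val_def num_def angle_sum_def)
  qed
  have lim: "(E \<longlongrightarrow> M * K1 * 0 + a1 * 0 + a2 * 0^2 + a3 * 0) (at_right 0)"
  proof -
    have id: "((\<lambda>\<epsilon>::real. \<epsilon>) \<longlongrightarrow> 0) (at_right 0)" by (rule tendsto_ident_at)
    have p: "((\<lambda>\<epsilon>::real. (2 * \<epsilon>) powr a) \<longlongrightarrow> 0) (at_right 0)" if "a > 0" for a
    proof -
      have "((\<lambda>\<epsilon>::real. 2 * \<epsilon>) \<longlongrightarrow> 2 * 0) (at_right 0)" by (intro tendsto_intros)
      then have "((\<lambda>\<epsilon>::real. (2 * \<epsilon>) powr a) \<longlongrightarrow> (2 * 0) powr a) (at_right 0)"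
        using that by (intro tendsto_powr2 tendsto_const) (auto simp: eventually_at_filter)
      then show ?thesis by simp
    qed
    show ?thesis unfolding E_def
      by (intro tendsto_add tendsto_mult_left tendsto_power p id) (use \<kappa>_ge in auto)
  qed
  show ?thesis
    unfolding I_def[symmetric]
  proof (rule qbound_limit)
    fix e :: real assume e: "e > 0"
    have "\<forall>\<^sub>F \<epsilon> in at_right 0. E \<epsilon> < e" using lim e by (intro order_tendstoD) auto
    moreover have "\<forall>\<^sub>F \<epsilon>::real in at_right 0. \<epsilon> \<in> {0<..<1 / 2}" by (rule eventually_at_right_real) simp
    ultimately have "\<forall>\<^sub>F \<epsilon> in at_right 0. E \<epsilon> < e \<and> \<epsilon> \<in> {0<..<1 / 2}" by eventually_elim simp
    then obtain \<epsilon> where \<epsilon>: "E \<epsilon> < e" "0 < \<epsilon>" "\<epsilon> < 1 / 2"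
      using eventually_happens'[OF trivial_limit_at_right_real] by fastforce
    show "qbound (\<lambda>T. angle_sum f T - pi * T^2 * I) (0 + e)"
      by (rule qbound_weaken[OF bound]) (use \<epsilon> in auto)
  qed
qed

text \<open>Exchanging the points of a pair reverses the sign of the angle. The angle \<open>\<pi>\<close> is its own mirror image, but lies outside the support of \<open>f\<close> when there are enough points.\<close>

lemma angle_sum_symmetrize:
  assumes f: "\<And>x. \<bar>x\<bar> \<ge> K \<Longrightarrow> f x = 0" and N: "real (card (disc \<zeta> T)) \<ge> 2 * K"
  shows "angle_sum f T = angle_sum (\<lambda>x. (f x + f (- x)) / 2) T"
proof -
  define N where "N = real (card (disc \<zeta> T))"
  define D where "D = disc \<zeta> T"
  define A where "A z y = Arg (cnj z * y)" for z y :: complex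
  have rev: "f (N * A z y / (2 * pi)) = f (- (N * A y z / (2 * pi)))" for y z
  proof (cases "A y z = pi")
    case True
    then have "cnj y * z \<in> \<real>" unfolding A_def by (simp add: Arg_eq_pi_iff)
    then have "A z y = pi" using True Arg_cnj[of "cnj y * z"] unfolding A_def by (simp add: mult.commute)
    then have "N * A z y / (2 * pi) = N / 2" "- (N * A y z / (2 * pi)) = - (N / 2)" using True by auto
    moreover have "\<bar>N / 2\<bar> \<ge> K" "\<bar>- (N / 2)\<bar> \<ge> K" using N by (auto simp: N_def)
    ultimately show ?thesis by (simp only: f)
  next
    case False
    then have "A z y = - A y z"
      using Arg_cnj[of "cnj y * z"] Arg_eq_0_pi[of "cnj y * z"] unfolding A_def by (auto simp: mult.commute)
    then show ?thesis by simp
  qed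
  have Dfin: "finite D" by (simp add: D_def finite_disc)
  have diag: "(\<Sum>y\<in>D. \<Sum>z\<in>D - {y}. g y z) = (\<Sum>y\<in>D. \<Sum>z\<in>D. g y z) - (\<Sum>y\<in>D. g y y)" for g :: "complex \<Rightarrow> complex \<Rightarrow> real"
    using Dfin by (simp add: sum_diff1 sum_subtractf)
  have swap: "(\<Sum>y\<in>D. \<Sum>z\<in>D - {y}. g y z) = (\<Sum>y\<in>D. \<Sum>z\<in>D - {y}. g z y)" for g :: "complex \<Rightarrow> complex \<Rightarrow> real"
    unfolding diag using sum.swap[of g D D] by simp
  have "angle_sum f T = (\<Sum>y\<in>D. \<Sum>z\<in>D - {y}. f (N * A z y / (2 * pi)))"
    by (simp add: angle_sum_def D_def N_def A_def)
  moreover have "\<dots> = (\<Sum>y\<in>D. \<Sum>z\<in>D - {y}. f (- (N * A z y / (2 * pi))))"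
    by (subst swap) (simp only: rev)
  moreover have "angle_sum (\<lambda>x. (f x + f (- x)) / 2) T
     = ((\<Sum>y\<in>D. \<Sum>z\<in>D - {y}. f (N * A z y / (2 * pi))) + (\<Sum>y\<in>D. \<Sum>z\<in>D - {y}. f (- (N * A z y / (2 * pi))))) / 2"
    by (simp add: angle_sum_def D_def N_def A_def sum_divide_distrib[symmetric] sum.distrib)
  ultimately show ?thesis by simp
qed

theorem angle_sum_limit:
  fixes f :: "real \<Rightarrow> real"
  assumes f: "continuous_on UNIV f" "\<And>x. \<bar>x\<bar> \<ge> K \<Longrightarrow> f x = 0" and K: "K > 0"
  shows "((\<lambda>T. angle_sum f T / real (card (disc \<zeta> T))) \<longlongrightarrow> integral {-K..K} f) at_top"
proof -
  define I where "I = integral {-K..K} f"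
  define g where "g x = (f x + f (- x)) / 2" for x
  have f_neg: "continuous_on UNIV (\<lambda>x. f (- x))"
    by (rule continuous_on_compose2[OF f(1)]) (auto intro: continuous_intros)
  have g_c: "continuous_on UNIV g" unfolding g_def[abs_def] by (intro continuous_intros f(1) f_neg) auto
  have I_g: "integral {-K..K} g = I"
  proof -
    have fi: "(f has_integral I) {-K..K}"
      unfolding I_def by (intro integrable_integral integrable_continuous_real continuous_on_subset[OF f(1)]) auto
    have "((\<lambda>x. f (- x)) has_integral I) {-K..K}"
      using has_integral_reflect_real[where f = f and a = "-K" and b = K and i = I] fi by simp
    from has_integral_add[OF fi this] have "((\<lambda>x. f x + f (- x)) has_integral I + I) {-K..K}" .
    from has_integral_divide[OF this, of 2] have "(g has_integral (I + I) / 2) {-K..K}" unfolding g_def[abs_def] .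
    then have "integral {-K..K} g = (I + I) / 2" by (rule integral_unique)
    then show ?thesis by simp
  qed
  have g_q: "qbound (\<lambda>T. angle_sum g T - pi * T^2 * I) 0"
    unfolding I_g[symmetric] by (rule angle_sum_even[OF g_c]) (auto simp: g_def f(2) K add.commute)
  note N = card_disc_limit[of \<zeta>]
  have N_large: "\<forall>\<^sub>F T in at_top. real (card (disc \<zeta> T)) \<ge> 2 * K" by (rule card_disc_eventually_ge)
  have "((\<lambda>T. (angle_sum g T - pi * T^2 * I) / T^2) \<longlongrightarrow> 0) at_top"
  proof (rule tendsto_norm_zero_cancel)
    show "((\<lambda>T. norm ((angle_sum g T - pi * T^2 * I) / T^2)) \<longlongrightarrow> 0) at_top"
      using g_q unfolding qbound_iff_tendsto by (simp add: abs_divide)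
  qed
  then have "((\<lambda>T. (1 / pi * ((angle_sum g T - pi * T^2 * I) / T^2) + I) / (real (card (disc \<zeta> T)) / (pi * T^2)))
      \<longlongrightarrow> (1 / pi * 0 + I) / 1) at_top"
    by (intro tendsto_divide tendsto_add tendsto_mult_left tendsto_const N) auto
  then have lim: "((\<lambda>T. (1 / pi * ((angle_sum g T - pi * T^2 * I) / T^2) + I) / (real (card (disc \<zeta> T)) / (pi * T^2))) \<longlongrightarrow> I) at_top"
    by simp
  show ?thesis
    unfolding I_def[symmetric]
  proof (rule Lim_transform_eventually[OF lim])
    show "\<forall>\<^sub>F T in at_top. (1 / pi * ((angle_sum g T - pi * T^2 * I) / T^2) + I) / (real (card (disc \<zeta> T)) / (pi * T^2))
      = angle_sum f T / real (card (disc \<zeta> T))"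
      using N_large eventually_gt_at_top[of 0]
    proof eventually_elim
      case (elim T)
      have eq: "angle_sum f T = angle_sum g T"
        unfolding g_def[abs_def] by (rule angle_sum_symmetrize[OF f(2) elim(1)])
      have "1 / pi * ((angle_sum g T - pi * T^2 * I) / T^2) + I = angle_sum g T / (pi * T^2)"
        using elim(2) by (simp add: diff_divide_distrib)
      then show ?case unfolding eq using elim by simp
    qed
  qed
qed

end

section \<open>Directions of points in the plane\<close>

definition to_complex :: "real ^ 2 \<Rightarrow> complex" where
  "to_complex y = Complex (y $ 1) (y $ 2)"

lemma norm_to_complex: "norm (to_complex y) = norm y"
  by (simp add: to_complex_def cmod_def norm_vec_def L2_set_def UNIV_2)

lemma inj_to_complex: "inj to_complex"
  by (rule injI) (simp add: to_complex_def vec_eq_iff forall_2)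

lemma to_complex_eq_0_iff: "to_complex y = 0 \<longleftrightarrow> y = 0"
  by (simp add: to_complex_def complex_eq_iff vec_eq_iff forall_2)

lemma direction_angle_diff:
  assumes "to_complex y \<noteq> 0" "to_complex z \<noteq> 0"
  shows "\<exists>j::int. direction_angle y - direction_angle z = Arg (cnj (to_complex z) * to_complex y) / (2 * pi) + of_int j"
proof -
  define a b where "a = to_complex y" and "b = to_complex z"
  define x where "x = cnj b * a"
  have nz: "a \<noteq> 0" "b \<noteq> 0" "x \<noteq> 0" using assms by (auto simp: a_def b_def x_def)
  have polar: "w = of_real (norm w) * cis (Arg2pi w)" for w
    using Arg2pi[of w] unfolding is_Arg_def cis_conv_exp by blast
  have "cnj (of_real r * cis \<beta>) * (of_real s * cis \<alpha>) = of_real (r * s) * cis (\<alpha> - \<beta>)" for r s \<alpha> \<beta>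
    by (simp add: complex_eq_iff cos_diff sin_diff algebra_simps)
  from this[of "norm b" "Arg2pi b" "norm a" "Arg2pi a"]
  have "x = of_real (norm b * norm a) * cis (Arg2pi a - Arg2pi b)"
    unfolding polar[symmetric] x_def .
  then have "x = of_real (norm x) * cis (Arg2pi a - Arg2pi b)"
    by (simp add: x_def norm_mult)
  moreover have "x = of_real (norm x) * cis (Arg x)" using rcis_cmod_Arg[of x] by (simp add: rcis_def)
  ultimately have "of_real (norm x) * cis (Arg2pi a - Arg2pi b) = of_real (norm x) * cis (Arg x)" by simp
  then have "cis (Arg2pi a - Arg2pi b) = cis (Arg x)" using nz by simp
  then have "sin (Arg2pi a - Arg2pi b) = sin (Arg x) \<and> cos (Arg2pi a - Arg2pi b) = cos (Arg x)"
    by (simp add: complex_eq_iff)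
  then obtain j :: int where "Arg2pi a - Arg2pi b = Arg x + 2 * pi * j" unfolding sin_cos_eq_iff by blast
  then have "(Arg2pi a - Arg2pi b) / (2 * pi) = Arg x / (2 * pi) + j" by (simp add: add_divide_distrib)
  then show ?thesis
    unfolding direction_angle_def x_def a_def b_def to_complex_def by (auto simp: diff_divide_distrib)
qed

text \<open>At most one translate of \<open>\<theta>\<close> lies in the support, namely the one in \<open>[-1/2, 1/2]\<close>.\<close>

lemma infsum_periodization:
  fixes f :: "real \<Rightarrow> real"
  assumes f: "\<And>x. \<bar>x\<bar> \<ge> K \<Longrightarrow> f x = 0" and K: "K > 0" and N: "N \<ge> 2 * K"
    and \<phi>: "\<bar>\<phi>\<bar> \<le> 1 / 2" "\<theta> = \<phi> + of_int j"
  shows "(\<Sum>\<^sub>\<infinity>m::int. f (N * (\<theta> + of_int m))) = f (N * \<phi>)"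
proof -
  have "f (N * (\<theta> + of_int m)) = 0" if "m \<noteq> - j" for m :: int
  proof (rule f)
    have "1 \<le> \<bar>real_of_int (j + m)\<bar>" using that by linarith
    then have "1 / 2 \<le> \<bar>\<theta> + of_int m\<bar>" using \<phi> unfolding of_int_add by linarith
    then have "(2 * K) * (1 / 2) \<le> N * \<bar>\<theta> + of_int m\<bar>" using N K by (intro mult_mono) auto
    then show "K \<le> \<bar>N * (\<theta> + of_int m)\<bar>" using N K by (simp add: abs_mult)
  qed
  then have "(\<Sum>\<^sub>\<infinity>m::int. f (N * (\<theta> + of_int m))) = infsum (\<lambda>m::int. f (N * (\<theta> + of_int m))) {- j}"
    by (intro infsum_cong_neutral) auto
  also have "\<dots> = f (N * \<phi>)" by (simp add: \<phi>)
  finally show ?thesis .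
qed

theorem corollary5:
  fixes M\<^sub>0 :: "real ^ 2 ^ 2" and \<xi> :: "real ^ 2" and f :: "real \<Rightarrow> real"
  assumes "det M\<^sub>0 = 1"
    and "diophantine \<xi>"
    and "continuous_on UNIV f"
    and "compact (closure {x. f x \<noteq> 0})"
  shows "((\<lambda>T. direction_pair_correlation M\<^sub>0 \<xi> T f) \<longlongrightarrow> (LINT s|lborel. f s)) at_top"
proof -
  define u v where "u = Complex (M\<^sub>0 $ 1 $ 1) (M\<^sub>0 $ 1 $ 2)" and "v = Complex (M\<^sub>0 $ 2 $ 1) (M\<^sub>0 $ 2 $ 2)"
  define \<zeta> where "\<zeta> = of_real (\<xi> $ 1) * u + of_real (\<xi> $ 2) * v"
  have uv: "wd u v = 1" using assms(1) by (simp add: wd_def u_def v_def det_2 mult.commute)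
  have L: "unimodular_lattice u v" by unfold_locales (rule uv)
  obtain \<kappa>0 C0 where C0: "C0 > 0" "\<And>k l. k \<in> integer_points - {0} \<Longrightarrow>
      \<bar>k \<bullet> \<xi> + of_int l\<bar> \<ge> C0 * (\<bar>k $ 1\<bar> + \<bar>k $ 2\<bar>) powr (- \<kappa>0)"
    using assms(2) unfolding diophantine_def diophantine_of_type_def by blast
  \<comment> \<open>Enlarging the exponent only weakens the Diophantine condition.\<close>
  define \<kappa> where "\<kappa> = max \<kappa>0 2"
  define A where "A = norm u + norm v"
  have "u \<noteq> 0" using uv by (auto simp: wd_def)
  then have A: "A > 0" unfolding A_def by (simp add: add_pos_nonneg)
  interpret diophantine_lattice u v \<zeta> "C0 * A powr (- \<kappa>)" \<kappa>
  proof (intro diophantine_lattice.intro diophantine_lattice_axioms.intro L)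
    show "0 < C0 * A powr (- \<kappa>)" using C0 A by simp
    show "2 \<le> \<kappa>" by (simp add: \<kappa>_def)
    fix m and l :: int assume m: "m \<in> unimodular_lattice.lattice u v" "m \<noteq> 0"
    obtain i j where ij: "m = of_int i * u + of_int j * v" using m(1) by (rule unimodular_lattice.latticeE[OF L])
    \<comment> \<open>\<open>wd \<zeta> m\<close> is the inner product of \<open>\<xi>\<close> with the coordinates of \<open>m\<close> rotated by a right angle.\<close>
    define k :: "real ^ 2" where "k = vector [of_int j, - of_int i]"
    have k12: "k $ 1 = of_int j" "k $ 2 = - of_int i" by (simp_all add: k_def)
    have "i \<noteq> 0 \<or> j \<noteq> 0" using m(2) ij by auto
    then have k: "k \<in> integer_points - {0}" "\<bar>real_of_int i\<bar> + \<bar>real_of_int j\<bar> \<ge> 1"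
      by (auto simp: integer_points_def forall_2 k12 vec_eq_iff)
    define s where "s = \<bar>real_of_int i\<bar> + \<bar>real_of_int j\<bar>"
    have "wd \<zeta> m = \<xi> $ 1 * of_int j - \<xi> $ 2 * of_int i"
      using uv wd_swap[of u v] unfolding ij \<zeta>_def by (simp add: wd_simps)
    then have wk: "wd \<zeta> m = k \<bullet> \<xi>" by (simp add: inner_vec_def sum_2 k12 mult.commute)
    have "of_int i = wd m v" "of_int j = wd u m" unfolding ij by (simp_all add: wd_simps uv)
    then have "s \<le> norm m * norm v + norm u * norm m" unfolding s_def by (intro add_mono) (simp_all only: abs_wd_le)
    then have s: "1 \<le> s" "s \<le> A * norm m" using k by (simp_all add: s_def A_def algebra_simps)
    have "(A * norm m) powr (- \<kappa>) \<le> s powr (- \<kappa>)" using s by (intro powr_mono2') (auto simp: \<kappa>_def)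
    also have "\<dots> \<le> s powr (- \<kappa>0)" using s by (intro powr_mono) (auto simp: \<kappa>_def)
    finally have "C0 * (A * norm m) powr (- \<kappa>) \<le> C0 * s powr (- \<kappa>0)" using C0(1) by (intro mult_left_mono) auto
    also have "\<dots> \<le> \<bar>k \<bullet> \<xi> + of_int l\<bar>" using C0(2)[OF k(1), of l] by (simp add: s_def k12 add.commute)
    finally show "C0 * A powr (- \<kappa>) * norm m powr (- \<kappa>) \<le> \<bar>wd \<zeta> m + of_int l\<bar>"
      unfolding wk by (simp add: powr_mult)
  qed
  have image: "to_complex ` lattice_points_upto M\<^sub>0 \<xi> T = disc \<zeta> T" for T
  proof -
    have coord: "to_complex ((k + \<xi>) v* M\<^sub>0) - \<zeta> = of_real (k $ 1) * u + of_real (k $ 2) * v" for k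
      by (simp add: to_complex_def vector_matrix_mult_def sum_2 u_def v_def \<zeta>_def complex_eq_iff algebra_simps)
    have aff: "to_complex ` affine_lattice M\<^sub>0 \<xi> = {z. z - \<zeta> \<in> lattice}"
    proof (intro equalityI subsetI)
      fix z assume "z \<in> to_complex ` affine_lattice M\<^sub>0 \<xi>"
      then obtain k where k: "k \<in> integer_points" "z = to_complex ((k + \<xi>) v* M\<^sub>0)" by (auto simp: affine_lattice_def)
      then obtain i j where "k $ 1 = of_int i" "k $ 2 = of_int j" unfolding integer_points_def by (metis Ints_cases mem_Collect_eq)
      then have "z - \<zeta> = of_int i * u + of_int j * v" using coord[of k] k(2) by simp
      then show "z \<in> {z. z - \<zeta> \<in> lattice}" by (simp add: latticeI)
    next
      fix z assume "z \<in> {z. z - \<zeta> \<in> lattice}"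
      then obtain i j where ij: "z - \<zeta> = of_int i * u + of_int j * v" by (auto elim: latticeE)
      define k :: "real ^ 2" where "k = vector [of_int i, of_int j]"
      have k: "k $ 1 = of_int i" "k $ 2 = of_int j" by (simp_all add: k_def)
      have "to_complex ((k + \<xi>) v* M\<^sub>0) - \<zeta> = z - \<zeta>" unfolding coord ij k by simp
      then have "z = to_complex ((k + \<xi>) v* M\<^sub>0)" by simp
      moreover have "k \<in> integer_points" by (simp add: integer_points_def forall_2 k)
      ultimately show "z \<in> to_complex ` affine_lattice M\<^sub>0 \<xi>" unfolding affine_lattice_def by blast
    qed
    have "to_complex ` lattice_points_upto M\<^sub>0 \<xi> T = {z \<in> to_complex ` affine_lattice M\<^sub>0 \<xi>. z \<noteq> 0 \<and> norm z < T}"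
      unfolding lattice_points_upto_def by (auto simp: to_complex_eq_0_iff norm_to_complex)
    then show ?thesis unfolding aff using zero_not_in_disc[of T] by (auto simp: disc_def)
  qed
  have bij: "bij_betw to_complex (lattice_points_upto M\<^sub>0 \<xi> T) (disc \<zeta> T)" for T
    unfolding bij_betw_def image using inj_to_complex by (auto intro: inj_on_subset)
  have "bounded {x. f x \<noteq> 0}"
    using compact_imp_bounded[OF assms(4)] by (rule bounded_subset) (rule closure_subset)
  then obtain K0 where K0: "\<And>x. f x \<noteq> 0 \<Longrightarrow> \<bar>x\<bar> \<le> K0" unfolding bounded_iff by auto
  define K where "K = \<bar>K0\<bar> + 1"
  have K: "K > 0" by (simp add: K_def)
  have supp: "f x = 0" if "\<bar>x\<bar> \<ge> K" for x
  proof (rule ccontr)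
    assume "f x \<noteq> 0"
    then show False using K0[of x] that unfolding K_def by linarith
  qed
  have int: "(LINT s|lborel. f s) = integral {-K..K} f"
  proof -
    have "(LINT s|lborel. f s) = (LINT s:{-K..K}|lborel. f s)"
    proof -
      have "indicator {-K..K} s *\<^sub>R f s = f s" for s
        by (cases "s \<in> {-K..K}") (use supp[of s] in auto)
      then show ?thesis unfolding set_lebesgue_integral_def by (simp only:)
    qed
    also have "\<dots> = integral {-K..K} f"
      by (rule set_borel_integral_eq_integral(2)[OF borel_integrable_atLeastAtMost'[OF continuous_on_subset[OF assms(3) subset_UNIV]]])
    finally show ?thesis .
  qed
  have eq: "angle_sum f T / real (card (disc \<zeta> T)) = direction_pair_correlation M\<^sub>0 \<xi> T f"
    if N: "real (card (disc \<zeta> T)) \<ge> 2 * K" for T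
  proof -
    define P where "P = lattice_points_upto M\<^sub>0 \<xi> T"
    define N where "N = real (card (disc \<zeta> T))"
    have card: "real (card P) = N" unfolding N_def P_def by (simp add: bij_betw_same_card[OF bij])
    have "(\<Sum>\<^sub>\<infinity>m::int. f (N * (direction_angle y - direction_angle z + of_int m)))
        = f (N * Arg (cnj (to_complex z) * to_complex y) / (2 * pi))" if "y \<in> P" "z \<in> P" for y z
    proof -
      have nz: "to_complex y \<noteq> 0" "to_complex z \<noteq> 0"
        using that by (auto simp: P_def lattice_points_upto_def to_complex_eq_0_iff)
      obtain j :: int where j: "direction_angle y - direction_angle z = Arg (cnj (to_complex z) * to_complex y) / (2 * pi) + of_int j"
        using direction_angle_diff[OF nz] by blast
      have "\<bar>Arg (cnj (to_complex z) * to_complex y)\<bar> \<le> pi"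
        using Arg_bounded[of "cnj (to_complex z) * to_complex y"] by auto
      then have "\<bar>Arg (cnj (to_complex z) * to_complex y) / (2 * pi)\<bar> \<le> 1 / 2"
        by (simp add: abs_divide divide_le_eq)
      moreover have "N \<ge> 2 * K" using N by (simp add: N_def)
      ultimately show ?thesis using infsum_periodization[where f = f and K = K and N = N, OF supp K _ _ j] by simp
    qed
    then have "direction_pair_correlation M\<^sub>0 \<xi> T f
      = 1 / N * (\<Sum>y\<in>P. \<Sum>z\<in>P - {y}. f (N * Arg (cnj (to_complex z) * to_complex y) / (2 * pi)))"
      unfolding direction_pair_correlation_def pair_correlation_def P_def[symmetric] card by simp
    also have "(\<Sum>y\<in>P. \<Sum>z\<in>P - {y}. f (N * Arg (cnj (to_complex z) * to_complex y) / (2 * pi)))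
      = (\<Sum>y\<in>P. \<Sum>z\<in>disc \<zeta> T - {to_complex y}. f (N * Arg (cnj z * to_complex y) / (2 * pi)))"
    proof (rule sum.cong[OF refl], rule sum.reindex_bij_betw)
      fix y assume y: "y \<in> P"
      then have "to_complex y \<in> disc \<zeta> T" unfolding P_def image[symmetric] by (rule imageI)
      with y show "bij_betw to_complex (P - {y}) (disc \<zeta> T - {to_complex y})"
        using bij_betw_DiffI[OF bij, of "{y}" "{to_complex y}"] unfolding P_def by (simp add: bij_betw_def)
    qed
    also have "\<dots> = angle_sum f T"
      unfolding angle_sum_def N_def[symmetric] P_def
      by (rule sum.reindex_bij_betw[OF bij, of "\<lambda>y. \<Sum>z\<in>disc \<zeta> T - {y}. f (N * Arg (cnj z * y) / (2 * pi))" T])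
    finally show ?thesis by (simp add: N_def)
  qed
  show ?thesis
    unfolding int
  proof (rule Lim_transform_eventually[OF angle_sum_limit[OF assms(3) supp K]])
    show "\<forall>\<^sub>F T in at_top. angle_sum f T / real (card (disc \<zeta> T)) = direction_pair_correlation M\<^sub>0 \<xi> T f"
      using card_disc_eventually_ge[of "2 * K" \<zeta>] by (rule eventually_mono) (rule eq)
  qed
qed

end
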